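(* Let $k$ be a field, $\mathcal U$ a small category and $\mathcal A$ a prestack of $k$-linear categories on $\mathcal U$. Then for all $n\ge0$, $H^n(\mathbf C^\bullet_{\mathrm{GS}}(\mathcal A),d)\cong\mathrm{Ext}^n_{\mathcal A-\mathcal A}(\mathcal A,\mathcal A)$, where $\mathrm{Ext}_{\mathcal A-\mathcal A}$ denotes Ext in the abelian category of $\mathcal A$-bimodules.
   Context: **Prestacks.** A prestack $\mathcal A=(\mathcal A,m,f,c)$ on $\mathcal U$ consists of: for each object $U$ a $k$-linear category $\mathcal A(U)$ with composition written as juxtaposition; for each $u:V\to U$ a $k$-linear functor $u^*=f^u:\mathcal A(U)\to\mathcal A(V)$, with $(1_U)^*=1$; for $v:W\to V$, $u:V\to U$ a natural isomorphism $c^{u,v}:v^*u^*\to(uv)^*$, equal to the identity if $u$ or $v$ is an identity, such that $c^{u,vw}(c^{v,w}u^* )=c^{uv,w}(w^*c^{u,v})$ for all $w:T\to W$. **Bimodules.** An $\mathcal A$-bimodule $M$ consists of $k$-modules $M^U(A,B)$ for $A,B\in\mathcal A(U)$, $k$-linearly contravariant in $A$ and covariant in $B$ (actions written $b\,x\,a$), and $k$-linear maps $M^u:M^U(A,B)\to M^V(u^*A,u^*B)$ for $u:V\to U$ with $M^{1_U}=\mathrm{id}$, $M^u(bxa)=u^*(b)M^u(x)u^*(a)$ and $M^{uv}(x)\,c^{u,v,A}=c^{u,v,B}\,M^v(M^u(x))$. Morphisms of bimodules are families of $k$-linear maps compatible with the actions and with the maps $M^u$. $\mathcal A$ itself is the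 bimodule $\mathcal A^U(A,B)=\mathcal A(U)(A,B)$ with maps $u^*$. **Simplices.** A $p$-simplex of the nerve $\mathcal N_p(\mathcal U)$ is $\sigma=(u_1,\dots,u_p)$, $U_0\xrightarrow{u_1}U_1\to\cdots\xrightarrow{u_p}U_p$. Put $\sigma^*=(u_p\cdots u_1)^*$, $\sigma^\star=u_1^*\cdots u_p^*:\mathcal A(U_p)\to\mathcal A(U_0)$ (identities if $p=0$), $L_k\sigma=(u_1,\dots,u_k)$, $R_k\sigma=(u_{k+1},\dots,u_p)$, and let $\partial_0\sigma=(u_2,\dots,u_p)$, $\partial_i\sigma=(u_1,\dots,u_{i+1}u_i,\dots,u_p)$, $\partial_p\sigma=(u_1,\dots,u_{p-1})$. Put $c^{\sigma,k}=c^{u_p\cdots u_{k+1},\,u_k\cdots u_1}:(L_k\sigma)^*(R_k\sigma)^*\to\sigma^*$ (identity for $k=0,p$) and, for $1\le k\le p-1$, $\epsilon^{\sigma,k}=u_1^*\cdots u_{k-1}^*c^{u_{k+1},u_k}u_{k+2}^*\cdots u_p^*:\sigma^\star\to(\partial_k\sigma)^\star$; components at $A$ are written $c^{\sigma,k,A}$, $\epsilon^{\sigma,k,A}$. A $q$-simplex $a=(a_1,\dots,a_q)$ in a category is $A_0\xrightarrow{a_q}A_1\to\cdots\xrightarrow{a_1}A_q$, so $a_i:A_{q-i}\to A_{q-i+1}$. **Cochains.** $\mathbf C^{p,q}(\mathcal A)=\prod_{\sigma\in\mathcal N_p(\mathcal U)}\prod_{A_0,\dots,A_q\in\mathcal A(U_p)}\mathrm{Hom}_k\big(\mathcal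 A(U_p)(A_{q-1},A_q)\otimes\cdots\otimes\mathcal A(U_p)(A_0,A_1),\mathcal A(U_0)(\sigma^\star A_0,\sigma^*A_q)\big)$ (for $q=0$ just $\mathcal A(U_0)(\sigma^\star A_0,\sigma^*A_0)$), and $\mathbf C^n_{\mathrm{GS}}(\mathcal A)=\prod_{p+q=n}\mathbf C^{p,q}(\mathcal A)$. **Paths.** For $\sigma=(u_1,\dots,u_n)$, $n\ge1$, the paths $r=(r_1,\dots,r_{n-1})\in\mathcal P(\sigma)$ are chains of natural transformations $T_0\xrightarrow{r_{n-1}}T_1\to\cdots\xrightarrow{r_1}T_{n-1}$ from $T_0=\sigma^\star$ to $T_{n-1}=\sigma^*$, with a sign $(-1)^r$: $\mathcal P(u_1)$ has only the empty path (with $T_0=u_1^*$, sign $1$); for $n\ge2$, $\mathcal P(\sigma)=\{(r_1,\dots,r_{n-2},\epsilon^{\sigma,i}):1\le i\le n-1,\ r\in\mathcal P(\partial_i\sigma)\}$ with sign $(-1)^i(-1)^r$. Paths are indexed by the choices made ($(n-1)!$ of them). **Shuffles.** $S_{m,l}$ is the set of permutations $\beta$ of $\{1,\dots,m+l\}$ increasing on $\{1,\dots,m\}$ and on $\{m+1,\dots,m+l\}$; $(-1)^\beta$ is its sign. Given an $m$-simplex $a$ in $\mathcal A(U)$ and a chain $r=(r_1,\dots,r_l)$, $T_0\xrightarrow{r_l}\cdots\xrightarrow{r_1}T_l$, of natural transformations of functors $\mathcal A(U)\to\mathcal A(V)$, place the $i$-th entry of $(a_1,\dots,a_m,r_1,\dots,r_l)$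 in position $\beta(i)$. Then $\beta(a,r)=(b_1,\dots,b_{m+l})$ is the simplex in $\mathcal A(V)$ from $T_0(A_0)$ to $T_l(A_m)$ with $b_x=T_{l-y}(a_i)$ if position $x$ holds $a_i$ and $y$ of the $r$'s are in positions $<x$, and $b_x=r_i(A_{m-y})$ if position $x$ holds $r_i$ and $y$ of the $a$'s are in positions $<x$. **Differential.** For $\phi\in\mathbf C^{p,q}(\mathcal A)$, $p+q=n-1$, $d\phi=\sum_{j=0}^{q+1}d_j\phi$ with $d_j\phi\in\mathbf C^{p+j,q+1-j}(\mathcal A)$: $(d_0\phi)^\sigma(a_1,\dots,a_{q+1})=\sigma^*(a_1)\phi^\sigma(a_2,\dots,a_{q+1})+\sum_{i=1}^q(-1)^i\phi^\sigma(\dots,a_ia_{i+1},\dots)+(-1)^{q+1}\phi^\sigma(a_1,\dots,a_q)\sigma^\star(a_{q+1})$; $d_1\phi=(-1)^nd_{\mathrm{simp}}\phi$, $(d_{\mathrm{simp}}\phi)^\sigma(a)=c^{\sigma,1,A_q}u_1^*(\phi^{\partial_0\sigma}(a))+\sum_{i=1}^p(-1)^i\phi^{\partial_i\sigma}(a)\epsilon^{\sigma,i,A_0}+(-1)^{p+1}c^{\sigma,p,A_q}\phi^{\partial_{p+1}\sigma}(u_{p+1}^*a_1,\dots,u_{p+1}^*a_q)$ for a $(p+1)$-simplex $\sigma$; for $j\ge2$, $t=q+1-j$, $\sigma$ a $(p+j)$-simplex: $(d_j\phi)^\sigma(a_1,\dots,a_t)=\sum_{r\in\mathcal P(R_p\sigma),\,\beta\in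 S_{t,j-1}}(-1)^r(-1)^\beta(-1)^t\,c^{\sigma,p,A_t}\,\phi^{L_p\sigma}(\beta(a,r))$. *)

theory Defs
  imports Complex_Main "HOL-Library.Function_Algebras" "HOL-Combinatorics.Permutations"
begin

section \<open>Vector spaces inside an ambient vector space\<close>

text \<open>
  The field is the type \<open>'k\<close>.  All modules are linear subspaces of some ambient vector space
  given by a type of class \<open>ab_group_add\<close> and a scalar multiplication \<open>s\<close> on it.  The ambient
  types are arbitrary, and every family of vector spaces embeds into a common one (its direct sum).
\<close>

definition linear_from ::
  "('k \<Rightarrow> 'x \<Rightarrow> 'x) \<Rightarrow> ('k \<Rightarrow> 'y \<Rightarrow> 'y) \<Rightarrow> 'x::ab_group_add set \<Rightarrow> ('x \<Rightarrow> 'y::ab_group_add) \<Rightarrow> bool" where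
  "linear_from s s' X f \<longleftrightarrow>
     (\<forall>x\<in>X. \<forall>y\<in>X. f (x + y) = f x + f y) \<and> (\<forall>c. \<forall>x\<in>X. f (s c x) = s' c (f x))"

record ('k, 'x) kspace =
  vcarrier :: "'x set"
  vadd :: "'x \<Rightarrow> 'x \<Rightarrow> 'x"
  vscale :: "'k \<Rightarrow> 'x \<Rightarrow> 'x"

definition kspace_iso :: "('k, 'x) kspace \<Rightarrow> ('k, 'y) kspace \<Rightarrow> bool" where
  "kspace_iso V W \<longleftrightarrow>
     (\<exists>F. bij_betw F (vcarrier V) (vcarrier W) \<and>
          (\<forall>x\<in>vcarrier V. \<forall>y\<in>vcarrier V. F (vadd V x y) = vadd W (F x) (F y)) \<and>
          (\<forall>c. \<forall>x\<in>vcarrier V. F (vscale V c x) = vscale W c (F x)))"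

definition quot_rel :: "'x::ab_group_add set \<Rightarrow> 'x set \<Rightarrow> ('x \<times> 'x) set" where
  "quot_rel Z B = {(x, y). x \<in> Z \<and> y \<in> Z \<and> x - y \<in> B}"

definition quot_space ::
  "('k \<Rightarrow> 'x \<Rightarrow> 'x) \<Rightarrow> 'x::ab_group_add set \<Rightarrow> 'x set \<Rightarrow> ('k, 'x set) kspace" where
  "quot_space s Z B =
     \<lparr>vcarrier = Z // quot_rel Z B,
      vadd = (\<lambda>X Y. \<Union>x\<in>X. \<Union>y\<in>Y. quot_rel Z B `` {x + y}),
      vscale = (\<lambda>c X. \<Union>x\<in>X. quot_rel Z B `` {s c x})\<rparr>"

definition cocycles :: "(nat \<Rightarrow> 'x::ab_group_add set) \<Rightarrow> (nat \<Rightarrow> 'x \<Rightarrow> 'x) \<Rightarrow> nat \<Rightarrow> 'x set" where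
  "cocycles C d n = {x \<in> C n. d n x = 0}"

definition coboundaries :: "(nat \<Rightarrow> 'x::ab_group_add set) \<Rightarrow> (nat \<Rightarrow> 'x \<Rightarrow> 'x) \<Rightarrow> nat \<Rightarrow> 'x set" where
  "coboundaries C d n = (case n of 0 \<Rightarrow> {0} | Suc m \<Rightarrow> d m ` C m)"

text \<open>Cohomology at degree \<open>n\<close> of a complex of subspaces with \<open>d n : C n \<rightarrow> C (n+1)\<close>.\<close>

definition cohomology ::
  "('k \<Rightarrow> 'x \<Rightarrow> 'x) \<Rightarrow> (nat \<Rightarrow> 'x::ab_group_add set) \<Rightarrow> (nat \<Rightarrow> 'x \<Rightarrow> 'x) \<Rightarrow> nat \<Rightarrow> ('k, 'x set) kspace" where
  "cohomology s C d n = quot_space s (cocycles C d n) (coboundaries C d n)"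


section \<open>Small categories and prestacks\<close>

text \<open>\<open>cmp \<U> u v\<close> is the composite \<open>uv\<close> (first \<open>v\<close>, then \<open>u\<close>).\<close>

record ('u, 'm) cat =
  Ob :: "'u set"
  Ar :: "'m set"
  src :: "'m \<Rightarrow> 'u"
  tgt :: "'m \<Rightarrow> 'u"
  idn :: "'u \<Rightarrow> 'm"
  cmp :: "'m \<Rightarrow> 'm \<Rightarrow> 'm"

locale small_category =
  fixes \<U> :: "('u, 'm) cat"
  assumes src_Ob: "u \<in> Ar \<U> \<Longrightarrow> src \<U> u \<in> Ob \<U>"
    and tgt_Ob: "u \<in> Ar \<U> \<Longrightarrow> tgt \<U> u \<in> Ob \<U>"
    and idn_Ar: "U \<in> Ob \<U> \<Longrightarrow> idn \<U> U \<in> Ar \<U>"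
    and src_idn: "U \<in> Ob \<U> \<Longrightarrow> src \<U> (idn \<U> U) = U"
    and tgt_idn: "U \<in> Ob \<U> \<Longrightarrow> tgt \<U> (idn \<U> U) = U"
    and cmp_Ar: "\<lbrakk>u \<in> Ar \<U>; v \<in> Ar \<U>; src \<U> u = tgt \<U> v\<rbrakk> \<Longrightarrow> cmp \<U> u v \<in> Ar \<U>"
    and src_cmp: "\<lbrakk>u \<in> Ar \<U>; v \<in> Ar \<U>; src \<U> u = tgt \<U> v\<rbrakk> \<Longrightarrow> src \<U> (cmp \<U> u v) = src \<U> v"
    and tgt_cmp: "\<lbrakk>u \<in> Ar \<U>; v \<in> Ar \<U>; src \<U> u = tgt \<U> v\<rbrakk> \<Longrightarrow> tgt \<U> (cmp \<U> u v) = tgt \<U> u"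
    and cmp_idn_right: "u \<in> Ar \<U> \<Longrightarrow> cmp \<U> u (idn \<U> (src \<U> u)) = u"
    and cmp_idn_left: "u \<in> Ar \<U> \<Longrightarrow> cmp \<U> (idn \<U> (tgt \<U> u)) u = u"
    and cmp_assoc: "\<lbrakk>u \<in> Ar \<U>; v \<in> Ar \<U>; w \<in> Ar \<U>; src \<U> u = tgt \<U> v; src \<U> v = tgt \<U> w\<rbrakk>
      \<Longrightarrow> cmp \<U> (cmp \<U> u v) w = cmp \<U> u (cmp \<U> v w)"

text \<open>
  \<open>obj U\<close> and \<open>hom U A B\<close> are the objects and morphism spaces of \<open>\<A>(U)\<close>; \<open>ccmp U A B C g f\<close> is
  the composite of \<open>f : A \<rightarrow> B\<close> and \<open>g : B \<rightarrow> C\<close>.  The functor \<open>u\<^sup>*\<close> is \<open>fob u\<close> on objects and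
  \<open>fmor u A B\<close> on \<open>hom U A B\<close>; \<open>tw u v A\<close> is the component at \<open>A\<close> of the twist
  \<open>v\<^sup>* u\<^sup>* \<rightarrow> (uv)\<^sup>*\<close>.  As morphism spaces need not be disjoint, operations on
  morphisms carry the objects as arguments.
\<close>

record ('k, 'u, 'm, 'a, 'h) prestack_data =
  hscale :: "'k \<Rightarrow> 'h \<Rightarrow> 'h"
  obj :: "'u \<Rightarrow> 'a set"
  hom :: "'u \<Rightarrow> 'a \<Rightarrow> 'a \<Rightarrow> 'h set"
  ccmp :: "'u \<Rightarrow> 'a \<Rightarrow> 'a \<Rightarrow> 'a \<Rightarrow> 'h \<Rightarrow> 'h \<Rightarrow> 'h"
  cid :: "'u \<Rightarrow> 'a \<Rightarrow> 'h"
  fob :: "'m \<Rightarrow> 'a \<Rightarrow> 'a"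
  fmor :: "'m \<Rightarrow> 'a \<Rightarrow> 'a \<Rightarrow> 'h \<Rightarrow> 'h"
  tw :: "'m \<Rightarrow> 'm \<Rightarrow> 'a \<Rightarrow> 'h"

locale prestack = small_category \<U> for \<U> :: "('u, 'm) cat" +
  fixes \<A> :: "('k::field, 'u, 'm, 'a, 'h::ab_group_add) prestack_data"
  assumes hscale_vector_space: "vector_space (hscale \<A>)"
    \<comment> \<open>the linear categories\<close>
    and hom_subspace: "\<lbrakk>U \<in> Ob \<U>; A \<in> obj \<A> U; B \<in> obj \<A> U\<rbrakk>
      \<Longrightarrow> module.subspace (hscale \<A>) (hom \<A> U A B)"
    and cid_hom: "\<lbrakk>U \<in> Ob \<U>; A \<in> obj \<A> U\<rbrakk> \<Longrightarrow> cid \<A> U A \<in> hom \<A> U A A"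
    and ccmp_hom: "\<lbrakk>U \<in> Ob \<U>; A \<in> obj \<A> U; B \<in> obj \<A> U; C \<in> obj \<A> U;
        g \<in> hom \<A> U B C; f \<in> hom \<A> U A B\<rbrakk> \<Longrightarrow> ccmp \<A> U A B C g f \<in> hom \<A> U A C"
    and ccmp_linear_left: "\<lbrakk>U \<in> Ob \<U>; A \<in> obj \<A> U; B \<in> obj \<A> U; C \<in> obj \<A> U; f \<in> hom \<A> U A B\<rbrakk>
      \<Longrightarrow> linear_from (hscale \<A>) (hscale \<A>) (hom \<A> U B C) (\<lambda>g. ccmp \<A> U A B C g f)"
    and ccmp_linear_right: "\<lbrakk>U \<in> Ob \<U>; A \<in> obj \<A> U; B \<in> obj \<A> U; C \<in> obj \<A> U; g \<in> hom \<A> U B C\<rbrakk>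
      \<Longrightarrow> linear_from (hscale \<A>) (hscale \<A>) (hom \<A> U A B) (\<lambda>f. ccmp \<A> U A B C g f)"
    and ccmp_cid_right: "\<lbrakk>U \<in> Ob \<U>; A \<in> obj \<A> U; B \<in> obj \<A> U; f \<in> hom \<A> U A B\<rbrakk>
      \<Longrightarrow> ccmp \<A> U A A B f (cid \<A> U A) = f"
    and ccmp_cid_left: "\<lbrakk>U \<in> Ob \<U>; A \<in> obj \<A> U; B \<in> obj \<A> U; f \<in> hom \<A> U A B\<rbrakk>
      \<Longrightarrow> ccmp \<A> U A B B (cid \<A> U B) f = f"
    and ccmp_assoc: "\<lbrakk>U \<in> Ob \<U>; A \<in> obj \<A> U; B \<in> obj \<A> U; C \<in> obj \<A> U; D \<in> obj \<A> U;
        h \<in> hom \<A> U C D; g \<in> hom \<A> U B C; f \<in> hom \<A> U A B\<rbrakk>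
      \<Longrightarrow> ccmp \<A> U A B D (ccmp \<A> U B C D h g) f = ccmp \<A> U A C D h (ccmp \<A> U A B C g f)"
    \<comment> \<open>the linear functors\<close>
    and fob_obj: "\<lbrakk>u \<in> Ar \<U>; A \<in> obj \<A> (tgt \<U> u)\<rbrakk> \<Longrightarrow> fob \<A> u A \<in> obj \<A> (src \<U> u)"
    and fmor_hom: "\<lbrakk>u \<in> Ar \<U>; A \<in> obj \<A> (tgt \<U> u); B \<in> obj \<A> (tgt \<U> u); f \<in> hom \<A> (tgt \<U> u) A B\<rbrakk>
      \<Longrightarrow> fmor \<A> u A B f \<in> hom \<A> (src \<U> u) (fob \<A> u A) (fob \<A> u B)"
    and fmor_linear: "\<lbrakk>u \<in> Ar \<U>; A \<in> obj \<A> (tgt \<U> u); B \<in> obj \<A> (tgt \<U> u)\<rbrakk>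
      \<Longrightarrow> linear_from (hscale \<A>) (hscale \<A>) (hom \<A> (tgt \<U> u) A B) (fmor \<A> u A B)"
    and fmor_cid: "\<lbrakk>u \<in> Ar \<U>; A \<in> obj \<A> (tgt \<U> u)\<rbrakk>
      \<Longrightarrow> fmor \<A> u A A (cid \<A> (tgt \<U> u) A) = cid \<A> (src \<U> u) (fob \<A> u A)"
    and fmor_ccmp: "\<lbrakk>u \<in> Ar \<U>; A \<in> obj \<A> (tgt \<U> u); B \<in> obj \<A> (tgt \<U> u); C \<in> obj \<A> (tgt \<U> u);
        g \<in> hom \<A> (tgt \<U> u) B C; f \<in> hom \<A> (tgt \<U> u) A B\<rbrakk>
      \<Longrightarrow> fmor \<A> u A C (ccmp \<A> (tgt \<U> u) A B C g f) =
          ccmp \<A> (src \<U> u) (fob \<A> u A) (fob \<A> u B) (fob \<A> u C) (fmor \<A> u B C g) (fmor \<A> u A B f)"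
    and fob_idn: "\<lbrakk>U \<in> Ob \<U>; A \<in> obj \<A> U\<rbrakk> \<Longrightarrow> fob \<A> (idn \<U> U) A = A"
    and fmor_idn: "\<lbrakk>U \<in> Ob \<U>; A \<in> obj \<A> U; B \<in> obj \<A> U; f \<in> hom \<A> U A B\<rbrakk>
      \<Longrightarrow> fmor \<A> (idn \<U> U) A B f = f"
    \<comment> \<open>the twists\<close>
    and tw_hom: "\<lbrakk>u \<in> Ar \<U>; v \<in> Ar \<U>; src \<U> u = tgt \<U> v; A \<in> obj \<A> (tgt \<U> u)\<rbrakk>
      \<Longrightarrow> tw \<A> u v A \<in> hom \<A> (src \<U> v) (fob \<A> v (fob \<A> u A)) (fob \<A> (cmp \<U> u v) A)"
    and tw_natural: "\<lbrakk>u \<in> Ar \<U>; v \<in> Ar \<U>; src \<U> u = tgt \<U> v;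
        A \<in> obj \<A> (tgt \<U> u); B \<in> obj \<A> (tgt \<U> u); f \<in> hom \<A> (tgt \<U> u) A B\<rbrakk>
      \<Longrightarrow> ccmp \<A> (src \<U> v) (fob \<A> v (fob \<A> u A)) (fob \<A> (cmp \<U> u v) A) (fob \<A> (cmp \<U> u v) B)
            (fmor \<A> (cmp \<U> u v) A B f) (tw \<A> u v A) =
          ccmp \<A> (src \<U> v) (fob \<A> v (fob \<A> u A)) (fob \<A> v (fob \<A> u B)) (fob \<A> (cmp \<U> u v) B)
            (tw \<A> u v B) (fmor \<A> v (fob \<A> u A) (fob \<A> u B) (fmor \<A> u A B f))"
    and tw_iso: "\<lbrakk>u \<in> Ar \<U>; v \<in> Ar \<U>; src \<U> u = tgt \<U> v; A \<in> obj \<A> (tgt \<U> u)\<rbrakk>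
      \<Longrightarrow> \<exists>c' \<in> hom \<A> (src \<U> v) (fob \<A> (cmp \<U> u v) A) (fob \<A> v (fob \<A> u A)).
            ccmp \<A> (src \<U> v) (fob \<A> v (fob \<A> u A)) (fob \<A> (cmp \<U> u v) A) (fob \<A> v (fob \<A> u A))
              c' (tw \<A> u v A) = cid \<A> (src \<U> v) (fob \<A> v (fob \<A> u A)) \<and>
            ccmp \<A> (src \<U> v) (fob \<A> (cmp \<U> u v) A) (fob \<A> v (fob \<A> u A)) (fob \<A> (cmp \<U> u v) A)
              (tw \<A> u v A) c' = cid \<A> (src \<U> v) (fob \<A> (cmp \<U> u v) A)"
    and tw_idn_left: "\<lbrakk>v \<in> Ar \<U>; A \<in> obj \<A> (tgt \<U> v)\<rbrakk>
      \<Longrightarrow> tw \<A> (idn \<U> (tgt \<U> v)) v A = cid \<A> (src \<U> v) (fob \<A> v A)"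
    and tw_idn_right: "\<lbrakk>u \<in> Ar \<U>; A \<in> obj \<A> (tgt \<U> u)\<rbrakk>
      \<Longrightarrow> tw \<A> u (idn \<U> (src \<U> u)) A = cid \<A> (src \<U> u) (fob \<A> u A)"
    and tw_coherence: "\<lbrakk>u \<in> Ar \<U>; v \<in> Ar \<U>; w \<in> Ar \<U>; src \<U> u = tgt \<U> v; src \<U> v = tgt \<U> w;
        A \<in> obj \<A> (tgt \<U> u)\<rbrakk>
      \<Longrightarrow> ccmp \<A> (src \<U> w) (fob \<A> w (fob \<A> v (fob \<A> u A))) (fob \<A> (cmp \<U> v w) (fob \<A> u A))
            (fob \<A> (cmp \<U> u (cmp \<U> v w)) A)
            (tw \<A> u (cmp \<U> v w) A) (tw \<A> v w (fob \<A> u A)) =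
          ccmp \<A> (src \<U> w) (fob \<A> w (fob \<A> v (fob \<A> u A))) (fob \<A> w (fob \<A> (cmp \<U> u v) A))
            (fob \<A> (cmp \<U> (cmp \<U> u v) w) A)
            (tw \<A> (cmp \<U> u v) w A)
            (fmor \<A> w (fob \<A> v (fob \<A> u A)) (fob \<A> (cmp \<U> u v) A) (tw \<A> u v A))"


section \<open>Bimodules\<close>

text \<open>
  \<open>lact U A B C b x\<close> is \<open>bx\<close> for \<open>x \<in> M\<^sup>U(A,B)\<close>, \<open>b : B \<rightarrow> C\<close>, and \<open>ract U A B C x a\<close> is \<open>xa\<close> for
  \<open>a : A \<rightarrow> B\<close>, \<open>x \<in> M\<^sup>U(B,C)\<close>; \<open>res u A B\<close> is \<open>M\<^sup>u\<close> on \<open>M\<^sup>U(A,B)\<close>.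
\<close>

record ('u, 'm, 'a, 'h, 'v) bimod =
  car :: "'u \<Rightarrow> 'a \<Rightarrow> 'a \<Rightarrow> 'v set"
  lact :: "'u \<Rightarrow> 'a \<Rightarrow> 'a \<Rightarrow> 'a \<Rightarrow> 'h \<Rightarrow> 'v \<Rightarrow> 'v"
  ract :: "'u \<Rightarrow> 'a \<Rightarrow> 'a \<Rightarrow> 'a \<Rightarrow> 'v \<Rightarrow> 'h \<Rightarrow> 'v"
  res :: "'m \<Rightarrow> 'a \<Rightarrow> 'a \<Rightarrow> 'v \<Rightarrow> 'v"

locale bimodule =
  fixes \<U> :: "('u, 'm) cat"
    and \<A> :: "('k::field, 'u, 'm, 'a, 'h::ab_group_add) prestack_data"
    and s :: "'k \<Rightarrow> 'v \<Rightarrow> 'v::ab_group_add"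
    and M :: "('u, 'm, 'a, 'h, 'v) bimod"
  assumes scale_vector_space: "vector_space s"
    and car_subspace: "\<lbrakk>U \<in> Ob \<U>; A \<in> obj \<A> U; B \<in> obj \<A> U\<rbrakk> \<Longrightarrow> module.subspace s (car M U A B)"
    \<comment> \<open>the left action (covariance in the second argument)\<close>
    and lact_car: "\<lbrakk>U \<in> Ob \<U>; A \<in> obj \<A> U; B \<in> obj \<A> U; C \<in> obj \<A> U;
        b \<in> hom \<A> U B C; x \<in> car M U A B\<rbrakk> \<Longrightarrow> lact M U A B C b x \<in> car M U A C"
    and lact_linear_left: "\<lbrakk>U \<in> Ob \<U>; A \<in> obj \<A> U; B \<in> obj \<A> U; C \<in> obj \<A> U; x \<in> car M U A B\<rbrakk>
      \<Longrightarrow> linear_from (hscale \<A>) s (hom \<A> U B C) (\<lambda>b. lact M U A B C b x)"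
    and lact_linear_right: "\<lbrakk>U \<in> Ob \<U>; A \<in> obj \<A> U; B \<in> obj \<A> U; C \<in> obj \<A> U; b \<in> hom \<A> U B C\<rbrakk>
      \<Longrightarrow> linear_from s s (car M U A B) (\<lambda>x. lact M U A B C b x)"
    and lact_cid: "\<lbrakk>U \<in> Ob \<U>; A \<in> obj \<A> U; B \<in> obj \<A> U; x \<in> car M U A B\<rbrakk>
      \<Longrightarrow> lact M U A B B (cid \<A> U B) x = x"
    and lact_ccmp: "\<lbrakk>U \<in> Ob \<U>; A \<in> obj \<A> U; B \<in> obj \<A> U; C \<in> obj \<A> U; D \<in> obj \<A> U;
        b' \<in> hom \<A> U C D; b \<in> hom \<A> U B C; x \<in> car M U A B\<rbrakk>
      \<Longrightarrow> lact M U A B D (ccmp \<A> U B C D b' b) x = lact M U A C D b' (lact M U A B C b x)"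
    \<comment> \<open>the right action (contravariance in the first argument)\<close>
    and ract_car: "\<lbrakk>U \<in> Ob \<U>; A \<in> obj \<A> U; B \<in> obj \<A> U; C \<in> obj \<A> U;
        x \<in> car M U B C; a \<in> hom \<A> U A B\<rbrakk> \<Longrightarrow> ract M U A B C x a \<in> car M U A C"
    and ract_linear_left: "\<lbrakk>U \<in> Ob \<U>; A \<in> obj \<A> U; B \<in> obj \<A> U; C \<in> obj \<A> U; a \<in> hom \<A> U A B\<rbrakk>
      \<Longrightarrow> linear_from s s (car M U B C) (\<lambda>x. ract M U A B C x a)"
    and ract_linear_right: "\<lbrakk>U \<in> Ob \<U>; A \<in> obj \<A> U; B \<in> obj \<A> U; C \<in> obj \<A> U; x \<in> car M U B C\<rbrakk>
      \<Longrightarrow> linear_from (hscale \<A>) s (hom \<A> U A B) (\<lambda>a. ract M U A B C x a)"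
    and ract_cid: "\<lbrakk>U \<in> Ob \<U>; A \<in> obj \<A> U; B \<in> obj \<A> U; x \<in> car M U A B\<rbrakk>
      \<Longrightarrow> ract M U A A B x (cid \<A> U A) = x"
    and ract_ccmp: "\<lbrakk>U \<in> Ob \<U>; A \<in> obj \<A> U; B \<in> obj \<A> U; C \<in> obj \<A> U; D \<in> obj \<A> U;
        x \<in> car M U C D; a' \<in> hom \<A> U B C; a \<in> hom \<A> U A B\<rbrakk>
      \<Longrightarrow> ract M U A C D x (ccmp \<A> U A B C a' a) = ract M U A B D (ract M U B C D x a') a"
    and lact_ract: "\<lbrakk>U \<in> Ob \<U>; A \<in> obj \<A> U; B \<in> obj \<A> U; C \<in> obj \<A> U; D \<in> obj \<A> U;
        b \<in> hom \<A> U C D; x \<in> car M U B C; a \<in> hom \<A> U A B\<rbrakk>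
      \<Longrightarrow> ract M U A B D (lact M U B C D b x) a = lact M U A C D b (ract M U A B C x a)"
    \<comment> \<open>the restriction maps\<close>
    and res_car: "\<lbrakk>u \<in> Ar \<U>; A \<in> obj \<A> (tgt \<U> u); B \<in> obj \<A> (tgt \<U> u); x \<in> car M (tgt \<U> u) A B\<rbrakk>
      \<Longrightarrow> res M u A B x \<in> car M (src \<U> u) (fob \<A> u A) (fob \<A> u B)"
    and res_linear: "\<lbrakk>u \<in> Ar \<U>; A \<in> obj \<A> (tgt \<U> u); B \<in> obj \<A> (tgt \<U> u)\<rbrakk>
      \<Longrightarrow> linear_from s s (car M (tgt \<U> u) A B) (res M u A B)"
    and res_idn: "\<lbrakk>U \<in> Ob \<U>; A \<in> obj \<A> U; B \<in> obj \<A> U; x \<in> car M U A B\<rbrakk>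
      \<Longrightarrow> res M (idn \<U> U) A B x = x"
    and res_act: "\<lbrakk>u \<in> Ar \<U>; A \<in> obj \<A> (tgt \<U> u); B \<in> obj \<A> (tgt \<U> u); C \<in> obj \<A> (tgt \<U> u);
        D \<in> obj \<A> (tgt \<U> u); b \<in> hom \<A> (tgt \<U> u) C D; x \<in> car M (tgt \<U> u) B C; a \<in> hom \<A> (tgt \<U> u) A B\<rbrakk>
      \<Longrightarrow> res M u A D (lact M (tgt \<U> u) A C D b (ract M (tgt \<U> u) A B C x a)) =
          lact M (src \<U> u) (fob \<A> u A) (fob \<A> u C) (fob \<A> u D) (fmor \<A> u C D b)
            (ract M (src \<U> u) (fob \<A> u A) (fob \<A> u B) (fob \<A> u C) (res M u B C x) (fmor \<A> u A B a))"
    and res_cmp: "\<lbrakk>u \<in> Ar \<U>; v \<in> Ar \<U>; src \<U> u = tgt \<U> v; A \<in> obj \<A> (tgt \<U> u); B \<in> obj \<A> (tgt \<U> u);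
        x \<in> car M (tgt \<U> u) A B\<rbrakk>
      \<Longrightarrow> ract M (src \<U> v) (fob \<A> v (fob \<A> u A)) (fob \<A> (cmp \<U> u v) A) (fob \<A> (cmp \<U> u v) B)
            (res M (cmp \<U> u v) A B x) (tw \<A> u v A) =
          lact M (src \<U> v) (fob \<A> v (fob \<A> u A)) (fob \<A> v (fob \<A> u B)) (fob \<A> (cmp \<U> u v) B)
            (tw \<A> u v B) (res M v (fob \<A> u A) (fob \<A> u B) (res M u A B x))"

definition self_bimod ::
  "('k, 'u, 'm, 'a, 'h) prestack_data \<Rightarrow> ('u, 'm, 'a, 'h, 'h) bimod" where
  "self_bimod \<A> = \<lparr>car = hom \<A>, lact = ccmp \<A>, ract = ccmp \<A>, res = fmor \<A>\<rparr>"

text \<open>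
  Morphisms are made extensional (zero off the carriers), so that the set of morphisms is a
  subspace of a function space.
\<close>

definition bimod_hom ::
  "('u, 'm) cat \<Rightarrow> ('k, 'u, 'm, 'a, 'h) prestack_data \<Rightarrow>
   ('k \<Rightarrow> 'v \<Rightarrow> 'v) \<Rightarrow> ('u, 'm, 'a, 'h, 'v::ab_group_add) bimod \<Rightarrow>
   ('k \<Rightarrow> 'w \<Rightarrow> 'w) \<Rightarrow> ('u, 'm, 'a, 'h, 'w::ab_group_add) bimod \<Rightarrow>
   ('u \<Rightarrow> 'a \<Rightarrow> 'a \<Rightarrow> 'v \<Rightarrow> 'w) set" where
  "bimod_hom \<U> \<A> s M s' N = {f.
     (\<forall>U\<in>Ob \<U>. \<forall>A\<in>obj \<A> U. \<forall>B\<in>obj \<A> U.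
        (\<forall>x\<in>car M U A B. f U A B x \<in> car N U A B) \<and> linear_from s s' (car M U A B) (f U A B)) \<and>
     (\<forall>U\<in>Ob \<U>. \<forall>A\<in>obj \<A> U. \<forall>B\<in>obj \<A> U. \<forall>C\<in>obj \<A> U. \<forall>b\<in>hom \<A> U B C. \<forall>x\<in>car M U A B.
        f U A C (lact M U A B C b x) = lact N U A B C b (f U A B x)) \<and>
     (\<forall>U\<in>Ob \<U>. \<forall>A\<in>obj \<A> U. \<forall>B\<in>obj \<A> U. \<forall>C\<in>obj \<A> U. \<forall>a\<in>hom \<A> U A B. \<forall>x\<in>car M U B C.
        f U A C (ract M U A B C x a) = ract N U A B C (f U B C x) a) \<and>
     (\<forall>u\<in>Ar \<U>. \<forall>A\<in>obj \<A> (tgt \<U> u). \<forall>B\<in>obj \<A> (tgt \<U> u). \<forall>x\<in>car M (tgt \<U> u) A B.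
        f (src \<U> u) (fob \<A> u A) (fob \<A> u B) (res M u A B x) = res N u A B (f (tgt \<U> u) A B x)) \<and>
     (\<forall>U A B x. \<not> (U \<in> Ob \<U> \<and> A \<in> obj \<A> U \<and> B \<in> obj \<A> U \<and> x \<in> car M U A B) \<longrightarrow> f U A B x = 0)}"


section \<open>Ext of bimodules\<close>

text \<open>
  Kernels, images and epimorphisms of bimodules are pointwise.
  \<open>Ext\<close> is formed in the category of bimodules contained in a fixed ambient vector space
  \<open>(V, s)\<close>, which plays the role of a universe of small vector spaces.
  \<open>bimod_universe\<close> asks that \<open>V\<close> be large enough: its dimension is at least
  the infinite cardinal bounding the number of objects and arrows of \<open>\<U>\<close>, of objects
  of the \<open>\<A>(U)\<close> and of morphisms in \<open>\<A>\<close>.  The category then contains copies of \<open>\<A>\<close> and of the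
  free bimodules on its own objects, so it is abelian with enough projectives, and being
  projective in it is the same as being projective among all bimodules.
\<close>

definition bimod_universe ::
  "('k::field, 'u, 'm, 'a, 'h) prestack_data \<Rightarrow> ('k \<Rightarrow> 'v \<Rightarrow> 'v::ab_group_add) \<Rightarrow> bool" where
  "bimod_universe \<A> s \<longleftrightarrow> vector_space s \<and>
     (\<exists>e :: ('u + 'm + 'a + 'h) list \<Rightarrow> 'v. inj e \<and> \<not> module.dependent s (range e))"

definition bimod_surj ::
  "('u, 'm) cat \<Rightarrow> ('k, 'u, 'm, 'a, 'h) prestack_data \<Rightarrow> ('u, 'm, 'a, 'h, 'v) bimod \<Rightarrow>
   ('u, 'm, 'a, 'h, 'w) bimod \<Rightarrow> ('u \<Rightarrow> 'a \<Rightarrow> 'a \<Rightarrow> 'v \<Rightarrow> 'w) \<Rightarrow> bool" where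
  "bimod_surj \<U> \<A> M N g \<longleftrightarrow>
     (\<forall>U\<in>Ob \<U>. \<forall>A\<in>obj \<A> U. \<forall>B\<in>obj \<A> U. g U A B ` car M U A B = car N U A B)"

definition bimod_exact ::
  "('u, 'm) cat \<Rightarrow> ('k, 'u, 'm, 'a, 'h) prestack_data \<Rightarrow>
   ('u, 'm, 'a, 'h, 'x) bimod \<Rightarrow> ('u \<Rightarrow> 'a \<Rightarrow> 'a \<Rightarrow> 'x \<Rightarrow> 'v) \<Rightarrow>
   ('u, 'm, 'a, 'h, 'v) bimod \<Rightarrow> ('u \<Rightarrow> 'a \<Rightarrow> 'a \<Rightarrow> 'v \<Rightarrow> 'w::zero) \<Rightarrow> bool" where
  "bimod_exact \<U> \<A> L f M g \<longleftrightarrow>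
     (\<forall>U\<in>Ob \<U>. \<forall>A\<in>obj \<A> U. \<forall>B\<in>obj \<A> U. f U A B ` car L U A B = {x \<in> car M U A B. g U A B x = 0})"

definition projective_bimod ::
  "('u, 'm) cat \<Rightarrow> ('k::field, 'u, 'm, 'a, 'h::ab_group_add) prestack_data \<Rightarrow>
   ('k \<Rightarrow> 'v \<Rightarrow> 'v) \<Rightarrow> ('u, 'm, 'a, 'h, 'v::ab_group_add) bimod \<Rightarrow> bool" where
  "projective_bimod \<U> \<A> s P \<longleftrightarrow> bimodule \<U> \<A> s P \<and>
     (\<forall>M N g f. bimodule \<U> \<A> s M \<longrightarrow> bimodule \<U> \<A> s N \<longrightarrow>
        g \<in> bimod_hom \<U> \<A> s M s N \<longrightarrow> bimod_surj \<U> \<A> M N g \<longrightarrow> f \<in> bimod_hom \<U> \<A> s P s N \<longrightarrow>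
        (\<exists>h\<in>bimod_hom \<U> \<A> s P s M.
           \<forall>U\<in>Ob \<U>. \<forall>A\<in>obj \<A> U. \<forall>B\<in>obj \<A> U. \<forall>x\<in>car P U A B. g U A B (h U A B x) = f U A B x))"

text \<open>\<open>\<dots> \<rightarrow> P 2 \<rightarrow> P 1 \<rightarrow> P 0 \<rightarrow> M \<rightarrow> 0\<close> with \<open>\<delta> n : P (n+1) \<rightarrow> P n\<close> and augmentation \<open>\<eta> : P 0 \<rightarrow> M\<close>.\<close>

definition projective_resolution ::
  "('u, 'm) cat \<Rightarrow> ('k::field, 'u, 'm, 'a, 'h::ab_group_add) prestack_data \<Rightarrow>
   ('k \<Rightarrow> 'v \<Rightarrow> 'v) \<Rightarrow> (nat \<Rightarrow> ('u, 'm, 'a, 'h, 'v::ab_group_add) bimod) \<Rightarrow>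
   (nat \<Rightarrow> 'u \<Rightarrow> 'a \<Rightarrow> 'a \<Rightarrow> 'v \<Rightarrow> 'v) \<Rightarrow> ('u \<Rightarrow> 'a \<Rightarrow> 'a \<Rightarrow> 'v \<Rightarrow> 'w) \<Rightarrow>
   ('k \<Rightarrow> 'w \<Rightarrow> 'w) \<Rightarrow> ('u, 'm, 'a, 'h, 'w::ab_group_add) bimod \<Rightarrow> bool" where
  "projective_resolution \<U> \<A> s P \<delta> \<eta> sM M \<longleftrightarrow>
     (\<forall>n. projective_bimod \<U> \<A> s (P n)) \<and>
     (\<forall>n. \<delta> n \<in> bimod_hom \<U> \<A> s (P (Suc n)) s (P n)) \<and>
     \<eta> \<in> bimod_hom \<U> \<A> s (P 0) sM M \<and>
     bimod_surj \<U> \<A> (P 0) M \<eta> \<and>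
     bimod_exact \<U> \<A> (P 1) (\<delta> 0) (P 0) \<eta> \<and>
     (\<forall>n. bimod_exact \<U> \<A> (P (Suc (Suc n))) (\<delta> (Suc n)) (P (Suc n)) (\<delta> n))"

text \<open>\<open>H\<^sup>n(Hom(P, N))\<close>: for a projective resolution \<open>(P, \<delta>)\<close> of \<open>M\<close> this is \<open>Ext\<^sup>n(M, N)\<close>.\<close>

definition Ext_via ::
  "('u, 'm) cat \<Rightarrow> ('k, 'u, 'm, 'a, 'h) prestack_data \<Rightarrow>
   ('k \<Rightarrow> 'v \<Rightarrow> 'v) \<Rightarrow> (nat \<Rightarrow> ('u, 'm, 'a, 'h, 'v::ab_group_add) bimod) \<Rightarrow>
   (nat \<Rightarrow> 'u \<Rightarrow> 'a \<Rightarrow> 'a \<Rightarrow> 'v \<Rightarrow> 'v) \<Rightarrow>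
   ('k \<Rightarrow> 'w \<Rightarrow> 'w) \<Rightarrow> ('u, 'm, 'a, 'h, 'w::ab_group_add) bimod \<Rightarrow> nat \<Rightarrow>
   ('k, ('u \<Rightarrow> 'a \<Rightarrow> 'a \<Rightarrow> 'v \<Rightarrow> 'w) set) kspace" where
  "Ext_via \<U> \<A> s P \<delta> sN N n =
     cohomology (\<lambda>c f U A B x. sN c (f U A B x))
       (\<lambda>i. bimod_hom \<U> \<A> s (P i) sN N)
       (\<lambda>i f U A B x. f U A B (\<delta> i U A B x)) n"


section \<open>The Gerstenhaber--Schack complex\<close>

text \<open>
  A simplex \<open>\<sigma> = (u\<^sub>1, \<dots>, u\<^sub>p)\<close> of the nerve is a pair \<open>(U\<^sub>0, [u\<^sub>1, \<dots>, u\<^sub>p])\<close>; the first component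
  matters for \<open>p = 0\<close>.  Lists are indexed from 0, so \<open>u\<^sub>i\<close> is \<open>us ! (i - 1)\<close>.  A simplex
  \<open>a = (a\<^sub>1, \<dots>, a\<^sub>q)\<close> in a category is given by the list \<open>As = [A\<^sub>0, \<dots>, A\<^sub>q]\<close> and the list
  \<open>as = [a\<^sub>1, \<dots>, a\<^sub>q]\<close>, where \<open>a\<^sub>i : A\<^sub>q\<^sub>-\<^sub>i \<rightarrow> A\<^sub>q\<^sub>-\<^sub>i\<^sub>+\<^sub>1\<close>.
\<close>

context
  fixes \<U> :: "('u, 'm) cat"
    and \<A> :: "('k::field, 'u, 'm, 'a, 'h::ab_group_add) prestack_data"
begin

fun composable :: "'u \<Rightarrow> 'm list \<Rightarrow> bool" where
  "composable X [] \<longleftrightarrow> X \<in> Ob \<U>"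
| "composable X (u # us) \<longleftrightarrow> u \<in> Ar \<U> \<and> src \<U> u = X \<and> composable (tgt \<U> u) us"

definition last_ob :: "'u \<Rightarrow> 'm list \<Rightarrow> 'u" where
  "last_ob X us = (if us = [] then X else tgt \<U> (last us))"

text \<open>\<open>u\<^sub>p \<cdots> u\<^sub>1\<close>, so that \<open>\<sigma>\<^sup>*\<close> is \<open>fob (composite X us)\<close>, \<open>fmor (composite X us)\<close>.\<close>

fun composite :: "'u \<Rightarrow> 'm list \<Rightarrow> 'm" where
  "composite X [] = idn \<U> X"
| "composite X (u # us) = cmp \<U> (composite (tgt \<U> u) us) u"

text \<open>The functor \<open>\<sigma>\<^sup>\<star> = u\<^sub>1\<^sup>* \<cdots> u\<^sub>p\<^sup>*\<close> on objects and on morphisms \<open>A \<rightarrow> B\<close>.\<close>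

fun star_ob :: "'m list \<Rightarrow> 'a \<Rightarrow> 'a" where
  "star_ob [] A = A"
| "star_ob (u # us) A = fob \<A> u (star_ob us A)"

fun star_mor :: "'m list \<Rightarrow> 'a \<Rightarrow> 'a \<Rightarrow> 'h \<Rightarrow> 'h" where
  "star_mor [] A B f = f"
| "star_mor (u # us) A B f = fmor \<A> u (star_ob us A) (star_ob us B) (star_mor us A B f)"

text \<open>\<open>inner_face i\<close> is \<open>\<partial>\<^sub>i\<close> for \<open>1 \<le> i \<le> p - 1\<close>; it does not involve \<open>U\<^sub>0\<close>.\<close>

definition inner_face :: "nat \<Rightarrow> 'm list \<Rightarrow> 'm list" where
  "inner_face i us = take (i - 1) us @ [cmp \<U> (us ! i) (us ! (i - 1))] @ drop (i + 1) us"

definition face :: "nat \<Rightarrow> 'u \<times> 'm list \<Rightarrow> 'u \<times> 'm list" where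
  "face i = (\<lambda>(X, us).
     if i = 0 then (tgt \<U> (hd us), tl us)
     else if i = length us then (X, butlast us)
     else (X, inner_face i us))"

text \<open>The component \<open>c\<^bsup>\<sigma>,k,A\<^esup>\<close>; by the axioms it is the identity for \<open>k = 0, p\<close>.\<close>

definition c_simp :: "'u \<Rightarrow> 'm list \<Rightarrow> nat \<Rightarrow> 'a \<Rightarrow> 'h" where
  "c_simp X us k A =
     tw \<A> (composite (last_ob X (take k us)) (drop k us)) (composite X (take k us)) A"

text \<open>The component \<open>\<epsilon>\<^bsup>\<sigma>,k,A\<^esup>\<close> for \<open>1 \<le> k \<le> p - 1\<close>.\<close>

definition eps :: "'m list \<Rightarrow> nat \<Rightarrow> 'a \<Rightarrow> 'h" where
  "eps us k A =
     (let D = star_ob (drop (k + 1) us) A in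
      star_mor (take (k - 1) us)
        (fob \<A> (us ! (k - 1)) (fob \<A> (us ! k) D))
        (fob \<A> (cmp \<U> (us ! k) (us ! (k - 1))) D)
        (tw \<A> (us ! k) (us ! (k - 1)) D))"

text \<open>
  A path \<open>(r\<^sub>1, \<dots>, r\<^sub>n\<^sub>-\<^sub>1)\<close> is recorded by listing, for each \<open>r\<^sub>j = \<epsilon>\<^bsup>\<tau>,i\<^esup> : \<tau>\<^sup>\<star> \<rightarrow> (\<partial>\<^sub>i\<tau>)\<^sup>\<star>\<close>, the pair \<open>(\<tau>, i)\<close>.
  \<open>paths l \<sigma>\<close> is the set of paths of a simplex with \<open>l + 1\<close> arrows; it has \<open>l!\<close> elements, one
  for each sequence of choices of \<open>i\<close>.
\<close>

fun paths :: "nat \<Rightarrow> 'm list \<Rightarrow> ('m list \<times> nat) list set" where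
  "paths 0 us = {[]}"
| "paths (Suc l) us = {r @ [(us, i)] | r i. i \<in> {1..Suc l} \<and> r \<in> paths l (inner_face i us)}"

definition path_sign :: "('m list \<times> nat) list \<Rightarrow> 'k" where
  "path_sign r = (- 1) ^ sum_list (map snd r)"

text \<open>
  The functors \<open>T\<^sub>0 = \<sigma>\<^sup>\<star>, \<dots>, T\<^sub>l = \<sigma>\<^sup>*\<close> of a path \<open>r = (r\<^sub>1, \<dots>, r\<^sub>l)\<close> of \<open>\<sigma> = (X, us)\<close> all have the form
  \<open>\<tau>\<^sup>\<star>\<close>: for \<open>y < l\<close>, \<open>T\<^sub>y\<close> is the source of \<open>r\<^sub>l\<^sub>-\<^sub>y\<close>.  \<open>path_fun X us r y\<close> is the \<open>\<tau>\<close> of \<open>T\<^sub>y\<close>.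
\<close>

definition path_fun :: "'u \<Rightarrow> 'm list \<Rightarrow> ('m list \<times> nat) list \<Rightarrow> nat \<Rightarrow> 'm list" where
  "path_fun X us r y =
     (if y < length r then fst (r ! (length r - 1 - y)) else [composite X us])"

definition shuffles :: "nat \<Rightarrow> nat \<Rightarrow> (nat \<Rightarrow> nat) set" where
  "shuffles m l = {\<beta>. \<beta> permutes {1..m + l} \<and>
     strict_mono_on {1..m} \<beta> \<and> strict_mono_on {m + 1..m + l} \<beta>}"

text \<open>
  The simplex \<open>\<beta>(a, r) = (b\<^sub>1, \<dots>, b\<^sub>m\<^sub>+\<^sub>l)\<close>.  \<open>shuffle_mor \<dots> x\<close> is \<open>b\<^sub>x\<close>, and \<open>shuffle_ob \<dots> x\<close> is its source
  (the target of \<open>b\<^sub>1\<close> for \<open>x = 0\<close>).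
\<close>

definition shuffle_mor ::
  "'u \<Rightarrow> 'm list \<Rightarrow> ('m list \<times> nat) list \<Rightarrow> 'a list \<Rightarrow> 'h list \<Rightarrow> (nat \<Rightarrow> nat) \<Rightarrow> nat \<Rightarrow> 'h" where
  "shuffle_mor X us r As as \<beta> x =
     (let m = length as; l = length r; i = inv \<beta> x in
      if i \<le> m then
        (let y = card {j \<in> {m + 1..m + l}. \<beta> j < x} in
         star_mor (path_fun X us r (l - y)) (As ! (m - i)) (As ! (m - i + 1)) (as ! (i - 1)))
      else
        (let y = card {j \<in> {1..m}. \<beta> j < x}; (\<tau>, k) = r ! (i - m - 1) in
         eps \<tau> k (As ! (m - y))))"

definition shuffle_ob ::
  "'u \<Rightarrow> 'm list \<Rightarrow> ('m list \<times> nat) list \<Rightarrow> 'a list \<Rightarrow> 'h list \<Rightarrow> (nat \<Rightarrow> nat) \<Rightarrow> nat \<Rightarrow> 'a" where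
  "shuffle_ob X us r As as \<beta> x =
     (let m = length as; l = length r;
          y = card {j \<in> {m + 1..m + l}. \<beta> j \<le> x};
          z = card {j \<in> {1..m}. \<beta> j \<le> x} in
      star_ob (path_fun X us r (l - y)) (As ! (m - z)))"

definition shuffle_obs ::
  "'u \<Rightarrow> 'm list \<Rightarrow> ('m list \<times> nat) list \<Rightarrow> 'a list \<Rightarrow> 'h list \<Rightarrow> (nat \<Rightarrow> nat) \<Rightarrow> 'a list" where
  "shuffle_obs X us r As as \<beta> =
     (let N = length as + length r in map (\<lambda>j. shuffle_ob X us r As as \<beta> (N - j)) [0..<N + 1])"

definition shuffle_mors ::
  "'u \<Rightarrow> 'm list \<Rightarrow> ('m list \<times> nat) list \<Rightarrow> 'a list \<Rightarrow> 'h list \<Rightarrow> (nat \<Rightarrow> nat) \<Rightarrow> 'h list" where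
  "shuffle_mors X us r As as \<beta> =
     map (shuffle_mor X us r As as \<beta>) [1..<length as + length r + 1]"

text \<open>
  A linear map on a tensor product is given as a multilinear map.  The bidegree \<open>(p, q)\<close> can be
  read off from the lengths of the arguments, so an element of \<open>\<Prod>\<^bsub>p+q=n\<^esub> \<^bold>C\<^bsup>p,q\<^esup>\<close> is a single
  function, extended by zero to arguments that are not simplices with \<open>p + q = n\<close>.
\<close>

definition GS_arg :: "'u \<times> 'm list \<Rightarrow> 'a list \<Rightarrow> 'h list \<Rightarrow> bool" where
  "GS_arg = (\<lambda>(X, us) As as.
     composable X us \<and> length As = length as + 1 \<and> set As \<subseteq> obj \<A> (last_ob X us) \<and>
     (\<forall>i<length as. as ! i \<in> hom \<A> (last_ob X us) (As ! (length as - 1 - i)) (As ! (length as - i))))"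

definition GS_cochains :: "nat \<Rightarrow> ('u \<times> 'm list \<Rightarrow> 'a list \<Rightarrow> 'h list \<Rightarrow> 'h) set" where
  "GS_cochains n = {\<phi>.
     (\<forall>X us As as. GS_arg (X, us) As as \<and> length us + length as = n \<longrightarrow>
        \<phi> (X, us) As as \<in> hom \<A> X (star_ob us (hd As)) (fob \<A> (composite X us) (last As)) \<and>
        (\<forall>i<length as.
           linear_from (hscale \<A>) (hscale \<A>)
             (hom \<A> (last_ob X us) (As ! (length as - 1 - i)) (As ! (length as - i)))
             (\<lambda>x. \<phi> (X, us) As (as[i := x])))) \<and>
     (\<forall>X us As as. \<not> (GS_arg (X, us) As as \<and> length us + length as = n) \<longrightarrow> \<phi> (X, us) As as = 0)}"

text \<open>
  Below, \<open>(X, us)\<close>, \<open>As\<close>, \<open>as\<close> are the arguments at which \<open>d\<^sub>j \<phi>\<close> is evaluated, so that \<open>d\<^sub>j\<close> uses the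
  component of \<open>\<phi>\<close> of bidegree \<open>(length us - j, length as + j - 1)\<close>.
\<close>

definition d_zero ::
  "('u \<times> 'm list \<Rightarrow> 'a list \<Rightarrow> 'h list \<Rightarrow> 'h) \<Rightarrow> 'u \<times> 'm list \<Rightarrow> 'a list \<Rightarrow> 'h list \<Rightarrow> 'h" where
  "d_zero \<phi> = (\<lambda>(X, us) As as.
     let Q = length as; Y = last_ob X us; w = composite X us in
     if Q = 0 then 0 else
       ccmp \<A> X (star_ob us (As ! 0)) (fob \<A> w (As ! (Q - 1))) (fob \<A> w (As ! Q))
         (fmor \<A> w (As ! (Q - 1)) (As ! Q) (as ! 0)) (\<phi> (X, us) (butlast As) (tl as)) +
       (\<Sum>i\<in>{1..<Q}. hscale \<A> ((- 1) ^ i)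
          (\<phi> (X, us) (take (Q - i) As @ drop (Q - i + 1) As)
             (take (i - 1) as @
              [ccmp \<A> Y (As ! (Q - i - 1)) (As ! (Q - i)) (As ! (Q - i + 1)) (as ! (i - 1)) (as ! i)] @
              drop (i + 1) as))) +
       hscale \<A> ((- 1) ^ Q)
         (ccmp \<A> X (star_ob us (As ! 0)) (star_ob us (As ! 1)) (fob \<A> w (As ! Q))
            (\<phi> (X, us) (tl As) (butlast as)) (star_mor us (As ! 0) (As ! 1) (as ! (Q - 1)))))"

definition d_simp ::
  "('u \<times> 'm list \<Rightarrow> 'a list \<Rightarrow> 'h list \<Rightarrow> 'h) \<Rightarrow> 'u \<times> 'm list \<Rightarrow> 'a list \<Rightarrow> 'h list \<Rightarrow> 'h" where
  "d_simp \<phi> = (\<lambda>(X, us) As as.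
     let p = length us - 1; q = length as; w = composite X us; u = hd us; v = last us;
         wR = composite (tgt \<U> u) (tl us); wL = composite X (butlast us);
         S = star_ob us (hd As); A = last As in
       ccmp \<A> X S (fob \<A> u (fob \<A> wR A)) (fob \<A> w A) (c_simp X us 1 A)
         (fmor \<A> u (star_ob (tl us) (hd As)) (fob \<A> wR A) (\<phi> (face 0 (X, us)) As as)) +
       (\<Sum>i\<in>{1..p}. hscale \<A> ((- 1) ^ i)
          (ccmp \<A> X S (star_ob (inner_face i us) (hd As)) (fob \<A> w A)
             (\<phi> (face i (X, us)) As as) (eps us i (hd As)))) +
       hscale \<A> ((- 1) ^ (p + 1))
         (ccmp \<A> X S (fob \<A> wL (fob \<A> v A)) (fob \<A> w A) (c_simp X us p A)
            (\<phi> (face (p + 1) (X, us)) (map (fob \<A> v) As)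
               (map (\<lambda>i. fmor \<A> v (As ! (q - 1 - i)) (As ! (q - i)) (as ! i)) [0..<q]))))"

definition d_higher ::
  "nat \<Rightarrow> ('u \<times> 'm list \<Rightarrow> 'a list \<Rightarrow> 'h list \<Rightarrow> 'h) \<Rightarrow> 'u \<times> 'm list \<Rightarrow> 'a list \<Rightarrow> 'h list \<Rightarrow> 'h" where
  "d_higher j \<phi> = (\<lambda>(X, us) As as.
     let p = length us - j; t = length as; L = take p us; R = drop p us; Y = last_ob X L;
         w = composite X us; wL = composite X L; wR = composite Y R; A = last As in
       \<Sum>r\<in>paths (j - 1) R. \<Sum>\<beta>\<in>shuffles t (j - 1).
         hscale \<A> (path_sign r * of_int (sign \<beta>) * (- 1) ^ t)
           (ccmp \<A> X (star_ob us (hd As)) (fob \<A> wL (fob \<A> wR A)) (fob \<A> w A)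
              (c_simp X us p A)
              (\<phi> (X, L) (shuffle_obs Y R r As as \<beta>) (shuffle_mors Y R r As as \<beta>))))"

text \<open>In \<open>d\<^sub>1\<close> the sign \<open>(-1)\<^sup>n\<close> has \<open>n\<close> the total degree of \<open>d \<phi>\<close>.\<close>

definition d_comp ::
  "nat \<Rightarrow> ('u \<times> 'm list \<Rightarrow> 'a list \<Rightarrow> 'h list \<Rightarrow> 'h) \<Rightarrow> 'u \<times> 'm list \<Rightarrow> 'a list \<Rightarrow> 'h list \<Rightarrow> 'h" where
  "d_comp j \<phi> = (\<lambda>\<sigma> As as.
     if j = 0 then d_zero \<phi> \<sigma> As as
     else if j = 1 then hscale \<A> ((- 1) ^ (length (snd \<sigma>) + length as)) (d_simp \<phi> \<sigma> As as)
     else d_higher j \<phi> \<sigma> As as)"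

definition GS_d ::
  "nat \<Rightarrow> ('u \<times> 'm list \<Rightarrow> 'a list \<Rightarrow> 'h list \<Rightarrow> 'h) \<Rightarrow> 'u \<times> 'm list \<Rightarrow> 'a list \<Rightarrow> 'h list \<Rightarrow> 'h" where
  "GS_d n \<phi> = (\<lambda>\<sigma> As as.
     if GS_arg \<sigma> As as \<and> length (snd \<sigma>) + length as = n + 1
     then \<Sum>j\<le>length (snd \<sigma>). d_comp j \<phi> \<sigma> As as else 0)"

definition GS_cohomology ::
  "nat \<Rightarrow> ('k, ('u \<times> 'm list \<Rightarrow> 'a list \<Rightarrow> 'h list \<Rightarrow> 'h) set) kspace" where
  "GS_cohomology n =
     cohomology (\<lambda>c \<phi> \<sigma> As as. hscale \<A> c (\<phi> \<sigma> As as)) GS_cochains GS_d n"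

end

end

theory Submission
  imports Defs
begin

text \<open>
  A Gerstenhaber--Schack cochain of degree \<open>n\<close> is a family of multilinear maps on simplices of
  the nerve decorated with simplices of \<open>\<A>\<close>.  Such families are the same as bimodule homomorphisms
  out of a bimodule freely generated by the decorated simplices, and the proof consists in turning
  this remark into a projective resolution of \<open>\<A>\<close>.

  \<^bold>\<open>The resolution.\<close>  \<open>Bb n\<close> is spanned at \<open>(X, P, Q)\<close> by elements \<open>gen us A xs b g\<close>, where \<open>us\<close> is a
  nonempty path starting at \<open>X\<close>, \<open>xs\<close> is a chain of composable morphisms starting at \<open>A\<close> and ending at \<open>E\<close> in the
  category over the end of \<open>us\<close>, \<open>g : P \<rightarrow> us\<^sup>\<star> A\<close> and \<open>b : us\<^sup>* E \<rightarrow> Q\<close>, and \<open>|us| + |xs| = n + 1\<close>; it is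
  multilinear in \<open>xs\<close>, \<open>b\<close> and \<open>g\<close>.  The generators whose first arrow is an identity and whose \<open>b\<close>
  and \<open>g\<close> are identities generate \<open>Bb n\<close> freely (\<open>gen_Fk_ug\<close>, \<open>ph_hom\<close>, \<open>ph_hg_Fk\<close>): homomorphisms
  \<open>Bb n \<rightarrow> M\<close> are cochains with values in \<open>M\<close>.  As the ground ring is a field, cochains lift
  along surjections value by value, so \<open>Bb n\<close> is projective (\<open>projective_Bb\<close>).

  \<^bold>\<open>Exactness.\<close>  For fixed \<open>(X, P, Q)\<close> the differential \<open>Dl\<close> has two kinds of contractions.  Putting the
  identity of \<open>X\<close> in front of the path is a homotopy between the identity and a map \<open>Pm\<close> onto the
  generators with \<open>us = [1]\<close> (\<open>Dl_contraction\<close>), and those form the bar complex of the category \<open>\<A>(X)\<close>,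
  which is contracted by moving \<open>g\<close> into the chain (\<open>Dl_Sm\<close>).  The map \<open>Pm\<close> sums over all
  ways to shuffle the chain with the paths from \<open>us\<^sup>\<star>\<close> to \<open>us\<^sup>*\<close>; that it is a chain map (\<open>Dl_Pm\<close>)
  is the combinatorial heart of the matter and rests on the formula for the boundary of a path-shuffle sum
  (\<open>S_boundary\<close>).  The contractions also show, by induction on the degree, that the differential
  squares to zero (\<open>dd_dd\<close>), so that \<open>Bb\<close> resolves \<open>\<A>\<close> (\<open>resolution_Bb\<close>).

  \<^bold>\<open>Comparison.\<close>  Any two projective resolutions are homotopy equivalent, so they compute the same
  \<open>Ext\<close> (\<open>Ext_independent\<close>).  Evaluating homomorphisms \<open>Bb n \<rightarrow> \<A>\<close> at the free generators is a bijection onto the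
  cochains of degree \<open>n\<close>, and it carries composition with the differential of \<open>Bb\<close> to the
  Gerstenhaber--Schack differential (\<open>Dl_ug_GS_d\<close>); for the components \<open>d\<^sub>j\<close> with \<open>j \<ge> 2\<close> this says that the sum over
  paths and shuffles satisfies the recursion that defines the path-shuffle sums (\<open>path_shuffle_sum\<close>).

  Formal sums are never written down.  A sum of decorated simplices is represented by the functional
  that takes a function \<open>K\<close> on simplices to the corresponding sum of values of \<open>K\<close>; the same formula then serves
  for the differential of \<open>Bb\<close> and for the differential of cochains.
\<close>

section \<open>Signs, subspaces and cohomology\<close>

text \<open>Signs act on arbitrary abelian groups, so that the values of sums of simplices need not
 be scaled by field elements.\<close>

definition sg :: "nat => 'x::ab_group_add => 'x" where
 "sg n x = (if even n then x else - x)"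

lemma sg_0 [simp]: "sg 0 x = x"
 and sg_Suc [simp]: "sg (Suc n) x = - sg n x"
 and sg_zero [simp]: "sg n 0 = 0"
 and sg_minus [simp]: "sg n (- x) = - sg n x"
 by (auto simp: sg_def)

lemma sg_sg: "sg m (sg n x) = sg (m + n) x"
 and sg_add: "sg n (x + y) = sg n x + sg n y"
 and sg_diff: "sg n (x - y) = sg n x - sg n y"
 by (auto simp: sg_def)

lemma sg_sum: "sg n (sum f I) = (\<Sum>i\<in>I. sg n (f i))"
 by (simp add: sg_def sum_negf)

lemma sg_parity: "even (m + n) ==> sg m x = sg n x"
 by (auto simp: sg_def)

lemma sg_parity_odd: "odd (m + n) ==> sg m x = - sg n x"
 by (auto simp: sg_def)

lemma (in module) scale_sg: "scale ((- 1) ^ n) x = sg n x"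
 by (cases "even n") (auto simp: sg_def)

lemma linear_fromI:
 assumes "!!x y. x \<in> X ==> y \<in> X ==> f (x + y) = f x + f y"
  and "!!c x. x \<in> X ==> f (s c x) = s' c (f x)"
 shows "linear_from s s' X f"
 using assms by (auto simp: linear_from_def)

lemma linear_fromD:
 assumes "linear_from s s' X f"
 shows "x \<in> X ==> y \<in> X ==> f (x + y) = f x + f y" "x \<in> X ==> f (s c x) = s' c (f x)"
 using assms by (auto simp: linear_from_def)

lemma lin_combination:
 assumes "linear_from s s' X f" "vector_space s" "module.subspace s X" "x \<in> X" "y \<in> X"
 shows "f (x + s c y) = f x + s' c (f y)"
proof -
 interpret vector_space s by fact
 show ?thesis
  using assms subspace_scale[OF assms(3,5)] by (simp add: linear_from_def)
qed

lemma lin_combinationI: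
 assumes "vector_space s" "vector_space s'" "module.subspace s X"
  and f: "!!c x y. x \<in> X ==> y \<in> X ==> f (x + s c y) = f x + s' c (f y)"
 shows "linear_from s s' X f"
proof -
 interpret s: vector_space s by fact
 interpret s': vector_space s' by fact
 have z: "0 \<in> X" by (rule s.subspace_0[OF assms(3)])
 have f0: "f 0 = 0" using f[OF z z, of 1] by simp
 show ?thesis
 proof (rule linear_fromI)
  show "f (x + y) = f x + f y" if "x \<in> X" "y \<in> X" for x y
   using f[OF that, of 1] by simp
  show "f (s c x) = s' c (f x)" if "x \<in> X" for c x
   using f[OF z that, of c] f0 by simp
 qed
qed

lemma lin_minus:
 assumes "linear_from s s' X f" "vector_space s" "vector_space s'" "x \<in> X"
 shows "f (- x) = - f x"
proof -
 interpret s: vector_space s by fact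
 interpret s': vector_space s' by fact
 show ?thesis using linear_fromD(2)[OF assms(1,4), of "- 1"] by simp
qed

lemma lin_diff:
 assumes "linear_from s s' X f" "vector_space s" "vector_space s'" "module.subspace s X" "x \<in> X" "y \<in> X"
 shows "f (x - y) = f x - f y"
proof -
 interpret s: vector_space s by fact
 show ?thesis
  using linear_fromD(1)[OF assms(1,5), of "- y"] lin_minus[OF assms(1-3,6)]
   s.subspace_neg[OF assms(4,6)] by simp
qed

lemma lin_0:
 assumes "linear_from s s' X f" "vector_space s" "module.subspace s X"
 shows "f 0 = 0"
proof -
 interpret s: vector_space s by fact
 show ?thesis
  using linear_fromD(1)[OF assms(1), of 0 0] s.subspace_0[OF assms(3)] by simp
qed

lemma vector_space_pointwise:
 assumes "vector_space s"
 shows "vector_space (%c f x. s c (f x))"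
proof -
 interpret vector_space s by fact
 show ?thesis
  by unfold_locales (auto simp: fun_eq_iff scale_right_distrib scale_left_distrib)
qed

lemma subspaceI:
 assumes "vector_space s" "0 \<in> X" "!!x y. x \<in> X ==> y \<in> X ==> x + y \<in> X" "!!c x. x \<in> X ==> s c x \<in> X"
 shows "module.subspace s X"
proof -
 interpret vector_space s by fact
 show ?thesis using assms by (auto simp: subspace_def)
qed

lemma subspaceD:
 assumes "vector_space s" "module.subspace s X"
 shows "0 \<in> X" "x \<in> X ==> y \<in> X ==> x + y \<in> X" "x \<in> X ==> s c x \<in> X" "x \<in> X ==> y \<in> X ==> x - y \<in> X"
  "x \<in> X ==> - x \<in> X"
proof -
 interpret vector_space s by fact
 show "0 \<in> X" "x \<in> X ==> y \<in> X ==> x + y \<in> X" "x \<in> X ==> s c x \<in> X" "x \<in> X ==> y \<in> X ==> x - y \<in> X"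
  "x \<in> X ==> - x \<in> X"
  by (simp_all add: assms(2) subspace_0 subspace_add subspace_scale subspace_diff subspace_neg)
qed

lemma subspace_sum_closed:
 assumes "vector_space s" "module.subspace s X" "!!i. i \<in> I ==> f i \<in> X"
 shows "sum f I \<in> X"
proof -
 interpret vector_space s by fact
 show ?thesis using assms subspace_sum by blast
qed

lemma subspace_sg:
 assumes "vector_space s" "module.subspace s X" "x \<in> X"
 shows "sg n x \<in> X"
 using assms subspaceD(5)[OF assms(1,2)] by (auto simp: sg_def)

lemma quot_rel_equiv:
 assumes "vector_space s" "module.subspace s B"
 shows "equiv Z (quot_rel Z B)"
proof (rule equivI)
 note D = subspaceD[OF assms]
 show "quot_rel Z B \<subseteq> Z \<times> Z" by (auto simp: quot_rel_def)
 show "refl_on Z (quot_rel Z B)" using D(1) by (auto simp: refl_on_def quot_rel_def)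
 show "sym (quot_rel Z B)"
  using D(5) by (force simp: sym_def quot_rel_def)
 show "trans (quot_rel Z B)"
 proof (rule transI)
  fix x y z
  assume "(x, y) \<in> quot_rel Z B" "(y, z) \<in> quot_rel Z B"
  then show "(x, z) \<in> quot_rel Z B"
   using D(2)[of "x - y" "y - z"] by (auto simp: quot_rel_def)
 qed
qed

text \<open>A quotient is handled through representatives: the sum and the multiples of classes are the
 classes of the sums and multiples.\<close>

lemma quot_space_ops:
 assumes s: "vector_space s" and Z: "module.subspace s Z" and B: "module.subspace s B"
  and x: "x \<in> Z" and y: "y \<in> Z"
 shows "vadd (quot_space s Z B) (quot_rel Z B `` {x}) (quot_rel Z B `` {y}) = quot_rel Z B `` {x + y}"
  and "vscale (quot_space s Z B) c (quot_rel Z B `` {x}) = quot_rel Z B `` {s c x}"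
proof -
 interpret vector_space s by fact
 note ZD = subspaceD[OF s Z] and BD = subspaceD[OF s B]
 note eq = quot_rel_equiv[OF s B, of Z]
 have 1: "congruent2 (quot_rel Z B) (quot_rel Z B) (%x y. quot_rel Z B `` {x + y})"
 proof (rule congruent2I')
  fix a b c d
  assume h: "(a, b) \<in> quot_rel Z B" "(c, d) \<in> quot_rel Z B"
  have "(a - b) + (c - d) \<in> B" using h by (intro BD(2)) (auto simp: quot_rel_def)
  then have "(a + c, b + d) \<in> quot_rel Z B"
   using h ZD(2) by (auto simp: quot_rel_def algebra_simps)
  then show "quot_rel Z B `` {a + c} = quot_rel Z B `` {b + d}"
   using eq by (rule equiv_class_eq[rotated])
 qed
 show "vadd (quot_space s Z B) (quot_rel Z B `` {x}) (quot_rel Z B `` {y}) = quot_rel Z B `` {x + y}"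
  unfolding quot_space_def using UN_equiv_class2[OF eq eq 1 x y] by simp
 have 2: "congruent (quot_rel Z B) (%x. quot_rel Z B `` {s c x})"
 proof (rule congruentI)
  fix a b
  assume h: "(a, b) \<in> quot_rel Z B"
  have "s c (a - b) \<in> B" using h by (intro BD(3)) (auto simp: quot_rel_def)
  then have "(s c a, s c b) \<in> quot_rel Z B"
   using h ZD(3) by (auto simp: quot_rel_def scale_right_diff_distrib)
  then show "quot_rel Z B `` {s c a} = quot_rel Z B `` {s c b}"
   using eq by (rule equiv_class_eq[rotated])
 qed
 show "vscale (quot_space s Z B) c (quot_rel Z B `` {x}) = quot_rel Z B `` {s c x}"
  unfolding quot_space_def using UN_equiv_class[OF eq 2 x] by simp
qed

text \<open>The values of \<open>\<alpha>\<close> are only needed up to \<open>B'\<close>, so surjectivity is asked for modulo \<open>B'\<close>.\<close>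

lemma quot_space_iso:
 fixes s :: "'k::field => 'x => 'x::ab_group_add" and s' :: "'k => 'y => 'y::ab_group_add"
 assumes s: "vector_space s" and Z: "module.subspace s Z" and B: "module.subspace s B"
  and s': "vector_space s'" and Z': "module.subspace s' Z'" and B': "module.subspace s' B'"
  and \<alpha>: "!!x. x \<in> Z ==> \<alpha> x \<in> Z'" "linear_from s s' Z \<alpha>"
  and inj: "!!x. x \<in> Z ==> \<alpha> x \<in> B' \<longleftrightarrow> x \<in> B"
  and surj: "!!z. z \<in> Z' ==> \<exists>x\<in>Z. \<alpha> x - z \<in> B'"
 shows "kspace_iso (quot_space s Z B) (quot_space s' Z' B')"
proof -
 let ?r = "quot_rel Z B" and ?r' = "quot_rel Z' B'"
 note ZD = subspaceD[OF s Z] and eq = quot_rel_equiv[OF s B, of Z]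
  and eq' = quot_rel_equiv[OF s' B', of Z']
 define F where "F X = (\<Union>x\<in>X. ?r' `` {\<alpha> x})" for X
 have rel: "(x, y) \<in> ?r \<longleftrightarrow> (\<alpha> x, \<alpha> y) \<in> ?r'" if "x \<in> Z" "y \<in> Z" for x y
  using that inj[of "x - y"] lin_diff[OF \<alpha>(2) s s' Z that] ZD(4) \<alpha>(1)
  by (auto simp: quot_rel_def)
 have cong: "congruent ?r (%x. ?r' `` {\<alpha> x})"
 proof (rule congruentI)
  fix x y assume "(x, y) \<in> ?r"
  then show "?r' `` {\<alpha> x} = ?r' `` {\<alpha> y}"
   using rel[of x y] eq' by (intro equiv_class_eq) (auto simp: quot_rel_def)
 qed
 have F: "F (?r `` {x}) = ?r' `` {\<alpha> x}" if "x \<in> Z" for x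
  unfolding F_def by (rule UN_equiv_class[OF eq cong that])
 have carr: "vcarrier (quot_space s Z B) = Z // ?r" "vcarrier (quot_space s' Z' B') = Z' // ?r'"
  by (simp_all add: quot_space_def)
 have "bij_betw F (Z // ?r) (Z' // ?r')"
 proof (rule bij_betwI')
  fix X Y assume X: "X \<in> Z // ?r" and Y: "Y \<in> Z // ?r"
  obtain x where x: "x \<in> Z" "X = ?r `` {x}" using X by (auto elim: quotientE)
  obtain y where y: "y \<in> Z" "Y = ?r `` {y}" using Y by (auto elim: quotientE)
  show "F X = F Y \<longleftrightarrow> X = Y"
   unfolding x(2) y(2) F[OF x(1)] F[OF y(1)]
   using eq_equiv_class_iff[OF eq x(1) y(1)] eq_equiv_class_iff[OF eq' \<alpha>(1)[OF x(1)] \<alpha>(1)[OF y(1)]]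
    rel[OF x(1) y(1)] by simp
  show "F X \<in> Z' // ?r'" unfolding x(2) F[OF x(1)] by (intro quotientI \<alpha> x)
 next
  fix W assume "W \<in> Z' // ?r'"
  then obtain z where z: "z \<in> Z'" "W = ?r' `` {z}" by (auto elim: quotientE)
  obtain x where x: "x \<in> Z" "\<alpha> x - z \<in> B'" using surj[OF z(1)] by blast
  have "(\<alpha> x, z) \<in> ?r'" using x z \<alpha>(1) by (auto simp: quot_rel_def)
  then have "W = F (?r `` {x})" unfolding F[OF x(1)] z(2) using eq' equiv_class_eq by fastforce
  then show "\<exists>X\<in>Z // ?r. W = F X" using x(1) by (auto intro: quotientI)
 qed
 moreover have "F (vadd (quot_space s Z B) X Y) = vadd (quot_space s' Z' B') (F X) (F Y)"
  if X: "X \<in> Z // ?r" and Y: "Y \<in> Z // ?r" for X Y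
 proof -
  obtain x where x: "x \<in> Z" "X = ?r `` {x}" using X by (auto elim: quotientE)
  obtain y where y: "y \<in> Z" "Y = ?r `` {y}" using Y by (auto elim: quotientE)
  show ?thesis
   unfolding x(2) y(2)
   using x(1) y(1) \<alpha> ZD(2) by (simp add: quot_space_ops[OF s Z B] quot_space_ops[OF s' Z' B'] F linear_fromD)
 qed
 moreover have "F (vscale (quot_space s Z B) c X) = vscale (quot_space s' Z' B') c (F X)"
  if X: "X \<in> Z // ?r" for c X
 proof -
  obtain x where x: "x \<in> Z" "X = ?r `` {x}" using X by (auto elim: quotientE)
  show ?thesis
   unfolding x(2)
   using x(1) \<alpha> ZD(3) quot_space_ops(2)[OF s Z B x(1) x(1)] quot_space_ops(2)[OF s' Z' B' \<alpha>(1) \<alpha>(1), OF x(1) x(1)]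
   by (simp add: F linear_fromD)
 qed
 ultimately show ?thesis unfolding kspace_iso_def carr by blast
qed

lemma kspace_iso_trans:
 assumes "kspace_iso V W" "kspace_iso W X"
 shows "kspace_iso V X"
proof -
 obtain F where F: "bij_betw F (vcarrier V) (vcarrier W)"
  "\<forall>x\<in>vcarrier V. \<forall>y\<in>vcarrier V. F (vadd V x y) = vadd W (F x) (F y)"
  "\<forall>c. \<forall>x\<in>vcarrier V. F (vscale V c x) = vscale W c (F x)"
  using assms(1) unfolding kspace_iso_def by blast
 obtain G where G: "bij_betw G (vcarrier W) (vcarrier X)"
  "\<forall>x\<in>vcarrier W. \<forall>y\<in>vcarrier W. G (vadd W x y) = vadd X (G x) (G y)"
  "\<forall>c. \<forall>x\<in>vcarrier W. G (vscale W c x) = vscale X c (G x)"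
  using assms(2) unfolding kspace_iso_def by blast
 have "F x \<in> vcarrier W" if "x \<in> vcarrier V" for x using F(1) that by (auto simp: bij_betw_def)
 then show ?thesis
  unfolding kspace_iso_def using F G bij_betw_trans[OF F(1) G(1)]
  by (intro exI[of _ "G \<circ> F"]) simp
qed

definition cochain_complex ::
 "('k::field => 'x => 'x) => (nat => 'x::ab_group_add set) => (nat => 'x => 'x) => bool" where
 "cochain_complex s C d \<longleftrightarrow> vector_space s &
   (\<forall>n. module.subspace s (C n) & linear_from s s (C n) (d n) & d n ` C n \<subseteq> C (Suc n))"

lemma cochain_complexD:
 assumes "cochain_complex s C d"
 shows "vector_space s" "module.subspace s (C n)" "linear_from s s (C n) (d n)"
  "x \<in> C n ==> d n x \<in> C (Suc n)"
 using assms by (auto simp: cochain_complex_def)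

lemma subspace_cocycles:
 assumes "cochain_complex s C d"
 shows "module.subspace s (cocycles C d n)"
proof (rule subspaceI)
 note D = cochain_complexD[OF assms]
 interpret vector_space s by (rule D)
 note S = subspaceD[OF D(1) D(2)]
 show "vector_space s" by (rule D)
 show "0 \<in> cocycles C d n" using lin_0[OF D(3) D(1) D(2)] S by (simp add: cocycles_def)
 show "x + y \<in> cocycles C d n" if "x \<in> cocycles C d n" "y \<in> cocycles C d n" for x y
  using that S linear_fromD(1)[OF D(3)] by (auto simp: cocycles_def)
 show "s c x \<in> cocycles C d n" if "x \<in> cocycles C d n" for c x
  using that S linear_fromD(2)[OF D(3)] by (auto simp: cocycles_def)
qed

lemma subspace_coboundaries:
 assumes "cochain_complex s C d"
 shows "module.subspace s (coboundaries C d n)"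
proof (cases n)
 case 0
 interpret vector_space s by (rule cochain_complexD[OF assms])
 show ?thesis by (simp add: 0 coboundaries_def subspace_single_0)
next
 case (Suc m)
 note D = cochain_complexD[OF assms]
 note S = subspaceD[OF D(1) D(2)]
 have e: "coboundaries C d n = d m ` C m" by (simp add: Suc coboundaries_def)
 show ?thesis unfolding e
 proof (rule subspaceI[OF D(1)])
  show "0 \<in> d m ` C m" using lin_0[OF D(3) D(1) D(2)] S(1) by (metis image_eqI)
  show "x + y \<in> d m ` C m" if "x \<in> d m ` C m" "y \<in> d m ` C m" for x y
   using that linear_fromD(1)[OF D(3), symmetric] S(2) by (auto intro!: imageI)
  show "s c x \<in> d m ` C m" if "x \<in> d m ` C m" for c x
   using that linear_fromD(2)[OF D(3), symmetric] S(3) by (auto intro!: imageI)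
 qed
qed

text \<open>Chain maps in both directions that are inverse to each other on cocycles up to coboundaries
 induce mutually inverse maps on cohomology.\<close>

lemma cohomology_iso:
 fixes s :: "'k::field => 'x => 'x::ab_group_add" and s' :: "'k => 'y => 'y::ab_group_add"
 assumes C: "cochain_complex s C d" and C': "cochain_complex s' C' d'"
  and \<alpha>: "!!n x. x \<in> C n ==> \<alpha> n x \<in> C' n" "!!n. linear_from s s' (C n) (\<alpha> n)"
   "!!n x. x \<in> C n ==> \<alpha> (Suc n) (d n x) = d' n (\<alpha> n x)"
  and \<beta>: "!!n x. x \<in> C' n ==> \<beta> n x \<in> C n" "!!n. linear_from s' s (C' n) (\<beta> n)"
   "!!n x. x \<in> C' n ==> \<beta> (Suc n) (d' n x) = d n (\<beta> n x)"
  and \<beta>\<alpha>: "!!n x. x \<in> cocycles C d n ==> \<beta> n (\<alpha> n x) - x \<in> coboundaries C d n"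
  and \<alpha>\<beta>: "!!n x. x \<in> cocycles C' d' n ==> \<alpha> n (\<beta> n x) - x \<in> coboundaries C' d' n"
 shows "kspace_iso (cohomology s C d n) (cohomology s' C' d' n)"
proof -
 note D = cochain_complexD[OF C] and D' = cochain_complexD[OF C']
 note Z = subspace_cocycles[OF C] subspace_coboundaries[OF C]
 note Z' = subspace_cocycles[OF C'] subspace_coboundaries[OF C']
 note BD = subspaceD[OF D(1) Z(2)] and BD' = subspaceD[OF D'(1) Z'(2)]
 have 0: "\<alpha> n 0 = 0" "\<beta> n 0 = 0" for n
  using lin_0[OF \<alpha>(2) D(1,2)] lin_0[OF \<beta>(2) D'(1,2)] by auto
 have \<alpha>Z: "\<alpha> n x \<in> cocycles C' d' n" if "x \<in> cocycles C d n" for x n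
  using that \<alpha>(1) \<alpha>(3)[of x n] 0 by (auto simp: cocycles_def)
 have \<beta>Z: "\<beta> n x \<in> cocycles C d n" if "x \<in> cocycles C' d' n" for x n
  using that \<beta>(1) \<beta>(3)[of x n] 0 by (auto simp: cocycles_def)
 have \<alpha>B: "\<alpha> n x \<in> coboundaries C' d' n" if "x \<in> coboundaries C d n" for x n
  using that \<alpha> 0 by (auto simp: coboundaries_def split: nat.splits)
 have \<beta>B: "\<beta> n x \<in> coboundaries C d n" if "x \<in> coboundaries C' d' n" for x n
  using that \<beta> 0 by (auto simp: coboundaries_def split: nat.splits)
 show ?thesis
  unfolding cohomology_def
 proof (rule quot_space_iso[OF D(1) Z D'(1) Z', where \<alpha> = "\<alpha> n"])
  show "linear_from s s' (cocycles C d n) (\<alpha> n)"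
   using \<alpha>(2)[of n] by (auto simp: linear_from_def cocycles_def)
  show "\<alpha> n x \<in> coboundaries C' d' n \<longleftrightarrow> x \<in> coboundaries C d n" if x: "x \<in> cocycles C d n" for x
  proof
   assume "\<alpha> n x \<in> coboundaries C' d' n"
   then have "\<beta> n (\<alpha> n x) \<in> coboundaries C d n" by (rule \<beta>B)
   from BD(4)[OF this \<beta>\<alpha>[OF x]] show "x \<in> coboundaries C d n" by simp
  qed (rule \<alpha>B)
  show "\<exists>x\<in>cocycles C d n. \<alpha> n x - z \<in> coboundaries C' d' n" if "z \<in> cocycles C' d' n" for z
   using \<alpha>\<beta>[OF that] \<beta>Z[OF that] by blast
 qed (rule \<alpha>Z)
qed

section \<open>Tensor products inside an ambient space\<close>

text \<open>An injective family of independent vectors indexed by pairs of an index and a word provides room for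
 one tensor power of \<open>'h\<close> for each index and each length: a word in a basis of \<open>'h\<close> goes to the corresponding
 vector, and \<open>ten_rec\<close> extends this linearly in each letter.\<close>

locale tensor_space = vs: vector_space s + hs: vector_space sh
 for s :: "'k::field => 'v => 'v::ab_group_add" and sh :: "'k => 'h => 'h::ab_group_add" +
 fixes e :: "'i * 'h list => 'v"
 assumes inj_e: "inj e" and independent_e: "~ module.dependent s (range e)"
begin

sublocale pair: vector_space_pair sh s ..

definition basis :: "'h set" where "basis = hs.extend_basis {}"

lemma basis: "~ hs.dependent basis" "hs.span basis = UNIV"
 unfolding basis_def
 using hs.independent_extend_basis[OF hs.independent_empty] hs.span_extend_basis[OF hs.independent_empty]
 by auto

fun ten_rec :: "'i => 'h list => 'h list => 'v" where
 "ten_rec i acc [] = e (i, acc)"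
| "ten_rec i acc (h # hs) = pair.construct basis (%b. ten_rec i (acc @ [b]) hs) h"

definition ten :: "'i => 'h list => 'v" where
 "ten i hs = ten_rec i [] hs"

lemma ten_rec_combination:
 "ten_rec i acc (xs @ (x + sh c y) # ys) = ten_rec i acc (xs @ x # ys) + s c (ten_rec i acc (xs @ y # ys))"
proof (induction xs arbitrary: acc)
 case Nil
 interpret l: Vector_Spaces.linear sh s "pair.construct basis (%b. ten_rec i (acc @ [b]) ys)"
  by (rule pair.linear_construct[OF basis(1)])
 show ?case by (simp add: l.add l.scale)
next
 case (Cons z xs)
 show ?case
  by (simp add: Cons.IH pair.construct_add[OF basis(1)] pair.construct_scale[OF basis(1)])
qed

lemma ten_combination:
 "ten i (xs @ (x + sh c y) # ys) = ten i (xs @ x # ys) + s c (ten i (xs @ y # ys))"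
 unfolding ten_def by (rule ten_rec_combination)

text \<open>A multilinear function given only on a product of subspaces extends to the full product, since
 subspaces are retracts; it then factors through the free vector space on words in a basis.\<close>

theorem ten_universal:
 fixes sw :: "'k => 'w => 'w::ab_group_add" and \<phi> :: "'i => 'h list => 'w" and Hs :: "'i => 'h set list"
 assumes sw: "vector_space sw"
  and sub: "!!i H. i \<in> I ==> H \<in> set (Hs i) ==> hs.subspace H"
  and multi: "!!i xs x y c ys. i \<in> I ==> list_all2 (\<in>) (xs @ x # ys) (Hs i) ==>
   list_all2 (\<in>) (xs @ y # ys) (Hs i) ==>
   \<phi> i (xs @ (x + sh c y) # ys) = \<phi> i (xs @ x # ys) + sw c (\<phi> i (xs @ y # ys))"
 obtains \<Phi> where "Vector_Spaces.linear s sw \<Phi>"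
  and "!!i hs. i \<in> I ==> list_all2 (\<in>) hs (Hs i) ==> \<Phi> (ten i hs) = \<phi> i hs"
proof -
 interpret ws: vector_space sw by fact
 interpret hw: vector_space_pair sh sw ..
 interpret vw: vector_space_pair s sw ..
 interpret hh: vector_space_pair sh sh ..
 have "\<exists>p. Vector_Spaces.linear sh sh p & (\<forall>x. p x \<in> H) & (\<forall>x\<in>H. p x = x)" if H: "hs.subspace H" for H
 proof -
  obtain B where B: "B \<subseteq> H" "~ hs.dependent B" "H \<subseteq> hs.span B"
   using hs.maximal_independent_subset by blast
  obtain p where p: "Vector_Spaces.linear sh sh p" "\<forall>x\<in>B. p x = id x" "range p = hs.span (id ` B)"
   using hh.linear_independent_extend_subspace[OF B(2), of id] by blast
  have "hs.span B \<subseteq> H" using B(1) H by (rule hs.span_minimal)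
  moreover have "p x = id x" if "x \<in> hs.span B" for x
   using hh.linear_eq_on_span[OF p(1) _ _ that, of id] p(2) hs.linear_id by auto
  ultimately show ?thesis using p B by (intro exI[of _ p]) auto
 qed
 then obtain pr where pr: "Vector_Spaces.linear sh sh (pr H)" "pr H x \<in> H" "y \<in> H ==> pr H y = y"
  if "hs.subspace H" for H x y
  by metis
 define \<psi> where "\<psi> i hs = \<phi> i (map2 pr (Hs i) hs)" for i hs
 have \<psi>: "\<psi> i (xs @ (x + sh c y) # ys) = \<psi> i (xs @ x # ys) + sw c (\<psi> i (xs @ y # ys))"
  if i: "i \<in> I" and len: "length (Hs i) = length (xs @ x # ys)" for i xs x c y ys
 proof -
  define H1 where "H1 = take (length xs) (Hs i)"
  define H2 where "H2 = Hs i ! length xs"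
  define H3 where "H3 = drop (Suc (length xs)) (Hs i)"
  have Hs: "Hs i = H1 @ H2 # H3" unfolding H1_def H2_def H3_def
   using len by (simp add: id_take_nth_drop[symmetric])
  have l: "length H1 = length xs" "length H3 = length ys" using len unfolding H1_def H3_def by auto
  have sub': "hs.subspace H2" "!!H. H \<in> set H1 ==> hs.subspace H" "!!H. H \<in> set H3 ==> hs.subspace H"
   using sub[OF i] Hs by auto
  interpret p: Vector_Spaces.linear sh sh "pr H2" by (rule pr(1)[OF sub'(1)])
  have "list_all2 (\<in>) (map2 pr H zs) H" if "length H = length zs" "!!X. X \<in> set H ==> hs.subspace X" for H zs
   unfolding list_all2_conv_all_nth using that pr(2) by simp
  then have la: "list_all2 (\<in>) (map2 pr H1 xs @ pr H2 z # map2 pr H3 ys) (H1 @ H2 # H3)" for z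
   using l sub' pr(2) by (simp add: list_all2_append)
  show ?thesis unfolding \<psi>_def Hs using l multi[OF i, unfolded Hs, OF la la]
   by (simp add: p.add p.scale)
 qed
 obtain \<Phi> where \<Phi>: "Vector_Spaces.linear s sw \<Phi>" "\<forall>v\<in>range e. \<Phi> v = (%v. case inv e v of (i, hs) => \<psi> i hs) v"
  using vw.linear_independent_extend[OF independent_e, of "%v. case inv e v of (i, hs) => \<psi> i hs"] by blast
 have \<Phi>e: "\<Phi> (e (i, hs)) = \<psi> i hs" for i hs using \<Phi>(2) inv_f_f[OF inj_e] by simp
 interpret \<Phi>: Vector_Spaces.linear s sw \<Phi> by fact
 have key: "\<Phi> (ten_rec i acc hs) = \<psi> i (acc @ hs)" if i: "i \<in> I" "length (acc @ hs) = length (Hs i)" for i acc hs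
  using that(2)
 proof (induction hs arbitrary: acc)
  case Nil then show ?case by (simp add: \<Phi>e)
 next
  case (Cons h hs)
  have m: "\<psi> i (acc @ (x + sh c y) # hs) = \<psi> i (acc @ x # hs) + sw c (\<psi> i (acc @ y # hs))" for x y c
   using \<psi>[OF i(1), of acc x hs c y] Cons.prems by simp
  have "linear_from sh sw UNIV (%h. \<psi> i (acc @ h # hs))"
   by (rule lin_combinationI[OF hs.vector_space_axioms sw hs.subspace_UNIV]) (rule m)
  then have 1: "Vector_Spaces.linear sh sw (%h. \<psi> i (acc @ h # hs))"
   using hs.vector_space_axioms sw by (simp add: Vector_Spaces.linear_iff linear_from_def)
  have 2: "Vector_Spaces.linear sh sw (%h. \<Phi> (ten_rec i acc (h # hs)))"
   using Vector_Spaces.linear_compose[OF pair.linear_construct[OF basis(1)] \<Phi>(1)] by (simp add: o_def)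
  have 3: "\<Phi> (ten_rec i acc (b # hs)) = \<psi> i (acc @ b # hs)" if "b \<in> basis" for b
   using Cons.IH[of "acc @ [b]"] Cons.prems that by (simp add: pair.construct_basis[OF basis(1)])
  show ?case by (rule hw.linear_eq_on_span[OF 2 1 3]) (auto simp: basis)
 qed
 have "\<Phi> (ten i hs) = \<phi> i hs" if i: "i \<in> I" and hs: "list_all2 (\<in>) hs (Hs i)" for i hs
 proof -
  have "map2 pr (Hs i) hs = hs"
   using sub[OF i] pr(3) list_all2_lengthD[OF hs] list_all2_nthD2[OF hs]
   by (intro nth_equalityI) auto
  then show ?thesis
   unfolding ten_def using key[OF i, of "[]" hs] list_all2_lengthD[OF hs] by (simp add: \<psi>_def)
 qed
 then show thesis using that \<Phi>(1) by blast
qed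

end

section \<open>Typed arrows\<close>

type_synonym ('a, 'h) mor = "'a \<times> 'a \<times> 'h"

abbreviation dm :: "('a, 'h) mor => 'a" where "dm f \<equiv> fst f"
abbreviation cd :: "('a, 'h) mor => 'a" where "cd f \<equiv> fst (snd f)"
abbreviation hm :: "('a, 'h) mor => 'h" where "hm f \<equiv> snd (snd f)"

context prestack
begin

lemmas vsA = hscale_vector_space

abbreviation "ObU \<equiv> Ob \<U>"
abbreviation "ArU \<equiv> Ar \<U>"
abbreviation "srU \<equiv> src \<U>"
abbreviation "tgU \<equiv> tgt \<U>"
abbreviation "cmU \<equiv> cmp \<U>"
abbreviation "idU \<equiv> idn \<U>"
abbreviation "lstU \<equiv> last_ob \<U>"
abbreviation "obA \<equiv> obj \<A>"
abbreviation "foA \<equiv> fob \<A>"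
abbreviation "scA \<equiv> hscale \<A>"
abbreviation "selfA \<equiv> self_bimod \<A>"
abbreviation "bimodA \<equiv> bimodule \<U> \<A>"
abbreviation "bhom \<equiv> bimod_hom \<U> \<A>"

text \<open>Morphisms carry their source and target, so that composition, the functors and the twists
 satisfy equations without object arguments.\<close>

definition arr :: "'u => ('a, 'h) mor set" where
 "arr U = {f. dm f \<in> obA U & cd f \<in> obA U & hm f \<in> hom \<A> U (dm f) (cd f)}"

definition cp :: "'u => ('a, 'h) mor => ('a, 'h) mor => ('a, 'h) mor" where
 "cp U g f = (dm f, cd g, ccmp \<A> U (dm f) (cd f) (cd g) (hm g) (hm f))"

definition ida :: "'u => 'a => ('a, 'h) mor" where
 "ida U A = (A, A, cid \<A> U A)"

definition fn :: "'m => ('a, 'h) mor => ('a, 'h) mor" where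
 "fn u f = (foA u (dm f), foA u (cd f), fmor \<A> u (dm f) (cd f) (hm f))"

definition tws :: "'m => 'm => 'a => ('a, 'h) mor" where
 "tws u v A = (foA v (foA u A), foA (cmU u v) A, tw \<A> u v A)"

text \<open>The inverse of a twist is unique, so any choice is the inverse.\<close>

definition twi :: "'m => 'm => 'a => ('a, 'h) mor" where
 "twi u v A = (SOME c. c \<in> arr (srU v) & dm c = foA (cmU u v) A & cd c = foA v (foA u A) &
   cp (srU v) c (tws u v A) = ida (srU v) (foA v (foA u A)) &
   cp (srU v) (tws u v A) c = ida (srU v) (foA (cmU u v) A))"

lemma dm_cp [simp]: "dm (cp U g f) = dm f" and cd_cp [simp]: "cd (cp U g f) = cd g"
 and dm_ida [simp]: "dm (ida U A) = A" and cd_ida [simp]: "cd (ida U A) = A"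
 and dm_fn [simp]: "dm (fn u f) = foA u (dm f)" and cd_fn [simp]: "cd (fn u f) = foA u (cd f)"
 and dm_tws [simp]: "dm (tws u v A) = foA v (foA u A)" and cd_tws [simp]: "cd (tws u v A) = foA (cmU u v) A"
 by (simp_all add: cp_def ida_def fn_def tws_def)

lemma arrD: "f \<in> arr U ==> dm f \<in> obA U" "f \<in> arr U ==> cd f \<in> obA U"
 "f \<in> arr U ==> hm f \<in> hom \<A> U (dm f) (cd f)"
 by (auto simp: arr_def)

lemma arr_iff: "(A, B, h) \<in> arr U \<longleftrightarrow> A \<in> obA U & B \<in> obA U & h \<in> hom \<A> U A B"
 by (simp add: arr_def)

lemma cp_arr [simp]: "U \<in> ObU ==> f \<in> arr U ==> g \<in> arr U ==> cd f = dm g ==> cp U g f \<in> arr U"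
 by (auto simp: arr_def cp_def intro: ccmp_hom)

lemma ida_arr [simp]: "U \<in> ObU ==> A \<in> obA U ==> ida U A \<in> arr U"
 by (simp add: arr_def ida_def cid_hom)

lemma fn_arr [simp]: "u \<in> ArU ==> f \<in> arr (tgU u) ==> fn u f \<in> arr (srU u)"
 by (auto simp: arr_def fn_def intro: fmor_hom fob_obj)

lemma tws_arr [simp]:
 "u \<in> ArU ==> v \<in> ArU ==> srU u = tgU v ==> A \<in> obA (tgU u) ==> tws u v A \<in> arr (srU v)"
 using fob_obj[of "cmU u v" A] fob_obj[of v "foA u A"] fob_obj[of u A] cmp_Ar[of u v]
 by (auto simp: arr_def tws_def src_cmp tgt_cmp intro: tw_hom)

lemma cp_assoc:
 "U \<in> ObU ==> f \<in> arr U ==> g \<in> arr U ==> h \<in> arr U ==> cd f = dm g ==> cd g = dm h ==>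
  cp U (cp U h g) f = cp U h (cp U g f)"
 using ccmp_assoc[of U "dm f" "dm g" "dm h" "cd h" "hm h" "hm g" "hm f"] by (auto simp: arr_def cp_def)

lemma cp_ida_left [simp]: "U \<in> ObU ==> f \<in> arr U ==> cd f = A ==> cp U (ida U A) f = f"
 and cp_ida_right [simp]: "U \<in> ObU ==> f \<in> arr U ==> dm f = A ==> cp U f (ida U A) = f"
 by (auto simp: arr_def cp_def ida_def ccmp_cid_left ccmp_cid_right prod_eq_iff)

lemma fn_cp: "u \<in> ArU ==> f \<in> arr (tgU u) ==> g \<in> arr (tgU u) ==> cd f = dm g ==>
  fn u (cp (tgU u) g f) = cp (srU u) (fn u g) (fn u f)"
 using fmor_ccmp[of u "dm f" "cd f" "cd g" "hm g" "hm f"] by (auto simp: arr_def cp_def fn_def)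

lemma fn_ida [simp]: "u \<in> ArU ==> A \<in> obA (tgU u) ==> fn u (ida (tgU u) A) = ida (srU u) (foA u A)"
 by (simp add: fn_def ida_def fmor_cid)

lemma fn_idn [simp]: "U \<in> ObU ==> f \<in> arr U ==> fn (idU U) f = f"
 by (auto simp: arr_def fn_def fob_idn fmor_idn prod_eq_iff)

lemma tws_nat:
 "u \<in> ArU ==> v \<in> ArU ==> srU u = tgU v ==> f \<in> arr (tgU u) ==>
  cp (srU v) (fn (cmU u v) f) (tws u v (dm f)) = cp (srU v) (tws u v (cd f)) (fn v (fn u f))"
 using tw_natural[of u v "dm f" "cd f" "hm f"] by (auto simp: arr_def cp_def fn_def tws_def)

lemma tws_coherence:
 assumes "u \<in> ArU" "v \<in> ArU" "w \<in> ArU" "srU u = tgU v" "srU v = tgU w" "A \<in> obA (tgU u)"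
 shows "cp (srU w) (tws u (cmU v w) A) (tws v w (foA u A)) = cp (srU w) (tws (cmU u v) w A) (fn w (tws u v A))"
 unfolding cp_def fn_def tws_def fst_conv snd_conv prod.inject
proof (intro conjI)
 show "foA (cmU u (cmU v w)) A = foA (cmU (cmU u v) w) A"
  by (simp only: cmp_assoc[OF assms(1-5)])
qed (rule refl tw_coherence[OF assms])+

lemma tws_idn_left [simp]: "v \<in> ArU ==> A \<in> obA (tgU v) ==> tws (idU (tgU v)) v A = ida (srU v) (foA v A)"
 and tws_idn_right [simp]: "u \<in> ArU ==> A \<in> obA (tgU u) ==> tws u (idU (srU u)) A = ida (srU u) (foA u A)"
 using fob_idn[OF tgt_Ob, of v A] fob_idn[OF src_Ob, of u "foA u A"] fob_obj[of u A]
 by (auto simp: tws_def ida_def tw_idn_left tw_idn_right cmp_idn_left cmp_idn_right)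

lemma twi:
 assumes "u \<in> ArU" "v \<in> ArU" "srU u = tgU v" "A \<in> obA (tgU u)"
 shows twi_arr: "twi u v A \<in> arr (srU v)" and dm_twi: "dm (twi u v A) = foA (cmU u v) A"
  and cd_twi: "cd (twi u v A) = foA v (foA u A)"
  and twi_tws: "cp (srU v) (twi u v A) (tws u v A) = ida (srU v) (foA v (foA u A))"
  and tws_twi: "cp (srU v) (tws u v A) (twi u v A) = ida (srU v) (foA (cmU u v) A)"
proof -
 let ?P = "%c. c \<in> arr (srU v) & dm c = foA (cmU u v) A & cd c = foA v (foA u A) &
   cp (srU v) c (tws u v A) = ida (srU v) (foA v (foA u A)) &
   cp (srU v) (tws u v A) c = ida (srU v) (foA (cmU u v) A)"
 obtain c' where "c' \<in> hom \<A> (srU v) (foA (cmU u v) A) (foA v (foA u A))"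
  "ccmp \<A> (srU v) (foA v (foA u A)) (foA (cmU u v) A) (foA v (foA u A))
       c' (tw \<A> u v A) = cid \<A> (srU v) (foA v (foA u A))"
  "ccmp \<A> (srU v) (foA (cmU u v) A) (foA v (foA u A)) (foA (cmU u v) A)
       (tw \<A> u v A) c' = cid \<A> (srU v) (foA (cmU u v) A)"
  using tw_iso[OF assms] by blast
 then have "?P (foA (cmU u v) A, foA v (foA u A), c')"
  using tws_arr[OF assms] by (auto simp: arr_def cp_def tws_def ida_def)
 then have "?P (twi u v A)" unfolding twi_def by (rule someI[of ?P])
 then show "twi u v A \<in> arr (srU v)" "dm (twi u v A) = foA (cmU u v) A"
  "cd (twi u v A) = foA v (foA u A)"
  "cp (srU v) (twi u v A) (tws u v A) = ida (srU v) (foA v (foA u A))"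
  "cp (srU v) (tws u v A) (twi u v A) = ida (srU v) (foA (cmU u v) A)" by auto
qed

section \<open>Faces of simplices of the nerve\<close>

abbreviation "co \<equiv> composite \<U>"
abbreviation "star \<equiv> star_ob \<A>"

fun pth :: "'u => 'm list => 'u => bool" where
 "pth X [] Y \<longleftrightarrow> X \<in> ObU & Y = X"
| "pth X (u # us) Y \<longleftrightarrow> u \<in> ArU & srU u = X & pth (tgU u) us Y"

lemma pth_iff: "pth X us Y \<longleftrightarrow> composable \<U> X us & Y = lstU X us"
 by (induction us arbitrary: X) (auto simp: last_ob_def)

lemma pth_Ob: "pth X us Y ==> X \<in> ObU" "pth X us Y ==> Y \<in> ObU"
 by (induction us arbitrary: X) (auto simp: src_Ob)

lemma pth_append: "pth X (us @ vs) Y \<longleftrightarrow> (\<exists>Z. pth X us Z & pth Z vs Y)"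
 by (induction us arbitrary: X) (auto dest: pth_Ob)

lemma co_Ar: "pth X us Y ==> co X us \<in> ArU"
 and src_co: "pth X us Y ==> srU (co X us) = X"
 and tgt_co: "pth X us Y ==> tgU (co X us) = Y"
proof (induction us arbitrary: X)
 case Nil
 { case 1 then show ?case by (simp add: idn_Ar) }
 { case 2 then show ?case by (simp add: src_idn) }
 { case 3 then show ?case by (simp add: tgt_idn) }
next
 case (Cons u us)
 { case 1 with Cons show ?case by (auto intro: cmp_Ar) }
 { case 2 with Cons show ?case by (auto simp: src_cmp) }
 { case 3 with Cons show ?case by (auto simp: tgt_cmp) }
qed

lemma co_single: "u \<in> ArU ==> co X [u] = u"
 by (simp add: cmp_idn_left)

lemma co_append: "pth X us Z ==> pth Z vs Y ==> co X (us @ vs) = cmU (co Z vs) (co X us)"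
proof (induction us arbitrary: X)
 case Nil then show ?case using cmp_idn_right[OF co_Ar[of X vs Y]] src_co[of X vs Y] by auto
next
 case (Cons u us)
 then show ?case
  using cmp_assoc[of "co Z vs" "co (tgU u) us" u] co_Ar[of Z vs Y] co_Ar[of "tgU u" us Z]
   src_co[of Z vs Y] tgt_co[of "tgU u" us Z] src_co[of "tgU u" us Z] by auto
qed

lemma star_append: "star (us @ vs) A = star us (star vs A)"
 by (induction us) auto

lemma star_obj: "pth X us Y ==> A \<in> obA Y ==> star us A \<in> obA X"
 by (induction us arbitrary: X) (auto intro: fob_obj)

definition sm :: "'m list => ('a, 'h) mor => ('a, 'h) mor" where
 "sm us f = foldr fn us f"

lemma sm_simps [simp]: "sm [] f = f" "sm (u # us) f = fn u (sm us f)" "sm (us @ vs) f = sm us (sm vs f)"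
 by (simp_all add: sm_def)

lemma dm_sm [simp]: "dm (sm us f) = star us (dm f)" and cd_sm [simp]: "cd (sm us f) = star us (cd f)"
 by (induction us) auto

lemma sm_arr [simp]: "pth X us Y ==> f \<in> arr Y ==> sm us f \<in> arr X"
 by (induction us arbitrary: X) auto

lemma sm_cp: "pth X us Y ==> f \<in> arr Y ==> g \<in> arr Y ==> cd f = dm g ==>
  sm us (cp Y g f) = cp X (sm us g) (sm us f)"
proof (induction us arbitrary: X)
 case (Cons u us)
 then show ?case using fn_cp[of u "sm us f" "sm us g"] by auto
qed simp

lemma hm_sm: "hm (sm us f) = star_mor \<A> us (dm f) (cd f) (hm f)"
 by (induction us) (simp_all add: fn_def)

text \<open>The inner faces, indexed from 0, and the comparison maps \<open>us\<^sup>\<star> \<rightarrow> (fc j us)\<^sup>\<star>\<close>; both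
 are given by recursion because the simplicial identities below are proved by induction.\<close>

fun fc :: "nat => 'm list => 'm list" where
 "fc 0 (u # v # us) = cmU v u # us"
| "fc (Suc j) (u # v # us) = u # fc j (v # us)"
| "fc j us = us"

fun ep :: "nat => 'm list => 'a => ('a, 'h) mor" where
 "ep 0 (u # v # us) A = tws v u (star us A)"
| "ep (Suc j) (u # v # us) A = fn u (ep j (v # us) A)"
| "ep j us A = undefined"

lemma fc_length: "Suc j < length us ==> length (fc j us) = length us - 1"
 by (induction j us rule: fc.induct) auto

lemma fc_pth: "Suc j < length us ==> pth X us Y ==> pth X (fc j us) Y"
 by (induction j us arbitrary: X rule: fc.induct) (auto simp: cmp_Ar src_cmp tgt_cmp)

lemma fc_co: "Suc j < length us ==> pth X us Y ==> co X (fc j us) = co X us"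
proof (induction j us arbitrary: X rule: fc.induct)
 case (1 u v us)
 then show ?case
  using cmp_assoc[of "co (tgU v) us" v u] co_Ar[of "tgU v" us Y] src_co[of "tgU v" us Y]
  by (auto simp: tgt_cmp)
qed auto

lemma dm_ep [simp]: "Suc j < length us ==> dm (ep j us A) = star us A"
 and cd_ep [simp]: "Suc j < length us ==> cd (ep j us A) = star (fc j us) A"
 by (induction j us rule: fc.induct) auto

lemma ep_arr [simp]: "Suc j < length us ==> pth X us Y ==> A \<in> obA Y ==> ep j us A \<in> arr X"
proof (induction j us arbitrary: X rule: fc.induct)
 case (1 u v us)
 then show ?case using tws_arr[of v u "star us A"] star_obj[of "tgU v" us Y A] by auto
qed auto

lemma ep_nat:
 "Suc j < length us ==> pth X us Y ==> f \<in> arr Y ==>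
  cp X (sm (fc j us) f) (ep j us (dm f)) = cp X (ep j us (cd f)) (sm us f)"
proof (induction j us arbitrary: X rule: fc.induct)
 case (1 u v us)
 then show ?case using tws_nat[of v u "sm us f"] by auto
next
 case (2 j u v us)
 have p: "pth (tgU u) (v # us) Y" and X: "u \<in> ArU" "srU u = X" and l: "Suc j < length (v # us)"
  using 2 by auto
 have "fn u (cp (tgU u) (sm (fc j (v # us)) f) (ep j (v # us) (dm f))) =
   fn u (cp (tgU u) (ep j (v # us) (cd f)) (sm (v # us) f))"
  using 2(1)[OF l p 2(4)] by simp
 then show ?case
  using X l p 2(4) fn_cp[OF X(1), of "ep j (v # us) (dm f)" "sm (fc j (v # us)) f"]
   fn_cp[OF X(1), of "sm (v # us) f" "ep j (v # us) (cd f)"] fc_pth[OF l p] ep_arr[OF l p arrD(1)[OF 2(4)]] ep_arr[OF l p arrD(2)[OF 2(4)]]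
   sm_arr[OF p 2(4)] sm_arr[OF fc_pth[OF l p] 2(4)] l
  by simp
qed auto

lemma fc_fc:
 "i \<le> j ==> Suc (Suc j) < length us ==> pth X us Y ==> fc j (fc i us) = fc i (fc (Suc j) us)"
proof (induction i us arbitrary: j X rule: fc.induct)
 case (1 u v us)
 then obtain w ws where us: "us = w # ws" by (cases us) auto
 show ?case using 1 by (cases j) (auto simp: us cmp_assoc)
next
 case (2 i u v us)
 then obtain j' where j: "j = Suc j'" by (cases j) auto
 obtain w ws where us: "us = w # ws" using 2 by (cases us) auto
 obtain z zs where z: "fc i (v # us) = z # zs" using fc_length[of i "v # us"] 2 us j by (cases "fc i (v # us)") auto
 obtain z' zs' where z': "fc (Suc j') (v # us) = z' # zs'" by (simp add: us)
 show ?case using 2 z z' j by auto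
qed auto

text \<open>Two comparison maps in disjoint places commute by naturality of the twist, those in adjacent places by its
 coherence.\<close>

lemma ep_ep:
 "i \<le> j ==> Suc (Suc j) < length us ==> pth X us Y ==> A \<in> obA Y ==>
  cp X (ep j (fc i us) A) (ep i us A) = cp X (ep i (fc (Suc j) us) A) (ep (Suc j) us A)"
proof (induction i us arbitrary: j X rule: fc.induct)
 case (1 u v us)
 then obtain w ws where us: "us = w # ws" by (cases us) auto
 show ?case
 proof (cases j)
  case 0
  show ?thesis
   using 1 tws_coherence[of w v u "star ws A"] star_obj[of "tgU w" ws Y A] by (auto simp: us 0)
 next
  case (Suc j')
  have p: "pth (tgU v) us Y" using 1 by auto
  have l: "Suc j' < length us" using 1 Suc by auto
  have "cp (srU u) (fn (cmU v u) (ep j' us A)) (tws v u (dm (ep j' us A))) =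
   cp (srU u) (tws v u (cd (ep j' us A))) (fn u (fn v (ep j' us A)))"
   using 1 p l by (intro tws_nat) auto
  then show ?thesis using 1 l by (auto simp: Suc us)
 qed
next
 case (2 i u v us)
 then obtain j' where j: "j = Suc j'" by (cases j) auto
 obtain w ws where us: "us = w # ws" using 2 by (cases us) auto
 have p: "pth (tgU u) (v # us) Y" and X: "u \<in> ArU" "srU u = X"
  and l: "Suc (Suc j') < length (v # us)" "i \<le> j'" and l': "Suc i < length (v # us)"
  using 2 j by auto
 obtain z zs where z: "fc i (v # us) = z # zs" using fc_length[of i "v # us"] 2 us j by (cases "fc i (v # us)") auto
 obtain z' zs' where z': "fc (Suc j') (v # us) = z' # zs'" by (simp add: us)
 have len: "length (fc i (v # us)) = length us" "length (fc (Suc j') (v # us)) = length us"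
  using fc_length[OF l(1)] fc_length[of i "v # us"] l by auto
 have pp: "pth (tgU u) (fc i (v # us)) Y" "pth (tgU u) (fc (Suc j') (v # us)) Y"
  using fc_pth[OF l(1) p] fc_pth[OF l' p] by auto
 have ff: "fc j' (fc i (v # us)) = fc i (fc (Suc j') (v # us))" by (rule fc_fc[OF l(2,1) p])
 have "fn u (cp (tgU u) (ep j' (fc i (v # us)) A) (ep i (v # us) A)) =
    fn u (cp (tgU u) (ep i (fc (Suc j') (v # us)) A) (ep (Suc j') (v # us) A))"
  using 2(1)[OF l(2,1) p 2(5)] by simp
 then have "cp X (fn u (ep j' (fc i (v # us)) A)) (fn u (ep i (v # us) A)) =
    cp X (fn u (ep i (fc (Suc j') (v # us)) A)) (fn u (ep (Suc j') (v # us) A))"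
  using fn_cp[OF X(1), of "ep i (v # us) A" "ep j' (fc i (v # us)) A"]
   fn_cp[OF X(1), of "ep (Suc j') (v # us) A" "ep i (fc (Suc j') (v # us)) A"] X l l' len ff
   ep_arr[OF l' p 2(5)] ep_arr[OF l(1) p 2(5)] ep_arr[OF _ pp(1) 2(5), of j'] ep_arr[OF _ pp(2) 2(5), of i]
  by (simp del: ep.simps)
 then show ?case by (simp add: j z z' del: ep.simps(1))
qed auto

lemma fc_append_left: "Suc j < length L ==> fc j (L @ R) = fc j L @ R"
 by (induction j L rule: fc.induct) auto

lemma ep_append_left: "Suc j < length L ==> ep j (L @ R) A = ep j L (star R A)"
 by (induction j L rule: fc.induct) (auto simp: star_append)

lemma fc_append_right: "Suc j < length R ==> fc (length L + j) (L @ R) = L @ fc j R"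
proof (induction L)
 case (Cons u L)
 then obtain z zs where "L @ R = z # zs" by (cases "L @ R") auto
 with Cons show ?case by auto
qed simp

lemma ep_append_right: "Suc j < length R ==> ep (length L + j) (L @ R) A = sm L (ep j R A)"
proof (induction L)
 case (Cons u L)
 then obtain z zs where "L @ R = z # zs" by (cases "L @ R") auto
 with Cons show ?case by auto
qed simp

text \<open>The comparison map \<open>L\<^sup>* R\<^sup>* \<rightarrow> (L @ R)\<^sup>*\<close> at \<open>A\<close>.\<close>

definition cut :: "'u => 'm list => 'm list => 'a => ('a, 'h) mor" where
 "cut X L R A = tws (co (lstU X L) R) (co X L) A"

lemma cut_eq: "pth X L Z ==> cut X L R A = tws (co Z R) (co X L) A"
 by (simp add: cut_def pth_iff)

lemma cut_arr:
 assumes "pth X L Z" "pth Z R Y" "A \<in> obA Y"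
 shows "cut X L R A \<in> arr X" "dm (cut X L R A) = foA (co X L) (foA (co Z R) A)"
  "cd (cut X L R A) = foA (co X (L @ R)) A"
 using assms tws_arr[OF co_Ar[OF assms(2)] co_Ar[OF assms(1)]]
 by (simp_all add: cut_eq src_co tgt_co co_append)

end

section \<open>Path-shuffle sums\<close>

lemma additive_sg:
 assumes "Modules.additive h"
 shows "h (sg n x) = sg n (h x)"
proof -
 interpret Modules.additive h by fact
 show ?thesis by (simp add: sg_def minus)
qed

lemma additive_sgI [intro]: "Modules.additive (sg n)"
 and additive_uminusI [intro]: "Modules.additive (uminus :: 'x::ab_group_add => 'x)"
 by (auto simp: Modules.additive_def sg_add)

lemma sum_pairs_split:
 fixes f :: "nat => nat => 'x::ab_group_add"
 shows "(\<Sum>j<Suc n. \<Sum>i<n. f j i) = (\<Sum>j\<le>n. \<Sum>i<j. f j i) + (\<Sum>j<n. \<Sum>i\<in>{j..<n}. f j i)"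
proof -
 have "(\<Sum>i<n. f j i) = (\<Sum>i<j. f j i) + (\<Sum>i\<in>{j..<n}. f j i)" if "j \<le> n" for j
  using that sum.union_disjoint[of "{..<j}" "{j..<n}" "f j"] by (simp add: ivl_disj_un ivl_disj_int)
 then have "(\<Sum>j\<le>n. \<Sum>i<n. f j i) = (\<Sum>j\<le>n. \<Sum>i<j. f j i) + (\<Sum>j\<le>n. \<Sum>i\<in>{j..<n}. f j i)"
  by (simp add: sum.distrib)
 moreover have "(\<Sum>j\<le>n. \<Sum>i\<in>{j..<n}. f j i) = (\<Sum>j<n. \<Sum>i\<in>{j..<n}. f j i)"
  by (simp add: lessThan_Suc_atMost[symmetric])
 ultimately show ?thesis by (simp add: lessThan_Suc_atMost)
qed

lemma sum_triangle_swap: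
 fixes f :: "nat => nat => 'x::ab_group_add"
 shows "(\<Sum>j<n. \<Sum>i\<in>{j..<n}. f j i) = (\<Sum>i<n. \<Sum>j\<le>i. f j i)"
 by (subst sum.Sigma, simp, simp, subst sum.Sigma, simp, simp, rule sum.reindex_bij_witness[of _ "%(i, j). (j, i)" "%(j, i). (i, j)"]) auto

text \<open>The simplicial identities make iterated alternating sums vanish.\<close>

lemma alternating_double_sum:
 fixes F :: "nat => nat => 'x::ab_group_add"
 assumes "!!i j. i \<le> j ==> j < n ==> F i j = F (Suc j) i"
 shows "(\<Sum>j<Suc n. \<Sum>i<n. sg (j + i) (F j i)) = 0"
proof -
 have "(\<Sum>j\<le>n. \<Sum>i<j. sg (j + i) (F j i)) = (\<Sum>j<n. \<Sum>i\<le>j. sg (Suc j + i) (F (Suc j) i))"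
  unfolding lessThan_Suc_atMost[symmetric] sum.lessThan_Suc_shift[of _ n]
  by (simp add: lessThan_Suc_atMost)
 also have "... = (\<Sum>j<n. \<Sum>i\<le>j. - sg (j + i) (F i j))"
  using assms by (intro sum.cong refl) auto
 also have "... = - (\<Sum>j<n. \<Sum>i\<in>{j..<n}. sg (j + i) (F j i))"
  unfolding sum_triangle_swap by (simp add: sum_negf add.commute)
 finally show ?thesis unfolding sum_pairs_split by simp
qed

text \<open>Inner faces and cuts of a path of length \<open>m\<close> combine in two ways: cut a face, or take a face of one of the
 two parts of a cut.\<close>

lemma alternating_cut_sum:
 fixes f :: "nat => nat => 'x::ab_group_add"
 assumes "m \<ge> 1"
 shows "(\<Sum>j<m - 1. \<Sum>k\<in>{1..<m - 1}. f j k) =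
     (\<Sum>k\<in>{1..<m}. (\<Sum>i<k - 1. f i (k - 1)) + (\<Sum>j<m - k - 1. f (k + j) k))"
proof -
 have "(\<Sum>k\<in>{1..<m}. \<Sum>i<k - 1. f i (k - 1)) = (\<Sum>k\<in>{1..<m - 1}. \<Sum>j<k. f j k)"
 proof -
  have "(\<Sum>k\<in>{1..<m}. \<Sum>i<k - 1. f i (k - 1)) = (\<Sum>k\<in>{0..<m - 1}. \<Sum>i<k. f i k)"
   by (rule sum.reindex_bij_witness[of _ Suc "%k. k - 1"]) auto
  also have "... = (\<Sum>k\<in>{1..<m - 1}. \<Sum>j<k. f j k)"
   by (rule sum.mono_neutral_right) (auto simp: not_le)
  finally show ?thesis .
 qed
 moreover have "(\<Sum>k\<in>{1..<m}. \<Sum>j<m - k - 1. f (k + j) k) = (\<Sum>k\<in>{1..<m - 1}. \<Sum>j\<in>{k..<m - 1}. f j k)"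
 proof -
  have "(\<Sum>j<m - k - 1. f (k + j) k) = (\<Sum>j\<in>{k..<m - 1}. f j k)" if "k < m" for k
   by (rule sum.reindex_bij_witness[of _ "%j. j - k" "%j. k + j"]) (use that in auto)
  then have "(\<Sum>k\<in>{1..<m}. \<Sum>j<m - k - 1. f (k + j) k) = (\<Sum>k\<in>{1..<m}. \<Sum>j\<in>{k..<m - 1}. f j k)"
   by simp
  also have "... = (\<Sum>k\<in>{1..<m - 1}. \<Sum>j\<in>{k..<m - 1}. f j k)"
   by (rule sum.mono_neutral_right) auto
  finally show ?thesis .
 qed
 moreover have "(\<Sum>j<m - 1. \<Sum>k\<in>{1..<m - 1}. f j k) = (\<Sum>k\<in>{1..<m - 1}. (\<Sum>j<k. f j k) + (\<Sum>j\<in>{k..<m - 1}. f j k))"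
 proof -
  have "(\<Sum>j<m - 1. f j k) = (\<Sum>j<k. f j k) + (\<Sum>j\<in>{k..<m - 1}. f j k)" if "k < m - 1" for k
   using that sum.union_disjoint[of "{..<k}" "{k..<m - 1}" "%j. f j k"] by (simp add: ivl_disj_un ivl_disj_int)
  then show ?thesis by (subst sum.swap) simp
 qed
 ultimately show ?thesis by (simp add: sum.distrib)
qed

context prestack
begin

text \<open>Chains are listed in the order of composition, the first morphism being the one that starts at \<open>A\<close>.
 This is the reverse of the indexing of simplices, and makes recursion on the first letter possible.\<close>

fun chain :: "'u => 'a => ('a, 'h) mor list => 'a => bool" where
 "chain U A [] E \<longleftrightarrow> A \<in> obA U & E = A"
| "chain U A (x # xs) E \<longleftrightarrow> x \<in> arr U & dm x = A & chain U (cd x) xs E"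

lemma chain_obj: "chain U A xs E ==> A \<in> obA U" "chain U A xs E ==> E \<in> obA U"
 by (induction xs arbitrary: A) (auto dest: arrD)

text \<open>\<open>S us A xs K\<close> is the signed sum of \<open>K\<close> over all shuffles of the chain \<open>xs\<close> with
 all paths from \<open>us\<^sup>\<star>\<close> to \<open>us\<^sup>*\<close>, given by recursion on the first letter: it is either a comparison map, after
 which a path of a face of \<open>us\<close> remains, or the image under \<open>us\<^sup>\<star>\<close> of the first morphism of the chain, which has
 moved past the \<open>length us - 1\<close> letters of the path.\<close>

function S :: "'m list => 'a => ('a, 'h) mor list => (('a, 'h) mor list => 'w::ab_group_add) => 'w" where
 "S us A xs K =
   (\<Sum>j\<in>{j. Suc j < length us}. - sg j (S (fc j us) A xs (%ys. K (ep j us A # ys)))) +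
   (case xs of [] => if length us = 1 then K [] else 0
   | x # xs' => sg (length us - 1) (S us (cd x) xs' (%ys. K (sm us x # ys))))"
 by pat_completeness auto
termination
 by (relation "measure (%(us, A, xs, K). length us + length xs)") (auto simp: fc_length)

declare S.simps [simp del]

lemma index_set: "{j. Suc j < n} = {..<n - 1}" for n
 by auto

lemmas S_expand = S.simps[unfolded index_set]

lemma S_single_Nil [simp]: "S [u] A [] K = K []"
 by (subst S_expand) simp

lemma S_single_Cons [simp]: "S [u] A (x # xs) K = S [u] (cd x) xs (%ys. K (fn u x # ys))"
 by (subst S_expand) simp

lemma S_single: "S [u] A xs K = K (map (fn u) xs)"
 by (induction xs arbitrary: A K) simp_all

lemma S_hom:
 assumes "Modules.additive h"
 shows "h (S us A xs K) = S us A xs (%ys. h (K ys))"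
proof (induction us A xs K rule: S.induct)
 case (1 us A xs K)
 interpret Modules.additive h by fact
 have "h (\<Sum>j<length us - 1. - sg j (S (fc j us) A xs (%ys. K (ep j us A # ys)))) =
   (\<Sum>j<length us - 1. - sg j (S (fc j us) A xs (%ys. h (K (ep j us A # ys)))))"
  using 1(1) by (simp add: sum minus additive_sg[OF assms])
 then show ?case
  using 1(2) by (subst (1 2) S_expand) (auto simp: add zero additive_sg[OF assms] split: list.split)
qed

lemma S_zero [simp]: "S us A xs (%ys. 0) = 0"
 using S_hom[of "%_. 0" us A xs "%_. 0"] by (simp add: Modules.additive_def)

lemma S_sg: "S us A xs (%ys. sg n (K ys)) = sg n (S us A xs K)"
 by (rule S_hom[symmetric]) auto

lemma S_minus: "S us A xs (%ys. - K ys) = - S us A xs K"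
 by (rule S_hom[symmetric]) auto

lemma S_add: "S us A xs (%ys. K ys + K' ys) = S us A xs K + S us A xs K'"
proof (induction us A xs K arbitrary: K' rule: S.induct)
 case (1 us A xs K)
 have e: "S (fc j us) A xs (%ys. K (ep j us A # ys) + K' (ep j us A # ys)) =
   S (fc j us) A xs (%ys. K (ep j us A # ys)) + S (fc j us) A xs (%ys. K' (ep j us A # ys))"
  if "j < length us - 1" for j
  using 1(1)[of j "%ys. K' (ep j us A # ys)"] that by simp
 show ?case
 proof (cases xs)
  case Nil
  then show ?thesis using e
   by (subst (1 2 3) S_expand) (simp add: sg_add sum_negf sum_subtractf)
 next
  case (Cons x xs')
  have "S us (cd x) xs' (%ys. K (sm us x # ys) + K' (sm us x # ys)) =
   S us (cd x) xs' (%ys. K (sm us x # ys)) + S us (cd x) xs' (%ys. K' (sm us x # ys))"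
   using 1(2)[OF Cons, of "%ys. K' (sm us x # ys)"] by simp
  then show ?thesis using e Cons
   by (subst (1 2 3) S_expand) (simp add: sg_add sum_negf sum_subtractf)
 qed
qed

lemma S_sum: "finite I ==> S us A xs (%ys. \<Sum>i\<in>I. K i ys) = (\<Sum>i\<in>I. S us A xs (K i))"
 by (induction I rule: finite_induct) (simp_all add: S_add)

lemma S_cong:
 assumes "pth X us Y" "us ~= []" "chain Y A xs E"
  and "!!ys. chain X (star us A) ys (foA (co X us) E) ==> Suc (length ys) = length us + length xs ==> K ys = K' ys"
 shows "S us A xs K = S us A xs K'"
 using assms
proof (induction us A xs K arbitrary: K' rule: S.induct)
 case (1 us A xs K)
 have e: "S (fc j us) A xs (%ys. K (ep j us A # ys)) = S (fc j us) A xs (%ys. K' (ep j us A # ys))"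
  if j: "j < length us - 1" for j
 proof -
  have j': "Suc j < length us" using j by simp
  note l = fc_length[OF j']
  show ?thesis
  proof (rule 1(1))
   show "j \<in> {j. Suc j < length us}" using j' by simp
   show "pth X (fc j us) Y" by (rule fc_pth[OF j' 1(3)])
   show "fc j us ~= []" using l j by auto
   show "chain Y A xs E" by fact
   show "K (ep j us A # ys) = K' (ep j us A # ys)"
    if "chain X (star (fc j us) A) ys (foA (co X (fc j us)) E)" "Suc (length ys) = length (fc j us) + length xs" for ys
    using that fc_co[OF j' 1(3)] l j' ep_arr[OF j' 1(3) chain_obj(1)[OF 1(5)]] by (intro 1(6)) auto
  qed
 qed
 show ?case
 proof (cases xs)
  case Nil
  have "K [] = K' []" if "length us = 1"
   using that 1(6)[of "[]"] 1(3,5) Nil star_obj[OF 1(3)] by (auto simp: length_Suc_conv cmp_idn_left fob_obj)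
  then show ?thesis using e Nil by (subst (1 2) S_expand) simp
 next
  case (Cons x xs')
  have "S us (cd x) xs' (%ys. K (sm us x # ys)) = S us (cd x) xs' (%ys. K' (sm us x # ys))"
   by (rule 1(2)[OF Cons 1(3,4)]) (use 1(3,5) Cons sm_arr[OF 1(3)] in \<open>auto intro!: 1(6)\<close>)
  then show ?thesis using e Cons by (subst (1 2) S_expand) simp
 qed
qed

text \<open>The inner and the last face of the bar differential.  The parameter \<open>la\<close> absorbs the last morphism of the chain
 into \<open>b\<close>; in \<open>bd\<close> the parameter \<open>ra\<close> absorbs the first one into \<open>g\<close>.\<close>

fun inn :: "('b => ('a, 'h) mor => 'b) => 'u => ('b => ('a, 'h) mor list => 'w::ab_group_add) =>
  'b => ('a, 'h) mor list => 'w" where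
 "inn la U K b [] = 0"
| "inn la U K b [x] = K (la b x) []"
| "inn la U K b (x # y # ys) =
   inn la U (%b zs. K b (x # zs)) b (y # ys) + sg (Suc (length ys)) (K b (cp U y x # ys))"

lemma inn_hom:
 assumes "Modules.additive h"
 shows "h (inn la U K b xs) = inn la U (%b ys. h (K b ys)) b xs"
proof -
 interpret Modules.additive h by fact
 show ?thesis by (induction la U K b xs rule: inn.induct) (simp_all add: zero add diff additive_sg[OF assms])
qed

lemma inn_zero [simp]: "inn la U (%b ys. 0) b xs = 0"
 using inn_hom[of "%_. 0" la U "%_ _. 0" b xs] by (simp add: Modules.additive_def)

lemma inn_sg: "inn la U (%b ys. sg n (K b ys)) b xs = sg n (inn la U K b xs)"
 by (rule inn_hom[symmetric]) auto

lemma inn_minus: "inn la U (%b ys. - K b ys) b xs = - inn la U K b xs"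
 by (rule inn_hom[symmetric]) auto

lemma inn_add: "inn la U (%b ys. K b ys + K' b ys) b xs = inn la U K b xs + inn la U K' b xs"
 by (induction la U K b xs arbitrary: K' rule: inn.induct) (simp_all add: sg_add)

lemma inn_diff: "inn la U (%b ys. K b ys - K' b ys) b xs = inn la U K b xs - inn la U K' b xs"
 using inn_add[of la U K "%b ys. - K' b ys" b xs] by (simp add: inn_minus)

lemma inn_sum: "finite I ==> inn la U (%b ys. \<Sum>i\<in>I. K i b ys) b xs = (\<Sum>i\<in>I. inn la U (K i) b xs)"
 by (induction I rule: finite_induct) (simp_all add: inn_add)

definition bd where
 "bd la ra U K b A xs g = (case xs of [] => 0
   | x # xs' => inn la U (%b ys. K b A ys g) b xs + sg (length xs) (K b (cd x) xs' (ra x g)))"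

text \<open>The bar differential of \<open>\<A>(X)\<close>, and the three kinds of terms in its value on a path-shuffle sum:
 \<open>HB\<close> comes from the differential of the chain, \<open>FA\<close> from the faces of the path that start with a comparison map, and
 \<open>CU\<close> from the ways to cut the path in two.\<close>

definition BD where
 "BD X K b ys g = bd (cp X) (cp X) X (%b A. K b) b (cd g) ys g"

lemma BD_Nil [simp]: "BD X K b [] g = 0"
 by (simp add: BD_def bd_def)

lemma BD_Cons:
 "BD X K b (y # ys) g =
   BD X (%b ys y'. K b (y' # ys) g) b ys y + (if ys = [] then K (cp X b y) [] g else 0) +
   sg (Suc (length ys)) (K b ys (cp X y g))"
 by (cases ys) (simp_all add: BD_def bd_def)

definition HB where
 "HB X Y us K b A xs g = bd (%b x. cp X b (fn (co X us) x)) (%x g. cp X (sm us x) g) Y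
   (%b A xs g. S us A xs (%ys. K b ys g)) b A xs g"

definition FA where
 "FA X us K b A xs g = (\<Sum>j<length us - 1. sg (length us + length xs + j)
   (S (fc j us) A xs (%ys. K b ys (cp X (ep j us A) g))))"

definition DD where
 "DD L R A xs K = S R A xs (%zs. S L (star R A) zs K)"

definition CU where
 "CU X us K b A xs E g = (\<Sum>k\<in>{1..<length us}. sg (length us + length xs + k)
   (DD (take k us) (drop k us) A xs (%ys. K (cp X b (cut X (take k us) (drop k us) E)) ys g)))"

lemma inn_S:
 assumes "us ~= []"
 shows "inn la Y (%b zs. S us A zs (K b)) b (x # xs) =
  (\<Sum>j<length us - 1. - sg j (inn la Y (%b zs. S (fc j us) A zs (%ys. K b (ep j us A # ys))) b (x # xs))) +
  (case xs of [] => if length us = 1 then K (la b x) [] else 0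
   | x2 # xs2 => sg (length us - 1) (inn la Y (%b zs. S us (cd x) zs (%ys. K b (sm us x # ys))) b xs +
     sg (length xs) (S us (cd x2) xs2 (%ys. K b (sm us (cp Y x2 x) # ys)))))"
proof (cases xs)
 case Nil
 then show ?thesis using S_expand[of us A "[]" "K (la b x)"] by simp
next
 case (Cons x2 xs2)
 have "inn la Y (%b zs. S us A zs (K b)) b (x # xs) =
  inn la Y (%b zs. S us A (x # zs) (K b)) b xs + sg (length xs) (S us A (cp Y x2 x # xs2) (K b))"
  by (simp add: Cons)
 also have "(%b zs. S us A (x # zs) (K b)) = (%b zs.
   (\<Sum>j<length us - 1. - sg j (S (fc j us) A (x # zs) (%ys. K b (ep j us A # ys)))) +
   sg (length us - 1) (S us (cd x) zs (%ys. K b (sm us x # ys))))"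
  by (subst S_expand) simp
 also have "S us A (cp Y x2 x # xs2) (K b) =
   (\<Sum>j<length us - 1. - sg j (S (fc j us) A (cp Y x2 x # xs2) (%ys. K b (ep j us A # ys)))) +
   sg (length us - 1) (S us (cd x2) xs2 (%ys. K b (sm us (cp Y x2 x) # ys)))"
  by (subst S_expand) simp
 finally show ?thesis
  by (simp add: Cons inn_add inn_sum inn_minus inn_sg inn_diff sg_add sg_diff sg_sum sum_subtractf sum_negf sg_sg ac_simps)
qed

text \<open>\<open>HB\<close>, \<open>DD\<close> and \<open>CU\<close> are expanded along the first letter, to match the recursion of \<open>S\<close>.  In \<open>HB\<close>, naturality of the
 comparison maps turns the terms in which the first morphism is absorbed by them into terms of \<open>FA\<close>.\<close>

lemma HB_rec:
 fixes K :: "('a, 'h) mor => ('a, 'h) mor list => ('a, 'h) mor => 'w::ab_group_add"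
 assumes us: "pth X us Y" "us ~= []" and xs: "chain Y A (x # xs) E"
 shows "HB X Y us K b A (x # xs) g =
  (\<Sum>j<length us - 1. - sg j (HB X Y (fc j us) (%b ys y. K b (y # ys) g) b A (x # xs) (ep j us A))) +
  sg (length us - 1) (HB X Y us (%b ys y. K b (y # ys) g) b (cd x) xs (sm us x) +
    FA X us (%b ys y. K b (y # ys) g) b (cd x) xs (sm us x) +
    sg (length us + length xs) (S us (cd x) xs (%ys. K b ys (cp X (sm us x) g)))) +
  (if length us = 1 & xs = [] then K (cp X b (sm us x)) [] g else 0)"
proof -
 define N where "N j = S (fc j us) (cd x) xs (%ys. K b (cp X (ep j us (cd x)) (sm us x) # ys) g)" for j
 define I where "I j = inn (%b x. cp X b (fn (co X us) x)) Y
   (%b zs. S (fc j us) A zs (%ys. K b (ep j us A # ys) g)) b (x # xs)" for j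
 have x: "x \<in> arr Y" "dm x = A" "chain Y (cd x) xs E" using xs by auto
 have HBj: "HB X Y (fc j us) (%b ys y. K b (y # ys) g) b A (x # xs) (ep j us A) = I j + sg (Suc (length xs)) (N j)"
  if "j < length us - 1" for j
 proof -
  have j: "Suc j < length us" using that by simp
  show ?thesis
   using ep_nat[OF j us(1) x(1)] by (simp add: HB_def bd_def I_def N_def fc_co[OF j us(1)] x(2))
 qed
 have FA: "FA X us (%b ys y. K b (y # ys) g) b (cd x) xs (sm us x) = (\<Sum>j<length us - 1. sg (length us + length xs + j) (N j))"
  by (simp add: FA_def N_def)
 have HBx: "HB X Y us (%b ys y. K b (y # ys) g) b (cd x) xs (sm us x) = (case xs of [] => 0 | x2 # xs2 =>
   inn (%b x. cp X b (fn (co X us) x)) Y (%b zs. S us (cd x) zs (%ys. K b (sm us x # ys) g)) b xs +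
     sg (length xs) (S us (cd x2) xs2 (%ys. K b (sm us (cp Y x2 x) # ys) g)))"
  using x sm_cp[OF us(1), of x] by (auto simp: HB_def bd_def split: list.split)
 have xx: "fn (co X us) x = sm us x" if "length us = 1"
  using that us(1) by (auto simp: length_Suc_conv cmp_idn_left)
 have s: "sg (length us - 1) (sg (length us + length xs) y) = - sg (length xs) y" for y :: 'w
  unfolding sg_sg using us(2) by (intro sg_parity_odd) (cases us, auto)
 have sN: "sg (length us - 1) (sg (length us + length xs + j) y) = sg j (sg (Suc (length xs)) y)" for y :: 'w and j
  unfolding sg_sg using us(2) by (intro sg_parity) (cases us, auto)
 have "HB X Y us K b A (x # xs) g =
  (\<Sum>j<length us - 1. - sg j (I j)) +
  (case xs of [] => if length us = 1 then K (cp X b (sm us x)) [] g else 0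
   | x2 # xs2 => sg (length us - 1) (inn (%b x. cp X b (fn (co X us) x)) Y (%b zs. S us (cd x) zs (%ys. K b (sm us x # ys) g)) b xs +
     sg (length xs) (S us (cd x2) xs2 (%ys. K b (sm us (cp Y x2 x) # ys) g)))) -
  sg (length xs) (S us (cd x) xs (%ys. K b ys (cp X (sm us x) g)))"
  using inn_S[OF us(2), of "%b x. cp X b (fn (co X us) x)" Y A "%b ys. K b ys g" b x xs] xx
  by (simp add: HB_def bd_def I_def split: list.split)
 also have "(\<Sum>j<length us - 1. - sg j (I j)) =
   (\<Sum>j<length us - 1. - sg j (HB X Y (fc j us) (%b ys y. K b (y # ys) g) b A (x # xs) (ep j us A))) +
   sg (length us - 1) (FA X us (%b ys y. K b (y # ys) g) b (cd x) xs (sm us x))"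
  unfolding FA sg_sum sN sum.distrib[symmetric] by (intro sum.cong refl) (simp add: HBj sg_add sg_diff)
 finally show ?thesis
  unfolding HBx sg_add s by (auto simp: sg_diff split: list.split)
qed

lemma DD_rec:
 assumes "pth X L Z" "L ~= []" "pth Z R Y" "R ~= []" "chain Y A xs E"
 shows "DD L R A xs K =
  (\<Sum>i<length L - 1. - sg i (DD (fc i L) R A xs (%ys. K (ep i L (star R A) # ys)))) +
  (\<Sum>j<length R - 1. - sg j (sg (length L - 1) (DD L (fc j R) A xs (%ys. K (sm L (ep j R A) # ys))))) +
  (case xs of [] => if length L = 1 & length R = 1 then K [] else 0
   | x # xs' => sg (length R - 1) (sg (length L - 1) (DD L R (cd x) xs' (%ys. K (sm L (sm R x) # ys)))))"
proof -
 define T where "T zs = (case zs of [] => if length L = 1 then K [] else 0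
   | z # zs' => sg (length L - 1) (S L (cd z) zs' (%ys. K (sm L z # ys))))" for zs
 have "DD L R A xs K = S R A xs (%zs.
   (\<Sum>i<length L - 1. - sg i (S (fc i L) (star R A) zs (%ys. K (ep i L (star R A) # ys)))) + T zs)"
  unfolding DD_def T_def by (subst S_expand[of L]) simp
 also have "... = (\<Sum>i<length L - 1. - sg i (DD (fc i L) R A xs (%ys. K (ep i L (star R A) # ys)))) + S R A xs T"
  by (simp add: S_add S_sum S_minus S_sg DD_def)
 also have "S R A xs T = (\<Sum>j<length R - 1. - sg j (S (fc j R) A xs (%ys. T (ep j R A # ys)))) +
   (case xs of [] => if length R = 1 then T [] else 0
   | x # xs' => sg (length R - 1) (S R (cd x) xs' (%ys. T (sm R x # ys))))"
  by (subst S_expand) simp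
 also have "(\<Sum>j<length R - 1. - sg j (S (fc j R) A xs (%ys. T (ep j R A # ys)))) =
   (\<Sum>j<length R - 1. - sg j (sg (length L - 1) (DD L (fc j R) A xs (%ys. K (sm L (ep j R A) # ys)))))"
  by (intro sum.cong refl) (simp add: T_def S_sg DD_def)
 finally show ?thesis by (simp add: T_def S_sg DD_def add.assoc split: list.split)
qed

text \<open>A comparison map of one of the two parts of a cut is a comparison map of the whole path, after which the face
 is cut; the exception is a path of length two, whose comparison map is the twist of the cut itself.\<close>

lemma CU_rec:
 fixes K :: "('a, 'h) mor => ('a, 'h) mor list => ('a, 'h) mor => 'w::ab_group_add"
 assumes us: "pth X us Y" "us ~= []" and xs: "chain Y A xs E"
 shows "CU X us K b A xs E g =
  (\<Sum>j<length us - 1. - sg j (CU X (fc j us) (%b ys y. K b (y # ys) g) b A xs E (ep j us A))) +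
  (case xs of [] => if length us = 2 then - K (cp X b (ep 0 us A)) [] g else 0
   | x # xs' => sg (length us - 1) (CU X us (%b ys y. K b (y # ys) g) b (cd x) xs' E (sm us x)))"
proof -
 define m where "m = length us"
 define q where "q = length xs"
 define c where "c k = cp X b (cut X (take k us) (drop k us) E)" for k
 define G where "G j k = DD (take k (fc j us)) (drop k (fc j us)) A xs
   (%ys. K (cp X b (cut X (take k (fc j us)) (drop k (fc j us)) E)) (ep j us A # ys) g)" for j k
 define H where "H k = (case xs of [] => if k = 1 & m - k = 1 then K (c k) [] g else 0
   | x # xs' => sg (m - k - 1) (sg (k - 1) (DD (take k us) (drop k us) (cd x) xs' (%ys. K (c k) (sm us x # ys) g))))" for k
 have m1: "m \<ge> 1" using us(2) by (cases us) (auto simp: m_def)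
 have D: "DD (take k us) (drop k us) A xs (%ys. K (c k) ys g) =
   (\<Sum>i<k - 1. - sg i (G i (k - 1))) + (\<Sum>j<m - k - 1. - sg j (sg (k - 1) (G (k + j) k))) + H k"
  if k: "1 \<le> k" "k < m" for k
 proof -
  define L where "L = take k us"
  define R where "R = drop k us"
  have LR: "us = L @ R" "length L = k" "length R = m - k" using k by (auto simp: L_def R_def m_def)
  obtain Z where Z: "pth X L Z" "pth Z R Y" using us(1) unfolding LR(1) pth_append by blast
  have ne: "L ~= []" "R ~= []" using LR k by auto
  have 1: "G i (k - 1) = DD (fc i L) R A xs (%ys. K (c k) (ep i L (star R A) # ys) g)" if i: "i < k - 1" for i
  proof -
   have i': "Suc i < length L" using i LR by simp
   have f: "take (k - 1) (fc i us) = fc i L" "drop (k - 1) (fc i us) = R"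
    using fc_length[OF i'] LR(2) by (simp_all add: LR(1) fc_append_left[OF i'])
   have e: "cut X (fc i L) R E = cut X L R E"
    using fc_co[OF i' Z(1)] by (simp add: cut_eq[OF Z(1)] cut_eq[OF fc_pth[OF i' Z(1)]])
   show ?thesis unfolding G_def f e c_def L_def[symmetric] R_def[symmetric]
    by (simp add: LR(1) ep_append_left[OF i'])
  qed
  have 2: "G (k + j) k = DD L (fc j R) A xs (%ys. K (c k) (sm L (ep j R A) # ys) g)" if j: "j < m - k - 1" for j
  proof -
   have j': "Suc j < length R" using j LR by simp
   have f: "take k (fc (k + j) us) = L" "drop k (fc (k + j) us) = fc j R"
    using fc_append_right[OF j', of L] LR by simp_all
   have e: "cut X L (fc j R) E = cut X L R E"
    using fc_co[OF j' Z(2)] by (simp add: cut_eq[OF Z(1)])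
   show ?thesis unfolding G_def f e c_def L_def[symmetric] R_def[symmetric]
    using ep_append_right[OF j', of L] LR by simp
  qed
  have 3: "H k = (case xs of [] => if length L = 1 & length R = 1 then K (c k) [] g else 0
   | x # xs' => sg (length R - 1) (sg (length L - 1) (DD L R (cd x) xs' (%ys. K (c k) (sm L (sm R x) # ys) g))))"
   unfolding H_def L_def[symmetric] R_def[symmetric] LR(2,3) using LR(1) by (simp split: list.split)
  show ?thesis
   unfolding L_def[symmetric] R_def[symmetric] DD_rec[OF Z(1) ne(1) Z(2) ne(2) xs] 3[symmetric]
   using 1 2 by (simp add: LR)
 qed
 have "CU X us K b A xs E g = (\<Sum>k\<in>{1..<m}. sg (m + q + k)
   ((\<Sum>i<k - 1. - sg i (G i (k - 1))) + (\<Sum>j<m - k - 1. - sg j (sg (k - 1) (G (k + j) k))) + H k))"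
  unfolding CU_def m_def[symmetric] q_def[symmetric] c_def[symmetric] using D by (intro sum.cong refl) auto
 also have "... = (\<Sum>k\<in>{1..<m}. (\<Sum>i<k - 1. - sg i (sg (m - 1 + q + (k - 1)) (G i (k - 1)))) +
   (\<Sum>j<m - k - 1. - sg (k + j) (sg (m - 1 + q + k) (G (k + j) k)))) + (\<Sum>k\<in>{1..<m}. sg (m + q + k) (H k))"
 proof -
  have s1: "sg (m + q + k) (- sg i x) = - sg i (sg (m - 1 + q + (k - 1)) x)" if "1 \<le> k" for k i and x :: 'w
   unfolding sg_minus sg_sg using that m1 by (auto intro!: sg_parity)
  have s2: "sg (m + q + k) (- sg j (sg (k - 1) x)) = - sg (k + j) (sg (m - 1 + q + k) x)" if "1 \<le> k" for k j and x :: 'w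
   unfolding sg_minus sg_sg using that m1 by (auto intro!: sg_parity)
  show ?thesis
   unfolding sum.distrib[symmetric]
  proof (rule sum.cong[OF refl])
   fix k assume k: "k \<in> {1..<m}"
   have "(\<Sum>i<k - 1. sg (m + q + k) (- sg i (G i (k - 1)))) = (\<Sum>i<k - 1. - sg i (sg (m - 1 + q + (k - 1)) (G i (k - 1))))"
    "(\<Sum>j<m - k - 1. sg (m + q + k) (- sg j (sg (k - 1) (G (k + j) k)))) =
     (\<Sum>j<m - k - 1. - sg (k + j) (sg (m - 1 + q + k) (G (k + j) k)))"
    using k by (intro sum.cong refl s1 s2; simp)+
   then show "sg (m + q + k) ((\<Sum>i<k - 1. - sg i (G i (k - 1))) + (\<Sum>j<m - k - 1. - sg j (sg (k - 1) (G (k + j) k))) + H k) =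
    (\<Sum>i<k - 1. - sg i (sg (m - 1 + q + (k - 1)) (G i (k - 1)))) +
    (\<Sum>j<m - k - 1. - sg (k + j) (sg (m - 1 + q + k) (G (k + j) k))) + sg (m + q + k) (H k)"
    by (simp only: sg_add sg_sum)
  qed
 qed
 also have "(\<Sum>k\<in>{1..<m}. (\<Sum>i<k - 1. - sg i (sg (m - 1 + q + (k - 1)) (G i (k - 1)))) +
   (\<Sum>j<m - k - 1. - sg (k + j) (sg (m - 1 + q + k) (G (k + j) k)))) =
   (\<Sum>j<m - 1. \<Sum>k\<in>{1..<m - 1}. - sg j (sg (m - 1 + q + k) (G j k)))"
  by (rule alternating_cut_sum[OF m1, symmetric])
 also have "... = (\<Sum>j<length us - 1. - sg j (CU X (fc j us) (%b ys y. K b (y # ys) g) b A xs E (ep j us A)))"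
  unfolding m_def[symmetric]
  by (intro sum.cong refl) (simp add: CU_def fc_length m_def q_def G_def sg_sum sum_negf)
 also have "(\<Sum>k\<in>{1..<m}. sg (m + q + k) (H k)) =
  (case xs of [] => if length us = 2 then - K (cp X b (ep 0 us A)) [] g else 0
   | x # xs' => sg (length us - 1) (CU X us (%b ys y. K b (y # ys) g) b (cd x) xs' E (sm us x)))"
 proof (cases xs)
  case Nil
  have EA: "E = A" using xs Nil by simp
  show ?thesis
  proof (cases "m = 2")
   case True
   then obtain u v where uv: "us = [u, v]" by (auto simp: m_def numeral_2_eq_2 length_Suc_conv)
   have "c 1 = cp X b (ep 0 us A)"
    using us(1) by (auto simp: c_def uv EA cut_eq[where Z = "srU v"] tgt_Ob cmp_idn_left)
   then show ?thesis using True Nil by (simp add: H_def m_def q_def numeral_2_eq_2)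
  next
   case False
   then have "H k = 0" if "k \<in> {1..<m}" for k using that Nil by (auto simp: H_def)
   then show ?thesis using Nil False by (simp add: m_def)
  qed
 next
  case (Cons x xs')
  have "sg (m + q + k) (sg (m - k - 1) (sg (k - 1) y)) = sg (m - 1) (sg (m + length xs' + k) y)"
   if "k \<in> {1..<m}" for k and y :: 'w
   unfolding sg_sg using that Cons by (intro sg_parity) (auto simp: q_def)
  then show ?thesis
   unfolding Cons by (simp add: H_def Cons CU_def m_def[symmetric] c_def sg_sum)
 qed
 finally show ?thesis .
qed

text \<open>The boundary of the path-shuffle sum.  Faces that drop the last or the first entry give the
 Hochschild terms and the terms where the first entry is a twist; interior faces merging two twists
 cancel by the simplicial identities, those merging a twist and a morphism cancel by naturality.\<close>

theorem S_boundary: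
 fixes K :: "('a, 'h) mor => ('a, 'h) mor list => ('a, 'h) mor => 'w::ab_group_add"
 assumes "pth X us Y" "us ~= []" "chain Y A xs E"
 shows "S us A xs (%ys. BD X K b ys g) = HB X Y us K b A xs g + FA X us K b A xs g + CU X us K b A xs E g"
 using assms
proof (induction "length us + length xs" arbitrary: us A xs K g rule: less_induct)
 case less
 note us = less.prems(1,2) and xs = less.prems(3)
 define m where "m = length us"
 define q where "q = length xs"
 define K' where "K' b ys y = K b (y # ys) g" for b ys y
 have m1: "m \<ge> 1" using us(2) by (cases us) (auto simp: m_def)
 have Sj: "S (fc j us) A xs (%ys. BD X K b (ep j us A # ys) g) =
   HB X Y (fc j us) K' b A xs (ep j us A) + FA X (fc j us) K' b A xs (ep j us A) + CU X (fc j us) K' b A xs E (ep j us A) +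
   (if m = 2 & q = 0 then K (cp X b (ep j us A)) [] g else 0) +
   sg (m + q - 1) (S (fc j us) A xs (%ys. K b ys (cp X (ep j us A) g)))" if j: "j < m - 1" for j
 proof -
  have j': "Suc j < length us" using j by (simp add: m_def)
  note l = fc_length[OF j'] and p = fc_pth[OF j' us(1)]
  have ne: "fc j us ~= []" using l j' by auto
  have "S (fc j us) A xs (%ys. BD X K b (ep j us A # ys) g) = S (fc j us) A xs (%ys. BD X K' b ys (ep j us A) +
    (if m = 2 & q = 0 then K (cp X b (ep j us A)) ys g else 0) + sg (m + q - 1) (K b ys (cp X (ep j us A) g)))"
  proof (rule S_cong[OF p ne xs])
   fix ys :: "('a, 'h) mor list" assume "Suc (length ys) = length (fc j us) + length xs"
   then have e: "Suc (length ys) = m + q - 1" "length ys = 0 \<longleftrightarrow> m = 2 & q = 0"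
    using l j' unfolding m_def q_def by linarith+
   show "BD X K b (ep j us A # ys) g = BD X K' b ys (ep j us A) +
    (if m = 2 & q = 0 then K (cp X b (ep j us A)) ys g else 0) + sg (m + q - 1) (K b ys (cp X (ep j us A) g))"
    unfolding BD_Cons e(1) K'_def[abs_def] using e(2) by auto
  qed
  also have "... = S (fc j us) A xs (%ys. BD X K' b ys (ep j us A)) +
    S (fc j us) A xs (%ys. if m = 2 & q = 0 then K (cp X b (ep j us A)) ys g else 0) +
    sg (m + q - 1) (S (fc j us) A xs (%ys. K b ys (cp X (ep j us A) g)))"
   by (simp only: S_add S_sg)
  also have "S (fc j us) A xs (%ys. BD X K' b ys (ep j us A)) =
   HB X Y (fc j us) K' b A xs (ep j us A) + FA X (fc j us) K' b A xs (ep j us A) + CU X (fc j us) K' b A xs E (ep j us A)"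
   by (rule less.hyps[OF _ p ne xs]) (use l j' in simp)
  also have "S (fc j us) A xs (%ys. if m = 2 & q = 0 then K (cp X b (ep j us A)) ys g else 0) =
    (if m = 2 & q = 0 then K (cp X b (ep j us A)) [] g else 0)"
  proof (cases "m = 2 & q = 0")
   case True
   then have "length (fc j us) = Suc 0" using l by (simp add: m_def)
   then obtain w where "fc j us = [w]" by (auto simp: length_Suc_conv)
   then show ?thesis using True by (simp add: q_def)
  qed auto
  finally show ?thesis .
 qed
 have cancel: "(\<Sum>j<m - 1. - sg j (FA X (fc j us) K' b A xs (ep j us A))) = 0"
 proof (cases "m = 1")
  case False
  define n where "n = m - 2"
  have n: "m = Suc (Suc n)" using False m1 by (simp add: n_def)
  define F where "F j i = S (fc i (fc j us)) A xs (%ys. K b (cp X (ep i (fc j us) A) (ep j us A) # ys) g)" for j i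
  have "(\<Sum>j<m - 1. - sg j (FA X (fc j us) K' b A xs (ep j us A))) =
    (\<Sum>j<Suc n. \<Sum>i<n. sg (Suc (m - 1 + q)) (sg (j + i) (F j i)))"
  proof -
   have "- sg j (FA X (fc j us) K' b A xs (ep j us A)) = (\<Sum>i<n. sg (Suc (m - 1 + q)) (sg (j + i) (F j i)))"
    if j: "j < Suc n" for j
   proof -
    have l: "length (fc j us) = Suc n" using fc_length[of j us] j n by (simp add: m_def)
    have "- sg j (sg (length (fc j us) + length xs + i) x) = sg (Suc (m - 1 + q)) (sg (j + i) x)" for i and x :: 'w
     unfolding sg_sg l using n by (intro sg_parity_odd[symmetric]) (simp add: q_def, blast)
    then show ?thesis unfolding FA_def sg_sum sum_negf[symmetric] by (simp add: F_def K'_def l)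
   qed
   then show ?thesis using n by (intro sum.cong) auto
  qed
  also have "... = sg (Suc (m - 1 + q)) (\<Sum>j<Suc n. \<Sum>i<n. sg (j + i) (F j i))"
   by (simp only: sg_sum)
  also have "(\<Sum>j<Suc n. \<Sum>i<n. sg (j + i) (F j i)) = 0"
  proof (rule alternating_double_sum)
   fix i j assume "i \<le> j" "j < n"
   then show "F i j = F (Suc j) i"
    using fc_fc[OF _ _ us(1), of i j] ep_ep[OF _ _ us(1) chain_obj(1)[OF xs], of i j] n
    by (simp add: F_def m_def)
  qed
  finally show ?thesis by simp
 qed simp
 have FAeq: "(\<Sum>j<m - 1. - sg j (sg (m + q - 1) (S (fc j us) A xs (%ys. K b ys (cp X (ep j us A) g))))) = FA X us K b A xs g"
 proof -
  have "- sg j (sg (m + q - 1) x) = sg (m + q + j) x" for j and x :: 'w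
   unfolding sg_sg using m1 by (intro sg_parity_odd[symmetric]) auto
  then show ?thesis by (simp add: FA_def m_def q_def)
 qed
 have corr: "(\<Sum>j<m - 1. - sg j (if m = 2 & q = 0 then K (cp X b (ep j us A)) [] g else 0)) =
   (if m = 2 & q = 0 then - K (cp X b (ep 0 us A)) [] g else 0)"
  by (auto simp: numeral_2_eq_2)
 have sum1: "(\<Sum>j<m - 1. - sg j (S (fc j us) A xs (%ys. BD X K b (ep j us A # ys) g))) =
   (\<Sum>j<m - 1. - sg j (HB X Y (fc j us) K' b A xs (ep j us A))) +
   (\<Sum>j<m - 1. - sg j (CU X (fc j us) K' b A xs E (ep j us A))) +
   (if m = 2 & q = 0 then - K (cp X b (ep 0 us A)) [] g else 0) + FA X us K b A xs g"
 proof -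
  have "(\<Sum>j<m - 1. - sg j (S (fc j us) A xs (%ys. BD X K b (ep j us A # ys) g))) =
   (\<Sum>j<m - 1. - sg j (HB X Y (fc j us) K' b A xs (ep j us A))) + (\<Sum>j<m - 1. - sg j (FA X (fc j us) K' b A xs (ep j us A))) +
   (\<Sum>j<m - 1. - sg j (CU X (fc j us) K' b A xs E (ep j us A))) +
   (\<Sum>j<m - 1. - sg j (if m = 2 & q = 0 then K (cp X b (ep j us A)) [] g else 0)) +
   (\<Sum>j<m - 1. - sg j (sg (m + q - 1) (S (fc j us) A xs (%ys. K b ys (cp X (ep j us A) g)))))"
   unfolding sum.distrib[symmetric] by (intro sum.cong refl) (simp add: Sj sg_add)
  then show ?thesis unfolding cancel corr FAeq by simp
 qed
 show ?case
 proof (cases xs)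
  case Nil
  have "HB X Y us K b A xs g = 0" "!!j. HB X Y (fc j us) K' b A xs (ep j us A) = 0"
   using Nil by (simp_all add: HB_def bd_def)
  moreover have "S us A xs (%ys. BD X K b ys g) = (\<Sum>j<m - 1. - sg j (S (fc j us) A xs (%ys. BD X K b (ep j us A # ys) g)))"
   using Nil by (subst S_expand) (simp add: m_def)
  ultimately show ?thesis
   unfolding sum1 using CU_rec[OF us xs, of K b g] Nil by (simp add: m_def[symmetric] q_def K'_def[abs_def])
 next
  case (Cons x xs')
  have q: "q = Suc (length xs')" by (simp add: q_def Cons)
  have xs': "chain Y (cd x) xs' E" using xs Cons by simp
  have "S us (cd x) xs' (%ys. BD X K b (sm us x # ys) g) = S us (cd x) xs' (%ys. BD X K' b ys (sm us x) +
    (if m = 1 & xs' = [] then K (cp X b (sm us x)) ys g else 0) + sg (m + length xs') (K b ys (cp X (sm us x) g)))"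
  proof (rule S_cong[OF us xs'])
   fix ys :: "('a, 'h) mor list" assume "Suc (length ys) = length us + length xs'"
   then have e: "Suc (length ys) = m + length xs'" "length ys = 0 \<longleftrightarrow> m = 1 & length xs' = 0"
    using m1 unfolding m_def by linarith+
   show "BD X K b (sm us x # ys) g = BD X K' b ys (sm us x) +
    (if m = 1 & xs' = [] then K (cp X b (sm us x)) ys g else 0) + sg (m + length xs') (K b ys (cp X (sm us x) g))"
    unfolding BD_Cons e(1) K'_def[abs_def] using e(2) by auto
  qed
  also have "... = S us (cd x) xs' (%ys. BD X K' b ys (sm us x)) +
    S us (cd x) xs' (%ys. if m = 1 & xs' = [] then K (cp X b (sm us x)) ys g else 0) +
    sg (m + length xs') (S us (cd x) xs' (%ys. K b ys (cp X (sm us x) g)))"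
   by (simp only: S_add S_sg)
  also have "S us (cd x) xs' (%ys. if m = 1 & xs' = [] then K (cp X b (sm us x)) ys g else 0) =
    (if m = 1 & xs' = [] then K (cp X b (sm us x)) [] g else 0)"
  proof (cases "m = 1 & xs' = []")
   case True
   then obtain w where "us = [w]" by (auto simp: m_def length_Suc_conv)
   then show ?thesis using True by simp
  qed auto
  also have "S us (cd x) xs' (%ys. BD X K' b ys (sm us x)) =
    HB X Y us K' b (cd x) xs' (sm us x) + FA X us K' b (cd x) xs' (sm us x) + CU X us K' b (cd x) xs' E (sm us x)"
   by (rule less.hyps[OF _ us xs']) (simp add: Cons)
  finally have Sx: "S us (cd x) xs' (%ys. BD X K b (sm us x # ys) g) =
    HB X Y us K' b (cd x) xs' (sm us x) + FA X us K' b (cd x) xs' (sm us x) + CU X us K' b (cd x) xs' E (sm us x) +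
    (if m = 1 & xs' = [] then K (cp X b (sm us x)) [] g else 0) +
    sg (m + length xs') (S us (cd x) xs' (%ys. K b ys (cp X (sm us x) g)))" .
  have "S us A xs (%ys. BD X K b ys g) = (\<Sum>j<m - 1. - sg j (S (fc j us) A xs (%ys. BD X K b (ep j us A # ys) g))) +
    sg (m - 1) (S us (cd x) xs' (%ys. BD X K b (sm us x # ys) g))"
   using Cons by (subst S_expand) (simp add: m_def)
  then show ?thesis
   unfolding sum1 Sx
   using HB_rec[OF us xs[unfolded Cons], of K b g] CU_rec[OF us xs, of K b g]
   by (auto simp: Cons m_def[symmetric] K'_def[symmetric] K'_def[abs_def, symmetric] q sg_add)
 qed
qed

end

section \<open>The differential on generators and its contraction\<close>

type_synonym ('m, 'a, 'h, 'w) gfun = "'m list => 'a => ('a, 'h) mor list => ('a, 'h) mor => ('a, 'h) mor => 'w"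

context prestack
begin

fun mg :: "'u => nat => ('a, 'h) mor list => ('a, 'h) mor list" where
 "mg U 0 (x # y # xs) = cp U y x # xs"
| "mg U (Suc i) (x # xs) = x # mg U i xs"
| "mg U i xs = xs"

lemma mg_length: "Suc i < length xs ==> length (mg U i xs) = length xs - 1"
 by (induction U i xs rule: mg.induct) auto

definition endo :: "'a => ('a, 'h) mor list => 'a" where
 "endo A xs = (if xs = [] then A else cd (last xs))"

lemma chain_endo: "chain U A xs E ==> endo A xs = E"
 by (induction xs arbitrary: A) (auto simp: endo_def)

lemma chain_append: "chain U A (xs @ ys) E \<longleftrightarrow> (\<exists>B. chain U A xs B & chain U B ys E)"
 by (induction xs arbitrary: A) (auto dest: chain_obj)

lemma chain_butlast:
 assumes "chain U A xs E" "xs ~= []"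
 shows "chain U A (butlast xs) (dm (last xs))" "last xs \<in> arr U" "cd (last xs) = E"
 using assms append_butlast_last_id[OF assms(2)] chain_append[of U A "butlast xs" "[last xs]" E] by auto

lemma chain_tl:
 assumes "chain U A xs E" "xs ~= []"
 shows "chain U (cd (hd xs)) (tl xs) E" "hd xs \<in> arr U" "dm (hd xs) = A"
 using assms by (cases xs; auto)+

lemma chain_mg: "U \<in> ObU ==> chain U A xs E ==> Suc i < length xs ==> chain U A (mg U i xs) E"
 by (induction U i xs arbitrary: A rule: mg.induct) auto

lemma inn_explicit:
 "xs ~= [] ==> inn la U K b xs = K (la b (last xs)) (butlast xs) +
   (\<Sum>i<length xs - 1. sg (length xs - 1 - i) (K b (mg U i xs)))"
proof (induction la U K b xs rule: inn.induct)
 case (3 la U K b x y ys)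
 then show ?case by (simp add: sum.lessThan_Suc_shift add_ac del: sum.lessThan_Suc)
qed simp_all

lemma bd_explicit:
 "bd la ra U K b A xs g = (if xs = [] then 0 else K (la b (last xs)) A (butlast xs) g +
   (\<Sum>i<length xs - 1. sg (length xs - 1 - i) (K b A (mg U i xs) g)) +
   sg (length xs) (K b (cd (hd xs)) (tl xs) (ra (hd xs) g)))"
 by (cases xs) (simp_all add: bd_def inn_explicit)

text \<open>The differential of the resolution in terms of values: the bar differential along the chain, the inner faces
 of the path, and the cuts of the path into \<open>L @ R\<close>, where \<open>R\<close> is shuffled into the chain and the twist of the cut
 is absorbed into \<open>b\<close>.  The first face of the path does not occur, as \<open>b\<close> and \<open>g\<close> live over its source.\<close>

definition Dl :: "'u => (('m, 'a, 'h, 'w::ab_group_add) gfun) =>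
  ('m, 'a, 'h, 'w) gfun" where
 "Dl X K us A xs b g =
   bd (%b x. cp X b (fn (co X us) x)) (%x g. cp X (sm us x) g) (lstU X us) (%b A xs g. K us A xs b g) b A xs g +
   (\<Sum>j<length us - 1. sg (Suc (length us + length xs + j)) (K (fc j us) A xs b (cp X (ep j us A) g))) +
   (\<Sum>k\<in>{1..<length us}. sg (length xs) (S (drop k us) A xs (%zs. K (take k us) (star (drop k us) A) zs
    (cp X b (cut X (take k us) (drop k us) (endo A xs))) g)))"

text \<open>The contraction \<open>Hm\<close> puts an identity in front of the simplex; \<open>Pm\<close> is the path-shuffle
 projection onto the bar construction of \<open>\<A>(X)\<close>, embedded via the simplex \<open>[1]\<close>; \<open>Sm\<close> is the extra
 degeneracy of that bar construction.\<close>

definition Hm :: "'u => (('m, 'a, 'h, 'w::ab_group_add) gfun) =>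
  ('m, 'a, 'h, 'w) gfun" where
 "Hm X K us A xs b g = sg (length us + length xs) (K (idU X # us) A xs b g)"

definition Pm :: "'u => (('m, 'a, 'h, 'w::ab_group_add) gfun) =>
  ('m, 'a, 'h, 'w) gfun" where
 "Pm X K us A xs b g = sg (Suc (length us)) (S us A xs (%ys. K [idU X] (star us A) ys b g))"

definition Sm :: "'u => (('m, 'a, 'h, 'w::ab_group_add) gfun) =>
  ('m, 'a, 'h, 'w) gfun" where
 "Sm X K us A xs b g = (if us = [idU X] then sg (Suc (length xs)) (K us (dm g) (g # xs) b (ida X (dm g))) else 0)"

text \<open>The data of a generator of degree \<open>n\<close> at \<open>(X, P, Q)\<close>.\<close>

definition gd where
 "gd n X P Q us A xs b g \<longleftrightarrow> (\<exists>Y E. pth X us Y & us ~= [] & length us + length xs = Suc n & chain Y A xs E &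
   b \<in> arr X & dm b = foA (co X us) E & cd b = Q & g \<in> arr X & dm g = P & cd g = star us A)"

lemma gdE [consumes 1, case_names gd]:
 assumes "gd n X P Q us A xs b g"
 obtains Y E where "pth X us Y" "us ~= []" "length us + length xs = Suc n" "chain Y A xs E"
  "b \<in> arr X" "dm b = foA (co X us) E" "cd b = Q" "g \<in> arr X" "dm g = P" "cd g = star us A"
  "lstU X us = Y" "endo A xs = E" "X \<in> ObU" "Y \<in> ObU"
 using assms unfolding gd_def by (metis chain_endo pth_iff pth_Ob)

lemma gdI:
 assumes "pth X us Y" "us ~= []" "length us + length xs = Suc n" "chain Y A xs E"
  "b \<in> arr X" "dm b = foA (co X us) E" "cd b = Q" "g \<in> arr X" "dm g = P" "cd g = star us A"
 shows "gd n X P Q us A xs b g"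
 using assms unfolding gd_def by blast

lemma gd_Ob: "gd n X P Q us A xs b g ==> X \<in> ObU & P \<in> obA X & Q \<in> obA X"
 by (elim gdE) (auto dest: arrD)

lemma gd_butlast:
 assumes "gd (Suc n) X P Q us A xs b g" "xs ~= []"
 shows "gd n X P Q us A (butlast xs) (cp X b (fn (co X us) (last xs))) g"
 using assms(1)
proof (cases rule: gdE)
 case h: (gd Y E)
 note c = chain_butlast[OF h(4) assms(2)]
 have "fn (co X us) (last xs) \<in> arr X" using fn_arr[of "co X us" "last xs"] co_Ar[OF h(1)] src_co[OF h(1)] tgt_co[OF h(1)] c by auto
 moreover obtain l where "length xs = Suc l" using assms(2) by (cases xs) auto
 ultimately show ?thesis using h c by (intro gdI[OF h(1,2) _ c(1)]) auto
qed

lemma gd_mg: "gd (Suc n) X P Q us A xs b g ==> Suc i < length xs ==> gd n X P Q us A (mg (lstU X us) i xs) b g"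
 by (elim gdE, rule gdI) (auto simp: mg_length intro: chain_mg)

lemma gd_tl:
 assumes "gd (Suc n) X P Q us A xs b g" "xs ~= []"
 shows "gd n X P Q us (cd (hd xs)) (tl xs) b (cp X (sm us (hd xs)) g)"
 using assms(1)
proof (cases rule: gdE)
 case h: (gd Y E)
 note c = chain_tl[OF h(4) assms(2)]
 have "sm us (hd xs) \<in> arr X" using sm_arr[OF h(1)] c by auto
 moreover obtain l where "length xs = Suc l" using assms(2) by (cases xs) auto
 ultimately show ?thesis using h c by (intro gdI[OF h(1,2) _ c(1)]) auto
qed

lemma gd_fc:
 assumes "gd (Suc n) X P Q us A xs b g" "Suc j < length us"
 shows "gd n X P Q (fc j us) A xs b (cp X (ep j us A) g)"
 using assms(1)
proof (cases rule: gdE)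
 case h: (gd Y E)
 show ?thesis
  using h ep_arr[OF assms(2) h(1) chain_obj(1)[OF h(4)]] fc_length[OF assms(2)] fc_co[OF assms(2) h(1)] assms(2)
  by (intro gdI[OF fc_pth[OF assms(2) h(1)] _ _ h(4)]) auto
qed

lemma gd_cut:
 assumes "gd (Suc n) X P Q us A xs b g" "1 \<le> k" "k < length us"
  and zs: "chain Z (star (drop k us) A) zs (foA (co Z (drop k us)) (endo A xs))" "Suc (length zs) = length (drop k us) + length xs"
  and Z: "pth X (take k us) Z" "pth Z (drop k us) Y"
 shows "gd n X P Q (take k us) (star (drop k us) A) zs (cp X b (cut X (take k us) (drop k us) (endo A xs))) g"
 using assms(1)
proof (cases rule: gdE)
 case h: (gd Y' E)
 have us: "take k us @ drop k us = us" by simp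
 have "Y = Y'" using Z h(1,11) pth_append[of X "take k us" "drop k us" Y] pth_iff[of X us Y] by auto
 then have E: "E \<in> obA Y" using chain_obj[OF h(4)] by simp
 show ?thesis
  using h zs assms(2,3) cut_arr[OF Z E] us star_append[of "take k us" "drop k us" A]
  by (intro gdI[OF Z(1)]) auto
qed

lemma gd_cutE:
 assumes "gd n X P Q us A xs b g" "1 \<le> k" "k < length us"
 obtains Z Y where "pth X (take k us) Z" "pth Z (drop k us) Y" "chain Y A xs (endo A xs)" "drop k us ~= []" "take k us ~= []"
 using assms(1)
proof (cases rule: gdE)
 case h: (gd Y E)
 have "pth X (take k us @ drop k us) Y" using h by simp
 then show ?thesis using that h assms(2,3) unfolding pth_append by auto
qed

lemma Dl_cong:
 assumes D: "gd (Suc n) X P Q us A xs b g"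
  and K: "!!us A xs b g. gd n X P Q us A xs b g ==> K us A xs b g = K' us A xs b g"
 shows "Dl X K us A xs b g = Dl X K' us A xs b g"
proof -
 have "S (drop k us) A xs (%zs. K (take k us) (star (drop k us) A) zs (cp X b (cut X (take k us) (drop k us) (endo A xs))) g) =
   S (drop k us) A xs (%zs. K' (take k us) (star (drop k us) A) zs (cp X b (cut X (take k us) (drop k us) (endo A xs))) g)"
  if "1 \<le> k" "k < length us" for k
  using D that
 proof (rule gd_cutE)
  fix Z Y assume h: "pth X (take k us) Z" "pth Z (drop k us) Y" "chain Y A xs (endo A xs)" "drop k us ~= []"
  show ?thesis by (rule S_cong[OF h(2,4,3)]) (rule K, rule gd_cut[OF D that _ _ h(1,2)])
 qed
 then show ?thesis
  unfolding Dl_def bd_explicit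
  using K[OF gd_butlast[OF D]] K[OF gd_mg[OF D]] K[OF gd_tl[OF D]] K[OF gd_fc[OF D]]
  by (auto intro!: arg_cong2[of _ _ _ _ "(+)"] sum.cong)
qed

lemma Dl_hom:
 assumes "Modules.additive h"
 shows "h (Dl X K us A xs b g) = Dl X (%us A xs b g. h (K us A xs b g)) us A xs b g"
proof -
 interpret Modules.additive h by fact
 show ?thesis unfolding Dl_def bd_explicit
  by (simp add: add zero sum additive_sg[OF assms] S_hom[OF assms] minus)
qed

text \<open>The face that merges the identity with the first arrow gives back the generator, the cut
 directly behind the identity gives \<open>Pm\<close>, and all other terms occur in both summands with opposite signs.\<close>

lemma Dl_contraction:
 fixes K :: "('m, 'a, 'h, 'w::ab_group_add) gfun"
 assumes D: "gd n X P Q us A xs b g"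
 shows "Hm X (Dl X K) us A xs b g + Dl X (Hm X K) us A xs b g = K us A xs b g - Pm X K us A xs b g"
 using D
proof (cases rule: gdE)
 case h: (gd Y E)
 define i where "i = idU X"
 define m where "m = length us"
 define q where "q = length xs"
 obtain u us' where us: "us = u # us'" using h(2) by (cases us) auto
 have u: "u \<in> ArU" "srU u = X" "pth (tgU u) us' Y" using h(1) us by auto
 have i: "i \<in> ArU" "srU i = X" "tgU i = X" using h(13) by (simp_all add: i_def idn_Ar src_idn tgt_idn)
 have A: "star us A \<in> obA X" by (rule star_obj[OF h(1) chain_obj(1)[OF h(4)]])
 have pi: "pth X (i # us) Y" using i h(1) by simp
 have coi: "co X (i # us) = co X us" using cmp_idn_right[OF co_Ar[OF h(1)]] src_co[OF h(1)] i by (simp add: i_def)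
 have loi: "lstU X (i # us) = Y" using pi by (simp add: pth_iff)
 have smi: "sm (i # us) x = sm us x" if "x \<in> arr Y" for x
  using sm_arr[OF h(1) that] h(13) by (simp add: i_def)
 define B where "B = bd (%b x. cp X b (fn (co X us) x)) (%x g. cp X (sm us x) g) Y (%b A xs g. K (i # us) A xs b g) b A xs g"
 define F where "F = (\<Sum>j<m - 1. sg (m + q + j) (K (i # fc j us) A xs b (cp X (ep j us A) g)))"
 define C where "C = (\<Sum>k\<in>{1..<m}. sg q (S (drop k us) A xs (%zs. K (i # take k us) (star (drop k us) A) zs
    (cp X b (cut X (take k us) (drop k us) E)) g)))"
 have cuti: "cut X (i # take k us) (drop k us) E = cut X (take k us) (drop k us) E" if k: "1 \<le> k" "k < m" for k
  using D k[unfolded m_def]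
 proof (rule gd_cutE)
  fix Z Y' assume z: "pth X (take k us) Z" "pth Z (drop k us) Y'"
  have p: "pth X (i # take k us) Z" using z i by simp
  moreover have "co X (i # take k us) = co X (take k us)"
   using cmp_idn_right[OF co_Ar[OF z(1)]] src_co[OF z(1)] i by (simp add: i_def)
  ultimately show ?thesis by (simp only: cut_eq[OF p] cut_eq[OF z(1)])
 qed
 have cut1: "cut X [i] us E = ida X (foA (co X us) E)"
 proof -
  have p: "pth X [i] X" using i h(13) by simp
  have c: "co X [i] = i" using i(1,3) cmp_idn_left[OF i(1)] by simp
  show ?thesis
   unfolding cut_eq[OF p] c using tws_idn_right[OF co_Ar[OF h(1)], of E] src_co[OF h(1)] tgt_co[OF h(1)] chain_obj(2)[OF h(4)]
   by (simp add: i_def)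
 qed
 have ep0: "cp X (ep 0 (i # us) A) g = g" "fc 0 (i # us) = us"
  using u tws_idn_right[OF u(1), of "star us' A"] star_obj[OF u(3) chain_obj(1)[OF h(4)]] h cmp_idn_right[OF u(1)]
  by (simp_all add: us i_def)
 have HD: "Hm X (Dl X K) us A xs b g = sg (m + q) B + (K us A xs b g - sg (m + q) F) +
   sg (m + q) (C + sg q (S us A xs (%zs. K [i] (star us A) zs b g)))"
 proof -
  have 1: "bd (%b x. cp X b (fn (co X (i # us)) x)) (%x g. cp X (sm (i # us) x) g) (lstU X (i # us)) (%b A xs g. K (i # us) A xs b g) b A xs g = B"
   unfolding B_def bd_explicit coi loi using smi chain_tl[OF h(4)] by (cases "xs = []") (auto simp del: sm_simps)
  have 2: "(\<Sum>j<length (i # us) - 1. sg (Suc (length (i # us) + length xs + j)) (K (fc j (i # us)) A xs b (cp X (ep j (i # us) A) g))) =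
    sg (m + q) (K us A xs b g) - F"
  proof -
   have m: "length us = Suc (m - 1)" using us by (simp add: m_def)
   have "cp X (ep (Suc j) (i # us) A) g = cp X (ep j us A) g" "fc (Suc j) (i # us) = i # fc j us" if "j < m - 1" for j
    using that ep_arr[OF _ h(1) chain_obj(1)[OF h(4)], of j] h(13) by (auto simp: us m_def i_def)
   then have "(\<Sum>j<m - 1. sg (Suc (length (i # us) + length xs + Suc j)) (K (fc (Suc j) (i # us)) A xs b (cp X (ep (Suc j) (i # us) A) g))) = - F"
    unfolding F_def sum_negf[symmetric] by (intro sum.cong refl) (simp add: m_def q_def)
   then show ?thesis unfolding list.size(4) m
    by (simp add: sum.lessThan_Suc_shift ep0 del: sum.lessThan_Suc fc.simps ep.simps) (simp add: m_def q_def us)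
  qed
  have 3: "(\<Sum>k\<in>{1..<length (i # us)}. sg (length xs) (S (drop k (i # us)) A xs (%zs. K (take k (i # us)) (star (drop k (i # us)) A) zs
    (cp X b (cut X (take k (i # us)) (drop k (i # us)) (endo A xs))) g))) = sg q (S us A xs (%zs. K [i] (star us A) zs b g)) + C"
  proof -
   have split: "(\<Sum>k\<in>{1..<length (i # us)}. f k) = f 1 + (\<Sum>k\<in>{1..<m}. f (Suc k))" for f :: "nat => 'w"
    using sum.atLeast_Suc_lessThan[of 1 "Suc m" f] us sum.shift_bounds_Suc_ivl[of f 1 m] by (simp add: m_def)
   show ?thesis unfolding split h(12) using cut1 h by (simp add: C_def cuti q_def)
  qed
  show ?thesis
   unfolding Hm_def Dl_def i_def[symmetric] 1 2 3 by (simp add: m_def[symmetric] q_def[symmetric] sg_add sg_diff sg_sg)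
     (simp add: sg_def)
 qed
 have DH: "Dl X (Hm X K) us A xs b g = - sg (m + q) B + sg (m + q) F - sg (m + q) C"
 proof -
  have 1: "bd (%b x. cp X b (fn (co X us) x)) (%x g. cp X (sm us x) g) (lstU X us) (%b A xs g. Hm X K us A xs b g) b A xs g = - sg (m + q) B"
  proof (cases "xs = []")
   case False
   then obtain q' where q': "q = Suc q'" by (cases xs) (auto simp: q_def)
   have "length (mg Y i xs) = q'" if "i < length xs - 1" for i using that mg_length[of i xs Y] q' by (simp add: q_def)
   then show ?thesis using False q'
    unfolding B_def bd_explicit h(11) by (simp add: Hm_def i_def[symmetric] m_def[symmetric] q_def[symmetric] sg_add sg_diff sg_sum sg_sg sum_negf add_ac)
  qed (simp add: B_def bd_explicit)
  have 2: "(\<Sum>j<length us - 1. sg (Suc (length us + length xs + j)) (Hm X K (fc j us) A xs b (cp X (ep j us A) g))) = sg (m + q) F"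
  proof -
   have "sg (Suc (m + q + j)) (sg (m - 1 + q) y) = sg (m + q) (sg (m + q + j) y)" for j and y :: 'w
    unfolding sg_sg using us by (intro sg_parity) (auto simp: m_def)
   then show ?thesis unfolding F_def sg_sum
    by (intro sum.cong) (auto simp: Hm_def fc_length i_def[symmetric] m_def q_def)
  qed
  have 3: "(\<Sum>k\<in>{1..<length us}. sg (length xs) (S (drop k us) A xs (%zs. Hm X K (take k us) (star (drop k us) A) zs
    (cp X b (cut X (take k us) (drop k us) (endo A xs))) g))) = - sg (m + q) C"
   unfolding C_def sg_sum sum_negf[symmetric]
  proof (intro sum.cong)
   fix k assume "k \<in> {1..<m}"
   then have k: "1 \<le> k" "k < length us" by (auto simp: m_def)
   show "sg (length xs) (S (drop k us) A xs (%zs. Hm X K (take k us) (star (drop k us) A) zs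
    (cp X b (cut X (take k us) (drop k us) (endo A xs))) g)) =
    - sg (m + q) (sg q (S (drop k us) A xs (%zs. K (i # take k us) (star (drop k us) A) zs
    (cp X b (cut X (take k us) (drop k us) E)) g)))"
    using D k
   proof (rule gd_cutE)
    fix Z Y' assume z: "pth Z (drop k us) Y'" "chain Y' A xs (endo A xs)" "drop k us ~= []"
    have "S (drop k us) A xs (%zs. Hm X K (take k us) (star (drop k us) A) zs (cp X b (cut X (take k us) (drop k us) (endo A xs))) g) =
     S (drop k us) A xs (%zs. - sg (m + q) (K (i # take k us) (star (drop k us) A) zs (cp X b (cut X (take k us) (drop k us) E)) g))"
    proof (rule S_cong[OF z(1,3,2)])
     fix zs :: "('a, 'h) mor list" assume "Suc (length zs) = length (drop k us) + length xs"
     then have "m + q = Suc (k + length zs)" "length (take k us) = k" using k by (auto simp: m_def q_def)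
     then have "odd (length (take k us) + length zs + (m + q))" by simp
     then show "Hm X K (take k us) (star (drop k us) A) zs (cp X b (cut X (take k us) (drop k us) (endo A xs))) g =
      - sg (m + q) (K (i # take k us) (star (drop k us) A) zs (cp X b (cut X (take k us) (drop k us) E)) g)"
      unfolding Hm_def h(12) i_def[symmetric] by (rule sg_parity_odd)
    qed
    then show ?thesis by (simp add: S_minus S_sg q_def sg_sg add.commute)
   qed
  qed (simp add: m_def)
  show ?thesis unfolding Dl_def 1 2 3 by simp
 qed
 have "sg (m + q) (sg q x) = sg m x" for x :: 'w unfolding sg_sg by (intro sg_parity) auto
 then show ?thesis unfolding HD DH Pm_def i_def[symmetric] m_def[symmetric] by (simp add: sg_add)
qed

text \<open>A path of length one has neither inner faces nor cuts.\<close>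

lemma Dl_idn:
 assumes X: "X \<in> ObU" and "chain X A xs E" "cd g = A"
 shows "Dl X K [idU X] A xs b g = BD X (%b ys g. K [idU X] (cd g) ys b g) b xs g"
proof -
 have "co X [idU X] = idU X" "lstU X [idU X] = X"
  using X by (simp_all add: tgt_idn cmp_idn_left[of "idU X", unfolded tgt_idn[OF X]] idn_Ar last_ob_def)
 then show ?thesis
  using chain_butlast[OF assms(2)] chain_tl[OF assms(2)] X assms(3)
  by (cases "xs = []") (simp_all add: Dl_def BD_def bd_explicit)
qed

text \<open>By \<open>S_boundary\<close>, once \<open>Dl\<close> on the path \<open>[1]\<close> is identified with the bar differential.\<close>

lemma Dl_Pm:
 fixes K :: "('m, 'a, 'h, 'w::ab_group_add) gfun"
 assumes D: "gd (Suc n) X P Q us A xs b g"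
 shows "Pm X (Dl X K) us A xs b g = Dl X (Pm X K) us A xs b g"
 using D
proof (cases rule: gdE)
 case h: (gd Y E)
 define i where "i = idU X"
 define m where "m = length us"
 define q where "q = length xs"
 define L where "L b ys g = K [i] (cd g) ys b g" for b ys g
 have "S us A xs (%ys. Dl X K [i] (star us A) ys b g) = S us A xs (%ys. BD X L b ys g)"
  unfolding i_def L_def
  by (rule S_cong[OF h(1,2,4)], rule Dl_idn[OF h(13)]) (use h in auto)
 also have "... = HB X Y us L b A xs g + FA X us L b A xs g + CU X us L b A xs E g"
  by (rule S_boundary[OF h(1,2,4)])
 finally have 1: "Pm X (Dl X K) us A xs b g = sg (Suc m) (HB X Y us L b A xs g) + sg (Suc m) (FA X us L b A xs g) + sg (Suc m) (CU X us L b A xs E g)"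
  by (simp only: Pm_def i_def sg_add m_def)
 have hb: "bd (%b x. cp X b (fn (co X us) x)) (%x g. cp X (sm us x) g) (lstU X us) (%b A xs g. Pm X K us A xs b g) b A xs g =
  sg (Suc m) (HB X Y us L b A xs g)"
  using h(10) chain_tl(2,3)[OF h(4)]
  by (cases "xs = []") (simp_all add: bd_explicit HB_def Pm_def L_def i_def m_def h(11) sg_add sg_sum sg_sg sum_negf add_ac)
 have fa: "(\<Sum>j<length us - 1. sg (Suc (length us + length xs + j)) (Pm X K (fc j us) A xs b (cp X (ep j us A) g))) =
  sg (Suc m) (FA X us L b A xs g)"
 proof -
  have "sg (Suc (m + q + j)) (sg (Suc (m - 1)) y) = sg (Suc m) (sg (m + q + j) y)" for j and y :: 'w
   unfolding sg_sg using h(2) by (intro sg_parity) (cases us, auto simp: m_def)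
  then show ?thesis unfolding FA_def sg_sum
   by (intro sum.cong) (auto simp: Pm_def fc_length i_def L_def m_def q_def simp del: sg_Suc)
 qed
 have cu: "(\<Sum>k\<in>{1..<length us}. sg (length xs) (S (drop k us) A xs (%zs. Pm X K (take k us) (star (drop k us) A) zs
    (cp X b (cut X (take k us) (drop k us) (endo A xs))) g))) = sg (Suc m) (CU X us L b A xs E g)"
 proof -
  have "sg q (sg (Suc k) y) = sg (Suc m) (sg (m + q + k) y)" for k and y :: 'w
   unfolding sg_sg by (intro sg_parity) auto
  moreover have "star (take k us) (star (drop k us) A) = star us A" for k
   using star_append[of "take k us" "drop k us" A] by simp
  ultimately show ?thesis unfolding CU_def sg_sum
   by (intro sum.cong) (auto simp: Pm_def DD_def i_def L_def m_def q_def h(12,10) S_sg min_def simp del: sg_Suc)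
 qed
 show ?thesis unfolding 1 Dl_def hb fa cu ..
qed

lemma Dl_Sm:
 fixes K :: "('m, 'a, 'h, 'w::ab_group_add) gfun"
 assumes D: "gd n X P Q [idU X] A xs b g"
 shows "Sm X (Dl X K) [idU X] A xs b g + Dl X (Sm X K) [idU X] A xs b g =
  K [idU X] A xs b g - (if xs = [] then K [idU X] (dm g) [] (cp X b g) (ida X (dm g)) else 0)"
 using D
proof (cases rule: gdE)
 case h: (gd Y E)
 define i where "i = idU X"
 have Y: "Y = X" using h(1) h(13) by (simp add: tgt_idn)
 have A: "cd g = A" "A \<in> obA X" "chain X A xs E" using h Y chain_obj[OF h(4)] by (auto simp: fob_idn)
 have P: "P \<in> obA X" using h(9) arrD(1)[OF h(8)] by simp
 define L where "L b ys y = K [i] P (y # ys) b (ida X P)" for b ys y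
 have "Dl X K [i] P (g # xs) b (ida X P) = BD X (%b ys g. K [i] (cd g) ys b g) b (g # xs) (ida X P)"
  unfolding i_def by (rule Dl_idn[OF h(13)]) (use h A in auto)
 also have "... = BD X L b xs g + (if xs = [] then K [i] P [] (cp X b g) (ida X P) else 0) + sg (Suc (length xs)) (K [i] A xs b g)"
  unfolding BD_Cons using h A P by (simp add: L_def[abs_def])
 finally have 1: "Sm X (Dl X K) [i] A xs b g = sg (Suc (length xs)) (BD X L b xs g) -
   (if xs = [] then K [i] P [] (cp X b g) (ida X P) else 0) + K [i] A xs b g"
  by (simp add: Sm_def i_def[symmetric] h sg_add sg_sg del: sg_Suc) (auto simp: sg_def)
 have "Dl X (Sm X K) [i] A xs b g = BD X (%b ys g. Sm X K [i] (cd g) ys b g) b xs g"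
  unfolding i_def by (rule Dl_idn[OF h(13) A(3,1)])
 also have "... = sg (length xs) (BD X L b xs g)"
 proof (cases "xs = []")
  case False
  then obtain q where q: "length xs = Suc q" by (cases xs) auto
  have "length (mg X i xs) = q" if "i < q" for i using that mg_length[of i xs X] q by simp
  then show ?thesis using False q
   by (simp add: BD_def bd_explicit Sm_def i_def[symmetric] L_def h sg_add sg_diff sg_sum sg_sg sum_negf add_ac)
 qed simp
 finally show ?thesis using 1 h by (simp add: i_def)
qed

end

section \<open>Multilinearity\<close>

context vector_space
begin

text \<open>Multilinearity is treated as the statement that a sum of values maps a relation
 \<open>z = x + c y\<close> to such a relation, which is closed under sums and signs.\<close>

lemma comb_add: "z = x + scale c y ==> z' = x' + scale c y' ==> z + z' = (x + x') + scale c (y + y')"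
 by (simp add: scale_right_distrib)

lemma comb_sg: "z = x + scale c y ==> sg n z = sg n x + scale c (sg n y)"
 by (auto simp: sg_def)

lemma comb_minus: "z = x + scale c y ==> - z = - x + scale c (- y)"
 by simp

lemma comb_sum:
 assumes "!!i. i \<in> I ==> f i = g i + scale c (h i)"
 shows "(\<Sum>i\<in>I. f i) = (\<Sum>i\<in>I. g i) + scale c (\<Sum>i\<in>I. h i)"
 using assms by (simp add: scale_sum_right sum.distrib)

lemmas comb_rules = comb_add comb_sg comb_minus comb_sum

lemma additive_scale: "Modules.additive (scale c)"
 by (simp add: Modules.additive_def scale_right_distrib)

end

context prestack
begin

sublocale hv: vector_space "scA"
 by (rule vsA)

text \<open>\<open>lc U c x y z\<close> means \<open>z = x + c y\<close> for parallel arrows; \<open>lcl\<close> is the same in one entry of a list and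
 \<open>lcd\<close> in one slot of the data of a generator.  A function is multilinear if it maps such triples to
 such triples.\<close>

definition lc :: "'u => 'k => ('a, 'h) mor => ('a, 'h) mor => ('a, 'h) mor => bool" where
 "lc U c x y z \<longleftrightarrow> x \<in> arr U & y \<in> arr U & dm y = dm x & cd y = cd x &
   z = (dm x, cd x, hm x + scA c (hm y))"

fun lcl :: "'u => 'k => ('a, 'h) mor list => ('a, 'h) mor list => ('a, 'h) mor list => bool" where
 "lcl U c (x # xs) (y # ys) (z # zs) \<longleftrightarrow>
   lc U c x y z & ys = xs & zs = xs | y = x & z = x & lcl U c xs ys zs"
| "lcl U c _ _ _ \<longleftrightarrow> False"

lemma lc_typ:
 assumes "lc U c x y z" "U \<in> ObU"
 shows "x \<in> arr U" "y \<in> arr U" "z \<in> arr U" "dm y = dm x" "dm z = dm x" "cd y = cd x" "cd z = cd x"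
proof -
 show "z \<in> arr U"
  using assms hom_subspace[of U "dm x" "cd x"] hv.subspace_add hv.subspace_scale
  by (auto simp: lc_def arr_def)
qed (use assms in \<open>auto simp: lc_def\<close>)

lemma lc_cp_left:
 assumes "lc U c x y z" "U \<in> ObU" "f \<in> arr U" "dm f = cd x"
 shows "lc U c (cp U f x) (cp U f y) (cp U f z)"
 using assms cp_arr[OF assms(2) _ assms(3)]
  lin_combination[OF ccmp_linear_right[of U "dm x" "cd x" "cd f" "hm f"] vsA hom_subspace, of "hm x" "hm y" c]
 by (auto simp: lc_def cp_def arr_def)

lemma lc_cp_right:
 assumes "lc U c x y z" "U \<in> ObU" "f \<in> arr U" "cd f = dm x"
 shows "lc U c (cp U x f) (cp U y f) (cp U z f)"
 using assms cp_arr[OF assms(2,3)]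
  lin_combination[OF ccmp_linear_left[of U "dm f" "cd f" "cd x" "hm f"] vsA hom_subspace, of "hm x" "hm y" c]
 by (auto simp: lc_def cp_def arr_def)

lemma lc_fn:
 assumes "lc (tgU u) c x y z" "u \<in> ArU"
 shows "lc (srU u) c (fn u x) (fn u y) (fn u z)"
 using assms fn_arr[OF assms(2)] tgt_Ob[OF assms(2)]
  lin_combination[OF fmor_linear[OF assms(2), of "dm x" "cd x"] vsA hom_subspace, of "hm x" "hm y" c]
 by (auto simp: lc_def fn_def arr_def)

lemma lc_sm: "pth X us Y ==> lc Y c x y z ==> lc X c (sm us x) (sm us y) (sm us z)"
 by (induction us arbitrary: X) (auto intro: lc_fn)

lemma lc_fn_co: "pth X us Y ==> lc Y c x y z ==> lc X c (fn (co X us) x) (fn (co X us) y) (fn (co X us) z)"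
 using lc_fn[of "co X us" c x y z] by (simp add: src_co tgt_co co_Ar)

lemma lcl_length: "lcl U c xs ys zs ==> length ys = length xs & length zs = length xs"
 by (induction U c xs ys zs rule: lcl.induct) auto

lemma lcl_chain: "lcl U c xs ys zs ==> U \<in> ObU ==> chain U A xs E ==> chain U A ys E & chain U A zs E"
 by (induction U c xs ys zs arbitrary: A rule: lcl.induct) (auto dest: lc_typ)

lemma lcl_hd:
 assumes "lcl U c xs ys zs" "U \<in> ObU"
 shows "cd (hd ys) = cd (hd xs)" "cd (hd zs) = cd (hd xs)"
  "lc U c (hd xs) (hd ys) (hd zs) & tl ys = tl xs & tl zs = tl xs |
   hd ys = hd xs & hd zs = hd xs & lcl U c (tl xs) (tl ys) (tl zs)"
 using assms by (cases "(U, c, xs, ys, zs)" rule: lcl.cases; auto dest: lc_typ)+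

lemma lcl_last:
 assumes "lcl U c xs ys zs"
 shows "lc U c (last xs) (last ys) (last zs) & butlast ys = butlast xs & butlast zs = butlast xs |
   last ys = last xs & last zs = last xs & lcl U c (butlast xs) (butlast ys) (butlast zs)"
 using assms
proof (induction U c xs ys zs rule: lcl.induct)
 case (1 U c x xs y ys z zs)
 then show ?case using lcl_length[of U c xs ys zs] by (cases "xs = []") auto
qed auto

lemma lcl_mg:
 "lcl U c xs ys zs ==> U \<in> ObU ==> chain U A xs E ==> Suc i < length xs ==>
  lcl U c (mg U i xs) (mg U i ys) (mg U i zs)"
proof (induction U i xs arbitrary: ys zs A rule: mg.induct)
 case (1 U x y xs)
 obtain x' y' xs' where ys: "ys = x' # y' # xs'" using lcl_length[OF 1(1)] by (auto simp: length_Suc_conv)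
 obtain x'' y'' xs'' where zs: "zs = x'' # y'' # xs''" using lcl_length[OF 1(1)] by (auto simp: length_Suc_conv)
 show ?case using 1 unfolding ys zs by (auto intro: lc_cp_left lc_cp_right)
next
 case (2 U i x xs)
 obtain x' xs' where ys: "ys = x' # xs'" using lcl_length[OF 2(2)] by (auto simp: length_Suc_conv)
 obtain x'' xs'' where zs: "zs = x'' # xs''" using lcl_length[OF 2(2)] by (auto simp: length_Suc_conv)
 show ?case using 2 unfolding ys zs by auto
qed auto

lemma S_combination:
 fixes sw :: "'k => 'w => 'w::ab_group_add"
 assumes sw: "vector_space sw"
  and "pth X us Y" "us ~= []" "chain Y A xs E" "lcl Y c xs xs' xs''"
  and "!!ys ys' ys''. chain X (star us A) ys (foA (co X us) E) ==> Suc (length ys) = length us + length xs ==>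
   lcl X c ys ys' ys'' ==> K ys'' = K ys + sw c (K ys')"
 shows "S us A xs'' K = S us A xs K + sw c (S us A xs' K)"
 using assms(2-)
proof (induction us A xs K arbitrary: xs' xs'' rule: S.induct)
 case (1 us A xs K)
 interpret ws: vector_space sw by (rule sw)
 note us = 1(3,4) and ch = 1(5) and l = 1(6) and K = 1(7)
 have e: "S (fc j us) A xs'' (%ys. K (ep j us A # ys)) =
   S (fc j us) A xs (%ys. K (ep j us A # ys)) + sw c (S (fc j us) A xs' (%ys. K (ep j us A # ys)))"
  if j: "j < length us - 1" for j
 proof -
  have j': "Suc j < length us" using j by simp
  note ln = fc_length[OF j']
  show ?thesis
  proof (rule 1(1))
   show "j \<in> {j. Suc j < length us}" using j' by simp
   show "pth X (fc j us) Y" by (rule fc_pth[OF j' us(1)])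
   show "fc j us ~= []" using ln j by auto
   show "chain Y A xs E" "lcl Y c xs xs' xs''" by fact+
   show "K (ep j us A # ys'') = K (ep j us A # ys) + sw c (K (ep j us A # ys'))"
    if "chain X (star (fc j us) A) ys (foA (co X (fc j us)) E)"
     "Suc (length ys) = length (fc j us) + length xs" "lcl X c ys ys' ys''" for ys ys' ys''
    using that fc_co[OF j' us(1)] ln j' ep_arr[OF j' us(1) chain_obj(1)[OF ch]] by (intro K) auto
  qed
 qed
 obtain x x1 where xs: "xs = x # x1" using l by (cases xs) auto
 obtain x' x1' where xs': "xs' = x' # x1'" using l xs by (cases xs') auto
 obtain x'' x1'' where xs'': "xs'' = x'' # x1''" using l xs xs' by (cases xs'') auto
 have Y: "Y \<in> ObU" using pth_Ob us by blast
 have x: "x \<in> arr Y" "dm x = A" "chain Y (cd x) x1 E" using ch xs by auto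
 have "S us (cd x'') x1'' (%ys. K (sm us x'' # ys)) =
  S us (cd x) x1 (%ys. K (sm us x # ys)) + sw c (S us (cd x') x1' (%ys. K (sm us x' # ys)))"
  using l unfolding xs xs' xs'' lcl.simps
 proof
  assume h: "lc Y c x x' x'' & x1' = x1 & x1'' = x1"
  have t: "cd x' = cd x" "cd x'' = cd x" using lc_typ[of Y c x x' x''] h Y by auto
  have "S us (cd x) x1 (%ys. K (sm us x'' # ys)) = S us (cd x) x1 (%ys. K (sm us x # ys) + sw c (K (sm us x' # ys)))"
  proof (rule S_cong[OF us x(3)])
   fix ys
   assume "chain X (star us (cd x)) ys (foA (co X us) E)" "Suc (length ys) = length us + length x1"
   then show "K (sm us x'' # ys) = K (sm us x # ys) + sw c (K (sm us x' # ys))"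
    using lc_sm[OF us(1), of c x x' x''] h x sm_arr[OF us(1)] by (intro K) (auto simp: xs)
  qed
  then show ?thesis unfolding t using h by (simp add: S_add S_hom[OF ws.additive_scale])
 next
  assume h: "x' = x & x'' = x & lcl Y c x1 x1' x1''"
  have "S us (cd x) x1'' (%ys. K (sm us x # ys)) =
   S us (cd x) x1 (%ys. K (sm us x # ys)) + sw c (S us (cd x) x1' (%ys. K (sm us x # ys)))"
   by (rule 1(2)[OF xs us x(3)]) (use h x sm_arr[OF us(1) x(1)] in \<open>auto intro!: K simp: xs\<close>)
  then show ?thesis using h by simp
 qed
 then show ?case
  unfolding xs xs' xs'' S_expand[of us A "x'' # x1''" K] S_expand[of us A "x # x1" K]
   S_expand[of us A "x' # x1'" K] list.case
  using e unfolding xs xs' xs'' by (intro ws.comb_rules) auto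
qed

definition lcd where
 "lcd X Y c xs b g xs' b' g' xs'' b'' g'' \<longleftrightarrow>
   lcl Y c xs xs' xs'' & b' = b & b'' = b & g' = g & g'' = g |
   xs' = xs & xs'' = xs & lc X c b b' b'' & g' = g & g'' = g |
   xs' = xs & xs'' = xs & b' = b & b'' = b & lc X c g g' g''"

definition mlK where
 "mlK n X P Q sw K \<longleftrightarrow> (\<forall>us A xs b g xs' b' g' xs'' b'' g'' c. gd n X P Q us A xs b g -->
   lcd X (lstU X us) c xs b g xs' b' g' xs'' b'' g'' -->
   K us A xs'' b'' g'' = K us A xs b g + sw c (K us A xs' b' g'))"

lemma mlKD:
 assumes "mlK n X P Q sw K" "gd n X P Q us A xs b g" "pth X us Y" "lcd X Y c xs b g xs' b' g' xs'' b'' g''"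
 shows "K us A xs'' b'' g'' = K us A xs b g + sw c (K us A xs' b' g')"
 using assms unfolding mlK_def pth_iff by blast

lemma lcd_length: "lcd X Y c xs b g xs' b' g' xs'' b'' g'' ==> length xs' = length xs & length xs'' = length xs"
 by (auto simp: lcd_def dest: lcl_length)

lemma lcd_gd:
 assumes "gd n X P Q us A xs b g" "pth X us Y" "lcd X Y c xs b g xs' b' g' xs'' b'' g''"
 shows "gd n X P Q us A xs' b' g'" "gd n X P Q us A xs'' b'' g''"
  "endo A xs' = endo A xs" "endo A xs'' = endo A xs"
proof -
 obtain E where h: "us ~= []" "length us + length xs = Suc n" "chain Y A xs E"
  "b \<in> arr X" "dm b = foA (co X us) E" "cd b = Q" "g \<in> arr X" "dm g = P" "cd g = star us A"
  using assms(1,2) by (auto simp: gd_def pth_iff)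
 have O: "X \<in> ObU" "Y \<in> ObU" using pth_Ob[OF assms(2)] by auto
 have "chain Y A xs' E & chain Y A xs'' E & b' \<in> arr X & b'' \<in> arr X & g' \<in> arr X & g'' \<in> arr X &
  dm b' = dm b & dm b'' = dm b & cd b' = cd b & cd b'' = cd b &
  dm g' = dm g & dm g'' = dm g & cd g' = cd g & cd g'' = cd g"
  using assms(3) h O lcl_chain[of Y c xs xs' xs'' A E] lc_typ[of X c] unfolding lcd_def by metis
 then show "gd n X P Q us A xs' b' g'" "gd n X P Q us A xs'' b'' g''"
  "endo A xs' = endo A xs" "endo A xs'' = endo A xs"
  using h lcd_length[OF assms(3)] chain_endo by (auto intro!: gdI[OF assms(2)])
qed

text \<open>Changing one slot of \<open>(xs, b, g)\<close> changes one slot in each term of the path-shuffle sum.\<close>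

lemma S_lcd:
 fixes sw :: "'k => 'w => 'w::ab_group_add"
 assumes sw: "vector_space sw" and p: "pth Z R Y" "R ~= []" "chain Y A xs E" and L: "lcd X Y c xs b g xs' b' g' xs'' b'' g''"
  and F: "!!zs zs' zs''. chain Z (star R A) zs (foA (co Z R) E) ==> Suc (length zs) = length R + length xs ==>
   lcd X Z c zs b g zs' b' g' zs'' b'' g'' ==> F b'' g'' zs'' = F b g zs + sw c (F b' g' zs')"
 shows "S R A xs'' (F b'' g'') = S R A xs (F b g) + sw c (S R A xs' (F b' g'))"
proof (cases "lcl Y c xs xs' xs'' & b' = b & b'' = b & g' = g & g'' = g")
 case True
 then have l: "lcl Y c xs xs' xs''" "b' = b" "b'' = b" "g' = g" "g'' = g" by auto
 show ?thesis unfolding l(2-) by (rule S_combination[OF sw p l(1)]) (use F l in \<open>auto simp: lcd_def\<close>)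
next
 case False
 interpret ws: vector_space sw by (rule sw)
 have l: "xs' = xs" "xs'' = xs" "lcd X Z c zs b g zs b' g' zs b'' g''" for zs using L False by (auto simp: lcd_def)
 have "S R A xs (F b'' g'') = S R A xs (%zs. F b g zs + sw c (F b' g' zs))" by (rule S_cong[OF p]) (rule F[OF _ _ l(3)])
 then show ?thesis unfolding l(1,2) by (simp add: S_add S_hom[OF ws.additive_scale])
qed

lemma mlK_Dl:
 fixes sw :: "'k => 'w => 'w::ab_group_add"
 assumes sw: "vector_space sw" and K: "mlK n X P Q sw K"
 shows "mlK (Suc n) X P Q sw (Dl X K)"
 unfolding mlK_def
proof (intro allI impI)
 fix us A xs b g xs' b' g' xs'' b'' g'' c
 assume D: "gd (Suc n) X P Q us A xs b g" and L0: "lcd X (lstU X us) c xs b g xs' b' g' xs'' b'' g''"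
 interpret ws: vector_space sw by (rule sw)
 show "Dl X K us A xs'' b'' g'' = Dl X K us A xs b g + sw c (Dl X K us A xs' b' g')"
  using D
 proof (cases rule: gdE)
  case h: (gd Y E)
  have L: "lcd X Y c xs b g xs' b' g' xs'' b'' g''" using L0 h by simp
  have len: "length xs' = length xs" "length xs'' = length xs" using lcd_length[OF L] by auto
  note M = mlKD[OF K]
  have en: "endo A xs' = E" "endo A xs'' = E" using lcd_gd(3,4)[OF D h(1) L] h(12) by auto
  have fnl: "fn (co X us) (last xs) \<in> arr X" if "xs ~= []"
   using chain_butlast[OF h(4) that] fn_arr[of "co X us" "last xs"] by (simp add: co_Ar[OF h(1)] src_co[OF h(1)] tgt_co[OF h(1)])
  have 1: "K us A (butlast xs'') (cp X b'' (fn (co X us) (last xs''))) g'' =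
   K us A (butlast xs) (cp X b (fn (co X us) (last xs))) g + sw c (K us A (butlast xs') (cp X b' (fn (co X us) (last xs'))) g')"
   if ne: "xs ~= []"
  proof (rule M[OF gd_butlast[OF D ne] h(1)])
   note cb = chain_butlast[OF h(4) ne]
   show "lcd X Y c (butlast xs) (cp X b (fn (co X us) (last xs))) g (butlast xs') (cp X b' (fn (co X us) (last xs'))) g'
     (butlast xs'') (cp X b'' (fn (co X us) (last xs''))) g''"
    using L unfolding lcd_def
    using lcl_last[of Y c xs xs' xs''] lc_cp_left[OF lc_fn_co[OF h(1)] h(13,5), of c "last xs" "last xs'" "last xs''"]
     lc_cp_right[OF _ h(13) fnl[OF ne], of c b b' b''] h cb
    by auto
  qed
  have 2: "K us A (mg Y i xs'') b'' g'' = K us A (mg Y i xs) b g + sw c (K us A (mg Y i xs') b' g')"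
   if i: "i < length xs - 1" for i
  proof (rule M[OF gd_mg[OF D, of i, unfolded h(11)] h(1)])
   show "Suc i < length xs" using i by simp
   then show "lcd X Y c (mg Y i xs) b g (mg Y i xs') b' g' (mg Y i xs'') b'' g''"
    using L lcl_mg[OF _ h(14,4), of c xs' xs'' i] unfolding lcd_def by auto
  qed
  have 3: "K us (cd (hd xs'')) (tl xs'') b'' (cp X (sm us (hd xs'')) g'') =
    K us (cd (hd xs)) (tl xs) b (cp X (sm us (hd xs)) g) + sw c (K us (cd (hd xs')) (tl xs') b' (cp X (sm us (hd xs')) g'))"
   if ne: "xs ~= []"
  proof -
   note ct = chain_tl[OF h(4) ne]
   have "cd (hd xs') = cd (hd xs) & cd (hd xs'') = cd (hd xs)"
    using L lcl_hd(1,2)[OF _ h(14)] unfolding lcd_def by metis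
   moreover have "K us (cd (hd xs)) (tl xs'') b'' (cp X (sm us (hd xs'')) g'') =
    K us (cd (hd xs)) (tl xs) b (cp X (sm us (hd xs)) g) + sw c (K us (cd (hd xs)) (tl xs') b' (cp X (sm us (hd xs')) g'))"
   proof (rule M[OF gd_tl[OF D ne] h(1)])
    show "lcd X Y c (tl xs) b (cp X (sm us (hd xs)) g) (tl xs') b' (cp X (sm us (hd xs')) g') (tl xs'') b'' (cp X (sm us (hd xs'')) g'')"
     using L unfolding lcd_def
     using lcl_hd(3)[OF _ h(14), of c xs xs' xs''] lc_cp_right[OF lc_sm[OF h(1)] h(13,8), of c "hd xs" "hd xs'" "hd xs''"]
      lc_cp_left[OF _ h(13) sm_arr[OF h(1) ct(2)], of c g g' g''] h ct
     by auto
   qed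
   ultimately show ?thesis by simp
  qed
  have 4: "K (fc j us) A xs'' b'' (cp X (ep j us A) g'') = K (fc j us) A xs b (cp X (ep j us A) g) + sw c (K (fc j us) A xs' b' (cp X (ep j us A) g'))"
   if "j < length us - 1" for j
  proof -
   have j: "Suc j < length us" using that by simp
   show ?thesis
   proof (rule M[OF gd_fc[OF D j] fc_pth[OF j h(1)]])
    show "lcd X Y c xs b (cp X (ep j us A) g) xs' b' (cp X (ep j us A) g') xs'' b'' (cp X (ep j us A) g'')"
     using L lc_cp_left[OF _ h(13) ep_arr[OF j h(1) chain_obj(1)[OF h(4)]], of c g g' g''] h j unfolding lcd_def by auto
   qed
  qed
  have 5: "S (drop k us) A xs'' (%zs. K (take k us) (star (drop k us) A) zs (cp X b'' (cut X (take k us) (drop k us) (endo A xs''))) g'') =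
    S (drop k us) A xs (%zs. K (take k us) (star (drop k us) A) zs (cp X b (cut X (take k us) (drop k us) (endo A xs))) g) +
    sw c (S (drop k us) A xs' (%zs. K (take k us) (star (drop k us) A) zs (cp X b' (cut X (take k us) (drop k us) (endo A xs'))) g'))"
   (is "?L = _") if "k \<in> {1..<length us}" for k
  proof -
   have k: "1 \<le> k" "k < length us" using that by auto
   obtain Z Y' where z: "pth X (take k us) Z" "pth Z (drop k us) Y'" "chain Y' A xs (endo A xs)" "drop k us ~= []" "take k us ~= []"
    using D k by (rule gd_cutE)
   have "Y' = Y" using h(1) z(1,2) append_take_drop_id[of k us] pth_append[of X "take k us" "drop k us" Y'] pth_iff[of X us Y'] h(11) by auto
   note z = z[unfolded this]
   have ca: "cut X (take k us) (drop k us) E \<in> arr X" "cd (cut X (take k us) (drop k us) E) = dm b"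
    using cut_arr[OF z(1,2) chain_obj(2)[OF h(4)]] h by auto
   note G = gd_cut[OF D k _ _ z(1,2), unfolded h(12)]
   define F where "F b g zs = K (take k us) (star (drop k us) A) zs (cp X b (cut X (take k us) (drop k us) E)) g" for b g zs
   have "S (drop k us) A xs'' (F b'' g'') = S (drop k us) A xs (F b g) + sw c (S (drop k us) A xs' (F b' g'))"
   proof (rule S_lcd[where F = F, OF sw z(2,4) z(3)[unfolded h(12)] L])
    fix zs zs' zs'' assume zs: "chain Z (star (drop k us) A) zs (foA (co Z (drop k us)) E)" "Suc (length zs) = length (drop k us) + length xs"
     and l: "lcd X Z c zs b g zs' b' g' zs'' b'' g''"
    show "F b'' g'' zs'' = F b g zs + sw c (F b' g' zs')"
     unfolding F_def
     by (rule M[OF G[OF zs] z(1)]) (use l lc_cp_right[OF _ h(13) ca(1), of c b b' b''] ca in \<open>auto simp: lcd_def\<close>)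
   qed
   then show ?thesis unfolding en h(12) F_def .
  qed
  have 0: "xs = [] \<longleftrightarrow> xs'' = []" "xs = [] \<longleftrightarrow> xs' = []" using len by auto
  let ?bd = "bd (%b x. cp X b (fn (co X us) x)) (%x g. cp X (sm us x) g) Y (%b A xs g. K us A xs b g)"
  have bdl: "?bd b'' A xs'' g'' =
    ?bd b A xs g +
    sw c (?bd b' A xs' g')"
  proof (cases "xs = []")
   case False
   then have f: "xs'' ~= []" "xs' ~= []" using 0 by auto
   show ?thesis
    unfolding bd_explicit if_not_P[OF False] if_not_P[OF f(1)] if_not_P[OF f(2)] len
    by (intro ws.comb_rules 1 2 3) (use False in auto)
  qed (use 0 in \<open>simp add: bd_explicit\<close>)
  show ?thesis
   unfolding Dl_def h(11) len by (intro ws.comb_rules bdl 4 5) auto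
 qed
qed

lemma mlK_Pm:
 fixes sw :: "'k => 'w => 'w::ab_group_add"
 assumes sw: "vector_space sw" and K: "mlK n X P Q sw K"
 shows "mlK n X P Q sw (Pm X K)"
 unfolding mlK_def
proof (intro allI impI)
 fix us A xs b g xs' b' g' xs'' b'' g'' c
 assume D: "gd n X P Q us A xs b g" and L0: "lcd X (lstU X us) c xs b g xs' b' g' xs'' b'' g''"
 interpret ws: vector_space sw by (rule sw)
 show "Pm X K us A xs'' b'' g'' = Pm X K us A xs b g + sw c (Pm X K us A xs' b' g')"
  using D
 proof (cases rule: gdE)
  case h: (gd Y E)
  note i = idn_Ar[OF h(13)] src_idn[OF h(13)] tgt_idn[OF h(13)]
  have p: "pth X [idU X] X" using i h by simp
  have coi: "co X [idU X] = idU X" using cmp_idn_left[OF i(1)] i by simp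
  define F where "F b g ys = K [idU X] (star us A) ys b g" for b g ys
  have "S us A xs'' (F b'' g'') = S us A xs (F b g) + sw c (S us A xs' (F b' g'))"
  proof (rule S_lcd[where F = F, OF sw h(1,2,4) L0[unfolded h(11)]])
   fix zs zs' zs'' assume zs: "chain X (star us A) zs (foA (co X us) E)" "Suc (length zs) = length us + length xs"
    and l: "lcd X X c zs b g zs' b' g' zs'' b'' g''"
   have "gd n X P Q [idU X] (star us A) zs b g"
    using h zs chain_obj[OF zs(1)] by (intro gdI[OF p]) (auto simp: coi fob_idn simp del: composite.simps)
   from mlKD[OF K this p l] show "F b'' g'' zs'' = F b g zs + sw c (F b' g' zs')" unfolding F_def .
  qed
  then show ?thesis unfolding Pm_def F_def[symmetric] by (rule ws.comb_sg)
 qed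
qed

lemma gd_idn_Cons:
 assumes "gd n X P Q us A xs b g"
 shows "gd (Suc n) X P Q (idU X # us) A xs b g"
 using assms
proof (cases rule: gdE)
 case h: (gd Y E)
 note i = idn_Ar[OF h(13)] src_idn[OF h(13)] tgt_idn[OF h(13)]
 have c: "cmU (co X us) (idU X) = co X us"
  using cmp_idn_right[OF co_Ar[OF h(1)]] src_co[OF h(1)] by simp
 show ?thesis
  by (rule gdI[of _ _ Y _ _ _ E]) (use h i c fob_idn[OF h(13) star_obj[OF h(1) chain_obj(1)[OF h(4)]]] in auto)
qed

lemma mlK_Hm:
 fixes sw :: "'k => 'w => 'w::ab_group_add"
 assumes sw: "vector_space sw" and K: "mlK (Suc n) X P Q sw K"
 shows "mlK n X P Q sw (Hm X K)"
 unfolding mlK_def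
proof (intro allI impI)
 fix us A xs b g xs' b' g' xs'' b'' g'' c
 assume D: "gd n X P Q us A xs b g" and L0: "lcd X (lstU X us) c xs b g xs' b' g' xs'' b'' g''"
 interpret ws: vector_space sw by (rule sw)
 obtain Y where Y: "pth X us Y" "lstU X us = Y" "X \<in> ObU" using D by (rule gdE)
 have p: "pth X (idU X # us) Y" using Y by (simp add: idn_Ar src_idn tgt_idn)
 have "length xs' = length xs" "length xs'' = length xs" using lcd_length[OF L0] by auto
 then show "Hm X K us A xs'' b'' g'' = Hm X K us A xs b g + sw c (Hm X K us A xs' b' g')"
  unfolding Hm_def
  using mlKD[OF K gd_idn_Cons[OF D] p L0[unfolded Y(2)]] ws.comb_sg by metis
qed

lemma gd_Sm:
 assumes "gd n X P Q [idU X] A xs b g"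
 shows "gd (Suc n) X P Q [idU X] (dm g) (g # xs) b (ida X (dm g))"
 using assms
proof (cases rule: gdE)
 case h: (gd Y E)
 have Y: "Y = X" using h(1,13) by (simp add: tgt_idn)
 show ?thesis using h chain_obj[OF h(4)] arrD[OF h(8)]
  by (intro gdI[OF h(1)]) (auto simp: Y fob_idn)
qed

lemma mlK_Sm:
 fixes sw :: "'k => 'w => 'w::ab_group_add"
 assumes sw: "vector_space sw" and K: "mlK (Suc n) X P Q sw K"
 shows "mlK n X P Q sw (Sm X K)"
 unfolding mlK_def
proof (intro allI impI)
 fix us A xs b g xs' b' g' xs'' b'' g'' c
 assume D: "gd n X P Q us A xs b g" and L0: "lcd X (lstU X us) c xs b g xs' b' g' xs'' b'' g''"
 interpret ws: vector_space sw by (rule sw)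
 show "Sm X K us A xs'' b'' g'' = Sm X K us A xs b g + sw c (Sm X K us A xs' b' g')"
 proof (cases "us = [idU X]")
  case True
  obtain Y where Y: "pth X us Y" "lstU X us = Y" "X \<in> ObU" using D by (rule gdE)
  have YX: "Y = X" using Y True by (simp add: tgt_idn)
  have t: "dm g' = dm g" "dm g'' = dm g"
   using L0 lc_typ[OF _ Y(3)] unfolding lcd_def by metis+
  have L: "lcd X X c (g # xs) b (ida X (dm g)) (g' # xs') b' (ida X (dm g)) (g'' # xs'') b'' (ida X (dm g))"
   using L0 unfolding lcd_def Y(2) YX by auto
  have "length xs' = length xs" "length xs'' = length xs" using lcd_length[OF L0] by auto
  then show ?thesis
   unfolding Sm_def True t
   using mlKD[OF K gd_Sm[OF D[unfolded True]] Y(1)[unfolded True YX] L] ws.comb_sg by simp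
 qed (simp add: Sm_def)
qed

end

section \<open>The free bimodules\<close>

lemma (in vector_space) span_eqI:
 assumes "vector_space sw" "linear_from scale sw (span G) f" "linear_from scale sw (span G) h"
  and "!!x. x \<in> G ==> f x = h x" "x \<in> span G"
 shows "f x = h x"
proof -
 have "x \<in> span G & f x = h x"
  using assms(5)
 proof (induction rule: span_induct_alt)
  case base
  show ?case
   using lin_0[OF assms(2) vector_space_axioms subspace_span] lin_0[OF assms(3) vector_space_axioms subspace_span]
   by (simp add: span_zero)
 next
  case (step c x y)
  have "x \<in> span G" by (rule span_base[OF step(1)])
  then show ?case
   using step assms(4) linear_fromD[OF assms(2)] linear_fromD[OF assms(3)] span_scale[of x G c]
   by (simp add: span_add)
 qed
 then show ?thesis by simp
qed

lemma lin_subset: "linear_from s s' X f ==> Y \<subseteq> X ==> linear_from s s' Y f"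
 unfolding linear_from_def by blast

lemma lin_cong: "(!!x. x \<in> X ==> f x = g x) ==> vector_space s ==> module.subspace s X ==>
  linear_from s s' X f \<longleftrightarrow> linear_from s s' X g"
 using subspaceD(2)[of s X] subspaceD(3)[of s X] by (auto simp: linear_from_def)

lemma lin_linear: "Vector_Spaces.linear s s' f ==> linear_from s s' X f"
 by (auto simp: linear_from_def Vector_Spaces.linear_iff)

lemma lin_comp:
 "linear_from s s' X f ==> (!!x. x \<in> X ==> f x \<in> Y) ==> linear_from s' s'' Y g ==> linear_from s s'' X (%x. g (f x))"
 by (simp add: linear_from_def)

lemma lin_id: "linear_from s s X (%x. x)"
 by (simp add: linear_from_def)

lemma lin_add:
 "vector_space s' ==> linear_from s s' X f ==> linear_from s s' X g ==> linear_from s s' X (%x. f x + g x)"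
proof -
 assume v: "vector_space s'" and h: "linear_from s s' X f" "linear_from s s' X g"
 interpret vector_space s' by (rule v)
 show ?thesis using h by (simp add: linear_from_def scale_right_distrib)
qed

lemma lin_scale:
 "vector_space s' ==> linear_from s s' X f ==> linear_from s s' X (%x. s' c (f x))"
proof -
 assume v: "vector_space s'" and h: "linear_from s s' X f"
 interpret vector_space s' by (rule v)
 show ?thesis using h by (simp add: linear_from_def scale_right_distrib scale_left_commute)
qed

lemma lin_zero: "vector_space s' ==> linear_from s s' X (%x. 0)"
 by (simp add: linear_from_def module.scale_zero_right vector_space_def module_def)

lemma lin_uminus:
 assumes "vector_space s'" "linear_from s s' X f"
 shows "linear_from s s' X (%x. - f x)"
proof -
 interpret vector_space s' by fact
 show ?thesis using lin_scale[OF assms, of "- 1"] by simp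
qed

lemma lin_minus2:
 "vector_space s' ==> linear_from s s' X f ==> linear_from s s' X g ==> linear_from s s' X (%x. f x - g x)"
 using lin_add[of s' s X f "%x. - g x"] lin_uminus[of s' s X g] by simp

locale prestack_universe = prestack \<U> \<A>
 for \<U> :: "('u, 'm) cat" and \<A> :: "('k::field, 'u, 'm, 'a, 'h::ab_group_add) prestack_data" +
 fixes s :: "'k => 'v => 'v::ab_group_add" and e :: "('u + 'm + 'a + 'h) list => 'v"
 assumes vsS: "vector_space s"
  and inj_e: "inj e"
  and independent_e: "~ module.dependent s (range e)"
begin

sublocale vs: vector_space s
 by (rule vsS)

text \<open>The independent family provided by the universe is reindexed by the discrete data \<open>(us, As)\<close> of a generator
 and the words that stand for tensors.\<close>

definition enc :: "('m list * 'a list) * 'h list => 'v" where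
 "enc = (%((us, As), hs). e (map (Inr \<circ> Inl) us @ map (Inr \<circ> Inr \<circ> Inl) As @ map (Inr \<circ> Inr \<circ> Inr) hs))"

lemma inj_enc: "inj enc"
proof (rule injI)
 fix x y assume xy: "enc x = enc y"
 obtain us As hs us' As' hs' where x: "x = ((us, As), hs)" "y = ((us', As'), hs')" by (metis surj_pair)
 define w :: "'m list => 'a list => 'h list => ('u + 'm + 'a + 'h) list" where "w us As hs = map (Inr \<circ> Inl) us @ map (Inr \<circ> Inr \<circ> Inl) As @ map (Inr \<circ> Inr \<circ> Inr) hs"
  for us As hs
 have w: "w us As hs = w us' As' hs'"
  using xy inj_e unfolding x enc_def w_def by (auto dest: injD)
 define f1 where "f1 z = (case z of Inr (Inl u) => [u] | _ => [])" for z :: "'u + 'm + 'a + 'h"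
 define f2 where "f2 z = (case z of Inr (Inr (Inl u)) => [u] | _ => [])" for z :: "'u + 'm + 'a + 'h"
 define f3 where "f3 z = (case z of Inr (Inr (Inr u)) => [u] | _ => [])" for z :: "'u + 'm + 'a + 'h"
 have id: "concat (map (%u. [u]) l) = l" "concat (map (%u. []) l') = ([] :: 'z list)" for l :: "'y list" and l' :: "'x list"
  by (induction l) simp_all
 have "concat (map f1 (w us As hs)) = us" "concat (map f2 (w us As hs)) = As" "concat (map f3 (w us As hs)) = hs" for us As hs
  by (simp_all add: w_def f1_def f2_def f3_def o_def id)
 then show "x = y" using w unfolding x by metis
qed

sublocale ts: tensor_space s "scA" enc
proof
 show "inj enc" by (rule inj_enc)
 have "range enc \<subseteq> range e" by (auto simp: enc_def)
 then show "vs.independent (range enc)" using independent_e vs.dependent_mono by blast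
qed

definition gen :: "'m list => 'a => ('a, 'h) mor list => ('a, 'h) mor => ('a, 'h) mor => 'v" where
 "gen us A xs b g = ts.ten (us, A # map cd xs) (hm b # hm g # map hm xs)"

lemma lcl_hm:
 assumes "lcl U c xs ys zs"
 shows "\<exists>l x y r. map hm xs = l @ x # r & map hm ys = l @ y # r & map hm zs = l @ (x + scA c y) # r"
  and "map cd ys = map cd xs & map cd zs = map cd xs"
 using assms
proof (induction U c xs ys zs rule: lcl.induct)
 case (1 U c x xs y ys z zs)
 { case 1
  show ?case
  proof (cases "lc U c x y z & ys = xs & zs = xs")
   case True
   then show ?thesis by (intro exI[of _ "[]"] exI[of _ "hm x"] exI[of _ "hm y"] exI[of _ "map hm xs"]) (auto simp: lc_def)
  next
   case False
   then have h: "y = x" "z = x" "lcl U c xs ys zs" using 1 by auto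
   obtain l a b r where lr: "map hm xs = l @ a # r" "map hm ys = l @ b # r" "map hm zs = l @ (a + scA c b) # r"
    using "1.IH"(1)[OF h(3)] by blast
   show ?thesis
    by (rule exI[of _ "hm x # l"], rule exI[of _ a], rule exI[of _ b], rule exI[of _ r]) (simp add: h lr)
  qed }
 { case 2 then show ?case using "1.IH"(2) by (auto simp: lc_def) }
qed auto

lemma mlK_gen: "mlK n X P Q s gen"
 unfolding mlK_def
proof (intro allI impI)
 fix us A xs b g xs' b' g' xs'' b'' g'' c
 assume "lcd X (lstU X us) c xs b g xs' b' g' xs'' b'' g''"
 then show "gen us A xs'' b'' g'' = gen us A xs b g + s c (gen us A xs' b' g')"
  unfolding lcd_def
 proof (elim disjE conjE)
  assume h: "lcl (lstU X us) c xs xs' xs''" "b' = b" "b'' = b" "g' = g" "g'' = g"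
  obtain l x y r where "map hm xs = l @ x # r" "map hm xs' = l @ y # r" "map hm xs'' = l @ (x + scA c y) # r"
   using lcl_hm(1)[OF h(1)] by blast
  then show ?thesis
   using lcl_hm(2)[OF h(1)] h ts.ten_combination[of "(us, A # map cd xs)" "hm b # hm g # l" x c y r]
   by (simp add: gen_def)
 next
  assume h: "xs' = xs" "xs'' = xs" "lc X c b b' b''" "g' = g" "g'' = g"
  then show ?thesis using ts.ten_combination[of "(us, A # map cd xs)" "[]" "hm b" c "hm b'"]
   by (auto simp: gen_def lc_def)
 next
  assume h: "xs' = xs" "xs'' = xs" "lc X c g g' g''" "b' = b" "b'' = b"
  then show ?thesis using ts.ten_combination[of "(us, A # map cd xs)" "[hm b]" "hm g" c "hm g'"]
   by (auto simp: gen_def lc_def)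
 qed
qed

fun mkx :: "'a list => 'h list => ('a, 'h) mor list" where
 "mkx (A # B # As) (h # hs) = (A, B, h) # mkx (B # As) hs"
| "mkx _ _ = []"

fun homs :: "'u => 'a list => 'h set list" where
 "homs Y (A # B # As) = hom \<A> Y A B # homs Y (B # As)"
| "homs Y _ = []"

lemma chain_mkx:
 "list_all2 (\<in>) hs (homs Y As) ==> set As \<subseteq> obA Y ==> As ~= [] ==>
  chain Y (hd As) (mkx As hs) (last As) & length (mkx As hs) = length As - 1"
proof (induction As hs rule: mkx.induct)
 case ("2_1" hs) then show ?case by simp
next
 case ("2_2" A hs) then show ?case by simp
next
 case ("2_3" As) then show ?case by (cases As; cases "tl As") auto
qed (auto simp: arr_iff)

lemma lcl_mkx:
 "list_all2 (\<in>) (l @ x # r) (homs Y As) ==> list_all2 (\<in>) (l @ y # r) (homs Y As) ==> set As \<subseteq> obA Y ==>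
  lcl Y c (mkx As (l @ x # r)) (mkx As (l @ y # r)) (mkx As (l @ (x + scA c y) # r))"
proof (induction Y As arbitrary: l rule: homs.induct)
 case (1 Y A B As)
 show ?case
 proof (cases l)
  case Nil then show ?thesis using 1 by (auto simp: lc_def arr_iff)
 next
  case (Cons z l') then show ?thesis using 1 by auto
 qed
qed auto

lemma mkx_chain:
 "chain Y A xs E ==> mkx (A # map cd xs) (map hm xs) = xs & list_all2 (\<in>) (map hm xs) (homs Y (A # map cd xs)) &
  last (A # map cd xs) = E & set (A # map cd xs) \<subseteq> obA Y"
 by (induction xs arbitrary: A) (auto simp: arr_def)

lemma homs_subspace: "Y \<in> ObU ==> set As \<subseteq> obA Y ==> H \<in> set (homs Y As) ==> module.subspace scA H"
 by (induction Y As rule: homs.induct) (auto simp: hom_subspace)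

text \<open>The tensors with discrete data ranging over valid simplices form a direct sum of tensor products of
 the morphism spaces, so a function that is multilinear on valid data extends to a linear map.\<close>

lemma gen_universal:
 fixes sw :: "'k => 'w => 'w::ab_group_add"
 assumes sw: "vector_space sw" and K: "mlK n X P Q sw K"
 shows "\<exists>\<Phi>. Vector_Spaces.linear s sw \<Phi> & (\<forall>us A xs b g. gd n X P Q us A xs b g --> \<Phi> (gen us A xs b g) = K us A xs b g)"
proof -
 define I where "I = {(us, As). us ~= [] & As ~= [] & pth X us (lstU X us) & set As \<subseteq> obA (lstU X us) &
   length us + length As = Suc (Suc n) & P \<in> obA X & Q \<in> obA X}"
 define Hs where "Hs = (%(us, As). hom \<A> X (foA (co X us) (last As)) Q # hom \<A> X P (star us (hd As)) # homs (lstU X us) As)"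
 define B where "B us As h = (foA (co X us) (last As), Q, h)" for us As and h :: 'h
 define G where "G us As h = (P, star us (hd As), h)" for us As and h :: 'h
 define \<phi> where "\<phi> = (%(us, As) hs. K us (hd As) (mkx As (drop 2 hs)) (B us As (hs ! 0)) (G us As (hs ! 1)))"
 have gdd: "gd n X P Q us (hd As) (mkx As hs) (B us As h1) (G us As h2)"
  if "(us, As) \<in> I" "list_all2 (\<in>) (h1 # h2 # hs) (Hs (us, As))" for us As h1 h2 hs
 proof -
  let ?Y = "lstU X us"
  have i: "us ~= []" "As ~= []" "pth X us ?Y" "set As \<subseteq> obA ?Y" "length us + length As = Suc (Suc n)" "P \<in> obA X" "Q \<in> obA X"
   using that(1) by (auto simp: I_def)
  have c: "chain ?Y (hd As) (mkx As hs) (last As)" "length (mkx As hs) = length As - 1"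
   using chain_mkx[of hs ?Y As] that(2) i by (auto simp: Hs_def)
  have o: "foA (co X us) (last As) \<in> obA X" "star us (hd As) \<in> obA X"
   using fob_obj[OF co_Ar[OF i(3)], of "last As"] star_obj[OF i(3), of "hd As"] chain_obj[OF c(1)]
   by (simp_all add: src_co[OF i(3)] tgt_co[OF i(3)])
  have "length As \<ge> 1" using i(2) by (cases As) auto
  then show ?thesis using i c o that(2) by (intro gdI[OF i(3,1) _ c(1)]) (auto simp: B_def G_def arr_iff Hs_def)
 qed
 obtain \<Phi> where \<Phi>: "Vector_Spaces.linear s sw \<Phi>" "!!i hs. i \<in> I ==> list_all2 (\<in>) hs (Hs i) ==> \<Phi> (ts.ten i hs) = \<phi> i hs"
 proof (rule ts.ten_universal[OF sw, of I Hs \<phi>])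
  fix i H assume i: "i \<in> I" "H \<in> set (Hs i)"
  obtain us As where ii: "i = (us, As)" by (cases i)
  let ?Y = "lstU X us"
  have h: "us ~= []" "As ~= []" "pth X us ?Y" "set As \<subseteq> obA ?Y" "P \<in> obA X" "Q \<in> obA X"
   using i by (auto simp: I_def ii)
  have la: "last As \<in> obA ?Y" "hd As \<in> obA ?Y" using h(2,4) by auto
  have o: "foA (co X us) (last As) \<in> obA X" "star us (hd As) \<in> obA X"
   using fob_obj[OF co_Ar[OF h(3)], of "last As"] star_obj[OF h(3) la(2)] la
   by (simp_all add: src_co[OF h(3)] tgt_co[OF h(3)])
  show "module.subspace scA H"
   using i(2) h o pth_Ob[OF h(3)] homs_subspace[of ?Y As H] hom_subspace[of X] by (auto simp: Hs_def ii)
 next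
  fix i xs x y c ys
  assume i: "i \<in> I" "list_all2 (\<in>) (xs @ x # ys) (Hs i)" "list_all2 (\<in>) (xs @ y # ys) (Hs i)"
  obtain us As where ii: "i = (us, As)" by (cases i)
  let ?Y = "lstU X us"
  have h: "pth X us ?Y" "set As \<subseteq> obA ?Y" "X \<in> ObU" using i(1) pth_Ob by (auto simp: I_def ii)
  consider "xs = []" | h1 where "xs = [h1]" | h1 h2 zs where "xs = h1 # h2 # zs" by (metis neq_Nil_conv)
  then show "\<phi> i (xs @ (x + scA c y) # ys) = \<phi> i (xs @ x # ys) + sw c (\<phi> i (xs @ y # ys))"
  proof cases
   case 1
   obtain h2 zs where ys: "ys = h2 # zs" using i(2) by (cases ys) (auto simp: 1 ii Hs_def)
   have g: "gd n X P Q us (hd As) (mkx As zs) (B us As x) (G us As h2)" "gd n X P Q us (hd As) (mkx As zs) (B us As y) (G us As h2)"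
    using gdd i unfolding ii 1 ys by auto
   have "lc X c (B us As x) (B us As y) (B us As (x + scA c y))"
    using g by (auto simp: lc_def B_def gd_def)
   then show ?thesis using mlKD[OF K g(1) h(1)] unfolding ii 1 ys \<phi>_def lcd_def by simp
  next
   case (2 h1)
   have g: "gd n X P Q us (hd As) (mkx As ys) (B us As h1) (G us As x)" "gd n X P Q us (hd As) (mkx As ys) (B us As h1) (G us As y)"
    using gdd i unfolding ii 2 by auto
   have "lc X c (G us As x) (G us As y) (G us As (x + scA c y))"
    using g by (auto simp: lc_def G_def gd_def)
   then show ?thesis using mlKD[OF K g(1) h(1)] unfolding ii 2 \<phi>_def lcd_def by simp
  next
   case (3 h1 h2 zs)
   have g: "gd n X P Q us (hd As) (mkx As (zs @ x # ys)) (B us As h1) (G us As h2)"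
    using gdd i unfolding ii 3 by auto
   have "lcl ?Y c (mkx As (zs @ x # ys)) (mkx As (zs @ y # ys)) (mkx As (zs @ (x + scA c y) # ys))"
    using i(2,3) h by (intro lcl_mkx) (auto simp: ii 3 Hs_def)
   then show ?thesis using mlKD[OF K g h(1)] unfolding ii 3 \<phi>_def lcd_def by simp
  qed
 qed auto
 have "\<Phi> (gen us A xs b g) = K us A xs b g" if "gd n X P Q us A xs b g" for us A xs b g
  using that
 proof (cases rule: gdE)
  case h: (gd Y E)
  note m = mkx_chain[OF h(4)]
  have 1: "(us, A # map cd xs) \<in> I" using h m arrD(1)[OF h(8)] arrD(2)[OF h(5)] by (auto simp: I_def)
  have 2: "list_all2 (\<in>) (hm b # hm g # map hm xs) (Hs (us, A # map cd xs))"
   using h m arrD(3)[OF h(5)] arrD(3)[OF h(8)] by (auto simp: Hs_def)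
  have "B us (A # map cd xs) (hm b) = b" "G us (A # map cd xs) (hm g) = g"
   using h m by (auto simp: B_def G_def prod_eq_iff)
  then show ?thesis unfolding gen_def \<Phi>(2)[OF 1 2] using m by (simp add: \<phi>_def)
 qed
 then show ?thesis using \<Phi>(1) by blast
qed

definition Bgens :: "nat => 'u => 'a => 'a => 'v set" where
 "Bgens n X P Q = {gen us A xs b g | us A xs b g. gd n X P Q us A xs b g}"

definition Bc :: "nat => 'u => 'a => 'a => 'v set" where
 "Bc n X P Q = vs.span (Bgens n X P Q)"

lemma Bc_subspace: "vs.subspace (Bc n X P Q)"
 unfolding Bc_def by (rule vs.subspace_span)

lemma gen_Bc: "gd n X P Q us A xs b g ==> gen us A xs b g \<in> Bc n X P Q"
 unfolding Bc_def Bgens_def by (rule vs.span_base) blast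

lemma Bc_eqI:
 assumes "vector_space sw" "linear_from s sw (Bc n X P Q) f" "linear_from s sw (Bc n X P Q) h"
  and "!!us A xs b g. gd n X P Q us A xs b g ==> f (gen us A xs b g) = h (gen us A xs b g)" "x \<in> Bc n X P Q"
 shows "f x = h x"
 by (rule vs.span_eqI[OF assms(1) assms(2,3)[unfolded Bc_def] _ assms(5)[unfolded Bc_def]])
  (use assms(4) in \<open>auto simp: Bgens_def\<close>)

lemma Bc_memI:
 assumes "vector_space sw" "module.subspace sw W" "linear_from s sw (Bc n X P Q) f"
  and "!!us A xs b g. gd n X P Q us A xs b g ==> f (gen us A xs b g) \<in> W" "x \<in> Bc n X P Q"
 shows "f x \<in> W"
proof -
 have "x \<in> Bc n X P Q & f x \<in> W"
  using assms(5) unfolding Bc_def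
 proof (induction rule: vs.span_induct_alt)
  case base
  show ?case using lin_0[OF assms(3) vsS Bc_subspace] subspaceD(1)[OF assms(1,2)]
   by (simp add: vs.span_zero)
 next
  case (step c x y)
  have x: "x \<in> Bc n X P Q" unfolding Bc_def by (rule vs.span_base[OF step(1)])
  have "f x \<in> W" using step(1) assms(4) by (auto simp: Bgens_def)
  moreover have "f (s c x + y) = sw c (f x) + f y"
   using linear_fromD[OF assms(3)] x step(2) vs.subspace_scale[OF Bc_subspace x] by (simp add: Bc_def)
  ultimately show ?case
   using step subspaceD(2,3)[OF assms(1,2)] x by (simp add: Bc_def vs.span_add vs.span_scale)
 qed
 then show ?thesis by simp
qed

text \<open>The extension to the whole space is not unique, but its values on generators are; keeping it linear
 on the whole space spares subspace conditions later on.\<close>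

definition lex where
 "lex n X P Q sw K = (SOME \<Phi>. Vector_Spaces.linear s sw \<Phi> &
   (\<forall>us A xs b g. gd n X P Q us A xs b g --> \<Phi> (gen us A xs b g) = K us A xs b g))"

lemma lex:
 assumes "vector_space sw" "mlK n X P Q sw K"
 shows lex_linear: "linear_from s sw Z (lex n X P Q sw K)"
  and lex_gen: "gd n X P Q us A xs b g ==> lex n X P Q sw K (gen us A xs b g) = K us A xs b g"
 using someI_ex[OF gen_universal[OF assms]] lin_linear unfolding lex_def by blast+

lemma lex_mem:
 assumes "vector_space sw" "mlK n X P Q sw K" "module.subspace sw W"
  and "!!us A xs b g. gd n X P Q us A xs b g ==> K us A xs b g \<in> W" "x \<in> Bc n X P Q"
 shows "lex n X P Q sw K x \<in> W"
 by (rule Bc_memI[OF assms(1,3) lex_linear[OF assms(1,2)] _ assms(5)]) (simp add: lex_gen[OF assms(1,2)] assms(4))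

end

subsection \<open>Actions on generators\<close>

context prestack
begin

lemma twi_idn_right: "u \<in> ArU ==> A \<in> obA (tgU u) ==> twi u (idU (srU u)) A = ida (srU u) (foA u A)"
 using twi[of u "idU (srU u)" A] src_Ob[of u] fob_obj[of u A]
 by (simp add: idn_Ar src_idn tgt_idn cmp_idn_right fob_idn)

text \<open>From the coherence of the twists, as both sides are inverse to the same composite of twists.\<close>

lemma twi_coherence:
 assumes "t \<in> ArU" "u \<in> ArU" "v \<in> ArU" "srU t = tgU u" "srU u = tgU v" "A \<in> obA (tgU t)"
 shows "cp (srU v) (tws u v (foA t A)) (cp (srU v) (fn v (twi t u A)) (twi (cmU t u) v A)) = twi t (cmU u v) A"
proof -
 let ?V = "srU v" and ?c = "cp (srU v)"
 have V: "?V \<in> ObU" using src_Ob[OF assms(3)] .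
 have tu: "cmU t u \<in> ArU" "srU (cmU t u) = tgU v" "tgU (cmU t u) = tgU t"
  and uv: "cmU u v \<in> ArU" "srU (cmU u v) = ?V" "tgU (cmU u v) = tgU u"
  using assms by (simp_all add: cmp_Ar src_cmp tgt_cmp)
 note a1 = twi[OF assms(1,2,4,6)]
 note a2 = twi[OF tu(1) assms(3) tu(2), unfolded tu(3), OF assms(6)]
 note a3 = twi[OF assms(1) uv(1) assms(4)[folded uv(3)] assms(6), unfolded uv(2)]
 note w1 = tws_arr[OF assms(1,2,4,6)]
 note w2 = tws_arr[OF tu(1) assms(3) tu(2), unfolded tu(3), OF assms(6)]
 note w3 = tws_arr[OF assms(1) uv(1) assms(4)[folded uv(3)] assms(6), unfolded uv(2)]
 have At: "foA t A \<in> obA (tgU u)" using fob_obj[OF assms(1,6)] assms(4) by simp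
 note w4 = tws_arr[OF assms(2,3,5) At]
 have f1: "fn v (twi t u A) \<in> arr ?V" "fn v (tws t u A) \<in> arr ?V"
  using fn_arr[OF assms(3)] a1(1) w1 assms(5) by auto
 have ass: "cmU t (cmU u v) = cmU (cmU t u) v" using cmp_assoc[OF assms(1-5)] by simp
 define L where "L = ?c (tws u v (foA t A)) (?c (fn v (twi t u A)) (twi (cmU t u) v A))"
 have i1: "?c (fn v (twi t u A)) (twi (cmU t u) v A) \<in> arr ?V" using V f1 a1 a2 by simp
 have L: "L \<in> arr ?V" "dm L = foA (cmU t (cmU u v)) A" "cd L = foA (cmU u v) (foA t A)"
  unfolding L_def using V i1 w4 a1 a2 f1 by (simp_all add: ass)
 have "?c (tws t (cmU u v) A) L = ?c (?c (tws t (cmU u v) A) (tws u v (foA t A))) (?c (fn v (twi t u A)) (twi (cmU t u) v A))"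
  unfolding L_def using V i1 w3 w4 a1 by (intro cp_assoc[symmetric]) auto
 also have "?c (tws t (cmU u v) A) (tws u v (foA t A)) = ?c (tws (cmU t u) v A) (fn v (tws t u A))"
  by (rule tws_coherence[OF assms])
 also have "?c ... (?c (fn v (twi t u A)) (twi (cmU t u) v A)) =
   ?c (tws (cmU t u) v A) (?c (fn v (tws t u A)) (?c (fn v (twi t u A)) (twi (cmU t u) v A)))"
  using V i1 w2 f1 a1 by (intro cp_assoc) auto
 also have "?c (fn v (tws t u A)) (?c (fn v (twi t u A)) (twi (cmU t u) v A)) =
   ?c (?c (fn v (tws t u A)) (fn v (twi t u A))) (twi (cmU t u) v A)"
  using V f1 a1 a2 by (intro cp_assoc[symmetric]) auto
 also have "?c (fn v (tws t u A)) (fn v (twi t u A)) = fn v (cp (srU u) (tws t u A) (twi t u A))"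
  unfolding assms(5) using a1 w1 assms(3,5) by (intro fn_cp[symmetric]) auto
 also have "... = ida ?V (foA v (foA (cmU t u) A))"
  using a1(5) fn_ida[OF assms(3), of "foA (cmU t u) A"] fob_obj[OF tu(1), of A] tu assms(5,6) by simp
 finally have e: "?c (tws t (cmU u v) A) L = ida ?V (foA (cmU t (cmU u v)) A)"
  using a2 V by (simp add: ass)
 have "L = ?c (?c (twi t (cmU u v) A) (tws t (cmU u v) A)) L" using a3 V L by simp
 also have "... = ?c (twi t (cmU u v) A) (?c (tws t (cmU u v) A) L)"
  using V L w3 a3 by (intro cp_assoc) auto
 finally have "L = ?c (twi t (cmU u v) A) (?c (tws t (cmU u v) A) L)" .
 then have "L = twi t (cmU u v) A" unfolding e using a3 V by simp
 then show ?thesis by (simp only: L_def)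
qed

text \<open>Restriction of a generator along \<open>u\<close> composes \<open>u\<close> with the first arrow of the path.  The resulting
 change of \<open>us\<^sup>*\<close> and \<open>us\<^sup>\<star>\<close> is absorbed into \<open>b\<close> and \<open>g\<close> by a twist; for \<open>b\<close> it is the inverse twist.\<close>

definition rs :: "'m => 'm list => 'm list" where
 "rs u us = cmU (hd us) u # tl us"

definition rb :: "'m => 'm list => 'a => ('a, 'h) mor list => ('a, 'h) mor => ('a, 'h) mor" where
 "rb u us A xs b = cp (srU u) (fn u b) (twi (co (tgU u) us) u (endo A xs))"

definition rg :: "'m => 'm list => 'a => ('a, 'h) mor => ('a, 'h) mor" where
 "rg u us A g = cp (srU u) (tws (hd us) u (star (tl us) A)) (fn u g)"

lemma rs:
 assumes "pth (tgU u) us Y" "us ~= []" "u \<in> ArU"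
 shows rs_pth: "pth (srU u) (rs u us) Y" and rs_co: "co (srU u) (rs u us) = cmU (co (tgU u) us) u"
  and rs_ne: "rs u us ~= []" and rs_length: "length (rs u us) = length us"
proof -
 obtain t ts where us: "us = t # ts" using assms(2) by (cases us) auto
 have t: "t \<in> ArU" "srU t = tgU u" "pth (tgU t) ts Y" using assms by (auto simp: us)
 show "pth (srU u) (rs u us) Y" "rs u us ~= []" "length (rs u us) = length us"
  using t assms(3) by (auto simp: rs_def us cmp_Ar src_cmp tgt_cmp)
 show "co (srU u) (rs u us) = cmU (co (tgU u) us) u"
  using t assms(3) cmp_assoc[OF co_Ar[OF t(3)] t(1) assms(3)] src_co[OF t(3)] by (auto simp: rs_def us tgt_cmp)
qed

lemma rg_typ:
 assumes "pth (tgU u) us Y" "us ~= []" "u \<in> ArU" "A \<in> obA Y" "g \<in> arr (tgU u)" "cd g = star us A"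
 shows "rg u us A g \<in> arr (srU u)" "dm (rg u us A g) = foA u (dm g)" "cd (rg u us A g) = star (rs u us) A"
  "tws (hd us) u (star (tl us) A) \<in> arr (srU u)" "dm (tws (hd us) u (star (tl us) A)) = cd (fn u g)"
proof -
 obtain t ts where us: "us = t # ts" using assms(2) by (cases us) auto
 have t: "t \<in> ArU" "srU t = tgU u" "pth (tgU t) ts Y" using assms by (auto simp: us)
 have w: "tws t u (star ts A) \<in> arr (srU u)" using t assms star_obj[OF t(3) assms(4)] by (intro tws_arr) auto
 have f: "fn u g \<in> arr (srU u)" using assms by simp
 show "rg u us A g \<in> arr (srU u)" "dm (rg u us A g) = foA u (dm g)" "cd (rg u us A g) = star (rs u us) A"
  "tws (hd us) u (star (tl us) A) \<in> arr (srU u)" "dm (tws (hd us) u (star (tl us) A)) = cd (fn u g)"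
  using w f assms src_Ob[OF assms(3)] by (simp_all add: rg_def us rs_def)
qed

lemma rb_typ:
 assumes "pth (tgU u) us Y" "u \<in> ArU" "chain Y A xs E" "b \<in> arr (tgU u)" "dm b = foA (co (tgU u) us) E"
 shows "rb u us A xs b \<in> arr (srU u)" "dm (rb u us A xs b) = foA (cmU (co (tgU u) us) u) E" "cd (rb u us A xs b) = foA u (cd b)"
  "twi (co (tgU u) us) u E \<in> arr (srU u)" "cd (twi (co (tgU u) us) u E) = dm (fn u b)"
proof -
 have E: "endo A xs = E" "E \<in> obA Y" using chain_endo[OF assms(3)] chain_obj[OF assms(3)] by auto
 note w = twi[OF co_Ar[OF assms(1)] assms(2) src_co[OF assms(1)], unfolded tgt_co[OF assms(1)], OF E(2)]
 show "rb u us A xs b \<in> arr (srU u)" "dm (rb u us A xs b) = foA (cmU (co (tgU u) us) u) E" "cd (rb u us A xs b) = foA u (cd b)"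
  "twi (co (tgU u) us) u E \<in> arr (srU u)" "cd (twi (co (tgU u) us) u E) = dm (fn u b)"
  using w assms src_Ob[OF assms(2)] by (simp_all add: rb_def E)
qed

lemma gd_res:
 assumes "gd n (tgU u) P Q us A xs b g" "u \<in> ArU"
 shows "gd n (srU u) (foA u P) (foA u Q) (rs u us) A xs (rb u us A xs b) (rg u us A g)"
 using assms(1)
proof (cases rule: gdE)
 case h: (gd Y E)
 note r = rs[OF h(1,2) assms(2)] and rb = rb_typ[OF h(1) assms(2) h(4,5,6)]
  and rg = rg_typ[OF h(1,2) assms(2) chain_obj(1)[OF h(4)] h(8,10)]
 show ?thesis by (rule gdI[OF r(1,3) _ h(4)]) (use h r rb rg in auto)
qed

lemma gd_lact:
 assumes "gd n X P Q us A xs b g" "b' \<in> arr X" "dm b' = Q"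
 shows "gd n X P (cd b') us A xs (cp X b' b) g"
 using assms by (elim gdE, intro gdI) auto

lemma gd_ract:
 assumes "gd n X P Q us A xs b g" "g' \<in> arr X" "cd g' = P"
 shows "gd n X (dm g') Q us A xs b (cp X g g')"
 using assms by (elim gdE, intro gdI) auto

lemma mlK_lact:
 assumes "mlK n X P (cd b') sw K" "b' \<in> arr X" "dm b' = Q"
 shows "mlK n X P Q sw (%us A xs b g. K us A xs (cp X b' b) g)"
 unfolding mlK_def
proof (intro allI impI)
 fix us A xs b g xs' b1 g' xs'' b2 g'' c
 assume D: "gd n X P Q us A xs b g" and L: "lcd X (lstU X us) c xs b g xs' b1 g' xs'' b2 g''"
 show "K us A xs'' (cp X b' b2) g'' = K us A xs (cp X b' b) g + sw c (K us A xs' (cp X b' b1) g')"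
  using D
 proof (cases rule: gdE)
  case h: (gd Y E)
  show ?thesis
   by (rule mlKD[OF assms(1) gd_lact[OF D assms(2,3)] h(1)])
    (use L lc_cp_left[OF _ h(13) assms(2), of c b b1 b2] assms h in \<open>auto simp: lcd_def\<close>)
 qed
qed

lemma mlK_ract:
 assumes "mlK n X (dm a) Q sw K" "a \<in> arr X" "cd a = P"
 shows "mlK n X P Q sw (%us A xs b g. K us A xs b (cp X g a))"
 unfolding mlK_def
proof (intro allI impI)
 fix us A xs b g xs' b1 g' xs'' b2 g'' c
 assume D: "gd n X P Q us A xs b g" and L: "lcd X (lstU X us) c xs b g xs' b1 g' xs'' b2 g''"
 show "K us A xs'' b2 (cp X g'' a) = K us A xs b (cp X g a) + sw c (K us A xs' b1 (cp X g' a))"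
  using D
 proof (cases rule: gdE)
  case h: (gd Y E)
  show ?thesis
   by (rule mlKD[OF assms(1) gd_ract[OF D assms(2,3)] h(1)])
    (use L lc_cp_right[OF _ h(13) assms(2), of c g g' g''] assms h in \<open>auto simp: lcd_def\<close>)
 qed
qed

lemma mlK_res:
 assumes "mlK n (srU u) (foA u P) (foA u Q) sw K" "u \<in> ArU"
 shows "mlK n (tgU u) P Q sw (%us A xs b g. K (rs u us) A xs (rb u us A xs b) (rg u us A g))"
 unfolding mlK_def
proof (intro allI impI)
 fix us A xs b g xs' b' g' xs'' b'' g'' c
 assume D: "gd n (tgU u) P Q us A xs b g" and L: "lcd (tgU u) (lstU (tgU u) us) c xs b g xs' b' g' xs'' b'' g''"
 show "K (rs u us) A xs'' (rb u us A xs'' b'') (rg u us A g'') =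
  K (rs u us) A xs (rb u us A xs b) (rg u us A g) + sw c (K (rs u us) A xs' (rb u us A xs' b') (rg u us A g'))"
  using D
 proof (cases rule: gdE)
  case h: (gd Y E)
  note r = rs[OF h(1,2) assms(2)] and rb = rb_typ[OF h(1) assms(2) h(4,5,6)]
   and rg = rg_typ[OF h(1,2) assms(2) chain_obj(1)[OF h(4)] h(8,10)]
  have en: "endo A xs' = E" "endo A xs'' = E" using lcd_gd(3,4)[OF D h(1) L[unfolded h(11)]] h(12) by auto
  show ?thesis
  proof (rule mlKD[OF assms(1) gd_res[OF D assms(2)] r(1)])
   show "lcd (srU u) Y c xs (rb u us A xs b) (rg u us A g) xs' (rb u us A xs' b') (rg u us A g') xs'' (rb u us A xs'' b'') (rg u us A g'')"
    using L lc_cp_right[OF lc_fn[OF _ assms(2)] src_Ob[OF assms(2)] rb(4,5), of c b' b'']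
     lc_cp_left[OF lc_fn[OF _ assms(2)] src_Ob[OF assms(2)] rg(4,5), of c g' g'']
    unfolding lcd_def h(11) rb_def rg_def en h(12) by metis
  qed
 qed
qed

lemma res_idn_gen:
 assumes "gd n X P Q us A xs b g"
 shows "rs (idU X) us = us" "rb (idU X) us A xs b = b" "rg (idU X) us A g = g"
proof -
 obtain Y E where h: "pth X us Y" "us ~= []" "chain Y A xs E" "b \<in> arr X" "dm b = foA (co X us) E" "g \<in> arr X" "cd g = star us A"
   "endo A xs = E" "X \<in> ObU"
  using assms by (rule gdE)
 obtain t ts where us: "us = t # ts" using h(2) by (cases us) auto
 have t: "t \<in> ArU" "srU t = X" "pth (tgU t) ts Y" using h by (auto simp: us)
 have A: "star ts A \<in> obA (tgU t)" "E \<in> obA Y" using star_obj[OF t(3)] chain_obj[OF h(3)] by auto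
 show "rs (idU X) us = us" using cmp_idn_right[OF t(1)] t by (simp add: rs_def us)
 have "twi (co X us) (idU X) E = ida X (foA (co X us) E)"
  using twi_idn_right[OF co_Ar[OF h(1)], of E] A by (simp add: src_co[OF h(1)] tgt_co[OF h(1)])
 then show "rb (idU X) us A xs b = b" using h by (simp add: rb_def src_idn tgt_idn)
 show "rg (idU X) us A g = g" using h tws_idn_right[OF t(1) A(1)] t by (simp add: rg_def src_idn tgt_idn us)
qed

lemma rb_lact:
 assumes "gd n (tgU u) P Q us A xs b g" "u \<in> ArU" "b' \<in> arr (tgU u)" "dm b' = Q"
 shows "rb u us A xs (cp (tgU u) b' b) = cp (srU u) (fn u b') (rb u us A xs b)"
 using assms(1)
proof (cases rule: gdE)
 case h: (gd Y E)
 note rb = rb_typ[OF h(1) assms(2) h(4,5,6)]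
 show ?thesis unfolding rb_def fn_cp[OF assms(2) h(5) assms(3) h(7)[folded assms(4)]]
  using rb h assms src_Ob[OF assms(2)] by (intro cp_assoc) auto
qed

lemma rg_ract:
 assumes "gd n (tgU u) P Q us A xs b g" "u \<in> ArU" "a \<in> arr (tgU u)" "cd a = P"
 shows "rg u us A (cp (tgU u) g a) = cp (srU u) (rg u us A g) (fn u a)"
 using assms(1)
proof (cases rule: gdE)
 case h: (gd Y E)
 note rg = rg_typ[OF h(1,2) assms(2) chain_obj(1)[OF h(4)] h(8,10)]
 show ?thesis unfolding rg_def fn_cp[OF assms(2,3) h(8) assms(4)[folded h(9)]]
  using rg h assms src_Ob[OF assms(2)] by (intro cp_assoc[symmetric]) auto
qed

lemma res_cmp_gen:
 assumes D: "gd n (tgU u) P Q us A xs b g" and u: "u \<in> ArU" "v \<in> ArU" "srU u = tgU v"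
 shows "rs (cmU u v) us = rs v (rs u us)"
  and "rb (cmU u v) us A xs b = cp (srU v) (tws u v Q) (rb v (rs u us) A xs (rb u us A xs b))"
  and "cp (srU v) (rg (cmU u v) us A g) (tws u v P) = rg v (rs u us) A (rg u us A g)"
proof -
 obtain Y E where h: "pth (tgU u) us Y" "us ~= []" "chain Y A xs E"
  "b \<in> arr (tgU u)" "dm b = foA (co (tgU u) us) E" "cd b = Q" "endo A xs = E"
  "g \<in> arr (tgU u)" "dm g = P" "cd g = star us A"
  using D by (rule gdE)
 obtain t ts where us: "us = t # ts" using h(2) by (cases us) auto
 have t: "t \<in> ArU" "srU t = tgU u" "pth (tgU t) ts Y" using h by (auto simp: us)
 have A: "star ts A \<in> obA (tgU t)" "E \<in> obA Y" using star_obj[OF t(3)] chain_obj[OF h(3)] by auto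
 have V: "srU v \<in> ObU" using src_Ob u by auto
 have uv: "cmU u v \<in> ArU" "srU (cmU u v) = srU v" "tgU (cmU u v) = tgU u"
  using u by (simp_all add: cmp_Ar src_cmp tgt_cmp)
 show "rs (cmU u v) us = rs v (rs u us)"
  using cmp_assoc[OF t(1) u(1,2) t(2) u(3)] by (simp add: rs_def us)
 note r = rs[OF h(1,2) u(1)] and rb = rb_typ[OF h(1) u(1) h(3-5)]
  and rg = rg_typ[OF h(1,2) u(1) chain_obj(1)[OF h(3)] h(8,10)]
 define T where "T = co (tgU u) us"
 have T: "T \<in> ArU" "srU T = tgU u" "tgU T = Y" using co_Ar[OF h(1)] src_co[OF h(1)] tgt_co[OF h(1)] by (simp_all add: T_def)
 let ?c = "cp (srU v)"
 have tuE: "twi T u E \<in> arr (tgU v)" "dm (twi T u E) = foA (cmU T u) E" "cd (twi T u E) = foA u (foA T E)"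
  using twi[OF T(1) u(1) T(2), of E] A T u by auto
 have Tu: "cmU T u \<in> ArU" "srU (cmU T u) = tgU v" "tgU (cmU T u) = Y"
  using T u by (simp_all add: cmp_Ar src_cmp tgt_cmp)
 note a2 = twi[OF Tu(1) u(2) Tu(2), of E, unfolded Tu(3), OF A(2)]
 have fvub: "fn v (fn u b) \<in> arr (srU v)" using h(4) u by (intro fn_arr) (auto simp: u(3)[symmetric])
 have ftu: "fn v (twi T u E) \<in> arr (srU v)" using tuE u by simp
 have wQ: "tws u v Q \<in> arr (srU v)" using arrD(2)[OF h(4)] h(6) u by (intro tws_arr) auto
 have TE: "foA T E \<in> obA (tgU u)" using arrD(1)[OF h(4)] h(5) T_def by simp
 have wT: "tws u v (foA T E) \<in> arr (srU v)" using TE u by (intro tws_arr) auto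
 have fuv: "fn (cmU u v) b \<in> arr (srU v)" using fn_arr[OF uv(1), of b] h(4) uv by simp
 have "rb v (rs u us) A xs (rb u us A xs b) = ?c (fn v (cp (srU u) (fn u b) (twi T u E))) (twi (cmU T u) v E)"
  unfolding rb_def[of v] u(3)[symmetric] rs_co[OF h(1,2) u(1)] unfolding rb_def T_def[symmetric] h(7) ..
 also have "fn v (cp (srU u) (fn u b) (twi T u E)) = ?c (fn v (fn u b)) (fn v (twi T u E))"
  using fn_cp[OF u(2), of "twi T u E" "fn u b"] tuE fn_arr[OF u(1) h(4)] h(5)[folded T_def] u(3) by simp
 finally have R: "rb v (rs u us) A xs (rb u us A xs b) = ?c (?c (fn v (fn u b)) (fn v (twi T u E))) (twi (cmU T u) v E)" .
 have "?c (tws u v Q) (rb v (rs u us) A xs (rb u us A xs b)) =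
   ?c (?c (tws u v Q) (fn v (fn u b))) (?c (fn v (twi T u E)) (twi (cmU T u) v E))"
  unfolding R using V fvub ftu wQ a2 tuE h T_def by (simp add: cp_assoc)
 also have "?c (tws u v Q) (fn v (fn u b)) = ?c (fn (cmU u v) b) (tws u v (foA T E))"
  using tws_nat[OF u h(4)] h by (simp add: T_def)
 also have "?c ... (?c (fn v (twi T u E)) (twi (cmU T u) v E)) =
  ?c (fn (cmU u v) b) (?c (tws u v (foA T E)) (?c (fn v (twi T u E)) (twi (cmU T u) v E)))"
  using V fuv wT ftu a2 tuE h T_def by (intro cp_assoc) auto
 also have "?c (tws u v (foA T E)) (?c (fn v (twi T u E)) (twi (cmU T u) v E)) = twi T (cmU u v) E"
  using twi_coherence[OF T(1) u(1,2) T(2) u(3)] A T by simp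
 finally show "rb (cmU u v) us A xs b = ?c (tws u v Q) (rb v (rs u us) A xs (rb u us A xs b))"
  by (simp add: rb_def uv T_def h(7))
 define B where "B = star ts A"
 have wt: "tws t u B \<in> arr (tgU v)" using tws_arr[OF t(1) u(1) t(2), of B] A u by (simp add: B_def)
 have tu: "cmU t u \<in> ArU" "srU (cmU t u) = tgU v" "tgU (cmU t u) = tgU t"
  using t u by (simp_all add: cmp_Ar src_cmp tgt_cmp)
 have w1: "tws (cmU t u) v B \<in> arr (srU v)" using tws_arr[OF tu(1) u(2) tu(2), of B] A tu by (simp add: B_def)
 have tB: "foA t B \<in> obA (tgU u)" using fob_obj[OF t(1), of B] A t by (simp add: B_def)
 have w2: "tws t (cmU u v) B \<in> arr (srU v)" using tws_arr[OF t(1) uv(1), of B] A t uv by (simp add: B_def)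
 have w3: "tws u v (foA t B) \<in> arr (srU v)" by (rule tws_arr[OF u tB])
 have wP: "tws u v P \<in> arr (srU v)" using arrD(1)[OF h(8)] h(9) u by (intro tws_arr) auto
 have fg: "fn v (fn u g) \<in> arr (srU v)" "fn (cmU u v) g \<in> arr (srU v)"
  using fn_arr[OF u(2), of "fn u g"] fn_arr[OF u(1) h(8)] fn_arr[OF uv(1), of g] h(8) uv u by auto
 have fw: "fn v (tws t u B) \<in> arr (srU v)" using fn_arr[OF u(2) wt] .
 have gB: "cd g = foA t B" using h(10) by (simp add: us B_def)
 have "rg v (rs u us) A (rg u us A g) = ?c (tws (cmU t u) v B) (fn v (cp (srU u) (tws t u B) (fn u g)))"
  by (simp add: rg_def rs_def us B_def)
 also have "fn v (cp (srU u) (tws t u B) (fn u g)) = ?c (fn v (tws t u B)) (fn v (fn u g))"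
  unfolding u(3) using wt fn_arr[OF u(1) h(8)] u gB by (intro fn_cp) auto
 also have "?c (tws (cmU t u) v B) ... = ?c (?c (tws (cmU t u) v B) (fn v (tws t u B))) (fn v (fn u g))"
  using V w1 fw fg gB by (intro cp_assoc[symmetric]) auto
 also have "?c (tws (cmU t u) v B) (fn v (tws t u B)) = ?c (tws t (cmU u v) B) (tws u v (foA t B))"
  using tws_coherence[OF t(1) u(1,2) t(2) u(3), of B] A by (simp add: B_def)
 also have "?c ... (fn v (fn u g)) = ?c (tws t (cmU u v) B) (?c (tws u v (foA t B)) (fn v (fn u g)))"
  using V w2 w3 fg gB by (intro cp_assoc) auto
 also have "?c (tws u v (foA t B)) (fn v (fn u g)) = ?c (fn (cmU u v) g) (tws u v P)"
  using tws_nat[OF u h(8)] gB h(9) by simp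
 also have "?c (tws t (cmU u v) B) ... = ?c (?c (tws t (cmU u v) B) (fn (cmU u v) g)) (tws u v P)"
  using V w2 wP fg gB h(9) by (intro cp_assoc[symmetric]) auto
 finally show "?c (rg (cmU u v) us A g) (tws u v P) = rg v (rs u us) A (rg u us A g)"
  by (simp add: rg_def uv us B_def)
qed

end

subsection \<open>The free bimodules and maps out of them\<close>

context prestack
begin

definition laM :: "('u, 'm, 'a, 'h, 'w) bimod => 'u => 'a => ('a, 'h) mor => 'w => 'w" where
 "laM M U P b x = lact M U P (dm b) (cd b) (hm b) x"

definition raM :: "('u, 'm, 'a, 'h, 'w) bimod => 'u => ('a, 'h) mor => 'a => 'w => 'w" where
 "raM M U a Q x = ract M U (dm a) (cd a) Q x (hm a)"

end

locale pbim = prestack \<U> \<A> + bimodule \<U> \<A> sw M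
 for \<U> :: "('u, 'm) cat" and \<A> :: "('k::field, 'u, 'm, 'a, 'h::ab_group_add) prestack_data"
  and sw :: "'k => 'w => 'w::ab_group_add" and M :: "('u, 'm, 'a, 'h, 'w) bimod"
begin

lemma la_car: "U \<in> ObU ==> b \<in> arr U ==> P \<in> obA U ==> x \<in> car M U P (dm b) ==> laM M U P b x \<in> car M U P (cd b)"
 by (auto simp: laM_def arr_def intro: lact_car)

lemma ra_car: "U \<in> ObU ==> a \<in> arr U ==> Q \<in> obA U ==> x \<in> car M U (cd a) Q ==> raM M U a Q x \<in> car M U (dm a) Q"
 by (auto simp: raM_def arr_def intro: ract_car)

lemma la_linear: "U \<in> ObU ==> b \<in> arr U ==> P \<in> obA U ==> linear_from sw sw (car M U P (dm b)) (laM M U P b)"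
 using lact_linear_right[of U P "dm b" "cd b" "hm b"] by (auto simp: laM_def[abs_def] arr_def)

lemma ra_linear: "U \<in> ObU ==> a \<in> arr U ==> Q \<in> obA U ==> linear_from sw sw (car M U (cd a) Q) (raM M U a Q)"
 using ract_linear_left[of U "dm a" "cd a" Q "hm a"] by (auto simp: raM_def[abs_def] arr_def)

lemma la_comb:
 assumes "lc U c b b' b''" "U \<in> ObU" "P \<in> obA U" "x \<in> car M U P (dm b)"
 shows "laM M U P b'' x = laM M U P b x + sw c (laM M U P b' x)"
 using assms lin_combination[OF lact_linear_left[of U P "dm b" "cd b" x] vsA hom_subspace, of "hm b" "hm b'" c]
 by (auto simp: lc_def laM_def arr_def)

lemma ra_comb:
 assumes "lc U c a a' a''" "U \<in> ObU" "Q \<in> obA U" "x \<in> car M U (cd a) Q"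
 shows "raM M U a'' Q x = raM M U a Q x + sw c (raM M U a' Q x)"
 using assms lin_combination[OF ract_linear_right[of U "dm a" "cd a" Q x] vsA hom_subspace, of "hm a" "hm a'" c]
 by (auto simp: lc_def raM_def arr_def)

lemma la_ida: "U \<in> ObU ==> P \<in> obA U ==> Q \<in> obA U ==> x \<in> car M U P Q ==> laM M U P (ida U Q) x = x"
 by (simp add: laM_def ida_def lact_cid)

lemma ra_ida: "U \<in> ObU ==> P \<in> obA U ==> Q \<in> obA U ==> x \<in> car M U P Q ==> raM M U (ida U P) Q x = x"
 by (simp add: raM_def ida_def ract_cid)

lemma la_cp: "U \<in> ObU ==> b \<in> arr U ==> b' \<in> arr U ==> cd b = dm b' ==> P \<in> obA U ==> x \<in> car M U P (dm b) ==>
  laM M U P (cp U b' b) x = laM M U P b' (laM M U P b x)"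
 using lact_ccmp[of U P "dm b" "dm b'" "cd b'" "hm b'" "hm b" x] by (auto simp: laM_def cp_def arr_def)

lemma ra_cp: "U \<in> ObU ==> a \<in> arr U ==> a' \<in> arr U ==> cd a = dm a' ==> Q \<in> obA U ==> x \<in> car M U (cd a') Q ==>
  raM M U (cp U a' a) Q x = raM M U a Q (raM M U a' Q x)"
 using ract_ccmp[of U "dm a" "dm a'" "cd a'" Q x "hm a'" "hm a"] by (auto simp: raM_def cp_def arr_def)

lemma ra_la: "U \<in> ObU ==> a \<in> arr U ==> b \<in> arr U ==> x \<in> car M U (cd a) (dm b) ==>
  raM M U a (cd b) (laM M U (cd a) b x) = laM M U (dm a) b (raM M U a (dm b) x)"
 using lact_ract[of U "dm a" "cd a" "dm b" "cd b" "hm b" x "hm a"] by (auto simp: raM_def laM_def arr_def)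

lemma res_la:
 assumes "u \<in> ArU" "b \<in> arr (tgU u)" "P \<in> obA (tgU u)" "x \<in> car M (tgU u) P (dm b)"
 shows "res M u P (cd b) (laM M (tgU u) P b x) = laM M (srU u) (foA u P) (fn u b) (res M u P (dm b) x)"
proof -
 have b: "dm b \<in> obA (tgU u)" "cd b \<in> obA (tgU u)" "hm b \<in> hom \<A> (tgU u) (dm b) (cd b)" using assms(2) by (auto simp: arr_def)
 note U = tgt_Ob[OF assms(1)] src_Ob[OF assms(1)]
 have "ract M (tgU u) P P (dm b) x (cid \<A> (tgU u) P) = x" using U assms b by (intro ract_cid) auto
 moreover have "ract M (srU u) (foA u P) (foA u P) (foA u (dm b)) (res M u P (dm b) x) (fmor \<A> u P P (cid \<A> (tgU u) P)) = res M u P (dm b) x"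
  using U assms b by (simp add: fmor_cid ract_cid fob_obj res_car)
 ultimately show ?thesis
  using res_act[OF assms(1,3,3) b(1,2,3) assms(4) cid_hom[OF U(1) assms(3)]] by (simp add: laM_def fn_def)
qed

lemma res_ra:
 assumes "u \<in> ArU" "a \<in> arr (tgU u)" "Q \<in> obA (tgU u)" "x \<in> car M (tgU u) (cd a) Q"
 shows "res M u (dm a) Q (raM M (tgU u) a Q x) = raM M (srU u) (fn u a) (foA u Q) (res M u (cd a) Q x)"
proof -
 have a: "dm a \<in> obA (tgU u)" "cd a \<in> obA (tgU u)" "hm a \<in> hom \<A> (tgU u) (dm a) (cd a)" using assms(2) by (auto simp: arr_def)
 note U = tgt_Ob[OF assms(1)] src_Ob[OF assms(1)]
 have 1: "lact M (tgU u) (dm a) Q Q (cid \<A> (tgU u) Q) (ract M (tgU u) (dm a) (cd a) Q x (hm a)) =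
  ract M (tgU u) (dm a) (cd a) Q x (hm a)"
  using U assms a by (intro lact_cid ract_car) auto
 have "fmor \<A> u (dm a) (cd a) (hm a) \<in> hom \<A> (srU u) (foA u (dm a)) (foA u (cd a))" using assms a by (intro fmor_hom) auto
 then have "lact M (srU u) (foA u (dm a)) (foA u Q) (foA u Q) (fmor \<A> u Q Q (cid \<A> (tgU u) Q))
   (ract M (srU u) (foA u (dm a)) (foA u (cd a)) (foA u Q) (res M u (cd a) Q x) (fmor \<A> u (dm a) (cd a) (hm a))) =
  ract M (srU u) (foA u (dm a)) (foA u (cd a)) (foA u Q) (res M u (cd a) Q x) (fmor \<A> u (dm a) (cd a) (hm a))"
  using U assms a by (simp add: fmor_cid lact_cid ract_car fob_obj res_car)
 then show ?thesis
  using res_act[OF assms(1) a(1,2) assms(3,3) cid_hom[OF U(1) assms(3)] assms(4) a(3)] 1 by (simp add: raM_def fn_def)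
qed

lemma res_tws:
 "u \<in> ArU ==> v \<in> ArU ==> srU u = tgU v ==> P \<in> obA (tgU u) ==> Q \<in> obA (tgU u) ==> x \<in> car M (tgU u) P Q ==>
  raM M (srU v) (tws u v P) (foA (cmU u v) Q) (res M (cmU u v) P Q x) =
  laM M (srU v) (foA v (foA u P)) (tws u v Q) (res M v (foA u P) (foA u Q) (res M u P Q x))"
 using res_cmp[of u v P Q x] by (simp add: raM_def laM_def tws_def)

end

context prestack
begin

lemma pbimI: "bimodA sw M ==> pbim \<U> \<A> sw M"
 by (simp add: pbim_def prestack_axioms)

lemma bimod_homD:
 assumes "f \<in> bhom s M s' N"
 shows "U \<in> ObU ==> A \<in> obA U ==> B \<in> obA U ==> x \<in> car M U A B ==> f U A B x \<in> car N U A B"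
  and "U \<in> ObU ==> A \<in> obA U ==> B \<in> obA U ==> linear_from s s' (car M U A B) (f U A B)"
  and "U \<in> ObU ==> b \<in> arr U ==> A \<in> obA U ==> x \<in> car M U A (dm b) ==> f U A (cd b) (laM M U A b x) = laM N U A b (f U A (dm b) x)"
  and "U \<in> ObU ==> a \<in> arr U ==> B \<in> obA U ==> x \<in> car M U (cd a) B ==> f U (dm a) B (raM M U a B x) = raM N U a B (f U (cd a) B x)"
  and "u \<in> ArU ==> A \<in> obA (tgU u) ==> B \<in> obA (tgU u) ==> x \<in> car M (tgU u) A B ==>
   f (srU u) (foA u A) (foA u B) (res M u A B x) = res N u A B (f (tgU u) A B x)"
  and "~ (U \<in> ObU & A \<in> obA U & B \<in> obA U & x \<in> car M U A B) ==> f U A B x = 0"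
proof -
 note F = assms[unfolded bimod_hom_def mem_Collect_eq]
 note F1 = F[THEN conjunct1] and F2 = F[THEN conjunct2, THEN conjunct1] and F3 = F[THEN conjunct2, THEN conjunct2, THEN conjunct1]
  and F4 = F[THEN conjunct2, THEN conjunct2, THEN conjunct2, THEN conjunct1]
  and F5 = F[THEN conjunct2, THEN conjunct2, THEN conjunct2, THEN conjunct2]
 show "f U A B x \<in> car N U A B" if "U \<in> ObU" "A \<in> obA U" "B \<in> obA U" "x \<in> car M U A B"
  using F1 that by blast
 show "linear_from s s' (car M U A B) (f U A B)" if "U \<in> ObU" "A \<in> obA U" "B \<in> obA U"
  using F1 that by blast
 show "f U A (cd b) (laM M U A b x) = laM N U A b (f U A (dm b) x)" if "U \<in> ObU" "b \<in> arr U" "A \<in> obA U" "x \<in> car M U A (dm b)"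
  using F2 that arrD[OF that(2)] unfolding laM_def by blast
 show "f U (dm a) B (raM M U a B x) = raM N U a B (f U (cd a) B x)" if "U \<in> ObU" "a \<in> arr U" "B \<in> obA U" "x \<in> car M U (cd a) B"
  using F3 that arrD[OF that(2)] unfolding raM_def by blast
 show "f (srU u) (foA u A) (foA u B) (res M u A B x) = res N u A B (f (tgU u) A B x)"
  if "u \<in> ArU" "A \<in> obA (tgU u)" "B \<in> obA (tgU u)" "x \<in> car M (tgU u) A B"
  using F4 that by blast
 show "f U A B x = 0" if "~ (U \<in> ObU & A \<in> obA U & B \<in> obA U & x \<in> car M U A B)"
  using F5 that by blast
qed

lemma bimod_homI:
 assumes "!!U A B x. U \<in> ObU ==> A \<in> obA U ==> B \<in> obA U ==> x \<in> car M U A B ==> f U A B x \<in> car N U A B"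
  and "!!U A B. U \<in> ObU ==> A \<in> obA U ==> B \<in> obA U ==> linear_from s s' (car M U A B) (f U A B)"
  and "!!U A b x. U \<in> ObU ==> b \<in> arr U ==> A \<in> obA U ==> x \<in> car M U A (dm b) ==> f U A (cd b) (laM M U A b x) = laM N U A b (f U A (dm b) x)"
  and "!!U B a x. U \<in> ObU ==> a \<in> arr U ==> B \<in> obA U ==> x \<in> car M U (cd a) B ==> f U (dm a) B (raM M U a B x) = raM N U a B (f U (cd a) B x)"
  and "!!u A B x. u \<in> ArU ==> A \<in> obA (tgU u) ==> B \<in> obA (tgU u) ==> x \<in> car M (tgU u) A B ==>
   f (srU u) (foA u A) (foA u B) (res M u A B x) = res N u A B (f (tgU u) A B x)"
  and "!!U A B x. ~ (U \<in> ObU & A \<in> obA U & B \<in> obA U & x \<in> car M U A B) ==> f U A B x = 0"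
 shows "f \<in> bhom s M s' N"
proof -
 have 3: "f U A C (lact M U A B C b x) = lact N U A B C b (f U A B x)"
  if "U \<in> ObU" "A \<in> obA U" "B \<in> obA U" "C \<in> obA U" "b \<in> hom \<A> U B C" "x \<in> car M U A B" for U A B C b x
  using assms(3)[of U "(B, C, b)" A x] that by (simp add: laM_def arr_iff)
 have 4: "f U A C (ract M U A B C x a) = ract N U A B C (f U B C x) a"
  if "U \<in> ObU" "A \<in> obA U" "B \<in> obA U" "C \<in> obA U" "a \<in> hom \<A> U A B" "x \<in> car M U B C" for U A B C a x
  using assms(4)[of U "(A, B, a)" C x] that by (simp add: raM_def arr_iff)
 show ?thesis unfolding bimod_hom_def mem_Collect_eq
  by (intro conjI ballI allI impI) (rule 3 4 assms(1,2,5,6); assumption)+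
qed

text \<open>Cochains of degree \<open>n\<close> with coefficients in \<open>M\<close>.\<close>

definition coch where
 "coch sw M n \<phi> \<longleftrightarrow> (\<forall>X us Y A xs E. pth X us Y --> length us + length xs = n --> chain Y A xs E -->
   \<phi> X us A xs \<in> car M X (star us A) (foA (co X us) E) &
   (\<forall>c xs' xs''. lcl Y c xs xs' xs'' --> \<phi> X us A xs'' = \<phi> X us A xs + sw c (\<phi> X us A xs')))"

text \<open>The value at a generator of the bimodule map determined by a cochain.\<close>

definition Fk where
 "Fk M \<phi> X us A xs b g =
   (let v = hd us; vs = tl us; Z = tgU v; E = foA (co Z vs) (endo A xs) in
   laM M X (dm g) (cp X b (tws (co Z vs) v (endo A xs)))
    (raM M X g (foA v E) (res M v (star vs A) E (\<phi> Z vs A xs))))"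

lemma gd_ConsE [consumes 1, case_names gd]:
 assumes "gd n X P Q us A xs b g"
 obtains v vs Z Y E where "us = v # vs" "v \<in> ArU" "srU v = X" "tgU v = Z" "pth Z vs Y" "length vs + length xs = n"
  "chain Y A xs E" "endo A xs = E" "b \<in> arr X" "dm b = foA (cmU (co Z vs) v) E" "cd b = Q"
  "g \<in> arr X" "dm g = P" "cd g = foA v (star vs A)" "X \<in> ObU" "Z \<in> ObU" "P \<in> obA X" "Q \<in> obA X"
  "co Z vs \<in> ArU" "srU (co Z vs) = Z" "tgU (co Z vs) = Y"
  "star vs A \<in> obA Z" "foA (co Z vs) E \<in> obA Z" "E \<in> obA Y" "pth X us Y"
  "tws (co Z vs) v E \<in> arr X" "dm (tws (co Z vs) v E) = foA v (foA (co Z vs) E)"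
proof -
 obtain Y E where h: "pth X us Y" "us ~= []" "length us + length xs = Suc n" "chain Y A xs E"
  "b \<in> arr X" "dm b = foA (co X us) E" "cd b = Q" "g \<in> arr X" "dm g = P" "cd g = star us A"
  "lstU X us = Y" "endo A xs = E" "X \<in> ObU" "Y \<in> ObU"
  using assms by (rule gdE)
 obtain v vs where us: "us = v # vs" using h(2) by (cases us) auto
 have p: "pth (tgU v) vs Y" "v \<in> ArU" "srU v = X" using h by (auto simp: us)
 note c = co_Ar[OF p(1)] src_co[OF p(1)] tgt_co[OF p(1)]
 have E: "E \<in> obA Y" using chain_obj[OF h(4)] by simp
 have o: "star vs A \<in> obA (tgU v)" "foA (co (tgU v) vs) E \<in> obA (tgU v)"
  using star_obj[OF p(1) chain_obj(1)[OF h(4)]] fob_obj[OF c(1), of E] E c by auto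
 show thesis
 proof (rule that[of v vs "tgU v" Y E])
  show "tws (co (tgU v) vs) v E \<in> arr X" using tws_arr[OF c(1) p(2) c(2), of E] E c p by simp
 qed (use h p c E o us tgt_Ob[OF p(2)] arrD(1)[OF h(8)] arrD(2)[OF h(5)] in auto)
qed

end

context pbim
begin

lemma Fk_mem:
 assumes "coch sw M n \<phi>" and D: "gd n X P Q us A xs b g"
 shows "Fk M \<phi> X us A xs b g \<in> car M X P Q"
 using D
proof (cases rule: gd_ConsE)
 case h: (gd v vs Z Y E)
 have "\<phi> Z vs A xs \<in> car M Z (star vs A) (foA (co Z vs) E)" using assms(1) h by (auto simp: coch_def)
 then have "res M v (star vs A) (foA (co Z vs) E) (\<phi> Z vs A xs) \<in> car M X (cd g) (foA v (foA (co Z vs) E))"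
  using res_car[of v "star vs A" "foA (co Z vs) E"] h by auto
 then have "raM M X g (foA v (foA (co Z vs) E)) (res M v (star vs A) (foA (co Z vs) E) (\<phi> Z vs A xs)) \<in>
   car M X P (dm (cp X b (tws (co Z vs) v E)))"
  using ra_car[OF h(15,12)] fob_obj[OF h(2), of "foA (co Z vs) E"] h by auto
 then show ?thesis
  unfolding Fk_def h(1) Let_def list.sel h(4,8,13)
  using la_car[of X "cp X b (tws (co Z vs) v E)" P] h by auto
qed

lemma mlK_Fk:
 assumes \<phi>: "coch sw M n \<phi>"
 shows "mlK n X P Q sw (Fk M \<phi> X)"
 unfolding mlK_def
proof (intro allI impI)
 fix us A xs b g xs' b' g' xs'' b'' g'' c
 assume D: "gd n X P Q us A xs b g" and L: "lcd X (lstU X us) c xs b g xs' b' g' xs'' b'' g''"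
 show "Fk M \<phi> X us A xs'' b'' g'' = Fk M \<phi> X us A xs b g + sw c (Fk M \<phi> X us A xs' b' g')"
  using D
 proof (cases rule: gd_ConsE)
  case h: (gd v vs Z Y E)
  have lo: "lstU X us = Y" using h(25) pth_iff by auto
  note L = L[unfolded lo]
  have en: "endo A xs' = E" "endo A xs'' = E" using lcd_gd(3,4)[OF D h(25) L] h(8) by auto
  let ?t = "tws (co Z vs) v E" and ?E = "foA (co Z vs) E"
  let ?R = "%xs. res M v (star vs A) ?E (\<phi> Z vs A xs)"
  let ?G = "%g xs. raM M X g (foA v ?E) (?R xs)"
  have vE: "foA v ?E \<in> obA X" using fob_obj[OF h(2), of ?E] h by auto
  have ph: "\<phi> Z vs A ys \<in> car M Z (star vs A) ?E" if "chain Y A ys E" "length ys = length xs" for ys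
   using \<phi> h that by (auto simp: coch_def)
  have R: "?R ys \<in> car M X (cd g) (foA v ?E)" if "chain Y A ys E" "length ys = length xs" for ys
   using res_car[of v "star vs A" ?E] ph[OF that] h by auto
  have G: "?G g ys \<in> car M X P (dm (cp X b ?t))" if "chain Y A ys E" "length ys = length xs" for ys
   using ra_car[OF h(15,12) vE R[OF that]] h by auto
  have bt: "cp X b ?t \<in> arr X" using h by auto
  have car: "module.subspace sw (car M X A B)" if "A \<in> obA X" "B \<in> obA X" for A B using car_subspace h that by auto
  have t: "dm g' = dm g" "dm g'' = dm g" using L lc_typ[OF _ h(15)] unfolding lcd_def by metis+
  show ?thesis
   unfolding Fk_def h(1) Let_def list.sel h(4,8,13) en t
   using L unfolding lcd_def
  proof (elim disjE conjE)
   assume l: "lcl Y c xs xs' xs''" "b' = b" "b'' = b" "g' = g" "g'' = g"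
   have ch: "chain Y A xs' E" "chain Y A xs'' E" "length xs' = length xs" "length xs'' = length xs"
    using lcl_chain[OF l(1) pth_Ob(2)[OF h(5)] h(7)] lcl_length[OF l(1)] by auto
   have "\<phi> Z vs A xs'' = \<phi> Z vs A xs + sw c (\<phi> Z vs A xs')" using \<phi> h l(1) by (auto simp: coch_def)
   then have "?R xs'' = ?R xs + sw c (?R xs')"
    using lin_combination[OF res_linear[OF h(2), unfolded h(4), OF h(22,23)] scale_vector_space
      car_subspace[OF tgt_Ob[OF h(2), unfolded h(4)] h(22,23)] ph[OF h(7)] ph[OF ch(1,3)], of c] by simp
   then have "?G g xs'' = ?G g xs + sw c (?G g xs')"
    using lin_combination[OF ra_linear[OF h(15,12) vE] scale_vector_space car[OF arrD(2)[OF h(12)] vE] R[OF h(7)] R[OF ch(1,3)], of c] by simp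
   then show "laM M X P (cp X b'' ?t) (?G g'' xs'') = laM M X P (cp X b ?t) (?G g xs) + sw c (laM M X P (cp X b' ?t) (?G g' xs'))"
    unfolding l(2-)
    using lin_combination[OF la_linear[OF h(15) bt h(17)] scale_vector_space _ G[OF h(7)] G[OF ch(1,3)], of c] car[OF h(17) arrD(1)[OF bt]] by simp
  next
   assume l: "xs' = xs" "xs'' = xs" "lc X c b b' b''" "g' = g" "g'' = g"
   show "laM M X P (cp X b'' ?t) (?G g'' xs'') = laM M X P (cp X b ?t) (?G g xs) + sw c (laM M X P (cp X b' ?t) (?G g' xs'))"
    unfolding l(1,2,4,5) using lc_cp_right[OF l(3) h(15,26)] h G[OF h(7)] by (intro la_comb) auto
  next
   assume l: "xs' = xs" "xs'' = xs" "lc X c g g' g''" "b' = b" "b'' = b"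
   have "?G g'' xs = ?G g xs + sw c (?G g' xs)" by (rule ra_comb[OF l(3) h(15) vE R[OF h(7)]]) simp
   moreover have "?G g' xs \<in> car M X P (dm (cp X b ?t))"
    using ra_car[of X g' "foA v ?E" "?R xs"] R[OF h(7)] lc_typ[OF l(3) h(15)] h vE by auto
   ultimately show "laM M X P (cp X b'' ?t) (?G g'' xs'') = laM M X P (cp X b ?t) (?G g xs) + sw c (laM M X P (cp X b' ?t) (?G g' xs'))"
    unfolding l(1,2,4,5)
    using lin_combination[OF la_linear[OF h(15) bt h(17)] scale_vector_space _ G[OF h(7)], of "?G g' xs" c] car[OF h(17) arrD(1)[OF bt]] by simp
  qed
 qed
qed

end

context prestack_universe
begin

definition Bb :: "nat => ('u, 'm, 'a, 'h, 'v) bimod" where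
 "Bb n = \<lparr>car = Bc n,
   lact = (%U A B C b. lex n U A B s (%us A' xs b0 g. gen us A' xs (cp U (B, C, b) b0) g)),
   ract = (%U A B C x a. lex n U B C s (%us A' xs b g. gen us A' xs b (cp U g (A, B, a))) x),
   res = (%u A B. lex n (tgU u) A B s (%us A' xs b g. gen (rs u us) A' xs (rb u us A' xs b) (rg u us A' g)))\<rparr>"

lemma car_Bb [simp]: "car (Bb n) = Bc n"
 by (simp add: Bb_def)

lemma Bb_la: "laM (Bb n) U P b = lex n U P (dm b) s (%us A xs b0 g. gen us A xs (cp U b b0) g)"
 by (simp add: laM_def[abs_def] Bb_def)

lemma Bb_ra: "raM (Bb n) U a Q = lex n U (cd a) Q s (%us A xs b g. gen us A xs b (cp U g a))"
 by (simp add: raM_def[abs_def] Bb_def)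

lemma Bb_res: "res (Bb n) u P Q = lex n (tgU u) P Q s (%us A xs b g. gen (rs u us) A xs (rb u us A xs b) (rg u us A g))"
 by (simp add: Bb_def)

lemma Bb_la_gen:
 assumes "b' \<in> arr X"
 shows "linear_from s s Z (laM (Bb n) X P b')"
  and "gd n X P (dm b') us A xs b g ==> laM (Bb n) X P b' (gen us A xs b g) = gen us A xs (cp X b' b) g"
  and "x \<in> Bc n X P (dm b') ==> laM (Bb n) X P b' x \<in> Bc n X P (cd b')"
proof -
 have m: "mlK n X P (dm b') s (%us A xs b g. gen us A xs (cp X b' b) g)" by (rule mlK_lact[OF mlK_gen assms refl])
 show "linear_from s s Z (laM (Bb n) X P b')" unfolding Bb_la by (rule lex_linear[OF vsS m])
 show "gd n X P (dm b') us A xs b g ==> laM (Bb n) X P b' (gen us A xs b g) = gen us A xs (cp X b' b) g"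
  unfolding Bb_la by (rule lex_gen[OF vsS m])
 show "x \<in> Bc n X P (dm b') ==> laM (Bb n) X P b' x \<in> Bc n X P (cd b')"
  unfolding Bb_la using gen_Bc[OF gd_lact[OF _ assms refl]] by (rule lex_mem[OF vsS m Bc_subspace])
qed

lemma Bb_ra_gen:
 assumes "a \<in> arr X"
 shows "linear_from s s Z (raM (Bb n) X a Q)"
  and "gd n X (cd a) Q us A xs b g ==> raM (Bb n) X a Q (gen us A xs b g) = gen us A xs b (cp X g a)"
  and "x \<in> Bc n X (cd a) Q ==> raM (Bb n) X a Q x \<in> Bc n X (dm a) Q"
proof -
 have m: "mlK n X (cd a) Q s (%us A xs b g. gen us A xs b (cp X g a))" by (rule mlK_ract[OF mlK_gen assms refl])
 show "linear_from s s Z (raM (Bb n) X a Q)" unfolding Bb_ra by (rule lex_linear[OF vsS m])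
 show "gd n X (cd a) Q us A xs b g ==> raM (Bb n) X a Q (gen us A xs b g) = gen us A xs b (cp X g a)"
  unfolding Bb_ra by (rule lex_gen[OF vsS m])
 show "x \<in> Bc n X (cd a) Q ==> raM (Bb n) X a Q x \<in> Bc n X (dm a) Q"
  unfolding Bb_ra using gen_Bc[OF gd_ract[OF _ assms refl]] by (rule lex_mem[OF vsS m Bc_subspace])
qed

lemma Bb_res_gen:
 assumes "u \<in> ArU"
 shows "linear_from s s Z (res (Bb n) u P Q)"
  and "gd n (tgU u) P Q us A xs b g ==> res (Bb n) u P Q (gen us A xs b g) = gen (rs u us) A xs (rb u us A xs b) (rg u us A g)"
  and "x \<in> Bc n (tgU u) P Q ==> res (Bb n) u P Q x \<in> Bc n (srU u) (foA u P) (foA u Q)"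
proof -
 have m: "mlK n (tgU u) P Q s (%us A xs b g. gen (rs u us) A xs (rb u us A xs b) (rg u us A g))" by (rule mlK_res[OF mlK_gen assms])
 show "linear_from s s Z (res (Bb n) u P Q)" unfolding Bb_res by (rule lex_linear[OF vsS m])
 show "gd n (tgU u) P Q us A xs b g ==> res (Bb n) u P Q (gen us A xs b g) = gen (rs u us) A xs (rb u us A xs b) (rg u us A g)"
  unfolding Bb_res by (rule lex_gen[OF vsS m])
 show "x \<in> Bc n (tgU u) P Q ==> res (Bb n) u P Q x \<in> Bc n (srU u) (foA u P) (foA u Q)"
  unfolding Bb_res using gen_Bc[OF gd_res[OF _ assms]] by (rule lex_mem[OF vsS m Bc_subspace])
qed

lemmas Bb_eqI = Bc_eqI[OF vsS]

lemma bimodule_Bb: "bimodA s (Bb n)"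
proof -
 have la: "lact (Bb n) U A B C b x = laM (Bb n) U A (B, C, b) x" for U A B C b x by (simp add: laM_def)
 have ra: "ract (Bb n) U A B C x a = raM (Bb n) U (A, B, a) C x" for U A B C a x by (simp add: raM_def)
 have cpt: "(A, C, ccmp \<A> U A B C g f) = cp U (B, C, g) (A, B, f)" for U A B C g f by (simp add: cp_def)
 note V = vsS vsA
 show ?thesis
 proof
  fix U A B C D assume U: "U \<in> ObU" and A: "A \<in> obA U" and B: "B \<in> obA U" and C: "C \<in> obA U" and D: "D \<in> obA U"
  show "vs.subspace (car (Bb n) U A B)" by (simp add: Bc_subspace)
  { fix b x assume h: "b \<in> hom \<A> U B C" "x \<in> car (Bb n) U A B"
   show "lact (Bb n) U A B C b x \<in> car (Bb n) U A C"
    using Bb_la_gen(3)[of "(B, C, b)" U x n A] h B C by (simp add: la arr_iff) }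
  { fix x assume x: "x \<in> car (Bb n) U A B"
   show "linear_from scA s (hom \<A> U B C) (%b. lact (Bb n) U A B C b x)"
   proof (rule lin_combinationI[OF V(2,1) hom_subspace[OF U B C]])
    fix c f g assume fg: "f \<in> hom \<A> U B C" "g \<in> hom \<A> U B C"
    have l: "lc U c (B, C, f) (B, C, g) (B, C, f + scA c g)" using fg B C by (simp add: lc_def arr_iff)
    note t = lc_typ(1-3)[OF l U]
    show "lact (Bb n) U A B C (f + scA c g) x = lact (Bb n) U A B C f x + s c (lact (Bb n) U A B C g x)"
     unfolding la
    proof (rule Bb_eqI[OF Bb_la_gen(1)[OF t(3)] lin_add[OF V(1) Bb_la_gen(1)[OF t(1)] lin_scale[OF V(1) Bb_la_gen(1)[OF t(2)]]] _ x[unfolded car_Bb]])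
     fix us A' xs b0 g0 assume d: "gd n U A B us A' xs b0 g0"
     then obtain Y E where h: "pth U us Y" "b0 \<in> arr U" "cd b0 = B" by (rule gdE)
     show "laM (Bb n) U A (B, C, f + scA c g) (gen us A' xs b0 g0) =
      laM (Bb n) U A (B, C, f) (gen us A' xs b0 g0) + s c (laM (Bb n) U A (B, C, g) (gen us A' xs b0 g0))"
      using mlKD[OF mlK_gen gd_lact[OF d t(1)] h(1), of c xs "cp U (B, C, g) b0" g0 xs "cp U (B, C, f + scA c g) b0" g0]
       lc_cp_right[OF l U h(2)] h(3) d
      by (simp add: Bb_la_gen(2)[OF t(1)] Bb_la_gen(2)[OF t(2)] Bb_la_gen(2)[OF t(3)] lcd_def)
    qed
   qed }
  { fix b assume b: "b \<in> hom \<A> U B C"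
   show "linear_from s s (car (Bb n) U A B) (%x. lact (Bb n) U A B C b x)"
    unfolding la using Bb_la_gen(1)[of "(B, C, b)"] b B C by (simp add: arr_iff) }
  { fix x assume x: "x \<in> car (Bb n) U A B"
   have i: "(B, B, cid \<A> U B) = ida U B" by (simp add: ida_def)
   show "lact (Bb n) U A B B (cid \<A> U B) x = x" unfolding la i
   proof (rule Bb_eqI[OF Bb_la_gen(1)[OF ida_arr[OF U B]] lin_id _ x[unfolded car_Bb]])
    fix us A' xs b0 g0 assume d: "gd n U A B us A' xs b0 g0"
    then have "b0 \<in> arr U" "cd b0 = B" by (auto elim: gdE)
    then show "laM (Bb n) U A (ida U B) (gen us A' xs b0 g0) = gen us A' xs b0 g0"
     using Bb_la_gen(2)[OF ida_arr[OF U B], of n A us A' xs b0 g0] d U by simp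
   qed }
  { fix b' b x assume h: "b' \<in> hom \<A> U C D" "b \<in> hom \<A> U B C" "x \<in> car (Bb n) U A B"
   have a: "(C, D, b') \<in> arr U" "(B, C, b) \<in> arr U" using h B C D by (simp_all add: arr_iff)
   have a': "cp U (C, D, b') (B, C, b) \<in> arr U" using a U by simp
   show "lact (Bb n) U A B D (ccmp \<A> U B C D b' b) x = lact (Bb n) U A C D b' (lact (Bb n) U A B C b x)"
    unfolding la cpt
   proof (rule Bb_eqI[OF Bb_la_gen(1)[OF a'] lin_comp[OF Bb_la_gen(1)[OF a(2)] UNIV_I Bb_la_gen(1)[OF a(1)]] _ h(3)[unfolded car_Bb]])
    fix us A' xs b0 g0 assume d: "gd n U A B us A' xs b0 g0"
    then have b0: "b0 \<in> arr U" "cd b0 = B" by (auto elim: gdE)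
    have "gd n U A C us A' xs (cp U (B, C, b) b0) g0" using gd_lact[OF d a(2)] by simp
    then show "laM (Bb n) U A (cp U (C, D, b') (B, C, b)) (gen us A' xs b0 g0) = laM (Bb n) U A (C, D, b') (laM (Bb n) U A (B, C, b) (gen us A' xs b0 g0))"
     using d b0 a U by (simp add: Bb_la_gen(2)[OF a'] Bb_la_gen(2)[OF a(1)] Bb_la_gen(2)[OF a(2)] cp_assoc)
   qed }
  { fix a x assume h: "x \<in> car (Bb n) U B C" "a \<in> hom \<A> U A B"
   show "ract (Bb n) U A B C x a \<in> car (Bb n) U A C"
    using Bb_ra_gen(3)[of "(A, B, a)" U x n C] h A B by (simp add: ra arr_iff) }
  { fix a assume b: "a \<in> hom \<A> U A B"
   show "linear_from s s (car (Bb n) U B C) (%x. ract (Bb n) U A B C x a)"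
    unfolding ra using Bb_ra_gen(1)[of "(A, B, a)"] b A B by (simp add: arr_iff) }
  { fix x assume x: "x \<in> car (Bb n) U B C"
   show "linear_from scA s (hom \<A> U A B) (%a. ract (Bb n) U A B C x a)"
   proof (rule lin_combinationI[OF V(2,1) hom_subspace[OF U A B]])
    fix c f g assume fg: "f \<in> hom \<A> U A B" "g \<in> hom \<A> U A B"
    have l: "lc U c (A, B, f) (A, B, g) (A, B, f + scA c g)" using fg A B by (simp add: lc_def arr_iff)
    note t = lc_typ(1-3)[OF l U]
    show "ract (Bb n) U A B C x (f + scA c g) = ract (Bb n) U A B C x f + s c (ract (Bb n) U A B C x g)"
     unfolding ra
    proof (rule Bb_eqI[OF Bb_ra_gen(1)[OF t(3)] lin_add[OF V(1) Bb_ra_gen(1)[OF t(1)] lin_scale[OF V(1) Bb_ra_gen(1)[OF t(2)]]] _ x[unfolded car_Bb]])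
     fix us A' xs b0 g0 assume d: "gd n U B C us A' xs b0 g0"
     then obtain Y E where h: "pth U us Y" "g0 \<in> arr U" "dm g0 = B" by (rule gdE)
     show "raM (Bb n) U (A, B, f + scA c g) C (gen us A' xs b0 g0) =
      raM (Bb n) U (A, B, f) C (gen us A' xs b0 g0) + s c (raM (Bb n) U (A, B, g) C (gen us A' xs b0 g0))"
      using mlKD[OF mlK_gen gd_ract[OF d t(1)] h(1), of c xs b0 "cp U g0 (A, B, g)" xs b0 "cp U g0 (A, B, f + scA c g)"]
       lc_cp_left[OF l U h(2)] h(3) d
      by (simp add: Bb_ra_gen(2)[OF t(1)] Bb_ra_gen(2)[OF t(2)] Bb_ra_gen(2)[OF t(3)] lcd_def)
    qed
   qed }
  { fix x assume x: "x \<in> car (Bb n) U A B"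
   have i: "(A, A, cid \<A> U A) = ida U A" by (simp add: ida_def)
   show "ract (Bb n) U A A B x (cid \<A> U A) = x" unfolding ra i
   proof (rule Bb_eqI[OF Bb_ra_gen(1)[OF ida_arr[OF U A]] lin_id _ x[unfolded car_Bb]])
    fix us A' xs b0 g0 assume d: "gd n U A B us A' xs b0 g0"
    then have "g0 \<in> arr U" "dm g0 = A" by (auto elim: gdE)
    then show "raM (Bb n) U (ida U A) B (gen us A' xs b0 g0) = gen us A' xs b0 g0"
     using Bb_ra_gen(2)[OF ida_arr[OF U A], of n B us A' xs b0 g0] d U by simp
   qed }
  { fix x a' a assume h: "x \<in> car (Bb n) U C D" "a' \<in> hom \<A> U B C" "a \<in> hom \<A> U A B"
   have a: "(B, C, a') \<in> arr U" "(A, B, a) \<in> arr U" using h A B C by (simp_all add: arr_iff)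
   have a': "cp U (B, C, a') (A, B, a) \<in> arr U" using a U by simp
   show "ract (Bb n) U A C D x (ccmp \<A> U A B C a' a) = ract (Bb n) U A B D (ract (Bb n) U B C D x a') a"
    unfolding ra cpt
   proof (rule Bb_eqI[OF Bb_ra_gen(1)[OF a'] lin_comp[OF Bb_ra_gen(1)[OF a(1)] UNIV_I Bb_ra_gen(1)[OF a(2)]] _ h(1)[unfolded car_Bb]])
    fix us A' xs b0 g0 assume d: "gd n U C D us A' xs b0 g0"
    then have g0: "g0 \<in> arr U" "dm g0 = C" by (auto elim: gdE)
    have "gd n U B D us A' xs b0 (cp U g0 (B, C, a'))" using gd_ract[OF d a(1)] by simp
    then show "raM (Bb n) U (cp U (B, C, a') (A, B, a)) D (gen us A' xs b0 g0) = raM (Bb n) U (A, B, a) D (raM (Bb n) U (B, C, a') D (gen us A' xs b0 g0))"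
     using d g0 a U by (simp add: Bb_ra_gen(2)[OF a'] Bb_ra_gen(2)[OF a(1)] Bb_ra_gen(2)[OF a(2)] cp_assoc)
   qed }
  { fix b x a assume h: "b \<in> hom \<A> U C D" "x \<in> car (Bb n) U B C" "a \<in> hom \<A> U A B"
   have t: "(C, D, b) \<in> arr U" "(A, B, a) \<in> arr U" using h A B C D by (simp_all add: arr_iff)
   show "ract (Bb n) U A B D (lact (Bb n) U B C D b x) a = lact (Bb n) U A C D b (ract (Bb n) U A B C x a)"
    unfolding ra la
   proof (rule Bb_eqI[OF lin_comp[OF Bb_la_gen(1)[OF t(1)] UNIV_I Bb_ra_gen(1)[OF t(2)]] lin_comp[OF Bb_ra_gen(1)[OF t(2)] UNIV_I Bb_la_gen(1)[OF t(1)]] _ h(2)[unfolded car_Bb]])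
    fix us A' xs b0 g0 assume d: "gd n U B C us A' xs b0 g0"
    have "gd n U B D us A' xs (cp U (C, D, b) b0) g0" "gd n U A C us A' xs b0 (cp U g0 (A, B, a))"
     using gd_lact[OF d t(1)] gd_ract[OF d t(2)] by simp_all
    then show "raM (Bb n) U (A, B, a) D (laM (Bb n) U B (C, D, b) (gen us A' xs b0 g0)) = laM (Bb n) U A (C, D, b) (raM (Bb n) U (A, B, a) C (gen us A' xs b0 g0))"
     using d by (simp add: Bb_la_gen(2)[OF t(1)] Bb_ra_gen(2)[OF t(2)])
   qed }
  { fix x assume x: "x \<in> car (Bb n) U A B"
   show "res (Bb n) (idU U) A B x = x"
   proof (rule Bb_eqI[OF Bb_res_gen(1)[OF idn_Ar[OF U]] lin_id _ x[unfolded car_Bb]])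
    fix us A' xs b0 g0 assume d: "gd n U A B us A' xs b0 g0"
    show "res (Bb n) (idU U) A B (gen us A' xs b0 g0) = gen us A' xs b0 g0"
     using Bb_res_gen(2)[OF idn_Ar[OF U], unfolded tgt_idn[OF U], OF d] res_idn_gen[OF d] by simp
   qed }
 next
  fix u A B C D assume u: "u \<in> ArU" and A: "A \<in> obA (tgU u)" and B: "B \<in> obA (tgU u)"
   and C: "C \<in> obA (tgU u)" and D: "D \<in> obA (tgU u)"
  { fix x assume "x \<in> car (Bb n) (tgU u) A B"
   then show "res (Bb n) u A B x \<in> car (Bb n) (srU u) (foA u A) (foA u B)" using Bb_res_gen(3)[OF u] by simp }
  show "linear_from s s (car (Bb n) (tgU u) A B) (res (Bb n) u A B)" by (rule Bb_res_gen(1)[OF u])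
  { fix b x a assume h: "b \<in> hom \<A> (tgU u) C D" "x \<in> car (Bb n) (tgU u) B C" "a \<in> hom \<A> (tgU u) A B"
   have t: "(C, D, b) \<in> arr (tgU u)" "(A, B, a) \<in> arr (tgU u)" using h A B C D by (simp_all add: arr_iff)
   have f: "fn u (C, D, b) = (foA u C, foA u D, fmor \<A> u C D b)" "fn u (A, B, a) = (foA u A, foA u B, fmor \<A> u A B a)" by (simp_all add: fn_def)
   note t' = fn_arr[OF u t(1)] fn_arr[OF u t(2)]
   show "res (Bb n) u A D (lact (Bb n) (tgU u) A C D b (ract (Bb n) (tgU u) A B C x a)) =
     lact (Bb n) (srU u) (foA u A) (foA u C) (foA u D) (fmor \<A> u C D b)
      (ract (Bb n) (srU u) (foA u A) (foA u B) (foA u C) (res (Bb n) u B C x) (fmor \<A> u A B a))"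
    unfolding ra la f[symmetric]
   proof (rule Bb_eqI[OF lin_comp[OF lin_comp[OF Bb_ra_gen(1)[OF t(2)] UNIV_I Bb_la_gen(1)[OF t(1)]] UNIV_I Bb_res_gen(1)[OF u]]
      lin_comp[OF lin_comp[OF Bb_res_gen(1)[OF u] UNIV_I Bb_ra_gen(1)[OF t'(2)]] UNIV_I Bb_la_gen(1)[OF t'(1)]] _ h(2)[unfolded car_Bb]])
    fix us A' xs b0 g0 assume d: "gd n (tgU u) B C us A' xs b0 g0"
    have d1: "gd n (tgU u) A C us A' xs b0 (cp (tgU u) g0 (A, B, a))" using gd_ract[OF d t(2)] by simp
    have d2: "gd n (tgU u) A D us A' xs (cp (tgU u) (C, D, b) b0) (cp (tgU u) g0 (A, B, a))" using gd_lact[OF d1 t(1)] by simp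
    note d3 = gd_res[OF d u]
    have d4: "gd n (srU u) (foA u A) (foA u C) (rs u us) A' xs (rb u us A' xs b0) (cp (srU u) (rg u us A' g0) (fn u (A, B, a)))"
     using gd_ract[OF d3 t'(2)] by simp
    show "res (Bb n) u A D (laM (Bb n) (tgU u) A (C, D, b) (raM (Bb n) (tgU u) (A, B, a) C (gen us A' xs b0 g0))) =
     laM (Bb n) (srU u) (foA u A) (fn u (C, D, b)) (raM (Bb n) (srU u) (fn u (A, B, a)) (foA u C) (res (Bb n) u B C (gen us A' xs b0 g0)))"
     using d d1 d2 d3 d4 rb_lact[OF d1 u t(1)] rg_ract[OF d u t(2)]
     by (simp add: Bb_la_gen(2)[OF t(1)] Bb_ra_gen(2)[OF t(2)] Bb_la_gen(2)[OF t'(1)] Bb_ra_gen(2)[OF t'(2)] Bb_res_gen(2)[OF u])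
   qed }
  { fix v x assume v: "v \<in> ArU" "srU u = tgU v" and x: "x \<in> car (Bb n) (tgU u) A B"
   have t: "tws u v A \<in> arr (srU v)" "tws u v B \<in> arr (srU v)" using tws_arr u v A B by auto
   have uv: "cmU u v \<in> ArU" "srU (cmU u v) = srU v" "tgU (cmU u v) = tgU u"
    using u v by (simp_all add: cmp_Ar src_cmp tgt_cmp)
   have f: "tws u v A = (foA v (foA u A), foA (cmU u v) A, tw \<A> u v A)" for A by (simp add: tws_def)
   show "ract (Bb n) (srU v) (foA v (foA u A)) (foA (cmU u v) A) (foA (cmU u v) B)
      (res (Bb n) (cmU u v) A B x) (tw \<A> u v A) =
     lact (Bb n) (srU v) (foA v (foA u A)) (foA v (foA u B)) (foA (cmU u v) B)
      (tw \<A> u v B) (res (Bb n) v (foA u A) (foA u B) (res (Bb n) u A B x))"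
    unfolding ra la f[symmetric]
   proof (rule Bb_eqI[OF lin_comp[OF Bb_res_gen(1)[OF uv(1)] UNIV_I Bb_ra_gen(1)[OF t(1)]]
      lin_comp[OF lin_comp[OF Bb_res_gen(1)[OF u] UNIV_I Bb_res_gen(1)[OF v(1)]] UNIV_I Bb_la_gen(1)[OF t(2)]] _ x[unfolded car_Bb]])
    fix us A' xs b0 g0 assume d: "gd n (tgU u) A B us A' xs b0 g0"
    note d1 = gd_res[OF d u]
    note d2 = gd_res[OF d1[unfolded v(2)] v(1)]
    note d3 = gd_res[OF d[folded uv(3)] uv(1), unfolded uv(2)]
    show "raM (Bb n) (srU v) (tws u v A) (foA (cmU u v) B) (res (Bb n) (cmU u v) A B (gen us A' xs b0 g0)) =
     laM (Bb n) (srU v) (foA v (foA u A)) (tws u v B) (res (Bb n) v (foA u A) (foA u B) (res (Bb n) u A B (gen us A' xs b0 g0)))"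
     using d d1 d2 d3 v(2) res_cmp_gen[OF d u v]
     by (simp add: Bb_la_gen(2)[OF t(2)] Bb_ra_gen(2)[OF t(1)] Bb_res_gen(2)[OF u] Bb_res_gen(2)[OF v(1)] Bb_res_gen(2)[OF uv(1)] uv(3))
   qed }
 qed
qed

end

subsection \<open>Bimodule maps out of a free bimodule are cochains\<close>

context pbim
begin

lemma Fk_lact:
 assumes \<phi>: "coch sw M n \<phi>" and D: "gd n X P Q us A xs b g" and b': "b' \<in> arr X" "dm b' = Q"
 shows "Fk M \<phi> X us A xs (cp X b' b) g = laM M X P b' (Fk M \<phi> X us A xs b g)"
 using D
proof (cases rule: gd_ConsE)
 case h: (gd v vs Z Y E)
 have "\<phi> Z vs A xs \<in> car M Z (star vs A) (foA (co Z vs) E)" using \<phi> h by (auto simp: coch_def)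
 then have "res M v (star vs A) (foA (co Z vs) E) (\<phi> Z vs A xs) \<in> car M X (cd g) (foA v (foA (co Z vs) E))"
  using res_car[of v "star vs A" "foA (co Z vs) E"] h by auto
 then have r: "raM M X g (foA v (foA (co Z vs) E)) (res M v (star vs A) (foA (co Z vs) E) (\<phi> Z vs A xs)) \<in>
   car M X P (dm (cp X b (tws (co Z vs) v E)))"
  using ra_car[OF h(15,12)] fob_obj[OF h(2), of "foA (co Z vs) E"] h by auto
 have "cp X (cp X b' b) (tws (co Z vs) v E) = cp X b' (cp X b (tws (co Z vs) v E))"
  using h b' by (intro cp_assoc) auto
 then show ?thesis
  unfolding Fk_def h(1) Let_def list.sel h(4,8,13)
  using la_cp[OF h(15) _ b'(1) _ h(17) r] h b' by simp
qed

lemma Fk_ract: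
 assumes \<phi>: "coch sw M n \<phi>" and D: "gd n X P Q us A xs b g" and a: "a \<in> arr X" "cd a = P"
 shows "Fk M \<phi> X us A xs b (cp X g a) = raM M X a Q (Fk M \<phi> X us A xs b g)"
 using D
proof (cases rule: gd_ConsE)
 case h: (gd v vs Z Y E)
 let ?E = "foA v (foA (co Z vs) E)"
 let ?y = "res M v (star vs A) (foA (co Z vs) E) (\<phi> Z vs A xs)"
 have vE: "?E \<in> obA X" using fob_obj[OF h(2), of "foA (co Z vs) E"] h by auto
 have "\<phi> Z vs A xs \<in> car M Z (star vs A) (foA (co Z vs) E)" using \<phi> h by (auto simp: coch_def)
 then have y: "?y \<in> car M X (cd g) ?E"
  using res_car[of v "star vs A" "foA (co Z vs) E"] h by auto
 have bt: "cp X b (tws (co Z vs) v E) \<in> arr X" using h by simp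
 have "raM M X (cp X g a) ?E ?y = raM M X a ?E (raM M X g ?E ?y)"
  using ra_cp[OF h(15) a(1) h(12) _ vE y] a h by simp
 then show ?thesis
  unfolding Fk_def h(1) Let_def list.sel h(4,8,13)
  using ra_la[OF h(15) a(1) bt, of "raM M X g ?E ?y"] ra_car[OF h(15,12) vE y] h a by simp
qed

text \<open>Both sides restrict \<open>\<phi>\<close> of the tail of the path along \<open>v u\<close>, once in one step and once in two; the two differ by a twist
 because \<open>M\<close> is a bimodule over a prestack, and coherence moves that twist into \<open>b\<close>.\<close>

lemma Fk_res:
 assumes \<phi>: "coch sw M n \<phi>" and D: "gd n (tgU u) P Q us A xs b g" and u: "u \<in> ArU"
 shows "Fk M \<phi> (srU u) (rs u us) A xs (rb u us A xs b) (rg u us A g) = res M u P Q (Fk M \<phi> (tgU u) us A xs b g)"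
 using D
proof (rule gd_ConsE)
 fix v vs Z Y E
 define X where "X = tgU u"
 define W where "W = srU u"
 define T where "T = co Z vs"
 define F where "F = foA T E"
 define B where "B = star vs A"
 assume "us = v # vs" "v \<in> ArU" "srU v = tgU u" "tgU v = Z" "pth Z vs Y" "length vs + length xs = n"
  "chain Y A xs E" "endo A xs = E" "b \<in> arr (tgU u)" "dm b = foA (cmU (co Z vs) v) E" "cd b = Q"
  "g \<in> arr (tgU u)" "dm g = P" "cd g = foA v (star vs A)" "tgU u \<in> ObU" "P \<in> obA (tgU u)"
  "star vs A \<in> obA Z" "foA (co Z vs) E \<in> obA Z"
  "tws (co Z vs) v E \<in> arr (tgU u)" "dm (tws (co Z vs) v E) = foA v (foA (co Z vs) E)"
  "co Z vs \<in> ArU" "srU (co Z vs) = Z" "tgU (co Z vs) = Y" "E \<in> obA Y"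
 note h = this[folded X_def T_def, folded F_def B_def]
 have W: "W \<in> ObU" using src_Ob[OF u] by (simp add: W_def)
 have vu: "cmU v u \<in> ArU" "srU (cmU v u) = W" "tgU (cmU v u) = Z"
  using h u by (simp_all add: cmp_Ar src_cmp tgt_cmp X_def W_def)
 have Tv: "cmU T v \<in> ArU" "srU (cmU T v) = X" "tgU (cmU T v) = Y"
  using h by (simp_all add: cmp_Ar src_cmp tgt_cmp)
 define y where "y = \<phi> Z vs A xs"
 have y: "y \<in> car M Z B F" using \<phi> h unfolding y_def F_def B_def T_def by (auto simp: coch_def)
 have vF: "foA v F \<in> obA X" "foA v B \<in> obA X" using fob_obj[OF h(2), of F] fob_obj[OF h(2), of B] h by auto
 have ry: "res M v B F y \<in> car M X (foA v B) (foA v F)" using res_car[OF h(2), of B F y] h y by auto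
 define z where "z = raM M X g (foA v F) (res M v B F y)"
 have z: "z \<in> car M X P (foA v F)" using ra_car[OF h(15,12) vF(1)] ry h unfolding z_def by auto
 define w where "w = res M u (foA v B) (foA v F) (res M v B F y)"
 have w: "w \<in> car M W (foA u (foA v B)) (foA u (foA v F))"
  using res_car[OF u, of "foA v B" "foA v F"] ry vF unfolding w_def W_def X_def by auto
 have rz: "res M u P (foA v F) z = raM M W (fn u g) (foA u (foA v F)) w"
  using res_ra[OF u, of g "foA v F" "res M v B F y"] h ry vF unfolding z_def w_def W_def X_def by auto
 have t1: "tws T v E \<in> arr X" by fact
 have bt: "cp X b (tws T v E) \<in> arr X" using h by auto
 have "res M u P Q (laM M X P (cp X b (tws T v E)) z) = laM M W (foA u P) (fn u (cp X b (tws T v E))) (res M u P (foA v F) z)"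
  using res_la[OF u bt[unfolded X_def] h(16)[unfolded X_def], of z] z h unfolding W_def X_def F_def by auto
 then have R: "res M u P Q (Fk M \<phi> X us A xs b g) = laM M W (foA u P) (fn u (cp X b (tws T v E))) (raM M W (fn u g) (foA u (foA v F)) w)"
  unfolding Fk_def h(1) Let_def list.sel h(4,8,13) T_def[symmetric] F_def[symmetric] B_def[symmetric] y_def[symmetric] z_def[symmetric] rz by simp
 have gu: "fn u g \<in> arr W" using fn_arr[OF u] h unfolding X_def W_def by auto
 have tvB: "tws v u B \<in> arr W" "tws v u F \<in> arr W" using tws_arr[OF h(2) u h(3)[unfolded X_def]] h unfolding W_def by auto
 have ryu: "res M (cmU v u) B F y \<in> car M W (foA (cmU v u) B) (foA (cmU v u) F)"
  using res_car[OF vu(1), of B F y] vu h y by auto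
 have vuF: "foA (cmU v u) F \<in> obA W" using fob_obj[OF vu(1), of F] vu h by auto
 have "raM M W (rg u us A g) (foA (cmU v u) F) (res M (cmU v u) B F y) =
   raM M W (fn u g) (foA (cmU v u) F) (raM M W (tws v u B) (foA (cmU v u) F) (res M (cmU v u) B F y))"
  unfolding rg_def h(1) list.sel W_def[symmetric] B_def[symmetric]
  using ra_cp[OF W gu tvB(1) _ vuF ryu[folded cd_tws[of v u B]]] h by simp
 also have "raM M W (tws v u B) (foA (cmU v u) F) (res M (cmU v u) B F y) = laM M W (foA u (foA v B)) (tws v u F) w"
  using res_tws[OF h(2) u h(3)[unfolded X_def], of B F y] h y unfolding w_def W_def by auto
 also have "raM M W (fn u g) (foA (cmU v u) F) ... = laM M W (foA u P) (tws v u F) (raM M W (fn u g) (foA u (foA v F)) w)"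
  using ra_la[OF W gu tvB(2), of w] w h by simp
 finally have 1: "raM M W (rg u us A g) (foA (cmU v u) F) (res M (cmU v u) B F y) =
  laM M W (foA u P) (tws v u F) (raM M W (fn u g) (foA u (foA v F)) w)" .
 have uP: "foA u P \<in> obA W" using fob_obj[OF u] h unfolding X_def W_def by auto
 have ww: "raM M W (fn u g) (foA u (foA v F)) w \<in> car M W (foA u P) (foA u (foA v F))"
  using ra_car[OF W gu, of "foA u (foA v F)" w] w h arrD(1)[OF tvB(2)] by auto
 note rbt = rb_typ[of u us Y A xs E b]
 have p: "pth (tgU u) us Y" using h unfolding X_def by simp
 have cous: "co (tgU u) us = cmU T v" by (simp add: h(1,4) T_def)
 have rbt: "rb u us A xs b \<in> arr W" "dm (rb u us A xs b) = foA (cmU (cmU T v) u) E" "cd (rb u us A xs b) = foA u Q"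
  using rb_typ[OF p u h(7) h(9)[unfolded X_def]] cous h unfolding W_def by auto
 have ass: "cmU (cmU T v) u = cmU T (cmU v u)" using h u by (intro cmp_assoc) (auto simp: X_def)
 have t2: "tws T (cmU v u) E \<in> arr W" using tws_arr[OF h(21) vu(1), of E] vu h by auto
 have t3: "tws (cmU T v) u E \<in> arr W" using tws_arr[OF Tv(1) u, of E] Tv h unfolding W_def X_def by auto
 note ti = twi[OF Tv(1) u, of E, unfolded Tv X_def, OF refl h(24), folded W_def]
 have fb: "fn u b \<in> arr W" "fn u (tws T v E) \<in> arr W" using fn_arr[OF u, of b] fn_arr[OF u, of "tws T v E"] h t1 unfolding X_def W_def by auto
 have "cp W (cp W (rb u us A xs b) (tws T (cmU v u) E)) (tws v u F) = cp W (rb u us A xs b) (cp W (tws T (cmU v u) E) (tws v u F))"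
  using W rbt t2 tvB ass by (intro cp_assoc) (auto simp: F_def)
 also have "cp W (tws T (cmU v u) E) (tws v u F) = cp W (tws (cmU T v) u E) (fn u (tws T v E))"
  using tws_coherence[OF h(21,2) u, of E] h unfolding F_def W_def X_def by auto
 also have "cp W (rb u us A xs b) ... = cp W (fn u b) (cp W (twi (cmU T v) u E) (cp W (tws (cmU T v) u E) (fn u (tws T v E))))"
  unfolding rb_def cous W_def[symmetric] h(8) using W fb t3 ti h by (intro cp_assoc) auto
 also have "cp W (twi (cmU T v) u E) (cp W (tws (cmU T v) u E) (fn u (tws T v E))) =
   cp W (cp W (twi (cmU T v) u E) (tws (cmU T v) u E)) (fn u (tws T v E))"
  using W fb t3 ti by (intro cp_assoc[symmetric]) auto
 also have "... = fn u (tws T v E)" unfolding ti(4) using W fb by simp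
 also have "cp W (fn u b) (fn u (tws T v E)) = fn u (cp X b (tws T v E))"
  unfolding W_def X_def using h t1 u by (intro fn_cp[symmetric]) (auto simp: X_def)
 finally have 2: "cp W (cp W (rb u us A xs b) (tws T (cmU v u) E)) (tws v u F) = fn u (cp X b (tws T v E))" .
 have rsu: "rs u us = cmU v u # vs" by (simp add: rs_def h(1))
 have drg: "dm (rg u us A g) = foA u P" using h by (simp add: rg_def)
 have "Fk M \<phi> W (rs u us) A xs (rb u us A xs b) (rg u us A g) =
  laM M W (foA u P) (cp W (rb u us A xs b) (tws T (cmU v u) E)) (laM M W (foA u P) (tws v u F) (raM M W (fn u g) (foA u (foA v F)) w))"
  unfolding Fk_def rsu Let_def list.sel vu(3) h(8) T_def[symmetric] F_def[symmetric] B_def[symmetric] y_def[symmetric] drg 1 ..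
 also have "... = laM M W (foA u P) (cp W (cp W (rb u us A xs b) (tws T (cmU v u) E)) (tws v u F)) (raM M W (fn u g) (foA u (foA v F)) w)"
  using la_cp[OF W tvB(2) _ _ uP, of "cp W (rb u us A xs b) (tws T (cmU v u) E)" "raM M W (fn u g) (foA u (foA v F)) w"]
   ww W rbt t2 ass by (simp add: F_def)
 finally show ?thesis unfolding 2 R[symmetric] unfolding W_def X_def .
qed

lemma Fk_idn:
 assumes \<phi>: "coch sw M n \<phi>" and us: "pth X us Y" "chain Y A xs E" "length us + length xs = n"
 shows "Fk M \<phi> X (idU X # us) A xs (ida X (foA (co X us) E)) (ida X (star us A)) = \<phi> X us A xs"
proof -
 have X: "X \<in> ObU" using pth_Ob[OF us(1)] by simp
 note c = co_Ar[OF us(1)] src_co[OF us(1)] tgt_co[OF us(1)]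
 have E: "E \<in> obA Y" "endo A xs = E" "A \<in> obA Y" using chain_obj[OF us(2)] chain_endo[OF us(2)] by auto
 have o: "star us A \<in> obA X" "foA (co X us) E \<in> obA X" using star_obj[OF us(1) E(3)] fob_obj[OF c(1)] E c by auto
 have y: "\<phi> X us A xs \<in> car M X (star us A) (foA (co X us) E)" using \<phi> us by (auto simp: coch_def)
 have "tws (co X us) (idU X) E = ida X (foA (co X us) E)" using tws_idn_right[OF c(1), of E] c E by simp
 then show ?thesis
  unfolding Fk_def Let_def list.sel tgt_idn[OF X] E(2)
  using X o y by (simp add: fob_idn res_idn ra_ida la_ida)
qed

end

context prestack
begin

lemma Fk_hom:
 assumes f: "f \<in> bhom s1 M s2 N" and M: "bimodA s1 M"
  and \<psi>: "coch s1 M n \<psi>" and D: "gd n X P Q us A xs b g"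
 shows "f X P Q (Fk M \<psi> X us A xs b g) =
  Fk N (%X us A xs. f X (star us A) (foA (co X us) (endo A xs)) (\<psi> X us A xs)) X us A xs b g"
 using D
proof (rule gd_ConsE)
 interpret M: pbim \<U> \<A> s1 M by (rule pbimI[OF M])
 fix v vs Z Y E
 assume h: "us = v # vs" "v \<in> ArU" "srU v = X" "tgU v = Z" "pth Z vs Y" "length vs + length xs = n"
  "chain Y A xs E" "endo A xs = E" "b \<in> arr X" "dm b = foA (cmU (co Z vs) v) E" "cd b = Q"
  "g \<in> arr X" "dm g = P" "cd g = foA v (star vs A)" "X \<in> ObU" "P \<in> obA X"
  "star vs A \<in> obA Z" "foA (co Z vs) E \<in> obA Z"
  "tws (co Z vs) v E \<in> arr X" "dm (tws (co Z vs) v E) = foA v (foA (co Z vs) E)"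
 let ?E = "foA v (foA (co Z vs) E)"
 have y: "\<psi> Z vs A xs \<in> car M Z (star vs A) (foA (co Z vs) E)" using \<psi> h by (auto simp: coch_def)
 then have r: "res M v (star vs A) (foA (co Z vs) E) (\<psi> Z vs A xs) \<in> car M X (cd g) ?E"
  using M.res_car[of v "star vs A" "foA (co Z vs) E"] h by auto
 have vE: "?E \<in> obA X" using fob_obj[OF h(2), of "foA (co Z vs) E"] h by auto
 note z = M.ra_car[OF h(15,12) vE r]
 have bt: "cp X b (tws (co Z vs) v E) \<in> arr X" "dm (cp X b (tws (co Z vs) v E)) = ?E" "cd (cp X b (tws (co Z vs) v E)) = Q" using h by auto
 note F = bimod_homD[OF f]
 show ?thesis
  unfolding Fk_def h(1) Let_def list.sel h(4,8,13)
  using F(3)[OF h(15) bt(1) h(16)] z F(4)[OF h(15,12) vE r] F(5)[OF h(2), unfolded h(3,4), OF h(17,18) y] h(13,14) bt by simp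
qed

lemma linear_section:
 fixes s1 :: "'k => 'x => 'x::ab_group_add" and s2 :: "'k => 'y => 'y::ab_group_add"
 assumes v: "vector_space s1" "vector_space s2" and X: "module.subspace s1 X" and Y: "module.subspace s2 Y"
  and f: "linear_from s1 s2 X f" "f ` X = Y"
 obtains r where "linear_from s2 s1 Y r" "!!y. y \<in> Y ==> r y \<in> X" "!!y. y \<in> Y ==> f (r y) = y"
proof -
 interpret v1: vector_space s1 by (rule v)
 interpret v2: vector_space s2 by (rule v)
 interpret p: vector_space_pair s2 s1 ..
 obtain B where B: "B \<subseteq> Y" "~ v2.dependent B" "Y \<subseteq> v2.span B" using v2.maximal_independent_subset by blast
 have "\<forall>y\<in>B. \<exists>x\<in>X. f x = y" using B f(2) by blast
 then obtain p where p: "!!y. y \<in> B ==> p y \<in> X & f (p y) = y" by metis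
 obtain r where r: "Vector_Spaces.linear s2 s1 r" "\<forall>x\<in>B. r x = p x" using p.linear_independent_extend[OF B(2)] by blast
 interpret r: Vector_Spaces.linear s2 s1 r by (rule r(1))
 have "r y \<in> X & f (r y) = y" if "y \<in> v2.span B" for y
  using that
 proof (induction rule: v2.span_induct_alt)
  case base
  show ?case using lin_0[OF f(1) v(1) X] v1.subspace_0[OF X] by (simp add: r.zero)
 next
  case (step c x y)
  then show ?case
   using p r(2) linear_fromD[OF f(1)] v1.subspace_add[OF X] v1.subspace_scale[OF X] by (simp add: r.add r.scale)
 qed
 then show thesis using that[of r] lin_linear[OF r(1)] B(3) by blast
qed

end

context prestack_universe
begin

text \<open>The bimodule map with prescribed values at the generators.\<close>

definition hg where
 "hg n sw K U A B x = (if U \<in> ObU & A \<in> obA U & B \<in> obA U & x \<in> Bc n U A B then lex n U A B sw (K U) x else 0)"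

lemma hg_gen:
 assumes "vector_space sw" "mlK n X P Q sw (K X)" "gd n X P Q us A xs b g"
 shows "hg n sw K X P Q (gen us A xs b g) = K X us A xs b g"
 using gd_Ob[OF assms(3)] gen_Bc[OF assms(3)] lex_gen[OF assms] by (simp add: hg_def)

lemma hg_hom:
 assumes M: "bimodA sw M"
  and ml: "!!X P Q. X \<in> ObU ==> mlK n X P Q sw (K X)"
  and mem: "!!X P Q us A xs b g. gd n X P Q us A xs b g ==> K X us A xs b g \<in> car M X P Q"
  and l: "!!X P Q us A xs b g b'. gd n X P Q us A xs b g ==> b' \<in> arr X ==> dm b' = Q ==>
    K X us A xs (cp X b' b) g = laM M X P b' (K X us A xs b g)"
  and r: "!!X P Q us A xs b g a. gd n X P Q us A xs b g ==> a \<in> arr X ==> cd a = P ==>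
    K X us A xs b (cp X g a) = raM M X a Q (K X us A xs b g)"
  and rs: "!!u P Q us A xs b g. gd n (tgU u) P Q us A xs b g ==> u \<in> ArU ==>
    K (srU u) (rs u us) A xs (rb u us A xs b) (rg u us A g) = res M u P Q (K (tgU u) us A xs b g)"
 shows "hg n sw K \<in> bhom s (Bb n) sw M"
proof (rule bimod_homI)
 interpret M: pbim \<U> \<A> sw M by (rule pbimI[OF M])
 note sw = M.scale_vector_space
 note lin = lex_linear[OF sw ml] and lg = lex_gen[OF sw ml]
 have lm: "lex n U A B sw (K U) x \<in> car M U A B" if "U \<in> ObU" "A \<in> obA U" "B \<in> obA U" "x \<in> Bc n U A B" for U A B x
  using that lex_mem[OF sw ml M.car_subspace mem] by blast
 note comp = lin_comp
 show "hg n sw K U A B x \<in> car M U A B" if "U \<in> ObU" "A \<in> obA U" "B \<in> obA U" "x \<in> car (Bb n) U A B" for U A B x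
  using that lm by (simp add: hg_def)
 show "linear_from s sw (car (Bb n) U A B) (hg n sw K U A B)" if h: "U \<in> ObU" "A \<in> obA U" "B \<in> obA U" for U A B
 proof -
  have "linear_from s sw (Bc n U A B) (hg n sw K U A B) \<longleftrightarrow> linear_from s sw (Bc n U A B) (lex n U A B sw (K U))"
   by (rule lin_cong[OF _ vsS Bc_subspace]) (simp add: hg_def h)
  then show ?thesis using lin[OF h(1)] by simp
 qed
 show "hg n sw K U A (cd b) (laM (Bb n) U A b x) = laM M U A b (hg n sw K U A (dm b) x)"
  if h: "U \<in> ObU" "b \<in> arr U" "A \<in> obA U" "x \<in> car (Bb n) U A (dm b)" for U A b x
 proof -
  have o: "dm b \<in> obA U" "cd b \<in> obA U" using arrD h by auto
  have x: "x \<in> Bc n U A (dm b)" using h by simp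
  have "lex n U A (cd b) sw (K U) (laM (Bb n) U A b x) = laM M U A b (lex n U A (dm b) sw (K U) x)"
  proof (rule Bc_eqI[OF sw comp[OF Bb_la_gen(1)[OF h(2)] UNIV_I lin[OF h(1)]] comp[OF lin[OF h(1)] lm[OF h(1,3) o(1)] M.la_linear[OF h(1,2,3)]] _ x])
   fix us A' xs b0 g assume d: "gd n U A (dm b) us A' xs b0 g"
   show "lex n U A (cd b) sw (K U) (laM (Bb n) U A b (gen us A' xs b0 g)) = laM M U A b (lex n U A (dm b) sw (K U) (gen us A' xs b0 g))"
    using d gd_lact[OF d h(2) refl] by (simp add: Bb_la_gen(2)[OF h(2)] lg[OF h(1)] l[OF d h(2) refl])
  qed
  then show ?thesis using h o Bb_la_gen(3)[OF h(2) x] by (simp add: hg_def)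
 qed
 show "hg n sw K U (dm a) B (raM (Bb n) U a B x) = raM M U a B (hg n sw K U (cd a) B x)"
  if h: "U \<in> ObU" "a \<in> arr U" "B \<in> obA U" "x \<in> car (Bb n) U (cd a) B" for U B a x
 proof -
  have o: "dm a \<in> obA U" "cd a \<in> obA U" using arrD h by auto
  have x: "x \<in> Bc n U (cd a) B" using h by simp
  have "lex n U (dm a) B sw (K U) (raM (Bb n) U a B x) = raM M U a B (lex n U (cd a) B sw (K U) x)"
  proof (rule Bc_eqI[OF sw comp[OF Bb_ra_gen(1)[OF h(2)] UNIV_I lin[OF h(1)]] comp[OF lin[OF h(1)] lm[OF h(1) o(2) h(3)] M.ra_linear[OF h(1,2,3)]] _ x])
   fix us A' xs b0 g assume d: "gd n U (cd a) B us A' xs b0 g"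
   show "lex n U (dm a) B sw (K U) (raM (Bb n) U a B (gen us A' xs b0 g)) = raM M U a B (lex n U (cd a) B sw (K U) (gen us A' xs b0 g))"
    using d gd_ract[OF d h(2) refl] by (simp add: Bb_ra_gen(2)[OF h(2)] lg[OF h(1)] r[OF d h(2) refl])
  qed
  then show ?thesis using h o Bb_ra_gen(3)[OF h(2) x] by (simp add: hg_def)
 qed
 show "hg n sw K (srU u) (foA u A) (foA u B) (res (Bb n) u A B x) = res M u A B (hg n sw K (tgU u) A B x)"
  if h: "u \<in> ArU" "A \<in> obA (tgU u)" "B \<in> obA (tgU u)" "x \<in> car (Bb n) (tgU u) A B" for u A B x
 proof -
  have x: "x \<in> Bc n (tgU u) A B" using h by simp
  note t = tgt_Ob[OF h(1)] and sO = src_Ob[OF h(1)]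
  have "lex n (srU u) (foA u A) (foA u B) sw (K (srU u)) (res (Bb n) u A B x) = res M u A B (lex n (tgU u) A B sw (K (tgU u)) x)"
  proof (rule Bc_eqI[OF sw comp[OF Bb_res_gen(1)[OF h(1)] UNIV_I lin[OF sO]] comp[OF lin[OF t] lm[OF t h(2,3)] M.res_linear[OF h(1-3)]] _ x])
   fix us A' xs b0 g assume d: "gd n (tgU u) A B us A' xs b0 g"
   show "lex n (srU u) (foA u A) (foA u B) sw (K (srU u)) (res (Bb n) u A B (gen us A' xs b0 g)) =
     res M u A B (lex n (tgU u) A B sw (K (tgU u)) (gen us A' xs b0 g))"
    using d gd_res[OF d h(1)] by (simp add: Bb_res_gen(2)[OF h(1)] lg[OF t] lg[OF sO] rs[OF d h(1)])
  qed
  then show ?thesis using h t sO Bb_res_gen(3)[OF h(1) x] by (simp add: hg_def fob_obj)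
 qed
 show "hg n sw K U A B x = 0" if "~ (U \<in> ObU & A \<in> obA U & B \<in> obA U & x \<in> car (Bb n) U A B)" for U A B x
  using that by (auto simp: hg_def)
qed

lemma hom_eqI:
 assumes "bimodA sw M" "f \<in> bhom s (Bb n) sw M" "f' \<in> bhom s (Bb n) sw M"
  and "!!X P Q us A xs b g. gd n X P Q us A xs b g ==> f X P Q (gen us A xs b g) = f' X P Q (gen us A xs b g)"
 shows "f = f'"
proof (intro ext)
 fix U A B x
 interpret M: pbim \<U> \<A> sw M by (rule pbimI[OF assms(1)])
 show "f U A B x = f' U A B x"
 proof (cases "U \<in> ObU & A \<in> obA U & B \<in> obA U & x \<in> car (Bb n) U A B")
  case True
  then show ?thesis
   using Bc_eqI[where f = "f U A B" and h = "f' U A B", OF M.scale_vector_space _ _ assms(4)] bimod_homD(2)[OF assms(2), of U A B] bimod_homD(2)[OF assms(3), of U A B] by auto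
 next
  case False
  then show ?thesis using bimod_homD(6)[OF assms(2) False] bimod_homD(6)[OF assms(3) False] by simp
 qed
qed

lemma hg_Fk_hom:
 assumes M: "bimodA sw M" and \<phi>: "coch sw M n \<phi>"
 shows "hg n sw (Fk M \<phi>) \<in> bhom s (Bb n) sw M"
proof -
 interpret M: pbim \<U> \<A> sw M by (rule pbimI[OF M])
 show ?thesis
  by (rule hg_hom[OF M M.mlK_Fk[OF \<phi>] M.Fk_mem[OF \<phi>] M.Fk_lact[OF \<phi>] M.Fk_ract[OF \<phi>] M.Fk_res[OF \<phi>]])
qed

text \<open>The free generators.  They form a cochain with values in \<open>Bb n\<close>, the universal one.\<close>

definition ug :: "'u => 'm list => 'a => ('a, 'h) mor list => 'v" where
 "ug X us A xs = gen (idU X # us) A xs (ida X (foA (co X us) (endo A xs))) (ida X (star us A))"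

lemma gd_ug:
 assumes us: "pth X us Y" "chain Y A xs E" "length us + length xs = n"
 shows "gd n X (star us A) (foA (co X us) E) (idU X # us) A xs (ida X (foA (co X us) E)) (ida X (star us A))"
proof -
 have X: "X \<in> ObU" using pth_Ob[OF us(1)] by simp
 note c = co_Ar[OF us(1)] src_co[OF us(1)] tgt_co[OF us(1)]
 have E: "E \<in> obA Y" "endo A xs = E" "A \<in> obA Y" using chain_obj[OF us(2)] chain_endo[OF us(2)] by auto
 have o: "star us A \<in> obA X" "foA (co X us) E \<in> obA X" using star_obj[OF us(1) E(3)] fob_obj[OF c(1)] E c by auto
 have "cmU (co X us) (idU X) = co X us" using cmp_idn_right[OF c(1)] c by simp
 then show ?thesis
  by (intro gdI[of _ _ Y _ _ _ E]) (use us X o in \<open>auto simp: idn_Ar src_idn tgt_idn fob_idn\<close>)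
qed

lemma ug_combination:
 assumes us: "pth X us Y" "chain Y A xs E" and l: "lcl Y c xs xs' xs''"
 shows "ug X us A xs'' = ug X us A xs + s c (ug X us A xs')"
proof -
 have Y: "Y \<in> ObU" "X \<in> ObU" using pth_Ob[OF us(1)] by auto
 have en: "endo A xs = E" "endo A xs' = E" "endo A xs'' = E" using lcl_chain[OF l Y(1) us(2)] us(2) chain_endo by auto
 have p: "pth X (idU X # us) Y" using us Y by (simp add: idn_Ar src_idn tgt_idn)
 show ?thesis unfolding ug_def en
  by (rule mlKD[OF mlK_gen gd_ug[OF us refl] p]) (use l in \<open>auto simp: lcd_def\<close>)
qed

lemma coch_ug: "coch s (Bb n) n ug"
 unfolding coch_def
proof (intro allI impI conjI)
 fix X us Y A xs E assume us: "pth X us Y" "length us + length xs = n" "chain Y A xs E"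
 show "ug X us A xs \<in> car (Bb n) X (star us A) (foA (co X us) E)"
  using gen_Bc[OF gd_ug[OF us(1,3,2)]] chain_endo[OF us(3)] by (simp add: ug_def)
 show "ug X us A xs'' = ug X us A xs + s c (ug X us A xs')" if "lcl Y c xs xs' xs''" for c xs' xs''
  by (rule ug_combination[OF us(1,3) that])
qed

text \<open>Every generator arises from a free one: restrict along the first arrow of the path, then act by \<open>b\<close>, corrected by
 a twist, and by \<open>g\<close>.\<close>

lemma gen_Fk_ug:
 assumes D: "gd n X P Q us A xs b g"
 shows "gen us A xs b g = Fk (Bb n) ug X us A xs b g"
 using D
proof (cases rule: gd_ConsE)
 case h: (gd v vs Z Y E)
 let ?F = "foA (co Z vs) E"
 have vF: "foA v ?F \<in> obA X" "foA v (star vs A) \<in> obA X"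
  using fob_obj[OF h(2), of ?F] fob_obj[OF h(2), of "star vs A"] h by auto
 note d0 = gd_ug[OF h(5,7,6)]
 note d1 = gd_res[OF d0[folded h(4)] h(2), unfolded h(3)]
 have coi: "co Z (idU Z # vs) = co Z vs" using cmp_idn_right[OF h(19)] h(16,20) by (simp add: tgt_idn)
 note ti = twi[OF h(19) h(2), of E, unfolded h(3,20,21), OF h(4)[symmetric] h(24)]
 have 1: "rs v (idU Z # vs) = v # vs" "rb v (idU Z # vs) A xs (ida Z ?F) = twi (co Z vs) v E"
  "rg v (idU Z # vs) A (ida Z (star vs A)) = ida X (foA v (star vs A))"
  using fn_ida[OF h(2), of ?F] fn_ida[OF h(2), of "star vs A"] tws_idn_left[OF h(2), of "star vs A"] cmp_idn_left[OF h(2)] h vF ti coi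
  by (simp_all add: rs_def rb_def rg_def del: composite.simps)
 have r: "res (Bb n) v (star vs A) ?F (ug Z vs A xs) = gen (v # vs) A xs (twi (co Z vs) v E) (ida X (foA v (star vs A)))"
  using Bb_res_gen(2)[OF h(2), unfolded h(4), OF d0] 1 by (simp add: ug_def h(8))
 note d1' = d1[unfolded h(4) 1]
 have bt: "cp X b (tws (co Z vs) v E) \<in> arr X" using h by simp
 have d2: "gd n X P (foA v ?F) (v # vs) A xs (twi (co Z vs) v E) (cp X (ida X (foA v (star vs A))) g)"
  using gd_ract[OF d1' h(12)] h by simp
 have "cp X (cp X b (tws (co Z vs) v E)) (twi (co Z vs) v E) = cp X b (cp X (tws (co Z vs) v E) (twi (co Z vs) v E))"
  using h ti by (intro cp_assoc) auto
 also have "... = b" unfolding ti(5) using h by simp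
 finally have e: "cp X (cp X b (tws (co Z vs) v E)) (twi (co Z vs) v E) = b" .
 show ?thesis
  unfolding Fk_def h(1) Let_def list.sel h(4,8,13) r
  using Bb_ra_gen(2)[OF h(12), of n "foA v ?F"] d1' Bb_la_gen(2)[OF bt, of n P] d2 h e by simp
qed

definition ph :: "('u => 'a => 'a => 'v => 'w) => 'u => 'm list => 'a => ('a, 'h) mor list => 'w" where
 "ph f X us A xs = f X (star us A) (foA (co X us) (endo A xs)) (ug X us A xs)"

lemma ph_hom:
 assumes M: "bimodA sw M" and f: "f \<in> bhom s (Bb n) sw M"
 shows coch_ph: "coch sw M n (ph f)"
  and hom_gen: "gd n X P Q us A xs b g ==> f X P Q (gen us A xs b g) = Fk M (ph f) X us A xs b g"
proof -
 interpret M: pbim \<U> \<A> sw M by (rule pbimI[OF M])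
 show "gd n X P Q us A xs b g ==> f X P Q (gen us A xs b g) = Fk M (ph f) X us A xs b g"
  using Fk_hom[OF f bimodule_Bb coch_ug] gen_Fk_ug by (simp add: ph_def[abs_def])
 show "coch sw M n (ph f)"
  unfolding coch_def
 proof (intro allI impI conjI)
  fix X us Y A xs E assume us: "pth X us Y" "length us + length xs = n" "chain Y A xs E"
  have d: "gd n X (star us A) (foA (co X us) E) (idU X # us) A xs (ida X (foA (co X us) E)) (ida X (star us A))"
   by (rule gd_ug[OF us(1,3,2)])
  have O: "X \<in> ObU" "star us A \<in> obA X" "foA (co X us) E \<in> obA X" using gd_Ob[OF d] by auto
  have u: "ug X us A ys \<in> Bc n X (star us A) (foA (co X us) E)" if "chain Y A ys E" "length ys = length xs" for ys
   using coch_ug[of n] us that unfolding coch_def by simp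
  show "ph f X us A xs \<in> car M X (star us A) (foA (co X us) E)"
   using bimod_homD(1)[OF f O] u[OF us(3) refl] chain_endo[OF us(3)] by (simp add: ph_def)
  show "ph f X us A xs'' = ph f X us A xs + sw c (ph f X us A xs')" if l: "lcl Y c xs xs' xs''" for c xs' xs''
  proof -
   have ch: "chain Y A xs' E" "chain Y A xs'' E" "length xs' = length xs"
    using lcl_chain[OF l pth_Ob(2)[OF us(1)] us(3)] lcl_length[OF l] by auto
   show ?thesis
    using lin_combination[OF bimod_homD(2)[OF f O] vsS _ _ _, of "ug X us A xs" "ug X us A xs'" c]
     u[OF us(3) refl] u[OF ch(1,3)] Bc_subspace ug_combination[OF us(1,3) l]
    by (simp add: ph_def chain_endo[OF us(3)] chain_endo[OF ch(1)] chain_endo[OF ch(2)])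
  qed
 qed
qed

lemma ph_hg_Fk:
 assumes M: "bimodA sw M" and \<phi>: "coch sw M n \<phi>"
  and us: "pth X us Y" "chain Y A xs E" "length us + length xs = n"
 shows "ph (hg n sw (Fk M \<phi>)) X us A xs = \<phi> X us A xs"
proof -
 interpret M: pbim \<U> \<A> sw M by (rule pbimI[OF M])
 show ?thesis
  unfolding ph_def ug_def chain_endo[OF us(2)]
  using hg_gen[where K = "Fk M \<phi>", OF M.scale_vector_space M.mlK_Fk[OF \<phi>] gd_ug[OF us]] M.Fk_idn[OF \<phi> us] by simp
qed

text \<open>Lifting along an epimorphism reduces to lifting the corresponding cochain, which is done with linear
 sections.\<close>

lemma projective_Bb: "projective_bimod \<U> \<A> s (Bb n)"
 unfolding projective_bimod_def
proof (intro conjI allI impI)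
 show "bimodA s (Bb n)" by (rule bimodule_Bb)
 fix M N :: "('u, 'm, 'a, 'h, 'v) bimod" and g f
 assume M: "bimodA s M" and N: "bimodA s N" and g: "g \<in> bhom s M s N"
  and surj: "bimod_surj \<U> \<A> M N g" and f: "f \<in> bhom s (Bb n) s N"
 interpret M: pbim \<U> \<A> s M by (rule pbimI[OF M])
 interpret N: pbim \<U> \<A> s N by (rule pbimI[OF N])
 have "\<exists>r. linear_from s s (car N U A B) r & (\<forall>y\<in>car N U A B. r y \<in> car M U A B & g U A B (r y) = y)"
  if h: "U \<in> ObU" "A \<in> obA U" "B \<in> obA U" for U A B
  using linear_section[OF vsS vsS M.car_subspace[OF h] N.car_subspace[OF h] bimod_homD(2)[OF g h]]
   surj[unfolded bimod_surj_def] h by metis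
 then obtain r where r: "!!U A B. U \<in> ObU ==> A \<in> obA U ==> B \<in> obA U ==>
   linear_from s s (car N U A B) (r U A B) & (\<forall>y\<in>car N U A B. r U A B y \<in> car M U A B & g U A B (r U A B y) = y)"
  by metis
 note cf = coch_ph[OF N f]
 define \<psi> where "\<psi> X us A xs = r X (star us A) (foA (co X us) (endo A xs)) (ph f X us A xs)" for X us A xs
 have \<psi>: "coch s M n \<psi>"
  unfolding coch_def
 proof (intro allI impI conjI)
  fix X us Y A xs E assume us: "pth X us Y" "length us + length xs = n" "chain Y A xs E"
  have O: "X \<in> ObU" "star us A \<in> obA X" "foA (co X us) E \<in> obA X" using gd_Ob[OF gd_ug[OF us(1,3,2)]] by auto
  have p: "ph f X us A ys \<in> car N X (star us A) (foA (co X us) E)" if "chain Y A ys E" "length ys = length xs" for ys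
   using cf us that unfolding coch_def by simp
  show "\<psi> X us A xs \<in> car M X (star us A) (foA (co X us) E)"
   using r[OF O] p[OF us(3) refl] chain_endo[OF us(3)] by (simp add: \<psi>_def)
  show "\<psi> X us A xs'' = \<psi> X us A xs + s c (\<psi> X us A xs')" if l: "lcl Y c xs xs' xs''" for c xs' xs''
  proof -
   have ch: "chain Y A xs' E" "chain Y A xs'' E" "length xs' = length xs"
    using lcl_chain[OF l pth_Ob(2)[OF us(1)] us(3)] lcl_length[OF l] by auto
   have "ph f X us A xs'' = ph f X us A xs + s c (ph f X us A xs')" using cf us l unfolding coch_def by blast
   then show ?thesis
    using lin_combination[OF conjunct1[OF r[OF O]] vsS N.car_subspace[OF O] p[OF us(3) refl] p[OF ch(1,3)], of c]
    by (simp add: \<psi>_def chain_endo[OF us(3)] chain_endo[OF ch(1)] chain_endo[OF ch(2)])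
  qed
 qed
 define h where "h = hg n s (Fk M \<psi>)"
 have h: "h \<in> bhom s (Bb n) s M" unfolding h_def by (rule hg_Fk_hom[OF M \<psi>])
 have gen: "g X P Q (h X P Q (gen us A xs b \<gamma>)) = f X P Q (gen us A xs b \<gamma>)" if d: "gd n X P Q us A xs b \<gamma>" for X P Q us A xs b \<gamma>
 proof -
  have "h X P Q (gen us A xs b \<gamma>) = Fk M \<psi> X us A xs b \<gamma>"
   unfolding h_def by (rule hg_gen[where K = "Fk M \<psi>", OF vsS M.mlK_Fk[OF \<psi>] d])
  then have 1: "g X P Q (h X P Q (gen us A xs b \<gamma>)) =
    Fk N (%X us A xs. g X (star us A) (foA (co X us) (endo A xs)) (\<psi> X us A xs)) X us A xs b \<gamma>"
   using Fk_hom[OF g M \<psi> d] by simp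
  show ?thesis
   unfolding 1 hom_gen[OF N f d]
   using d
  proof (cases rule: gd_ConsE)
   case k: (gd v vs Z Y E)
   have O: "Z \<in> ObU" "star vs A \<in> obA Z" "foA (co Z vs) E \<in> obA Z" using gd_Ob[OF gd_ug[OF k(5,7,6)]] by auto
   have "ph f Z vs A xs \<in> car N Z (star vs A) (foA (co Z vs) E)" using cf k unfolding coch_def by simp
   then show "Fk N (%X us A xs. g X (star us A) (foA (co X us) (endo A xs)) (\<psi> X us A xs)) X us A xs b \<gamma> = Fk N (ph f) X us A xs b \<gamma>"
    using r[OF O] by (simp add: Fk_def Let_def k \<psi>_def)
  qed
 qed
 show "\<exists>h\<in>bhom s (Bb n) s M. \<forall>U\<in>ObU. \<forall>A\<in>obA U. \<forall>B\<in>obA U. \<forall>x\<in>car (Bb n) U A B. g U A B (h U A B x) = f U A B x"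
 proof (intro bexI[OF _ h] ballI)
  fix U A B x assume U: "U \<in> ObU" "A \<in> obA U" "B \<in> obA U" "x \<in> car (Bb n) U A B"
  show "g U A B (h U A B x) = f U A B x"
   by (rule Bb_eqI[OF lin_comp[OF bimod_homD(2)[OF h U(1-3), unfolded car_Bb] bimod_homD(1)[OF h U(1-3), unfolded car_Bb] bimod_homD(2)[OF g U(1-3)]]
      bimod_homD(2)[OF f U(1-3), unfolded car_Bb] gen U(4)[unfolded car_Bb]])
 qed
qed

end

section \<open>The free resolution\<close>

context prestack
begin

lemma Dl_lact:
 assumes D: "gd (Suc n) X P Q us A xs b g" and c: "c \<in> arr X" "dm c = Q"
 shows "Dl X K us A xs (cp X c b) g = Dl X (%us A xs b g. K us A xs (cp X c b) g) us A xs b g"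
 using D
proof (cases rule: gdE)
 case h: (gd Y E)
 have 1: "cp X (cp X c b) (fn (co X us) (last xs)) = cp X c (cp X b (fn (co X us) (last xs)))" if "xs ~= []"
  using chain_butlast[OF h(4) that] fn_arr[of "co X us" "last xs"] co_Ar[OF h(1)] src_co[OF h(1)] tgt_co[OF h(1)] h c
  by (intro cp_assoc) auto
 have 2: "cp X (cp X c b) (cut X (take k us) (drop k us) (endo A xs)) = cp X c (cp X b (cut X (take k us) (drop k us) (endo A xs)))"
  if "k \<in> {1..<length us}" for k
 proof -
  have k: "1 \<le> k" "k < length us" using that by auto
  obtain Z Y' where z: "pth X (take k us) Z" "pth Z (drop k us) Y'" "chain Y' A xs (endo A xs)"
   using D k by (rule gd_cutE)
  show ?thesis using cut_arr[OF z(1,2) chain_obj(2)[OF z(3)]] h c by (intro cp_assoc) auto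
 qed
 show ?thesis unfolding Dl_def bd_explicit using 1 2 by (auto intro!: arg_cong2[of _ _ _ _ "(+)"] sum.cong)
qed

lemma Dl_ract:
 assumes D: "gd (Suc n) X P Q us A xs b g" and a: "a \<in> arr X" "cd a = P"
 shows "Dl X K us A xs b (cp X g a) = Dl X (%us A xs b g. K us A xs b (cp X g a)) us A xs b g"
 using D
proof (cases rule: gdE)
 case h: (gd Y E)
 have 1: "cp X (sm us (hd xs)) (cp X g a) = cp X (cp X (sm us (hd xs)) g) a" if "xs ~= []"
  using chain_tl[OF h(4) that] sm_arr[OF h(1)] h a by (intro cp_assoc[symmetric]) auto
 have 2: "cp X (ep j us A) (cp X g a) = cp X (cp X (ep j us A) g) a" if "j < length us - 1" for j
  using ep_arr[OF _ h(1) chain_obj(1)[OF h(4)], of j] that h a by (intro cp_assoc[symmetric]) auto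
 show ?thesis unfolding Dl_def bd_explicit using 1 2 by (auto intro!: arg_cong2[of _ _ _ _ "(+)"] sum.cong)
qed

lemma twi_nat:
 assumes "u \<in> ArU" "v \<in> ArU" "srU u = tgU v" "f \<in> arr (tgU u)"
 shows "cp (srU v) (twi u v (cd f)) (fn (cmU u v) f) = cp (srU v) (fn v (fn u f)) (twi u v (dm f))"
proof -
 let ?c = "cp (srU v)"
 have V: "srU v \<in> ObU" using src_Ob assms by auto
 note i1 = twi[OF assms(1-3) arrD(1)[OF assms(4)]] and i2 = twi[OF assms(1-3) arrD(2)[OF assms(4)]]
 note w1 = tws_arr[OF assms(1-3) arrD(1)[OF assms(4)]] and w2 = tws_arr[OF assms(1-3) arrD(2)[OF assms(4)]]
 have uv: "cmU u v \<in> ArU" "srU (cmU u v) = srU v" "tgU (cmU u v) = tgU u"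
  using assms by (simp_all add: cmp_Ar src_cmp tgt_cmp)
 have f1: "fn (cmU u v) f \<in> arr (srU v)" using fn_arr[OF uv(1)] uv assms by simp
 have f2: "fn v (fn u f) \<in> arr (srU v)" using fn_arr[OF assms(2), of "fn u f"] fn_arr[OF assms(1,4)] assms by simp
 have "?c (twi u v (cd f)) (fn (cmU u v) f) = ?c (twi u v (cd f)) (?c (fn (cmU u v) f) (?c (tws u v (dm f)) (twi u v (dm f))))"
  unfolding i1(5) using f1 V by simp
 also have "?c (fn (cmU u v) f) (?c (tws u v (dm f)) (twi u v (dm f))) = ?c (?c (fn (cmU u v) f) (tws u v (dm f))) (twi u v (dm f))"
  using V f1 w1 i1 by (intro cp_assoc[symmetric]) auto
 also have "?c (fn (cmU u v) f) (tws u v (dm f)) = ?c (tws u v (cd f)) (fn v (fn u f))" by (rule tws_nat[OF assms])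
 also have "?c (?c (tws u v (cd f)) (fn v (fn u f))) (twi u v (dm f)) = ?c (tws u v (cd f)) (?c (fn v (fn u f)) (twi u v (dm f)))"
  using V f2 w2 i1 by (intro cp_assoc) auto
 also have "?c (twi u v (cd f)) ... = ?c (?c (twi u v (cd f)) (tws u v (cd f))) (?c (fn v (fn u f)) (twi u v (dm f)))"
  using V f2 w2 i1 i2 by (intro cp_assoc[symmetric]) auto
 also have "... = ?c (fn v (fn u f)) (twi u v (dm f))" unfolding i2(4) using V f2 i1 by simp
 finally show ?thesis .
qed

lemma twi_cut:
 assumes "t \<in> ArU" "u \<in> ArU" "v \<in> ArU" "srU t = tgU u" "srU u = tgU v" "A \<in> obA (tgU t)"
 shows "cp (srU v) (fn v (tws t u A)) (twi u v (foA t A)) = cp (srU v) (twi (cmU t u) v A) (tws t (cmU u v) A)"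
proof -
 let ?V = "srU v" and ?c = "cp (srU v)"
 have V: "?V \<in> ObU" using src_Ob[OF assms(3)] .
 have tu: "cmU t u \<in> ArU" "srU (cmU t u) = tgU v" "tgU (cmU t u) = tgU t"
  and uv: "cmU u v \<in> ArU" "srU (cmU u v) = ?V" "tgU (cmU u v) = tgU u"
  using assms by (simp_all add: cmp_Ar src_cmp tgt_cmp)
 have At: "foA t A \<in> obA (tgU u)" using fob_obj[OF assms(1,6)] assms(4) by simp
 note i1 = twi[OF assms(2,3,5) At]
 note w1 = tws_arr[OF assms(2,3,5) At]
 note i2 = twi[OF tu(1) assms(3) tu(2), unfolded tu(3), OF assms(6)]
 note w2 = tws_arr[OF tu(1) assms(3) tu(2), unfolded tu(3), OF assms(6)]
 note w3 = tws_arr[OF assms(1) uv(1) assms(4)[folded uv(3)] assms(6), unfolded uv(2)]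
 have f: "fn v (tws t u A) \<in> arr ?V" using fn_arr[OF assms(3), of "tws t u A"] tws_arr[OF assms(1,2,4,6)] assms(5) by simp
 have ass: "cmU t (cmU u v) = cmU (cmU t u) v" using cmp_assoc[OF assms(1-5)] by simp
 have "?c (fn v (tws t u A)) (twi u v (foA t A)) =
   ?c (?c (twi (cmU t u) v A) (tws (cmU t u) v A)) (?c (fn v (tws t u A)) (twi u v (foA t A)))"
  unfolding i2(4) using V f i1 by simp
 also have "... = ?c (twi (cmU t u) v A) (?c (tws (cmU t u) v A) (?c (fn v (tws t u A)) (twi u v (foA t A))))"
  using V f i1 i2 w2 by (intro cp_assoc) auto
 also have "?c (tws (cmU t u) v A) (?c (fn v (tws t u A)) (twi u v (foA t A))) =
   ?c (?c (tws (cmU t u) v A) (fn v (tws t u A))) (twi u v (foA t A))"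
  using V f i1 w2 by (intro cp_assoc[symmetric]) auto
 also have "?c (tws (cmU t u) v A) (fn v (tws t u A)) = ?c (tws t (cmU u v) A) (tws u v (foA t A))"
  by (rule tws_coherence[OF assms, symmetric])
 also have "?c ... (twi u v (foA t A)) = ?c (tws t (cmU u v) A) (?c (tws u v (foA t A)) (twi u v (foA t A)))"
  using V w1 w3 i1 by (intro cp_assoc) auto
 also have "... = tws t (cmU u v) A" unfolding i1(5) using V w3 by simp
 finally show ?thesis .
qed

text \<open>Naturality of the twist, in the form in which it moves a morphism past \<open>rg\<close>.\<close>

lemma tws_fn_cp:
 assumes t: "t \<in> ArU" and u: "u \<in> ArU" "srU t = tgU u" and x: "x \<in> arr (tgU t)" and g: "g \<in> arr (tgU u)" "cd g = foA t (dm x)"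
 shows "cp (srU u) (fn (cmU t u) x) (cp (srU u) (tws t u (dm x)) (fn u g)) = cp (srU u) (tws t u (cd x)) (fn u (cp (tgU u) (fn t x) g))"
proof -
 have W: "srU u \<in> ObU" by (rule src_Ob[OF u(1)])
 have tu: "cmU t u \<in> ArU" "srU (cmU t u) = srU u" "tgU (cmU t u) = tgU t" using t u by (simp_all add: cmp_Ar src_cmp tgt_cmp)
 have f: "fn (cmU t u) x \<in> arr (srU u)" "fn t x \<in> arr (tgU u)" "fn u (fn t x) \<in> arr (srU u)" "fn u g \<in> arr (srU u)"
  using fn_arr[OF tu(1), of x] tu x fn_arr[OF t x] u fn_arr[OF u(1), of "fn t x"] fn_arr[OF u(1) g(1)] by simp_all
 have w: "tws t u (dm x) \<in> arr (srU u)" "tws t u (cd x) \<in> arr (srU u)" using tws_arr[OF t u] arrD[OF x] by simp_all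
 have "cp (srU u) (fn (cmU t u) x) (cp (srU u) (tws t u (dm x)) (fn u g)) = cp (srU u) (cp (srU u) (fn (cmU t u) x) (tws t u (dm x))) (fn u g)"
  using W f w g by (intro cp_assoc[symmetric]) auto
 also have "... = cp (srU u) (tws t u (cd x)) (cp (srU u) (fn u (fn t x)) (fn u g))"
  unfolding tws_nat[OF t u x] using W f w g by (intro cp_assoc) auto
 also have "cp (srU u) (fn u (fn t x)) (fn u g) = fn u (cp (tgU u) (fn t x) g)"
  using fn_cp[OF u(1), of g "fn t x"] f g by simp
 finally show ?thesis .
qed

text \<open>Chain terms and the first face of the path commute with restriction by naturality of the twists, or by their
 coherence when the twist of \<open>rg\<close> meets that of a face; the cuts use coherence for the inverse twist in \<open>rb\<close>.\<close>

lemma Dl_res: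
 assumes D: "gd (Suc n) (tgU u) P Q us A xs b g" and u: "u \<in> ArU"
 shows "Dl (srU u) K (rs u us) A xs (rb u us A xs b) (rg u us A g) =
   Dl (tgU u) (%us A xs b g. K (rs u us) A xs (rb u us A xs b) (rg u us A g)) us A xs b g"
 using D
proof (rule gdE)
 fix Y E
 define X where "X = tgU u"
 define W where "W = srU u"
 assume "pth (tgU u) us Y" "us ~= []" "length us + length xs = Suc (Suc n)" "chain Y A xs E"
  "b \<in> arr (tgU u)" "dm b = foA (co (tgU u) us) E" "cd b = Q" "g \<in> arr (tgU u)" "dm g = P" "cd g = star us A"
  "lstU (tgU u) us = Y" "endo A xs = E" "tgU u \<in> ObU"
 note h = this[folded X_def]
 note D = D[folded X_def]
 have W: "W \<in> ObU" using src_Ob[OF u] by (simp add: W_def)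
 obtain t ts where us: "us = t # ts" using h(2) by (cases us) auto
 have t: "t \<in> ArU" "srU t = tgU u" "pth (tgU t) ts Y" using h(1) by (auto simp: us X_def)
 have AE: "A \<in> obA Y" "E \<in> obA Y" using chain_obj[OF h(4)] by auto
 note r = rs[OF h(1)[unfolded X_def] h(2) u, folded X_def W_def]
 define T where "T = co X us"
 have T: "T \<in> ArU" "srU T = tgU u" "tgU T = Y" using co_Ar[OF h(1)] src_co[OF h(1)] tgt_co[OF h(1)] by (simp_all add: T_def X_def)
 have Tu: "cmU T u \<in> ArU" "srU (cmU T u) = W" "tgU (cmU T u) = Y" using T u by (simp_all add: cmp_Ar src_cmp tgt_cmp W_def)
 have lo: "lstU W (rs u us) = Y" using r(1) pth_iff by simp
 have cor: "co W (rs u us) = cmU T u" using r(2) by (simp add: T_def)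
 have rbE: "rb u us A xs b = cp W (fn u b) (twi T u E)" by (simp add: rb_def h(12) T_def X_def W_def)
 have fb: "fn u b \<in> arr W" using fn_arr[OF u] h(5) by (simp add: X_def W_def)
 have fg: "fn u g \<in> arr W" using fn_arr[OF u] h(8) by (simp add: X_def W_def)
 note tiE = twi[OF T(1) u T(2), of E, unfolded T(3), OF AE(2), folded W_def]
 have 1: "cp W (rb u us A xs b) (fn (cmU T u) (last xs)) = rb u us A (butlast xs) (cp X b (fn T (last xs)))"
  if ne: "xs ~= []"
 proof -
  note cb = chain_butlast[OF h(4) ne]
  note tiB = twi[OF T(1) u T(2), of "dm (last xs)", unfolded T(3), OF arrD(1)[OF cb(2)], folded W_def]
  have fT: "fn T (last xs) \<in> arr X" using fn_arr[OF T(1), of "last xs"] T cb by (simp add: X_def)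
  have fTu: "fn (cmU T u) (last xs) \<in> arr W" using fn_arr[OF Tu(1), of "last xs"] Tu cb by simp
  have fuT: "fn u (fn T (last xs)) \<in> arr W" using fn_arr[OF u] fT by (simp add: X_def W_def)
  have "cp W (rb u us A xs b) (fn (cmU T u) (last xs)) = cp W (fn u b) (cp W (twi T u E) (fn (cmU T u) (last xs)))"
   unfolding rbE using W fb fTu tiE cb h by (intro cp_assoc) (auto simp: T_def)
  also have "cp W (twi T u E) (fn (cmU T u) (last xs)) = cp W (fn u (fn T (last xs))) (twi T u (dm (last xs)))"
   using twi_nat[OF T(1) u T(2), of "last xs"] T cb by (simp add: W_def)
  also have "cp W (fn u b) ... = cp W (cp W (fn u b) (fn u (fn T (last xs)))) (twi T u (dm (last xs)))"
   using W fb fuT tiB cb h by (intro cp_assoc[symmetric]) (auto simp: T_def)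
  also have "cp W (fn u b) (fn u (fn T (last xs))) = fn u (cp X b (fn T (last xs)))"
   using fn_cp[OF u, of "fn T (last xs)" b] fT h cb by (simp add: X_def W_def T_def)
  finally show ?thesis using chain_endo[OF cb(1)] by (simp add: rb_def T_def X_def W_def)
 qed
 have 2: "endo A (mg Y i xs) = E" if "i < length xs - 1" for i
  using chain_endo[OF chain_mg[OF pth_Ob(2)[OF h(1)] h(4), of i]] that by simp
 have 3: "cp W (sm (rs u us) (hd xs)) (rg u us A g) = rg u us (cd (hd xs)) (cp X (sm us (hd xs)) g)" if ne: "xs ~= []"
 proof -
  note ct = chain_tl[OF h(4) ne]
  define x where "x = sm ts (hd xs)"
  have x: "x \<in> arr (tgU t)" "dm x = star ts A" "cd x = star ts (cd (hd xs))" using sm_arr[OF t(3) ct(2)] ct by (simp_all add: x_def)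
  have gx: "cd g = foA t (dm x)" using h by (simp add: us x)
  have "cp W (sm (rs u us) (hd xs)) (rg u us A g) = cp W (fn (cmU t u) x) (cp W (tws t u (dm x)) (fn u g))"
   by (simp add: rs_def rg_def us x_def[symmetric] x W_def)
  also have "... = cp W (tws t u (cd x)) (fn u (cp X (fn t x) g))"
   using tws_fn_cp[OF t(1) u t(2) x(1) _ gx] h by (simp add: X_def W_def)
  finally show ?thesis by (simp add: rg_def us x_def[symmetric] x W_def)
 qed
 have 4: "fc j (rs u us) = rs u (fc j us) & rb u (fc j us) A xs b = rb u us A xs b &
   cp W (ep j (rs u us) A) (rg u us A g) = rg u (fc j us) A (cp X (ep j us A) g)" if j: "j < length us - 1" for j
 proof -
  obtain v ts' where ts: "ts = v # ts'" using j by (cases ts) (auto simp: us)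
  have v: "v \<in> ArU" "srU v = tgU t" "pth (tgU v) ts' Y" using t by (auto simp: ts)
  have rbj: "rb u (fc j us) A xs b = rb u us A xs b"
   using fc_co[OF _ h(1), of j] j by (simp add: rb_def X_def)
  define B where "B = star ts' A"
  have B: "B \<in> obA (tgU v)" using star_obj[OF v(3) AE(1)] by (simp add: B_def)
  show ?thesis
  proof (cases j)
   case 0
   have "cmU v (cmU t u) = cmU (cmU v t) u" using cmp_assoc[OF v(1) t(1) u v(2) t(2)] by simp
   then have f: "fc j (rs u us) = rs u (fc j us)" by (simp add: 0 rs_def us ts)
   have tu: "cmU t u \<in> ArU" "srU (cmU t u) = W" "tgU (cmU t u) = tgU t" using t u by (simp_all add: cmp_Ar src_cmp tgt_cmp W_def)
   have vt: "cmU v t \<in> ArU" "srU (cmU v t) = tgU u" "tgU (cmU v t) = tgU v" using t v by (simp_all add: cmp_Ar src_cmp tgt_cmp)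
   have vB: "foA v B \<in> obA (tgU t)" using fob_obj[OF v(1) B] v by simp
   have w1: "tws v (cmU t u) B \<in> arr W" using tws_arr[OF v(1) tu(1), of B] tu v B by simp
   have w2: "tws t u (foA v B) \<in> arr W" using tws_arr[OF t(1) u t(2) vB] by (simp add: W_def)
   have w3: "tws (cmU v t) u B \<in> arr W" using tws_arr[OF vt(1) u vt(2), of B] vt B by (simp add: W_def)
   have w4: "tws v t B \<in> arr X" using tws_arr[OF v(1) t(1) v(2) B] t by (simp add: X_def)
   have fw4: "fn u (tws v t B) \<in> arr W" using fn_arr[OF u] w4 by (simp add: X_def W_def)
   have gB: "cd g = foA t (foA v B)" using h by (simp add: us ts B_def)
   have "cp W (ep j (rs u us) A) (rg u us A g) = cp W (tws v (cmU t u) B) (cp W (tws t u (foA v B)) (fn u g))"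
    by (simp add: 0 rs_def rg_def us ts B_def W_def)
   also have "... = cp W (cp W (tws v (cmU t u) B) (tws t u (foA v B))) (fn u g)"
    using W w1 w2 fg gB by (intro cp_assoc[symmetric]) auto
   also have "cp W (tws v (cmU t u) B) (tws t u (foA v B)) = cp W (tws (cmU v t) u B) (fn u (tws v t B))"
    using tws_coherence[OF v(1) t(1) u v(2) t(2) B] by (simp add: W_def)
   also have "cp W ... (fn u g) = cp W (tws (cmU v t) u B) (cp W (fn u (tws v t B)) (fn u g))"
    using W w3 fw4 fg gB by (intro cp_assoc) auto
   also have "cp W (fn u (tws v t B)) (fn u g) = fn u (cp X (tws v t B) g)"
    using fn_cp[OF u, of g "tws v t B"] h w4 gB by (simp add: X_def W_def)
   finally show ?thesis using f rbj by (simp add: 0 rg_def us ts B_def W_def)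
  next
   case (Suc i)
   have f: "fc j (rs u us) = rs u (fc j us)" by (simp add: Suc rs_def us ts)
   have i: "Suc i < length ts" using j by (simp add: us Suc)
   define y where "y = ep i ts A"
   have y: "y \<in> arr (tgU t)" "dm y = star ts A" "cd y = star (fc i ts) A" using ep_arr[OF i t(3) AE(1)] i by (simp_all add: y_def)
   have gx: "cd g = foA t (dm y)" using h by (simp add: us y)
   have "cp W (ep j (rs u us) A) (rg u us A g) = cp W (fn (cmU t u) y) (cp W (tws t u (dm y)) (fn u g))"
    by (simp add: Suc rs_def rg_def us y W_def ts[symmetric]) (simp add: ts y_def)
   also have "... = cp W (tws t u (cd y)) (fn u (cp X (fn t y) g))"
    using tws_fn_cp[OF t(1) u t(2) y(1) _ gx] h by (simp add: X_def W_def)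
   finally show ?thesis using f rbj y by (simp add: Suc rg_def us ts y_def W_def)
  qed
 qed
 have 5: "S (drop k (rs u us)) A xs (%zs. K (take k (rs u us)) (star (drop k (rs u us)) A) zs
    (cp W (rb u us A xs b) (cut W (take k (rs u us)) (drop k (rs u us)) E)) (rg u us A g)) =
   S (drop k us) A xs (%zs. K (rs u (take k us)) (star (drop k us) A) zs
    (rb u (take k us) (star (drop k us) A) zs (cp X b (cut X (take k us) (drop k us) E))) (rg u (take k us) (star (drop k us) A) (cp X (ida X (cd g)) g)))"
  if kk: "k \<in> {1..<length us}" for k
 proof -
  have k: "1 \<le> k" "k < length us" using kk by auto
  obtain Z Y' where z: "pth X (take k us) Z" "pth Z (drop k us) Y'" "chain Y' A xs (endo A xs)" "drop k us ~= []" "take k us ~= []"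
   using D k by (rule gd_cutE)
  have "Y' = Y" using h(1) z(1,2) append_take_drop_id[of k us] pth_append[of X "take k us" "drop k us" Y'] pth_iff[of X us Y'] h(11) by auto
  note z = z[unfolded this]
  obtain k' where k': "k = Suc k'" using k by (cases k) auto
  have td: "take k (rs u us) = rs u (take k us)" "drop k (rs u us) = drop k us" by (simp_all add: k' rs_def us)
  note rz = rs[OF z(1)[unfolded X_def] z(5) u, folded X_def W_def]
  define l where "l = co X (take k us)"
  define R where "R = co Z (drop k us)"
  have l: "l \<in> ArU" "srU l = tgU u" "tgU l = Z" using co_Ar[OF z(1)] src_co[OF z(1)] tgt_co[OF z(1)] by (simp_all add: l_def X_def)
  have R: "R \<in> ArU" "srU R = Z" "tgU R = Y" using co_Ar[OF z(2)] src_co[OF z(2)] tgt_co[OF z(2)] by (simp_all add: R_def)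
  have TRl: "T = cmU R l" using co_append[OF z(1,2)] by (simp add: T_def R_def l_def)
  have c1: "cut W (rs u (take k us)) (drop k us) E = tws R (cmU l u) E"
   unfolding cut_eq[OF rz(1)] rz(2) R_def l_def ..
  have c2: "cut X (take k us) (drop k us) E = tws R l E" unfolding cut_eq[OF z(1)] R_def l_def ..
  have lu: "cmU l u \<in> ArU" "srU (cmU l u) = W" "tgU (cmU l u) = Z" using l u by (simp_all add: cmp_Ar src_cmp tgt_cmp W_def)
  have w1: "tws R (cmU l u) E \<in> arr W" using tws_arr[OF R(1) lu(1), of E] lu R AE by simp
  have w2: "tws R l E \<in> arr X" using tws_arr[OF R(1) l(1), of E] l R AE by (simp add: X_def)
  have fw2: "fn u (tws R l E) \<in> arr W" using fn_arr[OF u] w2 by (simp add: X_def W_def)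
  have RE: "foA R E \<in> obA Z" using fob_obj[OF R(1)] R AE by simp
  note til = twi[OF l(1) u l(2), of "foA R E", unfolded l(3), OF RE, folded W_def]
  have ass: "cmU R (cmU l u) = cmU T u" unfolding TRl using cmp_assoc[OF R(1) l(1) u] R l by simp
  have "cp W (rb u us A xs b) (tws R (cmU l u) E) = cp W (fn u b) (cp W (twi T u E) (tws R (cmU l u) E))"
   unfolding rbE using W fb w1 tiE h ass by (intro cp_assoc) (auto simp: T_def)
  also have "cp W (twi T u E) (tws R (cmU l u) E) = cp W (fn u (tws R l E)) (twi l u (foA R E))"
   using twi_cut[OF R(1) l(1) u, of E] R l AE by (simp add: W_def TRl)
  also have "cp W (fn u b) ... = cp W (cp W (fn u b) (fn u (tws R l E))) (twi l u (foA R E))"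
   using W fb fw2 til h TRl by (intro cp_assoc[symmetric]) (auto simp: T_def)
  also have "cp W (fn u b) (fn u (tws R l E)) = fn u (cp X b (tws R l E))"
   using fn_cp[OF u, of "tws R l E" b] w2 h TRl by (simp add: X_def W_def T_def)
  finally have e: "cp W (rb u us A xs b) (tws R (cmU l u) E) = cp W (fn u (cp X b (tws R l E))) (twi l u (foA R E))" .
  have gg: "rg u (take k us) (star (drop k us) A) (cp X (ida X (cd g)) g) = rg u us A g"
   using h star_append[of "take k' ts" "drop k' ts" A] by (simp add: rg_def k' us)
  show ?thesis unfolding td gg
  proof (rule S_cong[OF z(2,4) z(3)[unfolded h(12)]])
   fix zs assume "chain Z (star (drop k us) A) zs (foA (co Z (drop k us)) E)"
   then have "endo (star (drop k us) A) zs = foA R E" using chain_endo R_def by simp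
   then show "K (rs u (take k us)) (star (drop k us) A) zs (cp W (rb u us A xs b) (cut W (rs u (take k us)) (drop k us) E)) (rg u us A g) =
    K (rs u (take k us)) (star (drop k us) A) zs (rb u (take k us) (star (drop k us) A) zs (cp X b (cut X (take k us) (drop k us) E))) (rg u us A g)"
    unfolding c1 c2 e by (simp add: rb_def l_def W_def X_def)
  qed
 qed
 have gi: "cp X (ida X (cd g)) g = g" using h by simp
 have rbm: "rb u us A ys b = rb u us A xs b" if "endo A ys = E" for ys using that by (simp add: rb_def h(12))
 have rbt: "rb u us (cd (hd xs)) (tl xs) b = rb u us A xs b" if "xs ~= []"
  using chain_endo[OF chain_tl(1)[OF h(4) that]] by (simp add: rb_def h(12))
 show ?thesis
  unfolding Dl_def bd_explicit W_def[symmetric] X_def[symmetric] lo h(11) cor T_def[symmetric] r(4) h(12)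
  using 1 2 3 4 5[unfolded gi] rbm rbt by (auto intro!: arg_cong2[of _ _ _ _ "(+)"] sum.cong)
qed

lemma S_mem:
 assumes sw: "vector_space sw" "module.subspace sw V"
  and "pth X us Y" "us ~= []" "chain Y A xs E"
  and "!!ys. chain X (star us A) ys (foA (co X us) E) ==> Suc (length ys) = length us + length xs ==> K ys \<in> V"
 shows "S us A xs K \<in> V"
 using assms(3-)
proof (induction us A xs K rule: S.induct)
 case (1 us A xs K)
 note D = subspaceD[OF sw]
 have e: "S (fc j us) A xs (%ys. K (ep j us A # ys)) \<in> V" if j: "j < length us - 1" for j
 proof -
  have j': "Suc j < length us" using j by simp
  note l = fc_length[OF j']
  show ?thesis
  proof (rule 1(1))
   show "j \<in> {j. Suc j < length us}" using j' by simp
   show "pth X (fc j us) Y" by (rule fc_pth[OF j' 1(3)])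
   show "fc j us ~= []" using l j by auto
   show "chain Y A xs E" by fact
   show "K (ep j us A # ys) \<in> V"
    if "chain X (star (fc j us) A) ys (foA (co X (fc j us)) E)" "Suc (length ys) = length (fc j us) + length xs" for ys
    using that fc_co[OF j' 1(3)] l j' ep_arr[OF j' 1(3) chain_obj(1)[OF 1(5)]] by (intro 1(6)) auto
  qed
 qed
 have f: "(\<Sum>j<length us - 1. - sg j (S (fc j us) A xs (%ys. K (ep j us A # ys)))) \<in> V"
  by (rule subspace_sum_closed[OF sw]) (intro D(5) subspace_sg[OF sw] e, simp)
 show ?case
 proof (cases xs)
  case Nil
  have "K [] \<in> V" if "length us = 1"
   using that 1(6)[of "[]"] 1(3,5) Nil star_obj[OF 1(3)] by (auto simp: length_Suc_conv cmp_idn_left fob_obj)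
  then show ?thesis using f D(1,2) Nil by (subst S_expand) auto
 next
  case (Cons x xs')
  have "S us (cd x) xs' (%ys. K (sm us x # ys)) \<in> V"
   by (rule 1(2)[OF Cons 1(3,4)]) (use 1(3,5) Cons sm_arr[OF 1(3)] in \<open>auto intro!: 1(6)\<close>)
  then show ?thesis using f D(2) Cons subspace_sg[OF sw] by (subst S_expand) auto
 qed
qed

lemma Dl_mem:
 assumes sw: "vector_space sw" "module.subspace sw V" and D: "gd (Suc n) X P Q us A xs b g"
  and K: "!!us A xs b g. gd n X P Q us A xs b g ==> K us A xs b g \<in> V"
 shows "Dl X K us A xs b g \<in> V"
proof -
 note V = subspaceD[OF sw]
 have 5: "S (drop k us) A xs (%zs. K (take k us) (star (drop k us) A) zs (cp X b (cut X (take k us) (drop k us) (endo A xs))) g) \<in> V"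
  if k: "k \<in> {1..<length us}" for k
 proof -
  have k: "1 \<le> k" "k < length us" using k by auto
  obtain Z Y where h: "pth X (take k us) Z" "pth Z (drop k us) Y" "chain Y A xs (endo A xs)" "drop k us ~= []"
   using D k by (rule gd_cutE)
  show ?thesis by (rule S_mem[OF sw h(2,4,3)]) (rule K, rule gd_cut[OF D k _ _ h(1,2)])
 qed
 show ?thesis
  unfolding Dl_def bd_explicit
  using K[OF gd_butlast[OF D]] K[OF gd_mg[OF D]] K[OF gd_tl[OF D]] K[OF gd_fc[OF D]] 5 V
  by (auto intro!: V(2,5) subspace_sum_closed[OF sw] subspace_sg[OF sw])
qed

lemma bimodule_self: "bimodA scA selfA"
proof
 fix u A B C D b x a
 assume h: "u \<in> ArU" "A \<in> obA (tgU u)" "B \<in> obA (tgU u)" "C \<in> obA (tgU u)" "D \<in> obA (tgU u)"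
  "b \<in> hom \<A> (tgU u) C D" "x \<in> car selfA (tgU u) B C" "a \<in> hom \<A> (tgU u) A B"
 then have x: "x \<in> hom \<A> (tgU u) B C" by (simp add: self_bimod_def)
 show "res selfA u A D (lact selfA (tgU u) A C D b (ract selfA (tgU u) A B C x a)) =
    lact selfA (srU u) (foA u A) (foA u C) (foA u D) (fmor \<A> u C D b)
    (ract selfA (srU u) (foA u A) (foA u B) (foA u C) (res selfA u B C x) (fmor \<A> u A B a))"
  using h x fmor_ccmp[OF h(1,2,4,5,6) ccmp_hom[OF tgt_Ob[OF h(1)] h(2,3,4) x h(8)]] fmor_ccmp[OF h(1,2,3,4) x h(8)]
  by (simp add: self_bimod_def)
qed (auto simp: self_bimod_def hom_subspace ccmp_hom ccmp_linear_left ccmp_linear_right ccmp_cid_left ccmp_cid_right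
  ccmp_assoc fmor_hom fmor_linear fmor_idn tw_natural)

lemma la_self: "laM selfA U (dm x) b (hm x) = hm (cp U b x)" if "cd x = dm b"
 using that by (simp add: laM_def self_bimod_def cp_def)

lemma ra_self: "raM selfA U a (cd x) (hm x) = hm (cp U x a)" if "cd a = dm x"
 using that by (simp add: raM_def self_bimod_def cp_def)

lemma res_self: "res selfA u (dm x) (cd x) (hm x) = hm (fn u x)"
 by (simp add: self_bimod_def fn_def)

lemma bimod_hom_comp:
 assumes f: "f \<in> bhom s1 M s2 N" and g: "g \<in> bhom s2 N s3 L" and N: "bimodA s2 N"
 shows "(%U A B x. g U A B (f U A B x)) \<in> bhom s1 M s3 L"
proof -
 interpret N: pbim \<U> \<A> s2 N by (rule pbimI[OF N])
 note F = bimod_homD[OF f] and G = bimod_homD[OF g]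
 have g0: "g U A B 0 = 0" for U A B
 proof (cases "U \<in> ObU & A \<in> obA U & B \<in> obA U")
  case True
  then show ?thesis using lin_0[OF G(2) N.scale_vector_space N.car_subspace, of U A B] by auto
 qed (use G(6) in auto)
 show ?thesis
 proof (rule bimod_homI)
  show "g U A B (f U A B x) \<in> car L U A B" if "U \<in> ObU" "A \<in> obA U" "B \<in> obA U" "x \<in> car M U A B" for U A B x
   using that F(1) G(1) by simp
  show "linear_from s1 s3 (car M U A B) (%x. g U A B (f U A B x))" if "U \<in> ObU" "A \<in> obA U" "B \<in> obA U" for U A B
   by (rule lin_comp[OF F(2)[OF that] F(1)[OF that] G(2)[OF that]])
  show "g U A (cd b) (f U A (cd b) (laM M U A b x)) = laM L U A b (g U A (dm b) (f U A (dm b) x))"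
   if "U \<in> ObU" "b \<in> arr U" "A \<in> obA U" "x \<in> car M U A (dm b)" for U A b x
   using that F(1,3) G(3) arrD(1)[OF that(2)] by simp
  show "g U (dm a) B (f U (dm a) B (raM M U a B x)) = raM L U a B (g U (cd a) B (f U (cd a) B x))"
   if "U \<in> ObU" "a \<in> arr U" "B \<in> obA U" "x \<in> car M U (cd a) B" for U B a x
   using that F(1,4) G(4) arrD(2)[OF that(2)] by simp
  show "g (srU u) (foA u A) (foA u B) (f (srU u) (foA u A) (foA u B) (res M u A B x)) =
    res L u A B (g (tgU u) A B (f (tgU u) A B x))"
   if "u \<in> ArU" "A \<in> obA (tgU u)" "B \<in> obA (tgU u)" "x \<in> car M (tgU u) A B" for u A B x
   using that F(1,5) G(5) tgt_Ob by simp
  show "g U A B (f U A B x) = 0" if "~ (U \<in> ObU & A \<in> obA U & B \<in> obA U & x \<in> car M U A B)" for U A B x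
   using F(6)[OF that] g0 by simp
 qed
qed

lemma gd_Pm:
 assumes D: "gd n X P Q us A xs b g"
  and zs: "chain X (star us A) zs (foA (co X us) (endo A xs))" "Suc (length zs) = length us + length xs"
 shows "gd n X P Q [idU X] (star us A) zs b g"
 using D
proof (cases rule: gdE)
 case h: (gd Y E)
 have p: "pth X [idU X] X" using h by (simp add: idn_Ar src_idn tgt_idn)
 have coi: "co X [idU X] = idU X" using cmp_idn_left[OF idn_Ar[OF h(13)]] h by (simp add: tgt_idn)
 show ?thesis
  using h zs chain_obj[OF zs(1)] by (intro gdI[OF p]) (auto simp: coi fob_idn simp del: composite.simps)
qed

end

context prestack_universe
begin

definition \<delta> :: "nat => 'u => 'a => 'a => 'v => 'v" where
 "\<delta> n = hg (Suc n) s (%X. Dl X gen)"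

definition aug :: "'u => 'a => 'a => 'v => 'h" where
 "aug = hg 0 scA (%X us A xs b g. hm (cp X b g))"

lemma additive_linear: "linear_from s1 s2 UNIV f ==> Modules.additive f"
 by (simp add: linear_from_def Modules.additive_def)

lemma mlK_Dl_gen: "mlK (Suc n) X P Q s (Dl X gen)"
 by (rule mlK_Dl[OF vsS mlK_gen])

lemma \<delta>_gen: "gd (Suc n) X P Q us A xs b g ==> \<delta> n X P Q (gen us A xs b g) = Dl X gen us A xs b g"
 unfolding \<delta>_def by (rule hg_gen[where K = "%X. Dl X gen", OF vsS mlK_Dl_gen])

lemma \<delta>_hom: "\<delta> n \<in> bhom s (Bb (Suc n)) s (Bb n)"
 unfolding \<delta>_def
proof (rule hg_hom[OF bimodule_Bb mlK_Dl_gen])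
 fix X P Q us A xs b g assume D: "gd (Suc n) X P Q us A xs b g"
 show "Dl X gen us A xs b g \<in> car (Bb n) X P Q"
  using Dl_mem[OF vsS Bc_subspace D gen_Bc] by simp
 { fix b' assume b': "b' \<in> arr X" "dm b' = Q"
  have "laM (Bb n) X P b' (Dl X gen us A xs b g) = Dl X (%us A xs b g. laM (Bb n) X P b' (gen us A xs b g)) us A xs b g"
   by (rule Dl_hom[OF additive_linear[OF Bb_la_gen(1)[OF b'(1)]]])
  also have "... = Dl X (%us A xs b g. gen us A xs (cp X b' b) g) us A xs b g"
   by (rule Dl_cong[OF D]) (simp add: Bb_la_gen(2)[OF b'(1)] b'(2))
  finally show "Dl X gen us A xs (cp X b' b) g = laM (Bb n) X P b' (Dl X gen us A xs b g)"
   using Dl_lact[OF D b'] by simp }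
 { fix a assume a: "a \<in> arr X" "cd a = P"
  have "raM (Bb n) X a Q (Dl X gen us A xs b g) = Dl X (%us A xs b g. raM (Bb n) X a Q (gen us A xs b g)) us A xs b g"
   by (rule Dl_hom[OF additive_linear[OF Bb_ra_gen(1)[OF a(1)]]])
  also have "... = Dl X (%us A xs b g. gen us A xs b (cp X g a)) us A xs b g"
   by (rule Dl_cong[OF D]) (simp add: Bb_ra_gen(2)[OF a(1)] a(2))
  finally show "Dl X gen us A xs b (cp X g a) = raM (Bb n) X a Q (Dl X gen us A xs b g)"
   using Dl_ract[OF D a] by simp }
next
 fix u P Q us A xs b g assume D: "gd (Suc n) (tgU u) P Q us A xs b g" and u: "u \<in> ArU"
 have "res (Bb n) u P Q (Dl (tgU u) gen us A xs b g) = Dl (tgU u) (%us A xs b g. res (Bb n) u P Q (gen us A xs b g)) us A xs b g"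
  by (rule Dl_hom[OF additive_linear[OF Bb_res_gen(1)[OF u]]])
 also have "... = Dl (tgU u) (%us A xs b g. gen (rs u us) A xs (rb u us A xs b) (rg u us A g)) us A xs b g"
  by (rule Dl_cong[OF D]) (simp add: Bb_res_gen(2)[OF u])
 finally show "Dl (srU u) gen (rs u us) A xs (rb u us A xs b) (rg u us A g) = res (Bb n) u P Q (Dl (tgU u) gen us A xs b g)"
  using Dl_res[OF D u] by simp
qed

lemma gd_0E:
 assumes "gd 0 X P Q us A xs b g"
 obtains v where "us = [v]" "xs = []" "v \<in> ArU" "srU v = X" "A \<in> obA (tgU v)" "b \<in> arr X" "dm b = foA v A" "cd b = Q"
  "g \<in> arr X" "dm g = P" "cd g = foA v A" "X \<in> ObU"
proof -
 obtain Y E where h: "pth X us Y" "us ~= []" "length us + length xs = Suc 0" "chain Y A xs E"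
  "b \<in> arr X" "dm b = foA (co X us) E" "cd b = Q" "g \<in> arr X" "dm g = P" "cd g = star us A" "X \<in> ObU"
  using assms by (rule gdE)
 obtain v where us: "us = [v]" "xs = []" using h(2,3) by (cases us) auto
 show thesis by (rule that[of v]) (use h us in \<open>auto simp: cmp_idn_left\<close>)
qed

lemma aug_gen: "gd 0 X P Q us A xs b g ==> aug X P Q (gen us A xs b g) = hm (cp X b g)"
 and aug_hom: "aug \<in> bhom s (Bb 0) scA selfA"
proof -
 have ml: "mlK 0 X P Q scA (%us A xs b g. hm (cp X b g))" for X P Q
  unfolding mlK_def
 proof (intro allI impI)
  fix us A xs b g xs' b' g' xs'' b'' g'' c
  assume D: "gd 0 X P Q us A xs b g" and L: "lcd X (lstU X us) c xs b g xs' b' g' xs'' b'' g''"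
  show "hm (cp X b'' g'') = hm (cp X b g) + scA c (hm (cp X b' g'))"
   using D
  proof (rule gd_0E)
   fix v assume h: "xs = []" "b \<in> arr X" "dm b = foA v A" "g \<in> arr X" "cd g = foA v A" "X \<in> ObU"
   have "lc X c (cp X b g) (cp X b' g') (cp X b'' g'')"
    using L h lc_cp_left[of X c g g' g'' b] lc_cp_right[of X c b b' b'' g] unfolding lcd_def by auto
   then show ?thesis by (simp add: lc_def)
  qed
 qed
 show "gd 0 X P Q us A xs b g ==> aug X P Q (gen us A xs b g) = hm (cp X b g)"
  unfolding aug_def by (rule hg_gen[where K = "%X us A xs b g. hm (cp X b g)", OF vsA ml])
 show "aug \<in> bhom s (Bb 0) scA selfA"
  unfolding aug_def
 proof (rule hg_hom[OF bimodule_self ml])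
  fix X P Q us A xs b g assume D: "gd 0 X P Q us A xs b g"
  obtain v where h: "b \<in> arr X" "dm b = foA v A" "cd b = Q" "g \<in> arr X" "dm g = P" "cd g = foA v A" "X \<in> ObU"
   using D by (rule gd_0E)
  have bg: "cp X b g \<in> arr X" using h by simp
  show "hm (cp X b g) \<in> car selfA X P Q" using arrD(3)[OF bg] h by (simp add: self_bimod_def)
  { fix b' assume b': "b' \<in> arr X" "dm b' = Q"
   show "hm (cp X (cp X b' b) g) = laM selfA X P b' (hm (cp X b g))"
    using la_self[of "cp X b g" b' X] cp_assoc[of X g b b'] h b' by simp }
  { fix a assume a: "a \<in> arr X" "cd a = P"
   show "hm (cp X b (cp X g a)) = raM selfA X a Q (hm (cp X b g))"
    using ra_self[of a "cp X b g" X] cp_assoc[of X a g b] h a by simp }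
 next
  fix u P Q us A xs b g assume D: "gd 0 (tgU u) P Q us A xs b g" and u: "u \<in> ArU"
  obtain v where h: "us = [v]" "xs = []" "v \<in> ArU" "srU v = tgU u" "A \<in> obA (tgU v)" "b \<in> arr (tgU u)" "dm b = foA v A"
   "cd b = Q" "g \<in> arr (tgU u)" "dm g = P" "cd g = foA v A"
   using D by (rule gd_0E)
  let ?c = "cp (srU u)"
  have W: "srU u \<in> ObU" using src_Ob[OF u] .
  note ti = twi[OF h(3) u h(4,5)] and w = tws_arr[OF h(3) u h(4,5)]
  have f: "fn u b \<in> arr (srU u)" "fn u g \<in> arr (srU u)" using fn_arr[OF u] h by auto
  have "?c (rb u us A xs b) (rg u us A g) = ?c (?c (fn u b) (twi v u A)) (?c (tws v u A) (fn u g))"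
   using h by (simp add: rb_def rg_def endo_def cmp_idn_left)
  also have "... = ?c (fn u b) (?c (twi v u A) (?c (tws v u A) (fn u g)))"
   using W f ti w h by (intro cp_assoc) auto
  also have "?c (twi v u A) (?c (tws v u A) (fn u g)) = ?c (?c (twi v u A) (tws v u A)) (fn u g)"
   using W f ti w h by (intro cp_assoc[symmetric]) auto
  also have "?c (fn u b) ... = fn u (cp (tgU u) b g)" unfolding ti(4) using W f h u by (simp add: fn_cp)
  finally show "hm (?c (rb u us A xs b) (rg u us A g)) = res selfA u P Q (hm (cp (tgU u) b g))"
   using res_self[of u "cp (tgU u) b g"] h by simp
 qed
qed

text \<open>Hypotheses such as being in a carrier would obstruct rewriting, so the elementwise arguments use the
 linear extensions of the value-level operations rather than the bimodule homomorphisms.\<close>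

abbreviation "hh n X P Q \<equiv> lex n X P Q s (Hm X gen)"
abbreviation "pp n X P Q \<equiv> lex n X P Q s (Pm X gen)"
abbreviation "ss n X P Q \<equiv> lex n X P Q s (Sm X gen)"
abbreviation "dd n X P Q \<equiv> lex (Suc n) X P Q s (Dl X gen)"

lemma dd_lin: "linear_from s s Z (dd n X P Q)" and dd_gen: "gd (Suc n) X P Q us A xs b g ==> dd n X P Q (gen us A xs b g) = Dl X gen us A xs b g"
 and dd_mem: "x \<in> Bc (Suc n) X P Q ==> dd n X P Q x \<in> Bc n X P Q"
proof -
 show "linear_from s s Z (dd n X P Q)" by (rule lex_linear[OF vsS mlK_Dl_gen])
 show "gd (Suc n) X P Q us A xs b g ==> dd n X P Q (gen us A xs b g) = Dl X gen us A xs b g"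
  by (rule lex_gen[OF vsS mlK_Dl_gen])
 show "x \<in> Bc (Suc n) X P Q ==> dd n X P Q x \<in> Bc n X P Q"
  by (rule lex_mem[OF vsS mlK_Dl_gen Bc_subspace]) (rule Dl_mem[OF vsS Bc_subspace _ gen_Bc])
qed

lemma hh_lin: "linear_from s s Z (hh n X P Q)" and hh_gen: "gd n X P Q us A xs b g ==> hh n X P Q (gen us A xs b g) = Hm X gen us A xs b g"
 and hh_mem: "x \<in> Bc n X P Q ==> hh n X P Q x \<in> Bc (Suc n) X P Q"
proof -
 note m = mlK_Hm[OF vsS mlK_gen, of n X P Q]
 show "linear_from s s Z (hh n X P Q)" "gd n X P Q us A xs b g ==> hh n X P Q (gen us A xs b g) = Hm X gen us A xs b g"
  using lex_linear[OF vsS m] lex_gen[OF vsS m] by blast+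
 show "x \<in> Bc n X P Q ==> hh n X P Q x \<in> Bc (Suc n) X P Q"
  by (rule lex_mem[OF vsS m Bc_subspace]) (auto simp: Hm_def intro!: subspace_sg[OF vsS Bc_subspace] gen_Bc gd_idn_Cons)
qed

lemma pp_lin: "linear_from s s Z (pp n X P Q)" and pp_gen: "gd n X P Q us A xs b g ==> pp n X P Q (gen us A xs b g) = Pm X gen us A xs b g"
 and pp_mem: "x \<in> Bc n X P Q ==> pp n X P Q x \<in> Bc n X P Q"
proof -
 note m = mlK_Pm[OF vsS mlK_gen, of n X P Q]
 show "linear_from s s Z (pp n X P Q)" "gd n X P Q us A xs b g ==> pp n X P Q (gen us A xs b g) = Pm X gen us A xs b g"
  using lex_linear[OF vsS m] lex_gen[OF vsS m] by blast+
 show "x \<in> Bc n X P Q ==> pp n X P Q x \<in> Bc n X P Q"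
 proof (rule lex_mem[OF vsS m Bc_subspace])
  fix us A xs b g assume D: "gd n X P Q us A xs b g"
  obtain Y E where h: "pth X us Y" "us ~= []" "chain Y A xs E" "endo A xs = E" using D by (rule gdE)
  show "Pm X gen us A xs b g \<in> Bc n X P Q"
   unfolding Pm_def
   by (intro subspace_sg[OF vsS Bc_subspace] S_mem[OF vsS Bc_subspace h(1-3)] gen_Bc gd_Pm[OF D]) (simp_all add: h(4))
 qed
qed

lemma ss_lin: "linear_from s s Z (ss n X P Q)" and ss_gen: "gd n X P Q us A xs b g ==> ss n X P Q (gen us A xs b g) = Sm X gen us A xs b g"
 and ss_mem: "x \<in> Bc n X P Q ==> ss n X P Q x \<in> Bc (Suc n) X P Q"
proof -
 note m = mlK_Sm[OF vsS mlK_gen, of n X P Q]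
 show "linear_from s s Z (ss n X P Q)" "gd n X P Q us A xs b g ==> ss n X P Q (gen us A xs b g) = Sm X gen us A xs b g"
  using lex_linear[OF vsS m] lex_gen[OF vsS m] by blast+
 show "x \<in> Bc n X P Q ==> ss n X P Q x \<in> Bc (Suc n) X P Q"
 proof (rule lex_mem[OF vsS m Bc_subspace])
  fix us A xs b g assume D: "gd n X P Q us A xs b g"
  show "Sm X gen us A xs b g \<in> Bc (Suc n) X P Q"
  proof (cases "us = [idU X]")
   case True
   then show ?thesis using gen_Bc[OF gd_Sm[OF D[unfolded True]]]
    by (simp add: Sm_def subspace_sg[OF vsS Bc_subspace] del: sg_Suc)
  qed (simp add: Sm_def subspaceD(1)[OF vsS Bc_subspace])
 qed
qed

lemma add_lin:
 assumes "linear_from s s UNIV f"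
 shows "f (x + y) = f x + f y" "f (x - y) = f x - f y" "f (- x) = - f x" "f (sg n x) = sg n (f x)" "f 0 = 0"
proof -
 interpret Modules.additive f by (rule additive_linear[OF assms])
 show "f (x + y) = f x + f y" "f (x - y) = f x - f y" "f (- x) = - f x" "f (sg n x) = sg n (f x)" "f 0 = 0"
  by (simp_all add: add diff minus zero additive_sg[OF additive_axioms])
qed

lemma dd_hh:
 assumes "x \<in> Bc (Suc n) X P Q"
 shows "dd (Suc n) X P Q (hh (Suc n) X P Q x) + hh n X P Q (dd n X P Q x) = x - pp (Suc n) X P Q x"
proof (rule Bb_eqI[OF lin_add[OF vsS lin_comp[OF hh_lin UNIV_I dd_lin] lin_comp[OF dd_lin UNIV_I hh_lin]] lin_minus2[OF vsS lin_id pp_lin] _ assms])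
 fix us A xs b g assume D: "gd (Suc n) X P Q us A xs b g"
 have "dd (Suc n) X P Q (hh (Suc n) X P Q (gen us A xs b g)) = Hm X (Dl X gen) us A xs b g"
  using add_lin(4)[OF dd_lin] dd_gen[OF gd_idn_Cons[OF D]] by (simp add: hh_gen[OF D] Hm_def)
 moreover have "hh n X P Q (dd n X P Q (gen us A xs b g)) = Dl X (Hm X gen) us A xs b g"
  using Dl_hom[OF additive_linear[OF hh_lin]] Dl_cong[OF D hh_gen] by (simp add: dd_gen[OF D])
 ultimately show "dd (Suc n) X P Q (hh (Suc n) X P Q (gen us A xs b g)) + hh n X P Q (dd n X P Q (gen us A xs b g)) =
   gen us A xs b g - pp (Suc n) X P Q (gen us A xs b g)"
  using Dl_contraction[OF D, of gen] by (simp add: pp_gen[OF D])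
qed

lemma dd_hh_0:
 assumes "x \<in> Bc 0 X P Q"
 shows "dd 0 X P Q (hh 0 X P Q x) = x - pp 0 X P Q x"
proof (rule Bb_eqI[OF lin_comp[OF hh_lin UNIV_I dd_lin] lin_minus2[OF vsS lin_id pp_lin] _ assms])
 fix us A xs b g assume D: "gd 0 X P Q us A xs b g"
 obtain v where h: "us = [v]" "xs = []" using D by (rule gd_0E)
 have "dd 0 X P Q (hh 0 X P Q (gen us A xs b g)) = Hm X (Dl X gen) us A xs b g"
  using add_lin(4)[OF dd_lin] dd_gen[OF gd_idn_Cons[OF D]] by (simp add: hh_gen[OF D] Hm_def)
 moreover have "Dl X (Hm X gen) us A xs b g = 0" by (simp add: Dl_def bd_explicit h)
 ultimately show "dd 0 X P Q (hh 0 X P Q (gen us A xs b g)) = gen us A xs b g - pp 0 X P Q (gen us A xs b g)"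
  using Dl_contraction[OF D, of gen] by (simp add: pp_gen[OF D])
qed

lemma pp_S:
 assumes D: "gd n X P Q us A xs b g" and f: "linear_from s s UNIV f"
  and e: "!!ys. gd n X P Q [idU X] (star us A) ys b g ==> f (gen [idU X] (star us A) ys b g) = K [idU X] (star us A) ys b g"
 shows "f (pp n X P Q (gen us A xs b g)) = Pm X K us A xs b g"
proof -
 obtain Y E where h: "pth X us Y" "us ~= []" "chain Y A xs E" "endo A xs = E" using D by (rule gdE)
 have "S us A xs (%ys. f (gen [idU X] (star us A) ys b g)) = S us A xs (%ys. K [idU X] (star us A) ys b g)"
  by (rule S_cong[OF h(1-3)]) (intro e gd_Pm[OF D], simp_all add: h(4))
 then show ?thesis
  unfolding pp_gen[OF D] Pm_def add_lin(4)[OF f] S_hom[OF additive_linear[OF f]] by simp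
qed

lemma pp_dd:
 assumes "x \<in> Bc (Suc n) X P Q"
 shows "pp n X P Q (dd n X P Q x) = dd n X P Q (pp (Suc n) X P Q x)"
proof (rule Bb_eqI[OF lin_comp[OF dd_lin UNIV_I pp_lin] lin_comp[OF pp_lin UNIV_I dd_lin] _ assms])
 fix us A xs b g assume D: "gd (Suc n) X P Q us A xs b g"
 have "pp n X P Q (dd n X P Q (gen us A xs b g)) = Dl X (Pm X gen) us A xs b g"
  using Dl_hom[OF additive_linear[OF pp_lin]] Dl_cong[OF D pp_gen] by (simp add: dd_gen[OF D])
 moreover have "dd n X P Q (pp (Suc n) X P Q (gen us A xs b g)) = Pm X (Dl X gen) us A xs b g"
  by (rule pp_S[where K = "Dl X gen", OF D dd_lin]) (rule dd_gen)
 ultimately show "pp n X P Q (dd n X P Q (gen us A xs b g)) = dd n X P Q (pp (Suc n) X P Q (gen us A xs b g))"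
  using Dl_Pm[OF D, of gen] by simp
qed

lemma gd_idn_length: "gd n X P Q [idU X] A xs b g ==> length xs = n"
 by (auto simp: gd_def)

lemma ss_pp:
 assumes "x \<in> Bc (Suc n) X P Q"
 shows "dd (Suc n) X P Q (ss (Suc n) X P Q (pp (Suc n) X P Q x)) + ss n X P Q (dd n X P Q (pp (Suc n) X P Q x)) = pp (Suc n) X P Q x"
proof (rule Bb_eqI[OF lin_comp[OF pp_lin UNIV_I lin_add[OF vsS lin_comp[OF ss_lin UNIV_I dd_lin] lin_comp[OF dd_lin UNIV_I ss_lin]]] pp_lin _ assms])
 fix us A xs b g assume D: "gd (Suc n) X P Q us A xs b g"
 have "(%y. dd (Suc n) X P Q (ss (Suc n) X P Q y) + ss n X P Q (dd n X P Q y)) (pp (Suc n) X P Q (gen us A xs b g)) = Pm X gen us A xs b g"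
 proof (rule pp_S[OF D])
  show "linear_from s s UNIV (%y. dd (Suc n) X P Q (ss (Suc n) X P Q y) + ss n X P Q (dd n X P Q y))"
   by (rule lin_add[OF vsS lin_comp[OF ss_lin UNIV_I dd_lin] lin_comp[OF dd_lin UNIV_I ss_lin]])
  fix ys assume d: "gd (Suc n) X P Q [idU X] (star us A) ys b g"
  have "dd (Suc n) X P Q (ss (Suc n) X P Q (gen [idU X] (star us A) ys b g)) = Sm X (Dl X gen) [idU X] (star us A) ys b g"
   using add_lin(4)[OF dd_lin] dd_gen[OF gd_Sm[OF d]] by (simp add: ss_gen[OF d] Sm_def add_lin(3)[OF dd_lin])
  moreover have "ss n X P Q (dd n X P Q (gen [idU X] (star us A) ys b g)) = Dl X (Sm X gen) [idU X] (star us A) ys b g"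
   using Dl_hom[OF additive_linear[OF ss_lin]] Dl_cong[OF d ss_gen] by (simp add: dd_gen[OF d])
  ultimately show "dd (Suc n) X P Q (ss (Suc n) X P Q (gen [idU X] (star us A) ys b g)) +
    ss n X P Q (dd n X P Q (gen [idU X] (star us A) ys b g)) = gen [idU X] (star us A) ys b g"
   using Dl_Sm[OF d, of gen] gd_idn_length[OF d] by auto
 qed
 then show "dd (Suc n) X P Q (ss (Suc n) X P Q (pp (Suc n) X P Q (gen us A xs b g))) +
    ss n X P Q (dd n X P Q (pp (Suc n) X P Q (gen us A xs b g))) = pp (Suc n) X P Q (gen us A xs b g)"
  by (simp add: pp_gen[OF D])
qed

text \<open>A section of the augmentation, linear but not a homomorphism of bimodules.\<close>

definition sec :: "'u => 'a => 'a => 'h => 'v" where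
 "sec X P Q f = gen [idU X] P [] (P, Q, f) (ida X P)"

lemma gd_sec:
 assumes "X \<in> ObU" "P \<in> obA X" "Q \<in> obA X" "f \<in> hom \<A> X P Q"
 shows "gd 0 X P Q [idU X] P [] (P, Q, f) (ida X P)"
 by (rule gdI[of _ _ X _ _ _ P])
  (use assms in \<open>auto simp: idn_Ar src_idn tgt_idn fob_idn arr_iff cmp_idn_left[OF idn_Ar[OF assms(1)], unfolded tgt_idn[OF assms(1)]]\<close>)

lemma sec_linear:
 assumes "X \<in> ObU" "P \<in> obA X" "Q \<in> obA X"
 shows "linear_from scA s (hom \<A> X P Q) (sec X P Q)"
proof (rule lin_combinationI[OF vsA vsS hom_subspace[OF assms]])
 fix c f g assume h: "f \<in> hom \<A> X P Q" "g \<in> hom \<A> X P Q"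
 have "pth X [idU X] X" using assms by (simp add: idn_Ar src_idn tgt_idn)
 then show "sec X P Q (f + scA c g) = sec X P Q f + s c (sec X P Q g)"
  unfolding sec_def using mlKD[OF mlK_gen gd_sec[OF assms h(1)]] h assms by (auto simp: lcd_def lc_def arr_iff)
qed

lemma sec_aug:
 assumes "x \<in> Bc 0 X P Q" "X \<in> ObU" "P \<in> obA X" "Q \<in> obA X"
 shows "dd 0 X P Q (ss 0 X P Q (pp 0 X P Q x)) = pp 0 X P Q x - sec X P Q (aug X P Q x)"
proof (rule Bb_eqI[OF lin_comp[OF pp_lin UNIV_I lin_comp[OF ss_lin UNIV_I dd_lin]] _ _ assms(1)])
 have al: "linear_from s scA (Bc 0 X P Q) (aug X P Q)" "!!x. x \<in> Bc 0 X P Q ==> aug X P Q x \<in> hom \<A> X P Q"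
  using bimod_homD(1,2)[OF aug_hom assms(2-4)] by (simp_all add: self_bimod_def)
 show "linear_from s s (Bc 0 X P Q) (%x. pp 0 X P Q x - sec X P Q (aug X P Q x))"
  by (rule lin_minus2[OF vsS pp_lin lin_comp[OF al sec_linear[OF assms(2-4)]]])
 fix us A xs b g assume D: "gd 0 X P Q us A xs b g"
 obtain v where h: "us = [v]" "xs = []" "v \<in> ArU" "srU v = X" "b \<in> arr X" "dm b = foA v A" "cd b = Q"
  "g \<in> arr X" "dm g = P" "cd g = foA v A" using D by (rule gd_0E)
 have bg: "(P, Q, hm (cp X b g)) = cp X b g" using h by (simp add: cp_def)
 have d: "gd 0 X P Q [idU X] (star us A) [] b g" using gd_Pm[OF D, of "[]"] h fob_obj[OF h(3)] arrD(1)[OF h(5)] by (simp add: endo_def cmp_idn_left)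
 have p: "pp 0 X P Q (gen us A xs b g) = gen [idU X] (star us A) [] b g" unfolding pp_gen[OF D] Pm_def using h by simp
 have "dd 0 X P Q (ss 0 X P Q (gen [idU X] (star us A) [] b g)) = Sm X (Dl X gen) [idU X] (star us A) [] b g"
  using dd_gen[OF gd_Sm[OF d]] by (simp add: ss_gen[OF d] Sm_def add_lin(3)[OF dd_lin])
 moreover have "Dl X (Sm X gen) [idU X] (star us A) [] b g = 0" by (simp add: Dl_def bd_explicit)
 ultimately show "dd 0 X P Q (ss 0 X P Q (pp 0 X P Q (gen us A xs b g))) = pp 0 X P Q (gen us A xs b g) - sec X P Q (aug X P Q (gen us A xs b g))"
  unfolding p aug_gen[OF D] sec_def bg using Dl_Sm[OF d, of gen] h by simp
qed

lemma aug_dd: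
 assumes "x \<in> Bc 1 X P Q" "X \<in> ObU" "P \<in> obA X" "Q \<in> obA X"
 shows "aug X P Q (dd 0 X P Q x) = 0"
proof (rule Bc_eqI[OF vsA _ _ _ assms(1)])
 note A = bimod_homD(2)[OF aug_hom assms(2-4), unfolded car_Bb]
 show "linear_from s scA (Bc 1 X P Q) (%x. aug X P Q (dd 0 X P Q x))"
  by (rule lin_comp[OF dd_lin _ A]) (simp add: dd_mem)
 show "linear_from s scA (Bc 1 X P Q) (%x. 0)" by (rule lin_zero[OF vsA])
 have aug2: "aug X P Q (x - y) = aug X P Q x - aug X P Q y" if "x \<in> Bc 0 X P Q" "y \<in> Bc 0 X P Q" for x y
  by (rule lin_diff[OF A vsS vsA Bc_subspace that])
 fix us A xs b g assume D0: "gd 1 X P Q us A xs b g"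
 note D = D0[unfolded One_nat_def]
 show "aug X P Q (dd 0 X P Q (gen us A xs b g)) = 0"
  using D
 proof (rule gdE)
  fix Y E
  assume h: "pth X us Y" "us ~= []" "length us + length xs = Suc (Suc 0)" "chain Y A xs E"
   "b \<in> arr X" "dm b = foA (co X us) E" "cd b = Q" "g \<in> arr X" "dm g = P" "cd g = star us A"
  show ?thesis
  proof (cases xs)
   case (Cons x xs')
   then obtain v where us: "us = [v]" "xs = [x]" using h(2,3) by (cases us) auto
   have v: "v \<in> ArU" "srU v = X" "tgU v = Y" "co X [v] = v" using h(1) us by (auto simp: cmp_idn_left)
   have fx: "fn v x \<in> arr X" using fn_arr[OF v(1), of x] h v us by simp
   have 1: "gd 0 X P Q us A [] (cp X b (fn v x)) g" using gd_butlast[OF D] us v by simp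
   have 2: "gd 0 X P Q us (cd x) [] b (cp X (fn v x) g)" using gd_tl[OF D] us by simp
   have "Dl X gen us A xs b g = gen us A [] (cp X b (fn v x)) g - gen us (cd x) [] b (cp X (fn v x) g)"
    using us v by (simp add: Dl_def bd_explicit del: composite.simps)
   then show ?thesis
    unfolding dd_gen[OF D] using aug2[OF gen_Bc[OF 1] gen_Bc[OF 2]] aug_gen[OF 1] aug_gen[OF 2] cp_assoc[OF assms(2) h(8) fx h(5)] h us v
    by (simp del: composite.simps)
  next
   case Nil
   then obtain v w where us: "us = [v, w]" using h(3) by (auto simp: length_Suc_conv)
   have v: "v \<in> ArU" "srU v = X" "w \<in> ArU" "srU w = tgU v" "tgU w = Y" using h(1) us by auto
   have A: "E = A" "A \<in> obA Y" using h(4) Nil by auto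
   have c: "cut X [v] [w] A = tws w v A" using cut_eq[of X "[v]" "tgU v" "[w]" A] v cmp_idn_left[OF v(1)] cmp_idn_left[OF v(3)] tgt_Ob[OF v(1)] by simp
   have w: "tws w v A \<in> arr X" using tws_arr[OF v(3,1,4), of A] v A by simp
   have 1: "gd 0 X P Q [cmU w v] A [] b (cp X (tws w v A) g)" using gd_fc[OF D, of 0] us Nil by simp
   have ch: "chain (tgU v) (foA w A) [] (foA (co (tgU v) [w]) A)"
    using fob_obj[OF v(3), of A] v A cmp_idn_left[OF v(3)] by simp
   have 2: "gd 0 X P Q [v] (foA w A) [] (cp X b (tws w v A)) g"
    using gd_cut[OF D, of 1 "tgU v" "[]" Y] ch us Nil v A c tgt_Ob[OF v(1)] tgt_Ob[OF v(3)] by (simp add: endo_def del: composite.simps)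
   have "Dl X gen us A xs b g = - gen [cmU w v] A [] b (cp X (tws w v A) g) + gen [v] (foA w A) [] (cp X b (tws w v A)) g"
    using us Nil c by (simp add: Dl_def bd_explicit endo_def atLeastLessThanSuc)
   then have "Dl X gen us A xs b g = gen [v] (foA w A) [] (cp X b (tws w v A)) g - gen [cmU w v] A [] b (cp X (tws w v A) g)" by simp
   moreover have "dm b = foA (cmU w v) A" using h(6) us v A cmp_idn_left[OF v(3)] by simp
   ultimately show ?thesis
    unfolding dd_gen[OF D] using aug2[OF gen_Bc[OF 2] gen_Bc[OF 1]] aug_gen[OF 1] aug_gen[OF 2] cp_assoc[OF assms(2) h(8) w h(5)] h us
    by simp
  qed
 qed
qed

lemma \<delta>_dd: "X \<in> ObU ==> P \<in> obA X ==> Q \<in> obA X ==> x \<in> Bc (Suc n) X P Q ==> \<delta> n X P Q x = dd n X P Q x"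
 by (simp add: \<delta>_def hg_def)

text \<open>The differential squares to zero: on generators in the image of the contraction this follows by
 induction on the degree, and these generate.\<close>

lemma dd_dd_step:
 assumes base: "!!X P Q y w. X \<in> ObU ==> P \<in> obA X ==> Q \<in> obA X ==> y = dd n X P Q w ==> w \<in> Bc (Suc n) X P Q ==>
    dd n X P Q (hh n X P Q y) = y - pp n X P Q y"
  "!!X P Q y w. X \<in> ObU ==> P \<in> obA X ==> Q \<in> obA X ==> y = dd n X P Q w ==> w \<in> Bc (Suc n) X P Q ==>
    dd n X P Q (ss n X P Q (pp n X P Q y)) = pp n X P Q y"
  and o: "X \<in> ObU" "P \<in> obA X" "Q \<in> obA X" and x: "x \<in> Bc (Suc (Suc n)) X P Q"
 shows "dd n X P Q (dd (Suc n) X P Q x) = 0"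
proof -
 define f where "f = (%U A B x. \<delta> n U A B (\<delta> (Suc n) U A B x))"
 have f: "f \<in> bhom s (Bb (Suc (Suc n))) s (Bb n)"
  unfolding f_def by (rule bimod_hom_comp[OF \<delta>_hom \<delta>_hom bimodule_Bb])
 have fd: "f X P Q x = dd n X P Q (dd (Suc n) X P Q x)"
  if "X \<in> ObU" "P \<in> obA X" "Q \<in> obA X" "x \<in> Bc (Suc (Suc n)) X P Q" for X P Q x
  using that dd_mem[OF that(4)] by (simp add: f_def \<delta>_dd)
 have "ph f Z vs A xs = 0" if us: "pth Z vs Y" "chain Y A xs E" "length vs + length xs = Suc (Suc n)" for Z vs Y A xs E
 proof -
  note d = gd_ug[OF us]
  define P where "P = star vs A"
  define Q where "Q = foA (co Z vs) E"
  define b where "b = ida Z Q"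
  have O: "Z \<in> ObU" "P \<in> obA Z" "Q \<in> obA Z" using gd_Ob[OF d] by (auto simp: P_def Q_def)
  have u: "ug Z vs A xs = gen (idU Z # vs) A xs b (ida Z P)" by (simp add: ug_def b_def P_def Q_def chain_endo[OF us(2)])
  note d = d[folded P_def Q_def, folded b_def]
  have "dd n Z P Q (dd (Suc n) Z P Q (ug Z vs A xs)) = 0"
  proof (cases "vs = []")
   case False
   have dw: "gd (Suc n) Z P Q vs A xs b (ida Z P)"
    by (rule gdI[OF us(1) False us(3,2)]) (use O in \<open>auto simp: b_def P_def Q_def\<close>)
   define w where "w = gen vs A xs b (ida Z P)"
   have w: "w \<in> Bc (Suc n) Z P Q" unfolding w_def by (rule gen_Bc[OF dw])
   \<comment> \<open>A free generator is, up to sign, in the image of the contraction by the identity.\<close>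
   have ugw: "ug Z vs A xs = sg (length vs + length xs) (hh (Suc n) Z P Q w)"
    unfolding u w_def hh_gen[OF dw] Hm_def sg_sg by (simp add: sg_def)
   have "dd (Suc n) Z P Q (hh (Suc n) Z P Q w) = w - pp (Suc n) Z P Q w - hh n Z P Q (dd n Z P Q w)"
    using dd_hh[OF w] by (simp add: eq_diff_eq)
   then have "dd n Z P Q (dd (Suc n) Z P Q (hh (Suc n) Z P Q w)) = dd n Z P Q w - dd n Z P Q (pp (Suc n) Z P Q w) - (dd n Z P Q w - pp n Z P Q (dd n Z P Q w))"
    by (simp add: add_lin(2)[OF dd_lin] base(1)[OF O refl w])
   also have "... = 0" by (simp add: pp_dd[OF w])
   finally show ?thesis unfolding ugw by (simp add: add_lin(4,5)[OF dd_lin])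
  next
   case True
   then obtain y ys where xs: "xs = y # ys" using us(3) by (cases xs) auto
   have Y: "Y = Z" "P = A" using us(1) True by (auto simp: P_def)
   have y: "y \<in> arr Z" "dm y = A" "chain Z (cd y) ys E" using us(2) xs Y by auto
   have E: "Q = E" using chain_obj[OF us(2)] Y O(1) True by (simp add: Q_def fob_idn)
   have c: "co Z [idU Z] = idU Z" using cmp_idn_left[OF idn_Ar[OF O(1)]] O(1) by (simp add: tgt_idn)
   have p: "pth Z [idU Z] Z" using O(1) by (simp add: idn_Ar src_idn tgt_idn)
   have dw: "gd (Suc n) Z P Q [idU Z] (cd y) ys b y"
    by (rule gdI[OF p _ _ y(3)])
     (use us(3) True xs O Y y E chain_obj[OF y(3)] in \<open>auto simp: b_def c fob_idn simp del: composite.simps\<close>)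
   define w where "w = gen [idU Z] (cd y) ys b y"
   have w: "w \<in> Bc (Suc n) Z P Q" unfolding w_def by (rule gen_Bc[OF dw])
   have ly: "length ys = Suc n" using gd_idn_length[OF dw] .
   have ppw: "pp (Suc n) Z P Q w = w"
   proof -
    have "map (fn (idU Z)) ys = ys"
    proof -
     have "\<forall>z\<in>set zs. z \<in> arr Z" if "chain Z D zs E" for D zs using that by (induction zs arbitrary: D) auto
     then show ?thesis using y(3) O(1) by (intro map_idI) auto
    qed
    then show ?thesis unfolding w_def pp_gen[OF dw] Pm_def S_single
     using O(1) chain_obj[OF y(3)] by (simp add: fob_idn)
   qed
   have ugw: "ug Z vs A xs = sg (Suc (length ys)) (ss (Suc n) Z P Q w)"
    unfolding u w_def ss_gen[OF dw] Sm_def using True xs y Y by (simp add: sg_sg del: sg_Suc) (simp add: sg_def)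
   have "dd (Suc n) Z P Q (ss (Suc n) Z P Q w) = w - ss n Z P Q (dd n Z P Q w)"
    using ss_pp[OF w] unfolding ppw by (simp add: eq_diff_eq)
   moreover have "pp n Z P Q (dd n Z P Q w) = dd n Z P Q w" using pp_dd[OF w] ppw by simp
   ultimately have "dd n Z P Q (dd (Suc n) Z P Q (ss (Suc n) Z P Q w)) = 0"
    using base(2)[OF O refl w] by (simp add: add_lin(2)[OF dd_lin])
   then show ?thesis unfolding ugw by (simp add: add_lin(3,4,5)[OF dd_lin] del: sg_Suc)
  qed
  moreover have "ug Z vs A xs \<in> Bc (Suc (Suc n)) Z P Q" unfolding u by (rule gen_Bc[OF d])
  ultimately show ?thesis
   using fd[OF O] by (simp add: ph_def chain_endo[OF us(2)] P_def Q_def)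
 qed
 note z = this
 interpret B: pbim \<U> \<A> s "Bb n" by (rule pbimI[OF bimodule_Bb])
 have "f X P Q x = 0"
 proof (rule Bb_eqI[OF _ _ _ x])
  show "linear_from s s (Bc (Suc (Suc n)) X P Q) (f X P Q)" using bimod_homD(2)[OF f o] by simp
  show "linear_from s s (Bc (Suc (Suc n)) X P Q) (%x. 0)" by (rule lin_zero[OF vsS])
  fix us A xs b g assume D: "gd (Suc (Suc n)) X P Q us A xs b g"
  show "f X P Q (gen us A xs b g) = 0"
   unfolding hom_gen[OF bimodule_Bb f D]
   using D
  proof (rule gd_ConsE)
   fix v vs Z Y E
   assume h: "us = v # vs" "v \<in> ArU" "srU v = X" "tgU v = Z" "pth Z vs Y" "length vs + length xs = Suc (Suc n)"
    "chain Y A xs E" "endo A xs = E" "b \<in> arr X" "dm b = foA (cmU (co Z vs) v) E" "g \<in> arr X" "dm g = P"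
    "tws (co Z vs) v E \<in> arr X"
   have bt: "cp X b (tws (co Z vs) v E) \<in> arr X" using h o by simp
   show "Fk (Bb n) (ph f) X us A xs b g = 0"
    unfolding Fk_def h(1) Let_def list.sel h(4,8,12) z[OF h(5,7,6)]
    by (simp add: add_lin(5)[OF Bb_res_gen(1)[OF h(2)]] add_lin(5)[OF Bb_ra_gen(1)[OF h(11)]] add_lin(5)[OF Bb_la_gen(1)[OF bt]])
  qed
 qed
 then show ?thesis using fd[OF o x] by simp
qed

lemma dd_dd:
 assumes "X \<in> ObU" "P \<in> obA X" "Q \<in> obA X" "x \<in> Bc (Suc (Suc n)) X P Q"
 shows "dd n X P Q (dd (Suc n) X P Q x) = 0"
 using assms
proof (induction n arbitrary: X P Q x)
 case step: (0 X P Q x)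
 have base: "dd 0 X P Q (hh 0 X P Q y) = y - pp 0 X P Q y" "dd 0 X P Q (ss 0 X P Q (pp 0 X P Q y)) = pp 0 X P Q y"
  if "X \<in> ObU" "P \<in> obA X" "Q \<in> obA X" "y = dd 0 X P Q w" "w \<in> Bc (Suc 0) X P Q" for X P Q y w
  using dd_hh_0[of y X P Q] sec_aug[of y X P Q] aug_dd[of w X P Q] that dd_mem[of w 0 X P Q]
   lin_0[OF sec_linear vsA hom_subspace] by auto
 show ?case by (rule dd_dd_step[OF base step])
next
 case step: (Suc n X P Q x)
 have base: "dd (Suc n) X P Q (hh (Suc n) X P Q y) = y - pp (Suc n) X P Q y"
   "dd (Suc n) X P Q (ss (Suc n) X P Q (pp (Suc n) X P Q y)) = pp (Suc n) X P Q y"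
  if "X \<in> ObU" "P \<in> obA X" "Q \<in> obA X" "y = dd (Suc n) X P Q w" "w \<in> Bc (Suc (Suc n)) X P Q" for X P Q y w
 proof -
  have y: "y \<in> Bc (Suc n) X P Q" using dd_mem that by simp
  have z: "dd n X P Q y = 0" using step(1)[OF that(1-3,5)] that(4) by simp
  show "dd (Suc n) X P Q (hh (Suc n) X P Q y) = y - pp (Suc n) X P Q y"
   using dd_hh[OF y] z add_lin(5)[OF hh_lin] by simp
  show "dd (Suc n) X P Q (ss (Suc n) X P Q (pp (Suc n) X P Q y)) = pp (Suc n) X P Q y"
   using ss_pp[OF y] z pp_dd[OF y, symmetric] add_lin(5)[OF ss_lin] add_lin(5)[OF pp_lin] by simp
 qed
 show ?case by (rule dd_dd_step[OF base step(2-)])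
qed

text \<open>Exactness: the contraction \<open>hh + ss pp\<close> of the augmented complex.\<close>

lemma exact_Bb: "bimod_exact \<U> \<A> (Bb (Suc (Suc n))) (\<delta> (Suc n)) (Bb (Suc n)) (\<delta> n)"
 unfolding bimod_exact_def
proof (intro ballI equalityI subsetI)
 fix U A B x assume o: "U \<in> ObU" "A \<in> obA U" "B \<in> obA U"
 { assume "x \<in> \<delta> (Suc n) U A B ` car (Bb (Suc (Suc n))) U A B"
  then obtain y where y: "y \<in> Bc (Suc (Suc n)) U A B" "x = dd (Suc n) U A B y" using o by (auto simp: \<delta>_dd)
  then show "x \<in> {x \<in> car (Bb (Suc n)) U A B. \<delta> n U A B x = 0}"
   using dd_dd[OF o y(1)] dd_mem[OF y(1)] o by (simp add: \<delta>_dd) }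
 assume "x \<in> {x \<in> car (Bb (Suc n)) U A B. \<delta> n U A B x = 0}"
 then have x: "x \<in> Bc (Suc n) U A B" "dd n U A B x = 0" using o by (auto simp: \<delta>_dd)
 let ?p = "pp (Suc n) U A B x"
 have "x = dd (Suc n) U A B (hh (Suc n) U A B x) + ?p" using dd_hh[OF x(1)] x(2) add_lin(5)[OF hh_lin] by simp
 also have "?p = dd (Suc n) U A B (ss (Suc n) U A B ?p)"
  using ss_pp[OF x(1)] pp_dd[OF x(1)] x(2) add_lin(5)[OF pp_lin] add_lin(5)[OF ss_lin] by simp
 finally have "x = dd (Suc n) U A B (hh (Suc n) U A B x + ss (Suc n) U A B ?p)" by (simp add: add_lin(1)[OF dd_lin])
 moreover have "hh (Suc n) U A B x + ss (Suc n) U A B ?p \<in> Bc (Suc (Suc n)) U A B"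
  by (rule subspaceD(2)[OF vsS Bc_subspace hh_mem[OF x(1)] ss_mem[OF pp_mem[OF x(1)]]])
 ultimately show "x \<in> \<delta> (Suc n) U A B ` car (Bb (Suc (Suc n))) U A B" using o by (auto simp: \<delta>_dd intro: image_eqI)
qed

lemma exact_aug: "bimod_exact \<U> \<A> (Bb 1) (\<delta> 0) (Bb 0) aug"
 unfolding bimod_exact_def One_nat_def
proof (intro ballI equalityI subsetI)
 fix U A B x assume o: "U \<in> ObU" "A \<in> obA U" "B \<in> obA U"
 { assume "x \<in> \<delta> 0 U A B ` car (Bb (Suc 0)) U A B"
  then obtain y where y: "y \<in> Bc (Suc 0) U A B" "x = dd 0 U A B y" using o by (auto simp: \<delta>_dd)
  then show "x \<in> {x \<in> car (Bb 0) U A B. aug U A B x = 0}"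
   using aug_dd[of y U A B] dd_mem[OF y(1)] o by simp }
 assume "x \<in> {x \<in> car (Bb 0) U A B. aug U A B x = 0}"
 then have x: "x \<in> Bc 0 U A B" "aug U A B x = 0" by auto
 let ?p = "pp 0 U A B x"
 have "sec U A B 0 = 0" by (rule lin_0[OF sec_linear[OF o] vsA hom_subspace[OF o]])
 then have "?p = dd 0 U A B (ss 0 U A B ?p)" using sec_aug[OF x(1) o] x(2) by simp
 moreover have "x = dd 0 U A B (hh 0 U A B x) + ?p" using dd_hh_0[OF x(1)] by simp
 ultimately have "x = dd 0 U A B (hh 0 U A B x + ss 0 U A B ?p)" by (simp add: add_lin(1)[OF dd_lin])
 moreover have "hh 0 U A B x + ss 0 U A B ?p \<in> Bc (Suc 0) U A B"
  by (rule subspaceD(2)[OF vsS Bc_subspace hh_mem[OF x(1)] ss_mem[OF pp_mem[OF x(1)]]])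
 ultimately show "x \<in> \<delta> 0 U A B ` car (Bb (Suc 0)) U A B" using o by (auto simp: \<delta>_dd intro: image_eqI)
qed

lemma surj_aug: "bimod_surj \<U> \<A> (Bb 0) selfA aug"
 unfolding bimod_surj_def
proof (intro ballI equalityI subsetI)
 fix U A B x assume o: "U \<in> ObU" "A \<in> obA U" "B \<in> obA U"
 { assume "x \<in> aug U A B ` car (Bb 0) U A B"
  then show "x \<in> car selfA U A B" using bimod_homD(1)[OF aug_hom o] by auto }
 assume "x \<in> car selfA U A B"
 then have x: "x \<in> hom \<A> U A B" by (simp add: self_bimod_def)
 note d = gd_sec[OF o x]
 have "aug U A B (sec U A B x) = x" using aug_gen[OF d] o x by (simp add: sec_def arr_iff)
 then show "x \<in> aug U A B ` car (Bb 0) U A B" using gen_Bc[OF d] unfolding sec_def car_Bb by (metis image_eqI)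
qed

theorem resolution_Bb: "projective_resolution \<U> \<A> s Bb \<delta> aug scA selfA"
 unfolding projective_resolution_def
 using projective_Bb \<delta>_hom aug_hom surj_aug exact_aug exact_Bb by blast

end

section \<open>Comparison of projective resolutions\<close>

lemma vs_pointwise4:
 assumes "vector_space s"
 shows "vector_space (%c f U A B x. s c (f U A B x))"
 by (rule vector_space_pointwise[OF vector_space_pointwise[OF vector_space_pointwise[OF vector_space_pointwise[OF assms]]]])

context prestack
begin

lemma bimod_hom_subspace:
 assumes N: "bimodA s2 N"
 shows "module.subspace (%c f U A B x. s2 c (f U A B x)) (bhom s1 M s2 N)"
proof (rule subspaceI)
 interpret N: pbim \<U> \<A> s2 N by (rule pbimI[OF N])
 note v = N.scale_vector_space
 interpret v: vector_space s2 by (rule v)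
 note comb = lin_combination[OF _ v]
 have D: "0 \<in> car N U A B" "x \<in> car N U A B ==> y \<in> car N U A B ==> x + y \<in> car N U A B" "x \<in> car N U A B ==> s2 c x \<in> car N U A B"
  if "U \<in> ObU" "A \<in> obA U" "B \<in> obA U" for U A B c x y
  using subspaceD(1-3)[OF v N.car_subspace[OF that]] by auto
 note L = N.la_linear N.ra_linear N.res_linear
 have l0: "laM N U P b 0 = 0" if "U \<in> ObU" "b \<in> arr U" "P \<in> obA U" for U P b
  using lin_0[OF N.la_linear[OF that] v N.car_subspace] that arrD by auto
 have r0: "raM N U a Q 0 = 0" if "U \<in> ObU" "a \<in> arr U" "Q \<in> obA U" for U a Q
  using lin_0[OF N.ra_linear[OF that] v N.car_subspace] that arrD by auto
 have s0: "res N u P Q 0 = 0" if "u \<in> ArU" "P \<in> obA (tgU u)" "Q \<in> obA (tgU u)" for u P Q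
  using lin_0[OF N.res_linear[OF that] v N.car_subspace] that tgt_Ob by auto
 show "vector_space (%c f U A B x. s2 c (f U A B x))" by (rule vs_pointwise4[OF v])
 show "0 \<in> bhom s1 M s2 N"
  by (rule bimod_homI) (auto simp: D l0 r0 s0 lin_zero[OF v] arrD zero_fun_def)
 { fix f g assume fg: "f \<in> bhom s1 M s2 N" "g \<in> bhom s1 M s2 N"
  note F = bimod_homD[OF fg(1)] and G = bimod_homD[OF fg(2)]
  show "f + g \<in> bhom s1 M s2 N"
  proof (rule bimod_homI)
   show "linear_from s1 s2 (car M U A B) ((f + g) U A B)" if "U \<in> ObU" "A \<in> obA U" "B \<in> obA U" for U A B
    using lin_add[OF v F(2)[OF that] G(2)[OF that]] by (simp add: plus_fun_def)
  qed (use F G in \<open>auto simp: D arrD tgt_Ob linear_fromD(1)[OF N.la_linear] linear_fromD(1)[OF N.ra_linear] linear_fromD(1)[OF N.res_linear]\<close>) }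
 { fix c f assume f: "f \<in> bhom s1 M s2 N"
  note F = bimod_homD[OF f]
  show "(%U A B x. s2 c (f U A B x)) \<in> bhom s1 M s2 N"
  proof (rule bimod_homI)
   show "linear_from s1 s2 (car M U A B) (%x. s2 c (f U A B x))" if "U \<in> ObU" "A \<in> obA U" "B \<in> obA U" for U A B
    by (rule lin_scale[OF v F(2)[OF that]])
  qed (use F in \<open>auto simp: D arrD tgt_Ob linear_fromD(2)[OF N.la_linear] linear_fromD(2)[OF N.ra_linear] linear_fromD(2)[OF N.res_linear]\<close>) }
qed

lemma bimod_hom_diff: "bimodA s2 N ==> f \<in> bhom s1 M s2 N ==> g \<in> bhom s1 M s2 N ==> f - g \<in> bhom s1 M s2 N"
 by (rule subspaceD(4)[OF vs_pointwise4[OF bimodule.scale_vector_space] bimod_hom_subspace])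

text \<open>Composition of families of maps.  Homomorphisms vanish off the carriers, so that equations between
 composites of homomorphisms hold everywhere as soon as they hold on the carriers.\<close>

definition bcomp :: "('u => 'a => 'a => 'x => 'y) => ('u => 'a => 'a => 'w => 'x) => 'u => 'a => 'a => 'w => 'y" (infixr "oo" 75)
 where "g oo f = (%U A B x. g U A B (f U A B x))"

lemma bcomp_assoc: "(h oo g) oo f = h oo g oo f" by (simp add: bcomp_def)

lemma bcomp_diff: "(g - h) oo f = g oo f - h oo f" and bcomp_0: "0 oo f = 0"
 by (simp_all add: bcomp_def fun_eq_iff)

lemma bhom_comp: "f \<in> bhom s1 M s2 N ==> g \<in> bhom s2 N s3 L ==> bimodA s2 N ==> g oo f \<in> bhom s1 M s3 L"
 unfolding bcomp_def by (rule bimod_hom_comp)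

lemma bhom_eqI:
 assumes "f \<in> bhom s1 M s2 N" "g \<in> bhom s1 M s2 N"
  and "!!U A B x. U \<in> ObU ==> A \<in> obA U ==> B \<in> obA U ==> x \<in> car M U A B ==> f U A B x = g U A B x"
 shows "f = g"
 using bimod_homD(6)[OF assms(1)] bimod_homD(6)[OF assms(2)] assms(3) by (auto simp: fun_eq_iff) metis

lemma bhom_zero:
 assumes f: "f \<in> bhom s1 M s2 N" and M: "bimodA s1 M"
 shows "f U A B 0 = 0"
proof (cases "U \<in> ObU & A \<in> obA U & B \<in> obA U")
 case True
 then show ?thesis using lin_0[OF bimod_homD(2)[OF f] bimodule.scale_vector_space[OF M] bimodule.car_subspace[OF M], of U A B] by auto
qed (use bimod_homD(6)[OF f] in auto)

lemma bcomp_0_right: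
 assumes "f \<in> bhom s1 M s2 N" "bimodA s1 M"
 shows "f oo 0 = 0"
 by (simp add: bcomp_def fun_eq_iff bhom_zero[OF assms])

lemma bcomp_diff_right:
 assumes f: "f \<in> bhom s2 M s3 N" and M: "bimodA s2 M" and N: "bimodA s3 N" and g: "g \<in> bhom s1 L s2 M" "h \<in> bhom s1 L s2 M"
 shows "f oo (g - h) = f oo g - f oo h"
proof -
 have "f U A B (g U A B x - h U A B x) = f U A B (g U A B x) - f U A B (h U A B x)" for U A B x
 proof (cases "U \<in> ObU & A \<in> obA U & B \<in> obA U & x \<in> car L U A B")
  case True
  then show ?thesis
   using lin_diff[OF bimod_homD(2)[OF f] bimodule.scale_vector_space[OF M] bimodule.scale_vector_space[OF N] bimodule.car_subspace[OF M]]
    bimod_homD(1)[OF g(1)] bimod_homD(1)[OF g(2)] by simp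
 qed (simp add: bimod_homD(6)[OF g(1)] bimod_homD(6)[OF g(2)] bhom_zero[OF f M])
 then show "f oo (g - h) = f oo g - f oo h" by (simp add: bcomp_def fun_eq_iff)
qed

definition idh :: "('u, 'm, 'a, 'h, 'w::zero) bimod => 'u => 'a => 'a => 'w => 'w" where
 "idh M U A B x = (if U \<in> ObU & A \<in> obA U & B \<in> obA U & x \<in> car M U A B then x else 0)"

lemma idh_hom:
 assumes M: "bimodA sw M"
 shows "idh M \<in> bhom sw M sw M"
proof -
 interpret M: pbim \<U> \<A> sw M by (rule pbimI[OF M])
 show ?thesis
 proof (rule bimod_homI)
  show "linear_from sw sw (car M U A B) (idh M U A B)" if "U \<in> ObU" "A \<in> obA U" "B \<in> obA U" for U A B
   using lin_cong[of "car M U A B" "idh M U A B" "%x. x" sw sw] lin_id M.scale_vector_space M.car_subspace that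
   by (simp add: idh_def)
 qed (auto simp: idh_def arrD M.la_car M.ra_car M.res_car tgt_Ob src_Ob fob_obj)
qed

lemma bcomp_idh: "f \<in> bhom s1 M s2 N ==> bimodA s1 M ==> f oo idh M = f" and idh_bcomp: "f \<in> bhom s1 M s2 N ==> idh N oo f = f"
 using bimod_homD(1,6)[of f s1 M s2 N] bhom_zero[of f s1 M s2 N] by (auto simp: bcomp_def idh_def fun_eq_iff) metis

text \<open>Kernels are needed because projectivity only allows lifting along surjections.\<close>

definition kerb where
 "kerb M g = M\<lparr>car := (%U A B. {x \<in> car M U A B. g U A B x = 0})\<rparr>"

lemma kerb_simps [simp]: "car (kerb M g) U A B = {x \<in> car M U A B. g U A B x = 0}"
 "lact (kerb M g) = lact M" "ract (kerb M g) = ract M" "res (kerb M g) = res M"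
 "laM (kerb M g) = laM M" "raM (kerb M g) = raM M"
 by (simp_all add: kerb_def laM_def[abs_def] raM_def[abs_def])

lemma bimodule_kerb:
 assumes M: "bimodA s1 M" and N: "bimodA s2 N" and g: "g \<in> bhom s1 M s2 N"
 shows "bimodA s1 (kerb M g)"
proof -
 interpret M: pbim \<U> \<A> s1 M by (rule pbimI[OF M])
 interpret N: pbim \<U> \<A> s2 N by (rule pbimI[OF N])
 note G = bimod_homD[OF g]
 have l0: "laM N U P b 0 = 0" if "U \<in> ObU" "b \<in> arr U" "P \<in> obA U" for U P b
  using lin_0[OF N.la_linear[OF that] N.scale_vector_space N.car_subspace] that arrD by auto
 have r0: "raM N U a Q 0 = 0" if "U \<in> ObU" "a \<in> arr U" "Q \<in> obA U" for U a Q
  using lin_0[OF N.ra_linear[OF that] N.scale_vector_space N.car_subspace] that arrD by auto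
 have s0: "res N u P Q 0 = 0" if "u \<in> ArU" "P \<in> obA (tgU u)" "Q \<in> obA (tgU u)" for u P Q
  using lin_0[OF N.res_linear[OF that] N.scale_vector_space N.car_subspace] that tgt_Ob by auto
 have sub: "car (kerb M g) U A B \<subseteq> car M U A B" for U A B by auto
 show ?thesis
 proof (rule bimodule.intro)
  show "vector_space s1" by (rule M.scale_vector_space)
  fix U A B assume o: "U \<in> ObU" "A \<in> obA U" "B \<in> obA U"
  note S = subspaceD[OF M.scale_vector_space M.car_subspace[OF o]]
  show "module.subspace s1 (car (kerb M g) U A B)"
   using S(1-3) G(2)[OF o] lin_0[OF G(2)[OF o] M.scale_vector_space M.car_subspace[OF o]] N.scale_vector_space
   by (intro subspaceI[OF M.scale_vector_space]) (auto simp: linear_fromD module.scale_zero_right vector_space_def module_def)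
  fix C assume C: "C \<in> obA U"
  show "lact (kerb M g) U A B C b x \<in> car (kerb M g) U A C" if "b \<in> hom \<A> U B C" "x \<in> car (kerb M g) U A B" for b x
   using G(3)[of U "(B, C, b)" A x] M.lact_car[OF o C] l0[of U "(B, C, b)" A] that o C by (simp add: arr_iff laM_def)
  show "linear_from s1 s1 (car (kerb M g) U A B) (%x. lact (kerb M g) U A B C b x)" if "b \<in> hom \<A> U B C" for b
   using lin_subset[OF M.lact_linear_right[OF o C that] sub] by simp
  show "ract (kerb M g) U A B C x a \<in> car (kerb M g) U A C" if "x \<in> car (kerb M g) U B C" "a \<in> hom \<A> U A B" for x a
   using G(4)[of U "(A, B, a)" C x] M.ract_car[OF o C] r0[of U "(A, B, a)" C] that o C by (simp add: arr_iff raM_def)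
  show "linear_from s1 s1 (car (kerb M g) U B C) (%x. ract (kerb M g) U A B C x a)" if "a \<in> hom \<A> U A B" for a
   using lin_subset[OF M.ract_linear_left[OF o C that] sub] by simp
 next
  fix u A B assume o: "u \<in> ArU" "A \<in> obA (tgU u)" "B \<in> obA (tgU u)"
  show "res (kerb M g) u A B x \<in> car (kerb M g) (srU u) (foA u A) (foA u B)" if "x \<in> car (kerb M g) (tgU u) A B" for x
   using G(5)[OF o] M.res_car[OF o] s0[OF o] that by simp
  show "linear_from s1 s1 (car (kerb M g) (tgU u) A B) (res (kerb M g) u A B)"
   using lin_subset[OF M.res_linear[OF o] sub] by simp
 qed (auto simp: M.lact_cid M.lact_ccmp M.ract_cid M.ract_ccmp M.lact_ract M.res_idn M.res_act M.res_cmp M.lact_linear_left M.ract_linear_right)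
qed

lemma hom_to_kerb:
 assumes f: "f \<in> bhom s0 L s1 M"
  and z: "!!U A B x. U \<in> ObU ==> A \<in> obA U ==> B \<in> obA U ==> x \<in> car L U A B ==> g U A B (f U A B x) = 0"
 shows "f \<in> bhom s0 L s1 (kerb M g)"
 by (rule bimod_homI) (use bimod_homD[OF f] z in auto)

lemma exact_comp:
 assumes "bimod_exact \<U> \<A> L f M g" "f \<in> bhom s1 L s2 M" "g \<in> bhom s2 M s3 N" "bimodA s2 M"
 shows "g oo f = 0"
proof -
 have "g U A B (f U A B x) = 0" for U A B x
  using assms(1) bimod_homD(6)[OF assms(2), of U A B x] bhom_zero[OF assms(3,4)] unfolding bimod_exact_def by (metis (mono_tags, lifting) imageI mem_Collect_eq)
 then show ?thesis by (simp add: bcomp_def fun_eq_iff)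
qed

lemma lift_exact:
 assumes P: "projective_bimod \<U> \<A> s P"
  and L: "bimodA s L" and M: "bimodA s M" and N: "bimodA s2 N"
  and f: "f \<in> bhom s L s M" and g: "g \<in> bhom s M s2 N" and ex: "bimod_exact \<U> \<A> L f M g"
  and \<phi>: "\<phi> \<in> bhom s P s M" and z: "g oo \<phi> = 0"
 shows "\<exists>\<psi>\<in>bhom s P s L. f oo \<psi> = \<phi>"
proof -
 have e: "f U A B ` car L U A B = {x \<in> car M U A B. g U A B x = 0}" if "U \<in> ObU" "A \<in> obA U" "B \<in> obA U" for U A B
  using ex that unfolding bimod_exact_def by blast
 have "g U A B (f U A B x) = 0" if "U \<in> ObU" "A \<in> obA U" "B \<in> obA U" "x \<in> car L U A B" for U A B x
  using e[OF that(1-3)] that(4) by blast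
 then have 1: "f \<in> bhom s L s (kerb M g)" by (rule hom_to_kerb[where g = g, OF f])
 have 2: "bimod_surj \<U> \<A> L (kerb M g) f" using e by (auto simp: bimod_surj_def)
 have 3: "\<phi> \<in> bhom s P s (kerb M g)" by (rule hom_to_kerb[where g = g, OF \<phi>]) (use z in \<open>simp add: bcomp_def fun_eq_iff\<close>)
 obtain \<psi> where \<psi>: "\<psi> \<in> bhom s P s L" "\<forall>U\<in>ObU. \<forall>A\<in>obA U. \<forall>B\<in>obA U. \<forall>x\<in>car P U A B. f U A B (\<psi> U A B x) = \<phi> U A B x"
  using P[unfolded projective_bimod_def, THEN conjunct2, rule_format, OF L bimodule_kerb[OF M N g] 1 2 3] by blast
 have "f oo \<psi> = \<phi>" by (rule bhom_eqI[OF bhom_comp[OF \<psi>(1) f L] \<phi>]) (use \<psi>(2) in \<open>simp add: bcomp_def\<close>)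
 then show ?thesis using \<psi>(1) by blast
qed

text \<open>A copy of a bimodule in another ambient space.  Projectivity refers to the ambient space of the
 resolutions, in which \<open>\<A>\<close> itself need not live.\<close>

definition trb :: "('w => 'x) => ('x => 'w) => ('u, 'm, 'a, 'h, 'w) bimod => ('u, 'm, 'a, 'h, 'x) bimod" where
 "trb J K M = \<lparr>car = (%U A B. J ` car M U A B), lact = (%U A B C b x. J (lact M U A B C b (K x))),
   ract = (%U A B C x a. J (ract M U A B C (K x) a)), res = (%u A B x. J (res M u A B (K x)))\<rparr>"

lemma trb_simps: "car (trb J K M) = (%U A B. J ` car M U A B)" "lact (trb J K M) = (%U A B C b x. J (lact M U A B C b (K x)))"
 "ract (trb J K M) = (%U A B C x a. J (ract M U A B C (K x) a))" "res (trb J K M) = (%u A B x. J (res M u A B (K x)))"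
 by (simp_all add: trb_def)

lemma bimodule_trb:
 assumes M: "bimodA s1 M" and v: "vector_space s2"
  and J: "Vector_Spaces.linear s1 s2 J" and KJ: "!!x. K (J x) = x"
 shows "bimodA s2 (trb J K M)"
proof -
 interpret M: pbim \<U> \<A> s1 M by (rule pbimI[OF M])
 interpret J: Vector_Spaces.linear s1 s2 J by (rule J)
 have lin: "linear_from s2 s2 (J ` X) (%x. J (f (K x)))" if "linear_from s1 s1 X f" for X f
  using that by (auto simp: linear_from_def KJ J.add[symmetric] J.scale[symmetric])
 have lin2: "linear_from s' s2 X (%x. J (f x))" if "linear_from s' s1 X f" for X f and s' :: "'k => 'y => 'y::ab_group_add"
  using that by (auto simp: linear_from_def J.add J.scale)
 show ?thesis
 proof (rule bimodule.intro)
  show "vector_space s2" by (rule v)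
  fix U A B assume o: "U \<in> ObU" "A \<in> obA U" "B \<in> obA U"
  note S = subspaceD[OF M.scale_vector_space M.car_subspace[OF o]]
  show "module.subspace s2 (car (trb J K M) U A B)"
   using S(1-3) J.zero by (intro subspaceI[OF v]) (auto simp: trb_simps J.add[symmetric] J.scale[symmetric] intro!: image_eqI[of 0 J 0])
  fix C assume C: "C \<in> obA U"
  show "linear_from scA s2 (hom \<A> U B C) (%b. lact (trb J K M) U A B C b x)" if "x \<in> car (trb J K M) U A B" for x
   using lin2[OF M.lact_linear_left[OF o C]] that by (auto simp: trb_simps KJ)
  show "linear_from s2 s2 (car (trb J K M) U A B) (%x. lact (trb J K M) U A B C b x)" if "b \<in> hom \<A> U B C" for b
   using lin[OF M.lact_linear_right[OF o C that]] by (simp add: trb_simps)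
  show "linear_from s2 s2 (car (trb J K M) U B C) (%x. ract (trb J K M) U A B C x a)" if "a \<in> hom \<A> U A B" for a
   using lin[OF M.ract_linear_left[OF o C that]] by (simp add: trb_simps)
  show "linear_from scA s2 (hom \<A> U A B) (%a. ract (trb J K M) U A B C x a)" if "x \<in> car (trb J K M) U B C" for x
   using lin2[OF M.ract_linear_right[OF o C]] that by (auto simp: trb_simps KJ)
 next
  fix u A B assume o: "u \<in> ArU" "A \<in> obA (tgU u)" "B \<in> obA (tgU u)"
  show "linear_from s2 s2 (car (trb J K M) (tgU u) A B) (res (trb J K M) u A B)"
   using lin[OF M.res_linear[OF o]] by (simp add: trb_simps)
  show "ract (trb J K M) (srU v) (foA v (foA u A)) (foA (cmU u v) A) (foA (cmU u v) B)
      (res (trb J K M) (cmU u v) A B x) (tw \<A> u v A) =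
     lact (trb J K M) (srU v) (foA v (foA u A)) (foA v (foA u B)) (foA (cmU u v) B)
      (tw \<A> u v B) (res (trb J K M) v (foA u A) (foA u B) (res (trb J K M) u A B x))"
   if "v \<in> ArU" "srU u = tgU v" "x \<in> car (trb J K M) (tgU u) A B" for v x
   using M.res_cmp[OF o(1) that(1,2) o(2,3)] that by (auto simp: trb_simps KJ)
  show "res (trb J K M) u A D (lact (trb J K M) (tgU u) A C D b (ract (trb J K M) (tgU u) A B C x a)) =
     lact (trb J K M) (srU u) (foA u A) (foA u C) (foA u D) (fmor \<A> u C D b)
      (ract (trb J K M) (srU u) (foA u A) (foA u B) (foA u C) (res (trb J K M) u B C x) (fmor \<A> u A B a))"
   if "C \<in> obA (tgU u)" "D \<in> obA (tgU u)" "b \<in> hom \<A> (tgU u) C D" "x \<in> car (trb J K M) (tgU u) B C" "a \<in> hom \<A> (tgU u) A B" for C D b x a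
   using M.res_act[OF o that(1,2,3) _ that(5)] that(4) by (auto simp: trb_simps KJ)
 qed (auto simp: trb_simps KJ M.lact_car M.lact_cid M.lact_ccmp M.ract_car M.ract_cid M.ract_ccmp M.lact_ract M.res_car M.res_idn)
qed

lemma hom_trb:
 assumes f: "f \<in> bhom s1 L s2 M" and J: "Vector_Spaces.linear s2 s3 J" and KJ: "!!x. K (J x) = x"
 shows "(%U A B x. J (f U A B x)) \<in> bhom s1 L s3 (trb J K M)"
proof -
 interpret J: Vector_Spaces.linear s2 s3 J by (rule J)
 note F = bimod_homD[OF f]
 show ?thesis
 proof (rule bimod_homI)
  show "linear_from s1 s3 (car L U A B) (%x. J (f U A B x))" if "U \<in> ObU" "A \<in> obA U" "B \<in> obA U" for U A B
   by (rule lin_comp[OF F(2)[OF that] UNIV_I lin_linear[OF J]])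
 qed (use F in \<open>auto simp: trb_simps laM_def raM_def KJ J.zero\<close>)
qed

end

context prestack_universe
begin

lemma embedding_exists:
 obtains J K where "Vector_Spaces.linear scA s J" "!!x. K (J x) = x"
proof -
 interpret hs: vector_space_pair "scA" s ..
 interpret sh: vector_space_pair s "scA" ..
 interpret hh: vector_space_pair "scA" "scA" ..
 let ?B = "ts.basis"
 define f where "f h = e [Inr (Inr (Inr h))]" for h
 have inj: "inj f" using inj_e by (auto simp: f_def inj_def)
 have "f ` ?B \<subseteq> range e" by (auto simp: f_def)
 then have ind: "vs.independent (f ` ?B)" using independent_e vs.dependent_mono by blast
 obtain J where J: "Vector_Spaces.linear scA s J" "\<forall>x\<in>?B. J x = f x"
  using ts.pair.linear_independent_extend[OF ts.basis(1)] by blast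
 obtain K where K: "Vector_Spaces.linear s scA K" "\<forall>x\<in>f ` ?B. K x = inv f x"
  using sh.linear_independent_extend[OF ind] by blast
 have "K (J x) = x" for x
  using hh.linear_eq_on_span[OF Vector_Spaces.linear_compose[OF J(1) K(1)] hv.linear_id, of ?B x] J(2) K(2) inj ts.basis(2)
  by (simp add: inv_f_f)
 then show thesis using that J(1) by blast
qed

lemma resolutionD:
 assumes "projective_resolution \<U> \<A> s P d \<eta> scA selfA"
 shows "projective_bimod \<U> \<A> s (P n)" "bimodA s (P n)" "d n \<in> bhom s (P (Suc n)) s (P n)"
  "\<eta> \<in> bhom s (P 0) scA selfA" "bimod_surj \<U> \<A> (P 0) selfA \<eta>"
  "bimod_exact \<U> \<A> (P 1) (d 0) (P 0) \<eta>" "bimod_exact \<U> \<A> (P (Suc (Suc n))) (d (Suc n)) (P (Suc n)) (d n)"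
 using assms by (auto simp: projective_resolution_def projective_bimod_def)

text \<open>Maps between the resolutions exist over the identity; the first step, a lift along the augmentation,
 takes place after embedding the bimodule \<open>\<A>\<close> into the ambient space of the resolutions.\<close>

lemma comparison_map:
 assumes P: "projective_resolution \<U> \<A> s P d \<eta> scA selfA"
  and P': "projective_resolution \<U> \<A> s P' d' \<eta>' scA selfA"
 obtains f where "!!n. f n \<in> bhom s (P n) s (P' n)" "\<eta>' oo f 0 = \<eta>" "!!n. d' n oo f (Suc n) = f n oo d n"
proof -
 note R = resolutionD[OF P] and R' = resolutionD[OF P']
 obtain J K where J: "Vector_Spaces.linear scA s J" and KJ: "!!x. K (J x) = x" using embedding_exists by blast
 let ?T = "trb J K selfA"
 note T = bimodule_trb[OF bimodule_self vsS J KJ]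
 have "bimod_surj \<U> \<A> (P' 0) ?T (%U A B x. J (\<eta>' U A B x))"
  using R'(5) by (auto simp: bimod_surj_def trb_simps image_image[symmetric])
 then obtain f0 where f0: "f0 \<in> bhom s (P 0) s (P' 0)"
  "!!U A B x. U \<in> ObU ==> A \<in> obA U ==> B \<in> obA U ==> x \<in> car (P 0) U A B ==> J (\<eta>' U A B (f0 U A B x)) = J (\<eta> U A B x)"
  using R(1)[unfolded projective_bimod_def, THEN conjunct2, rule_format, OF R'(2) T hom_trb[OF R'(4) J KJ] _ hom_trb[OF R(4) J KJ]] by blast
 have f0\<eta>: "\<eta>' oo f0 = \<eta>"
  by (rule bhom_eqI[OF bhom_comp[OF f0(1) R'(4,2)] R(4)]) (use f0(2) KJ in \<open>unfold bcomp_def, metis\<close>)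
 define I where "I n f \<longleftrightarrow> f \<in> bhom s (P n) s (P' n) & (n = 0 --> \<eta>' oo f = \<eta>) & (\<forall>m. n = Suc m --> d' m oo f oo d n = 0)" for n f
 have "\<exists>f. \<forall>n. I n (f n) & d' n oo f (Suc n) = f n oo d n"
 proof (rule dependent_nat_choice)
  show "\<exists>x. I 0 x" using f0(1) f0\<eta> by (auto simp: I_def)
 next
  fix f n assume I: "I n f"
  then have f: "f \<in> bhom s (P n) s (P' n)" by (simp add: I_def)
  note c = bhom_comp[OF R(3)[of n] f R(2)]
  have "\<exists>g\<in>bhom s (P (Suc n)) s (P' (Suc n)). d' n oo g = f oo d n"
  proof (cases n)
   case 0
   have "\<eta>' oo f oo d 0 = 0"
    using I exact_comp[OF R(6)[unfolded One_nat_def] R(3,4,2)] by (simp add: I_def 0 flip: bcomp_assoc)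
   then show ?thesis
    using lift_exact[OF R(1) R'(2) R'(2) bimodule_self R'(3)[of 0] R'(4) R'(6)[unfolded One_nat_def] c[unfolded 0]] unfolding 0 by blast
  next
   case (Suc m)
   then show ?thesis
    using I lift_exact[OF R(1) R'(2) R'(2) R'(2) R'(3)[of "Suc m"] R'(3) R'(7)[of m] c[unfolded Suc]] unfolding I_def Suc by blast
  qed
  then obtain g where g: "g \<in> bhom s (P (Suc n)) s (P' (Suc n))" "d' n oo g = f oo d n" by blast
  have "d' n oo g oo d (Suc n) = f oo d n oo d (Suc n)" by (simp only: bcomp_assoc[symmetric] g(2))
  also have "... = 0" unfolding exact_comp[OF R(7) R(3,3,2)] by (rule bcomp_0_right[OF f R(2)])
  finally have "I (Suc n) g" using g(1) by (simp add: I_def)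
  then show "\<exists>y. I (Suc n) y & d' n oo y = f oo d n" using g(2) by blast
 qed
 then show thesis using that unfolding I_def by blast
qed

text \<open>The homotopy is built degree by degree: what it fails to correct so far is a cycle and lifts.\<close>

lemma comparison_homotopy:
 assumes P: "projective_resolution \<U> \<A> s P d \<eta> scA selfA"
  and h: "!!n. h n \<in> bhom s (P n) s (P n)" and h0: "\<eta> oo h 0 = \<eta>" and hd: "!!n. d n oo h (Suc n) = h n oo d n"
 obtains t where "!!n. t n \<in> bhom s (P n) s (P (Suc n))" "d 0 oo t 0 = h 0 - idh (P 0)"
  "!!n. d (Suc n) oo t (Suc n) = h (Suc n) - idh (P (Suc n)) - t n oo d n"
proof -
 note R = resolutionD[OF P]
 note k = bimod_hom_diff[OF R(2) h idh_hom[OF R(2)]]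
 have "\<eta> oo (h 0 - idh (P 0)) = 0"
  using bcomp_diff_right[OF R(4,2) bimodule_self h idh_hom[OF R(2)]] bcomp_idh[OF R(4,2)] h0 by simp
 then obtain t0 where t0: "t0 \<in> bhom s (P 0) s (P (Suc 0))" "d 0 oo t0 = h 0 - idh (P 0)"
  using lift_exact[OF R(1) R(2) R(2) bimodule_self R(3)[of 0] R(4) R(6)[unfolded One_nat_def] k] by blast
 define l where "l n t = h (Suc n) - idh (P (Suc n)) - t oo d n" for n t
 define I where "I n t \<longleftrightarrow> t \<in> bhom s (P n) s (P (Suc n)) & (n = 0 --> t = t0) & d n oo l n t = 0" for n t
 have lh: "l n t \<in> bhom s (P (Suc n)) s (P (Suc n))" if "t \<in> bhom s (P n) s (P (Suc n))" for n t
  unfolding l_def by (rule bimod_hom_diff[OF R(2) k bhom_comp[OF R(3) that R(2)]])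
 have dl: "d n oo l n t = (h n - idh (P n) - d n oo t) oo d n" if t: "t \<in> bhom s (P n) s (P (Suc n))" for n t
  unfolding l_def bcomp_diff_right[OF R(3,2,2) k bhom_comp[OF R(3) t R(2)]] bcomp_diff_right[OF R(3,2,2) h idh_hom[OF R(2)]]
  by (simp add: hd bcomp_diff bcomp_idh[OF R(3,2)] idh_bcomp[OF R(3)] bcomp_assoc)
 have "\<exists>t. \<forall>n. I n (t n) & d (Suc n) oo t (Suc n) = l n (t n)"
 proof (rule dependent_nat_choice)
  show "\<exists>x. I 0 x" using t0 dl[OF t0(1)] by (auto simp: I_def bcomp_0)
 next
  fix t n assume I: "I n t"
  then have t: "t \<in> bhom s (P n) s (P (Suc n))" "d n oo l n t = 0" by (simp_all add: I_def)
  obtain t' where t': "t' \<in> bhom s (P (Suc n)) s (P (Suc (Suc n)))" "d (Suc n) oo t' = l n t"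
   using lift_exact[OF R(1) R(2) R(2) R(2) R(3)[of "Suc n"] R(3) R(7)[of n] lh[OF t(1)] t(2)] by blast
  have "d (Suc n) oo l (Suc n) t' = t oo d n oo d (Suc n)" unfolding dl[OF t'(1)] t'(2) by (simp add: l_def bcomp_assoc)
  also have "... = 0" unfolding exact_comp[OF R(7) R(3,3,2)] by (rule bcomp_0_right[OF t(1) R(2)])
  finally have "I (Suc n) t'" using t'(1) by (simp add: I_def)
  then show "\<exists>y. I (Suc n) y & d (Suc n) oo y = l n t" using t'(2) by blast
 qed
 then obtain t where t: "!!n. I n (t n)" "!!n. d (Suc n) oo t (Suc n) = l n (t n)" by blast
 have "t 0 = t0" "!!n. t n \<in> bhom s (P n) s (P (Suc n))" using t(1) by (auto simp: I_def)
 then show thesis using that[of t] t(2) t0(2) by (simp add: l_def)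
qed

lemma hom_complex:
 assumes P: "projective_resolution \<U> \<A> s P d \<eta> scA selfA"
 shows "cochain_complex (%c f U A B x. scA c (f U A B x)) (%i. bhom s (P i) scA selfA) (%i f. f oo d i)"
 unfolding cochain_complex_def
 using vs_pointwise4[OF vsA] bimod_hom_subspace[OF bimodule_self]
  bhom_comp[OF resolutionD(3)[OF P] _ resolutionD(2)[OF P]]
 by (auto simp: linear_from_def fun_eq_iff bcomp_def)

lemma homotopy_coboundary:
 assumes P: "projective_resolution \<U> \<A> s P d \<eta> scA selfA"
  and h: "!!n. h n \<in> bhom s (P n) s (P n)" "\<eta> oo h 0 = \<eta>" "!!n. d n oo h (Suc n) = h n oo d n"
  and \<phi>: "\<phi> \<in> cocycles (%i. bhom s (P i) scA selfA) (%i f. f oo d i) n"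
 shows "\<phi> oo h n - \<phi> \<in> coboundaries (%i. bhom s (P i) scA selfA) (%i f. f oo d i) n"
proof -
 note R = resolutionD[OF P]
 obtain t where t: "!!n. t n \<in> bhom s (P n) s (P (Suc n))" "d 0 oo t 0 = h 0 - idh (P 0)"
  "!!n. d (Suc n) oo t (Suc n) = h (Suc n) - idh (P (Suc n)) - t n oo d n"
  using comparison_homotopy[where h = h, OF P h] by blast
 have f: "\<phi> \<in> bhom s (P n) scA selfA" and z: "\<phi> oo d n = 0" using \<phi> by (auto simp: cocycles_def)
 note i = idh_hom[OF R(2)] and B = bcomp_diff_right[OF f R(2) bimodule_self]
 have hi: "\<phi> oo (h n - idh (P n)) = \<phi> oo h n - \<phi>" using B[OF h(1) i] bcomp_idh[OF f R(2)] by simp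
 have dt: "\<phi> oo d n oo t n = 0" using z by (simp add: bcomp_0 flip: bcomp_assoc)
 show ?thesis
 proof (cases n)
  case 0
  then show ?thesis using hi dt t(2) by (simp add: coboundaries_def)
 next
  case (Suc m)
  have "\<phi> oo h n - \<phi> - \<phi> oo t m oo d m = 0"
   using B[OF bimod_hom_diff[OF R(2) h(1) i] bhom_comp[OF R(3) t(1)[of m] R(2), folded Suc]] hi dt t(3)[of m] by (simp add: Suc)
  then have "\<phi> oo h n - \<phi> = (\<phi> oo t m) oo d m" by (simp add: bcomp_assoc)
  moreover have "\<phi> oo t m \<in> bhom s (P m) scA selfA" by (rule bhom_comp[OF t(1) f[unfolded Suc] R(2)])
  ultimately show ?thesis unfolding coboundaries_def Suc by auto
 qed
qed

lemma Ext_via_comp: "Ext_via \<U> \<A> s P d scA selfA n =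
  cohomology (%c f U A B x. scA c (f U A B x)) (%i. bhom s (P i) scA selfA) (%i f. f oo d i) n"
 unfolding Ext_via_def bcomp_def ..

theorem Ext_independent:
 assumes P: "projective_resolution \<U> \<A> s P d \<eta> scA selfA"
  and P': "projective_resolution \<U> \<A> s P' d' \<eta>' scA selfA"
 shows "kspace_iso (Ext_via \<U> \<A> s P d scA selfA n) (Ext_via \<U> \<A> s P' d' scA selfA n)"
proof -
 note R = resolutionD[OF P] and R' = resolutionD[OF P']
 obtain f where f: "!!n. f n \<in> bhom s (P n) s (P' n)" "\<eta>' oo f 0 = \<eta>" "!!n. d' n oo f (Suc n) = f n oo d n"
  using comparison_map[OF P P'] by blast
 obtain g where g: "!!n. g n \<in> bhom s (P' n) s (P n)" "\<eta> oo g 0 = \<eta>'" "!!n. d n oo g (Suc n) = g n oo d' n"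
  using comparison_map[OF P' P] by blast
 have gf: "g n oo f n \<in> bhom s (P n) s (P n)" "\<eta> oo g 0 oo f 0 = \<eta>" "d n oo g (Suc n) oo f (Suc n) = (g n oo f n) oo d n" for n
  by (rule bhom_comp[OF f(1) g(1) R'(2)], simp only: bcomp_assoc[symmetric] g(2) f(2), simp only: bcomp_assoc[symmetric] g(3))
   (simp only: bcomp_assoc f(3))
 have fg: "f n oo g n \<in> bhom s (P' n) s (P' n)" "\<eta>' oo f 0 oo g 0 = \<eta>'" "d' n oo f (Suc n) oo g (Suc n) = (f n oo g n) oo d' n" for n
  by (rule bhom_comp[OF g(1) f(1) R(2)], simp only: bcomp_assoc[symmetric] f(2) g(2), simp only: bcomp_assoc[symmetric] f(3))
   (simp only: bcomp_assoc g(3))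
 show ?thesis
  unfolding Ext_via_comp
 proof (rule cohomology_iso[OF hom_complex[OF P] hom_complex[OF P'], where \<alpha> = "%n \<phi>. \<phi> oo g n" and \<beta> = "%n \<phi>. \<phi> oo f n"])
  fix n \<phi> assume p: "\<phi> \<in> bhom s (P n) scA selfA"
  show "\<phi> oo g n \<in> bhom s (P' n) scA selfA" by (rule bhom_comp[OF g(1) p R(2)])
 next
  fix n \<phi> assume p: "\<phi> \<in> bhom s (P' n) scA selfA"
  show "\<phi> oo f n \<in> bhom s (P n) scA selfA" by (rule bhom_comp[OF f(1) p R'(2)])
 next
  fix n \<phi> assume "\<phi> \<in> cocycles (%i. bhom s (P i) scA selfA) (%i f. f oo d i) n"
  from homotopy_coboundary[where h = "%n. g n oo f n", OF P gf this] show "(\<phi> oo g n) oo f n - \<phi> \<in> coboundaries (%i. bhom s (P i) scA selfA) (%i f. f oo d i) n"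
   by (simp add: bcomp_assoc)
 next
  fix n \<phi> assume "\<phi> \<in> cocycles (%i. bhom s (P' i) scA selfA) (%i f. f oo d' i) n"
  from homotopy_coboundary[where h = "%n. f n oo g n", OF P' fg this] show "(\<phi> oo f n) oo g n - \<phi> \<in> coboundaries (%i. bhom s (P' i) scA selfA) (%i f. f oo d' i) n"
   by (simp add: bcomp_assoc)
 qed (auto simp: linear_from_def bcomp_assoc f(3) g(3), auto simp: bcomp_def fun_eq_iff)
qed

end

section \<open>Shuffles\<close>

text \<open>The cycle that moves position \<open>m\<close> to the end, past \<open>l\<close> others.  Precomposition with it inserts a last
 letter of the first word behind everything else and contributes the sign \<open>(-1)\<^sup>l\<close>.\<close>

definition rot :: "nat => nat => nat => nat" where
 "rot m l i = (if i = m then m + l else if m < i & i \<le> m + l then i - 1 else i)"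

lemma rot_Suc: "rot m (Suc l) = transpose (m + l) (Suc (m + l)) \<circ> rot m l"
 by (auto simp: rot_def fun_eq_iff transpose_def)

lemma rot_0: "rot m 0 = id"
 by (rule ext) (simp add: rot_def)

lemma rot_permutes: "rot m l permutes {m..m + l}" and sign_rot: "sign (rot m l) = (- 1) ^ l"
proof (induction l)
 case 0
 { case 1 show ?case unfolding rot_0 by (rule permutes_id)
 next case 2 show ?case by (simp add: rot_0) }
next
 case (Suc l)
 have p: "rot m l permutes {m..m + Suc l}" by (rule permutes_subset[OF Suc(1)]) auto
 have t: "transpose (m + l) (Suc (m + l)) permutes {m..m + Suc l}" by (rule permutes_swap_id) auto
 { case 1 show ?case unfolding rot_Suc by (rule permutes_compose[OF p t])
 next
  case 2
  have "permutation (rot m l)" "permutation (transpose (m + l) (Suc (m + l)))"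
   using p t permutation_permutes by (metis finite_atLeastAtMost)+
  from sign_compose[OF this(2,1)] show ?case unfolding rot_Suc by (simp add: Suc(2) sign_swap_id del: o_apply) }
qed

lemma shufflesD:
 assumes "\<beta> \<in> shuffles m l"
 shows "\<beta> permutes {1..m + l}" "strict_mono_on {1..m} \<beta>" "strict_mono_on {m + 1..m + l} \<beta>"
 using assms by (auto simp: shuffles_def)

lemma finite_shuffles: "finite (shuffles m l)"
 by (rule finite_subset[OF _ finite_permutations[of "{1..m + l}"]]) (auto simp: shuffles_def)

lemma shuffles_0: "shuffles 0 0 = {id}"
 by (auto simp: shuffles_def permutes_id)

lemma shuffles_Suc_right: "{\<beta> \<in> shuffles m (Suc l). \<beta> (m + Suc l) = m + Suc l} = shuffles m l"
proof (intro Set.equalityI subsetI)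
 fix \<beta> assume "\<beta> \<in> {\<beta> \<in> shuffles m (Suc l). \<beta> (m + Suc l) = m + Suc l}"
 then have b: "\<beta> \<in> shuffles m (Suc l)" "\<beta> (m + Suc l) = m + Suc l" by auto
 have "\<beta> x = x" if "x \<in> {1..m + Suc l} - {1..m + l}" for x
 proof -
  have "x = m + Suc l" using that by auto
  then show ?thesis using b(2) by simp
 qed
 then have "\<beta> permutes {1..m + l}" using permutes_superset[OF shufflesD(1)[OF b(1)]] by blast
 moreover have "strict_mono_on {m + 1..m + l} \<beta>" by (rule monotone_on_subset[OF shufflesD(3)[OF b(1)]]) auto
 ultimately show "\<beta> \<in> shuffles m l" using shufflesD(2)[OF b(1)] by (simp add: shuffles_def)
next
 fix \<beta> assume b: "\<beta> \<in> shuffles m l"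
 have N: "\<beta> (m + Suc l) = m + Suc l" by (rule permutes_not_in[OF shufflesD(1)[OF b]]) simp
 have p: "\<beta> permutes {1..m + Suc l}" by (rule permutes_subset[OF shufflesD(1)[OF b]]) auto
 have "strict_mono_on {m + 1..m + Suc l} \<beta>"
 proof (rule strict_mono_onI)
  fix r s assume rs: "r \<in> {m + 1..m + Suc l}" "s \<in> {m + 1..m + Suc l}" "r < s"
  show "\<beta> r < \<beta> s"
  proof (cases "s = m + Suc l")
   case True
   have "\<beta> r \<in> {1..m + l}" using permutes_in_image[OF shufflesD(1)[OF b], of r] rs True by auto
   then show ?thesis using True N by simp
  next
   case False
   then show ?thesis using strict_mono_onD[OF shufflesD(3)[OF b], of r s] rs by auto
  qed
 qed
 then show "\<beta> \<in> {\<beta> \<in> shuffles m (Suc l). \<beta> (m + Suc l) = m + Suc l}"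
  using p N shufflesD(2)[OF b] by (simp add: shuffles_def)
qed

lemma rot_shuffles: "bij_betw (%\<beta>. \<beta> \<circ> rot (Suc m) l) (shuffles m l) {\<beta> \<in> shuffles (Suc m) l. \<beta> (Suc m) = Suc m + l}"
proof (rule bij_betw_byWitness[where f' = "%\<beta>. \<beta> \<circ> inv (rot (Suc m) l)"])
 note R = rot_permutes[of "Suc m" l] and I = permutes_inv_o[OF rot_permutes[of "Suc m" l]]
 let ?N = "Suc m + l"
 have R': "rot (Suc m) l permutes {1..?N}" by (rule permutes_subset[OF R]) auto
 show "\<forall>\<beta>\<in>shuffles m l. \<beta> \<circ> rot (Suc m) l \<circ> inv (rot (Suc m) l) = \<beta>" by (simp add: o_assoc[symmetric] I)
 show "\<forall>\<beta>\<in>{\<beta> \<in> shuffles (Suc m) l. \<beta> (Suc m) = ?N}. \<beta> \<circ> inv (rot (Suc m) l) \<circ> rot (Suc m) l = \<beta>"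
  by (simp add: o_assoc[symmetric] I)
 have r: "i \<le> m ==> rot (Suc m) l i = i" "Suc m < i ==> i \<le> ?N ==> rot (Suc m) l i = i - 1" "rot (Suc m) l (Suc m) = ?N" for i
  by (auto simp: rot_def)
 show "(%\<beta>. \<beta> \<circ> rot (Suc m) l) ` shuffles m l \<subseteq> {\<beta> \<in> shuffles (Suc m) l. \<beta> (Suc m) = ?N}"
 proof (clarify)
  fix \<beta> assume b: "\<beta> \<in> shuffles m l"
  note B = shufflesD[OF b]
  have N: "\<beta> ?N = ?N" by (rule permutes_not_in[OF B(1)]) simp
  have "\<beta> permutes {1..?N}" by (rule permutes_subset[OF B(1)]) auto
  then have "\<beta> \<circ> rot (Suc m) l permutes {1..?N}" by (rule permutes_compose[OF R'])
  moreover have "strict_mono_on {1..Suc m} (\<beta> \<circ> rot (Suc m) l)"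
  proof (rule strict_mono_onI)
   fix x y assume xy: "x \<in> {1..Suc m}" "y \<in> {1..Suc m}" "x < y"
   show "(\<beta> \<circ> rot (Suc m) l) x < (\<beta> \<circ> rot (Suc m) l) y"
   proof (cases "y = Suc m")
    case True
    have "\<beta> x \<in> {1..m + l}" using permutes_in_image[OF B(1), of x] xy True by auto
    then show ?thesis using True N xy r by simp
   next
    case False
    then show ?thesis using strict_mono_onD[OF B(2), of x y] xy r by auto
   qed
  qed
  moreover have "strict_mono_on {Suc m + 1..?N} (\<beta> \<circ> rot (Suc m) l)"
  proof (rule strict_mono_onI)
   fix x y assume xy: "x \<in> {Suc m + 1..?N}" "y \<in> {Suc m + 1..?N}" "x < y"
   then have "\<beta> (x - 1) < \<beta> (y - 1)" using strict_mono_onD[OF B(3), of "x - 1" "y - 1"] by auto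
   then show "(\<beta> \<circ> rot (Suc m) l) x < (\<beta> \<circ> rot (Suc m) l) y" using xy r(2)[of x] r(2)[of y] by simp
  qed
  ultimately show "\<beta> \<circ> rot (Suc m) l \<in> shuffles (Suc m) l & (\<beta> \<circ> rot (Suc m) l) (Suc m) = ?N"
   using N r(3) by (simp add: shuffles_def)
 qed
 show "(%\<beta>. \<beta> \<circ> inv (rot (Suc m) l)) ` {\<beta> \<in> shuffles (Suc m) l. \<beta> (Suc m) = ?N} \<subseteq> shuffles m l"
 proof (clarify)
  fix \<beta> assume b: "\<beta> \<in> shuffles (Suc m) l" "\<beta> (Suc m) = ?N"
  note B = shufflesD[OF b(1)]
  let ?c = "\<beta> \<circ> inv (rot (Suc m) l)"
  have i: "inv (rot (Suc m) l) ?N = Suc m" "x \<le> m ==> inv (rot (Suc m) l) x = x"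
   "m < x ==> x < ?N ==> inv (rot (Suc m) l) x = Suc x" for x
   unfolding permutes_inv_eq[OF R] by (auto simp: rot_def)
  have p: "?c permutes {1..?N}" by (rule permutes_compose[OF permutes_inv[OF R'] B(1)])
  have "?c x = x" if "x \<in> {1..?N} - {1..m + l}" for x
  proof -
   have "x = ?N" using that by auto
   then show ?thesis using b(2) i(1) by simp
  qed
  then have "?c permutes {1..m + l}" using permutes_superset[OF p] by blast
  moreover have "strict_mono_on {1..m} ?c"
   by (rule strict_mono_onI) (use strict_mono_onD[OF B(2)] i(2) in auto)
  moreover have "strict_mono_on {m + 1..m + l} ?c"
   by (rule strict_mono_onI) (use strict_mono_onD[OF B(3)] i(3) in auto)
  ultimately show "?c \<in> shuffles m l" by (simp add: shuffles_def)
 qed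
qed

lemma shuffles_last:
 assumes "\<beta> \<in> shuffles m l" "m + l ~= 0"
 shows "m ~= 0 & \<beta> m = m + l | l ~= 0 & \<beta> (m + l) = m + l"
proof -
 note B = shufflesD[OF assms(1)]
 define i where "i = inv \<beta> (m + l)"
 have i: "\<beta> i = m + l" using permutes_inverses(1)[OF B(1)] by (simp add: i_def)
 then have "i \<in> {1..m + l}" using permutes_in_image[OF B(1), of i] assms(2) by auto
 moreover have le: "\<beta> x \<le> m + l" if "x \<in> {1..m + l}" for x using permutes_in_image[OF B(1), of x] that by auto
 moreover have False if "1 \<le> i" "i < m" using strict_mono_onD[OF B(2), of i m] that i le[of m] by auto
 moreover have False if "m < i" "i < m + l" using strict_mono_onD[OF B(3), of i "m + l"] that i le[of "m + l"] by auto
 ultimately have "i = m & m ~= 0 | i = m + l & l ~= 0"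
  by (metis add.right_neutral atLeastAtMost_iff le_eq_less_or_eq not_less not_one_le_zero)
 then show ?thesis using i by auto
qed

text \<open>The last position of a shuffle is occupied by the last letter of one of the two words.\<close>

lemma sum_shuffles:
 fixes F :: "(nat => nat) => 'x::ab_group_add"
 assumes "m + l ~= 0"
 shows "(\<Sum>\<beta>\<in>shuffles m l. F \<beta>) =
  (case l of 0 => 0 | Suc l' => \<Sum>\<beta>\<in>shuffles m l'. F \<beta>) +
  (case m of 0 => 0 | Suc m' => \<Sum>\<beta>\<in>shuffles m' l. F (\<beta> \<circ> rot m l))"
proof -
 let ?A = "{\<beta> \<in> shuffles m l. l ~= 0 & \<beta> (m + l) = m + l}" and ?B = "{\<beta> \<in> shuffles m l. m ~= 0 & \<beta> m = m + l}"
 have "?A \<inter> ?B = {}"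
 proof -
  have False if "\<beta> \<in> ?A" "\<beta> \<in> ?B" for \<beta>
   using that permutes_inj[OF shufflesD(1)[of \<beta> m l]] by (auto dest: injD[of \<beta> m "m + l"])
  then show ?thesis by blast
 qed
 moreover have "shuffles m l = ?A \<union> ?B" using shuffles_last[OF _ assms] by blast
 ultimately have "(\<Sum>\<beta>\<in>shuffles m l. F \<beta>) = (\<Sum>\<beta>\<in>?A. F \<beta>) + (\<Sum>\<beta>\<in>?B. F \<beta>)"
  using sum.union_disjoint[of ?A ?B F] finite_shuffles[of m l] by simp
 moreover have "(\<Sum>\<beta>\<in>?A. F \<beta>) = (case l of 0 => 0 | Suc l' => \<Sum>\<beta>\<in>shuffles m l'. F \<beta>)"
  using shuffles_Suc_right[of m] by (cases l) simp_all
 moreover have "(\<Sum>\<beta>\<in>?B. F \<beta>) = (case m of 0 => 0 | Suc m' => \<Sum>\<beta>\<in>shuffles m' l. F (\<beta> \<circ> rot m l))"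
  using sum.reindex_bij_betw[OF rot_shuffles, of F _ l] by (cases m) simp_all
 ultimately show ?thesis by simp
qed

section \<open>Comparison with the path-shuffle sums\<close>

text \<open>Positions of a shuffle decrease along the order of composition.\<close>

fun tlist :: "(nat => 'a) => (nat => 'h) => nat => ('a, 'h) mor list" where
 "tlist ob mo 0 = []"
| "tlist ob mo (Suc n) = (ob (Suc n), ob n, mo (Suc n)) # tlist ob mo n"

lemma tlist_cong: "(!!x. x \<le> n ==> ob x = ob' x) ==> (!!x. 1 \<le> x ==> x \<le> n ==> mo x = mo' x) ==> tlist ob mo n = tlist ob' mo' n"
 by (induction n) simp_all

lemma tlist_obs: "map (%j. ob (n - j)) [0..<n + 1] = ob n # map (%f. fst (snd f)) (tlist ob mo n)"
proof (induction n)
 case (Suc n)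
 have "map (%j. ob (Suc n - j)) [0..<Suc n + 1] = ob (Suc n) # map (%j. ob (n - j)) [0..<n + 1]"
  by (simp add: map_upt_Suc del: upt_Suc)
 then show ?case unfolding Suc by simp
qed simp

lemma tlist_mors: "map mo [1..<n + 1] = rev (map (%f. snd (snd f)) (tlist ob mo n))"
 by (induction n) simp_all

lemma finite_paths: "finite (paths \<U> l us)"
proof (induction l arbitrary: us)
 case (Suc l)
 have "paths \<U> (Suc l) us = (\<Union>i\<in>{1..Suc l}. (%r. r @ [(us, i)]) ` paths \<U> l (inner_face \<U> i us))"
  by auto
 then show ?case using Suc by (simp del: paths.simps)
qed simp

lemma paths_length: "r \<in> paths \<U> l us ==> length r = l"
 by (induction l arbitrary: r us) auto

lemma sum_paths_Suc:
 "(\<Sum>r\<in>paths \<U> (Suc l) us. F r) = (\<Sum>j<Suc l. \<Sum>r\<in>paths \<U> l (inner_face \<U> (Suc j) us). F (r @ [(us, Suc j)]))"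
proof -
 have "(\<Sum>r\<in>paths \<U> (Suc l) us. F r) = (\<Sum>(j, r)\<in>(SIGMA j:{..<Suc l}. paths \<U> l (inner_face \<U> (Suc j) us)). F (r @ [(us, Suc j)]))"
  by (rule sum.reindex_bij_witness[of _ "%(j, r). r @ [(us, Suc j)]" "%r. (snd (last r) - 1, butlast r)"]) auto
 also have "... = (\<Sum>j<Suc l. \<Sum>r\<in>paths \<U> l (inner_face \<U> (Suc j) us). F (r @ [(us, Suc j)]))"
  by (rule sum.Sigma[symmetric]) (simp_all add: finite_paths)
 finally show ?thesis .
qed

context prestack
begin

text \<open>A chain as the two lists that record a simplex: the objects in the order of composition, the morphisms in
 the opposite order.\<close>

definition obs :: "'a => ('a, 'h) mor list => 'a list" where
 "obs A xs = A # map cd xs"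

definition mrs :: "('a, 'h) mor list => 'h list" where
 "mrs xs = rev (map hm xs)"

lemma length_obs [simp]: "length (obs A xs) = Suc (length xs)" and length_mrs [simp]: "length (mrs xs) = length xs"
 by (simp_all add: obs_def mrs_def)

lemma fc_inner_face: "Suc j < length us ==> fc j us = inner_face \<U> (Suc j) us"
proof (induction j arbitrary: us)
 case 0
 then show ?case by (cases us rule: list.exhaust[case_product list.exhaust]; cases "tl us") (auto simp: inner_face_def)
next
 case (Suc j)
 then obtain u us' where us: "us = u # us'" by (cases us) auto
 have "fc (Suc j) us = u # fc j us'" using Suc(2) us by (cases us') auto
 then show ?case using Suc us by (simp add: inner_face_def)
qed

lemma ep_eps: "Suc j < length us ==> hm (ep j us A) = eps \<U> \<A> us (Suc j) A"
proof (induction j arbitrary: us)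
 case 0
 then obtain u v us' where "us = u # v # us'" by (auto simp: less_eq_Suc_le Suc_le_length_iff)
 then show ?case by (simp add: eps_def tws_def Let_def)
next
 case (Suc j)
 then obtain u vs where us: "us = u # vs" by (cases us) auto
 have j: "Suc j < length vs" using Suc(2) us by simp
 have e: "ep (Suc j) us A = fn u (ep j vs A)" using j us by (cases vs) auto
 have v: "take j vs @ vs ! j # vs ! Suc j # drop (Suc (Suc j)) vs = vs" using j by (simp add: Cons_nth_drop_Suc)
 have "star vs A = star (take j vs) (foA (vs ! j) (foA (vs ! Suc j) (star (drop (Suc (Suc j)) vs) A)))"
  using star_append[of "take j vs" "vs ! j # vs ! Suc j # drop (Suc (Suc j)) vs" A] unfolding v by simp
 moreover have "star (fc j vs) A = star (take j vs) (foA (cmU (vs ! Suc j) (vs ! j)) (star (drop (Suc (Suc j)) vs) A))"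
  unfolding fc_inner_face[OF j] by (simp add: inner_face_def star_append)
 ultimately show ?case
  using dm_ep[OF j, of A] cd_ep[OF j, of A] Suc(1)[OF j] unfolding us e[unfolded us] by (simp add: eps_def fn_def Let_def del: ep.simps)
qed

definition shob where
 "shob Y us r A xs \<beta> = shuffle_ob \<U> \<A> Y us r (obs A xs) (mrs xs) \<beta>"

definition shmo where
 "shmo Y us r A xs \<beta> = shuffle_mor \<U> \<A> Y us r (obs A xs) (mrs xs) \<beta>"

definition shl where
 "shl Y us r A xs \<beta> = tlist (shob Y us r A xs \<beta>) (shmo Y us r A xs \<beta>) (length xs + length r)"

lemma path_fun_start:
 assumes "r \<in> paths \<U> l us" "length us = Suc l" "pth Y us Z"
 shows "path_fun \<U> Y us r 0 = us"
proof (cases l)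
 case 0
 then obtain u where "us = [u]" using assms(2) by (auto simp: length_Suc_conv)
 then show ?thesis using assms 0 co_single[of u Y] by (auto simp: path_fun_def)
next
 case (Suc k)
 then show ?thesis using assms(1) by (auto simp: path_fun_def)
qed

lemma path_fun_snoc:
 assumes "y \<le> length r" "co Y (inner_face \<U> i us) = co Y us"
 shows "path_fun \<U> Y us (r @ [(us, i)]) (Suc (length r) - y) = path_fun \<U> Y (inner_face \<U> i us) r (length r - y)"
 using assms by (cases y) (auto simp: path_fun_def nth_append)

lemma shob_eq: "shob Y us r A xs \<beta> x =
  star (path_fun \<U> Y us r (length r - card {j \<in> {length xs + 1..length xs + length r}. \<beta> j \<le> x}))
   (obs A xs ! (length xs - card {j \<in> {1..length xs}. \<beta> j \<le> x}))"
 by (simp add: shob_def shuffle_ob_def Let_def)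

lemma shmo_eq: "shmo Y us r A xs \<beta> x =
  (let m = length xs; l = length r; i = inv \<beta> x in
   if i \<le> m then
     star_mor \<A> (path_fun \<U> Y us r (l - card {j \<in> {m + 1..m + l}. \<beta> j < x})) (obs A xs ! (m - i)) (obs A xs ! (m - i + 1)) (mrs xs ! (i - 1))
   else case_prod (%\<tau> k. eps \<U> \<A> \<tau> k (obs A xs ! (m - card {j \<in> {1..m}. \<beta> j < x}))) (r ! (i - m - 1)))"
 by (simp add: shmo_def shuffle_mor_def Let_def case_prod_beta)

lemma shuffle_obs_shl: "length r = l ==> shuffle_obs \<U> \<A> Y us r (obs A xs) (mrs xs) \<beta> = obs (shob Y us r A xs \<beta> (length xs + l)) (shl Y us r A xs \<beta>)"
 unfolding shuffle_obs_def obs_def[of "shob _ _ _ _ _ _ _"] shl_def shob_def[symmetric]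
 using tlist_obs[of "shob Y us r A xs \<beta>" "length xs + l" "shmo Y us r A xs \<beta>"] by (simp add: Let_def del: upt_Suc)

lemma shuffle_mors_shl: "length r = l ==> shuffle_mors \<U> \<A> Y us r (obs A xs) (mrs xs) \<beta> = mrs (shl Y us r A xs \<beta>)"
 unfolding shuffle_mors_def mrs_def[of "shl _ _ _ _ _ _"] shmo_def[symmetric]
 using tlist_mors[of "shmo Y us r A xs \<beta>" "length xs + l" "shob Y us r A xs \<beta>"] by (simp add: shl_def del: upt_Suc)

text \<open>The case in which the last position is occupied by a comparison map of the path.\<close>

lemma shl_path:
 assumes b: "\<beta> \<in> shuffles (length xs) l" and r': "r \<in> paths \<U> l (fc j us)" and us: "length us = Suc (Suc l)" and j: "j < Suc l" and p: "pth Y us Z"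
 shows "shl Y us (r @ [(us, Suc j)]) A xs \<beta> = ep j us A # shl Y (fc j us) r A xs \<beta>"
  and "shob Y us (r @ [(us, Suc j)]) A xs \<beta> (length xs + Suc l) = star us A"
proof -
 note B = shufflesD[OF b]
 have j: "Suc j < length us" and r: "length r = l" using us j paths_length[OF r'] by auto
 let ?m = "length xs" and ?N = "Suc (length xs + l)" and ?r = "r @ [(us, Suc j)]"
 have co: "co Y (inner_face \<U> (Suc j) us) = co Y us" using fc_co[OF j p] fc_inner_face[OF j] by simp
 have N: "\<beta> ?N = ?N" by (rule permutes_not_in[OF B(1)]) simp
 have im: "\<beta> x \<le> ?m + l" if "x \<in> {1..?m + l}" for x using permutes_in_image[OF B(1), of x] that by auto
 have ins: "{?m + 1..?N} = insert ?N {?m + 1..?m + l}" by auto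
 have le: "{x \<in> {?m + 1..?N}. \<beta> x \<le> y} = {x \<in> {?m + 1..?m + l}. \<beta> x \<le> y}"
  "{x \<in> {?m + 1..?N}. \<beta> x < y} = {x \<in> {?m + 1..?m + l}. \<beta> x < y}" if "y \<le> ?m + l" for y
  unfolding ins using N that by auto
 have c: "card {x \<in> {?m + 1..?m + l}. Q x} \<le> length r" for Q
  by (rule order_trans[OF card_mono[of "{?m + 1..?m + l}"]]) (use r in auto)
 have inv: "inv \<beta> y \<in> {1..?m + l}" if "y \<in> {1..?m + l}" for y
  using permutes_in_image[OF permutes_inv[OF B(1)], of y] that by simp
 have 1: "shob Y us ?r A xs \<beta> y = shob Y (fc j us) r A xs \<beta> y" if "y \<le> ?m + l" for y
  unfolding shob_eq fc_inner_face[OF j]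
  using le[OF that] path_fun_snoc[OF c co] r by simp
 have 2: "shmo Y us ?r A xs \<beta> y = shmo Y (fc j us) r A xs \<beta> y" if "1 \<le> y" "y \<le> ?m + l" for y
  unfolding shmo_eq fc_inner_face[OF j] Let_def
  using le[OF that(2)] path_fun_snoc[OF c co] r inv[of y] that by (auto simp: nth_append)
 have full: "{x \<in> {?m + 1..?N}. \<beta> x \<le> ?N} = {?m + 1..?N}" "{x \<in> {1..?m}. \<beta> x \<le> ?N} = {1..?m}" "{x \<in> {1..?m}. \<beta> x < ?N} = {1..?m}"
  using im[THEN le_SucI] im[THEN le_imp_less_Suc] N unfolding ins by auto
 have iN: "inv \<beta> ?N = ?N" using permutes_inv_eq[OF B(1)] N by simp
 show 3: "shob Y us ?r A xs \<beta> (?m + Suc l) = star us A"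
  unfolding shob_eq using full r by (simp add: path_fun_def obs_def nth_append)
 have 4: "shmo Y us ?r A xs \<beta> ?N = hm (ep j us A)"
  unfolding shmo_eq Let_def iN ep_eps[OF j] using full r by (simp add: obs_def nth_append)
 have 5: "shob Y (fc j us) r A xs \<beta> (?m + l) = star (fc j us) A"
 proof -
  have "{x \<in> {?m + 1..?m + l}. \<beta> x \<le> ?m + l} = {?m + 1..?m + l}" "{x \<in> {1..?m}. \<beta> x \<le> ?m + l} = {1..?m}"
   using im by auto
  then show ?thesis unfolding shob_eq using r path_fun_start[OF r' _ fc_pth[OF j p]] us fc_length[OF j] by (simp add: obs_def)
 qed
 have "shl Y us ?r A xs \<beta> = (star us A, star (fc j us) A, hm (ep j us A)) # tlist (shob Y us ?r A xs \<beta>) (shmo Y us ?r A xs \<beta>) (?m + l)"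
  using 1[of "?m + l"] 3 4 5 r by (simp add: shl_def)
 moreover have "tlist (shob Y us ?r A xs \<beta>) (shmo Y us ?r A xs \<beta>) (?m + l) = shl Y (fc j us) r A xs \<beta>"
  unfolding shl_def r by (rule tlist_cong) (use 1 2 in auto)
 ultimately show "shl Y us ?r A xs \<beta> = ep j us A # shl Y (fc j us) r A xs \<beta>"
  using dm_ep[OF j, of A] cd_ep[OF j, of A] by (cases "ep j us A") simp
qed

text \<open>The case in which the last position is occupied by a morphism of the chain.\<close>

lemma shl_chain:
 assumes b: "\<beta> \<in> shuffles (length xs) l" and r': "r \<in> paths \<U> l us" and us: "length us = Suc l" and p: "pth Y us Z"
  and x: "dm x = A"
 shows "shl Y us r A (x # xs) (\<beta> \<circ> rot (Suc (length xs)) l) = sm us x # shl Y us r (cd x) xs \<beta>"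
  and "shob Y us r A (x # xs) (\<beta> \<circ> rot (Suc (length xs)) l) (Suc (length xs) + l) = star us A"
proof -
 note B = shufflesD[OF b]
 have r: "length r = l" using paths_length[OF r'] by auto
 let ?m = "length xs" and ?\<beta> = "\<beta> \<circ> rot (Suc (length xs)) l" and ?N = "Suc (length xs) + l"
 have N: "\<beta> ?N = ?N" by (rule permutes_not_in[OF B(1)]) simp
 have im: "\<beta> x \<le> ?m + l" if "x \<in> {1..?m + l}" for x using permutes_in_image[OF B(1), of x] that by auto
 have rt: "i \<le> ?m ==> rot (Suc ?m) l i = i" "Suc ?m < i ==> i \<le> ?N ==> rot (Suc ?m) l i = i - 1" "rot (Suc ?m) l (Suc ?m) = ?N" for i
  by (auto simp: rot_def)
 have P: "?\<beta> permutes {1..?N}"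
  by (rule permutes_compose[OF permutes_subset[OF rot_permutes] permutes_subset[OF B(1)]]) auto
 have cr: "card {x \<in> {Suc ?m + 1..?N}. Q (?\<beta> x)} = card {x \<in> {?m + 1..?m + l}. Q (\<beta> x)}" for Q
 proof -
  have "{x \<in> {Suc ?m + 1..?N}. Q (?\<beta> x)} = Suc ` {x \<in> {?m + 1..?m + l}. Q (\<beta> x)}"
  proof (intro Set.equalityI subsetI)
   fix x assume "x \<in> {x \<in> {Suc ?m + 1..?N}. Q (?\<beta> x)}"
   then show "x \<in> Suc ` {x \<in> {?m + 1..?m + l}. Q (\<beta> x)}"
    using rt(2)[of x] by (intro image_eqI[of _ _ "x - 1"]) auto
  qed (use rt(2) in auto)
  then show ?thesis by (simp add: card_image)
 qed
 have cm: "{x \<in> {1..Suc ?m}. ?\<beta> x \<le> y} = {x \<in> {1..?m}. \<beta> x \<le> y}" "{x \<in> {1..Suc ?m}. ?\<beta> x < y} = {x \<in> {1..?m}. \<beta> x < y}" if "y \<le> ?m + l" for y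
 proof -
  have ins: "{1..Suc ?m} = insert (Suc ?m) {1..?m}" by auto
  show "{x \<in> {1..Suc ?m}. ?\<beta> x \<le> y} = {x \<in> {1..?m}. \<beta> x \<le> y}" "{x \<in> {1..Suc ?m}. ?\<beta> x < y} = {x \<in> {1..?m}. \<beta> x < y}"
   unfolding ins using rt N that by auto
 qed
 have c: "card {x \<in> {1..?m}. Q x} \<le> ?m" for Q
  by (rule order_trans[OF card_mono[of "{1..?m}"]]) auto
 have o: "obs A (x # xs) ! (Suc ?m - k) = obs (cd x) xs ! (?m - k)" if "k \<le> ?m" for k
  using that by (simp add: obs_def Suc_diff_le)
 have iv: "inv ?\<beta> y = (if inv \<beta> y \<le> ?m then inv \<beta> y else Suc (inv \<beta> y))" "inv \<beta> y \<in> {1..?m + l}" if "1 \<le> y" "y \<le> ?m + l" for y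
 proof -
  show k: "inv \<beta> y \<in> {1..?m + l}" using permutes_in_image[OF permutes_inv[OF B(1)], of y] that by simp
  show "inv ?\<beta> y = (if inv \<beta> y \<le> ?m then inv \<beta> y else Suc (inv \<beta> y))"
   unfolding permutes_inv_eq[OF P] using k rt(1)[of "inv \<beta> y"] rt(2)[of "Suc (inv \<beta> y)"] permutes_inverses(1)[OF B(1)] by auto
 qed
 have 1: "shob Y us r A (x # xs) ?\<beta> y = shob Y us r (cd x) xs \<beta> y" if "y \<le> ?m + l" for y
  unfolding shob_eq using cm[OF that] cr[of "%z. z \<le> y"] o[OF c] r by simp
 have 2: "shmo Y us r A (x # xs) ?\<beta> y = shmo Y us r (cd x) xs \<beta> y" if "1 \<le> y" "y \<le> ?m + l" for y
 proof (cases "inv \<beta> y \<le> ?m")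
  case True
  have "mrs (x # xs) ! (inv \<beta> y - 1) = mrs xs ! (inv \<beta> y - 1)"
   using iv(2)[OF that] True by (auto simp: mrs_def nth_append)
  moreover have "obs A (x # xs) ! (Suc ?m - inv \<beta> y + 1) = obs (cd x) xs ! (?m - inv \<beta> y + 1)"
   using True by (simp add: obs_def Suc_diff_le)
  ultimately show ?thesis
   unfolding shmo_eq Let_def iv(1)[OF that] using True o[OF True] cr[of "%z. z < y"] r by simp
 next
  case False
  then show ?thesis
   unfolding shmo_eq Let_def iv(1)[OF that] using cm(2)[OF that(2)] o[OF c] r by simp
 qed
 have iN: "inv ?\<beta> ?N = Suc ?m" unfolding permutes_inv_eq[OF P] using rt(3) N by simp
 have lt: "?\<beta> z < ?N" if "z \<in> {Suc ?m + 1..?N}" for z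
 proof -
  have "z - 1 \<in> {1..?m + l}" using that by auto
  from im[OF this] show ?thesis using rt(2)[of z] that by simp
 qed
 have full: "{x \<in> {Suc ?m + 1..?N}. ?\<beta> x \<le> ?N} = {Suc ?m + 1..?N}" "{x \<in> {Suc ?m + 1..?N}. ?\<beta> x < ?N} = {Suc ?m + 1..?N}"
  using lt by (auto simp: less_imp_le)
 have full': "{x \<in> {1..Suc ?m}. ?\<beta> x \<le> ?N} = {1..Suc ?m}"
 proof -
  have "?\<beta> z \<le> ?N" if "z \<in> {1..Suc ?m}" for z
  proof -
   have "z \<in> {1..?N}" using that by auto
   then have "?\<beta> z \<in> {1..?N}" using permutes_in_image[OF P, of z] by (rule iffD2[rotated])
   then show ?thesis by (rule atLeastAtMost_iff[THEN iffD1, THEN conjunct2])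
  qed
  then show ?thesis by blast
 qed
 have pf: "path_fun \<U> Y us r 0 = us" by (rule path_fun_start[OF r' us p])
 show 3: "shob Y us r A (x # xs) ?\<beta> ?N = star us A"
  unfolding shob_eq using full full' r pf by (simp add: obs_def)
 have 4: "shmo Y us r A (x # xs) ?\<beta> ?N = hm (sm us x)"
  unfolding shmo_eq Let_def iN using full r pf x by (simp add: obs_def mrs_def nth_append hm_sm)
 have 5: "shob Y us r (cd x) xs \<beta> (?m + l) = star us (cd x)"
 proof -
  have "{x \<in> {?m + 1..?m + l}. \<beta> x \<le> ?m + l} = {?m + 1..?m + l}" "{x \<in> {1..?m}. \<beta> x \<le> ?m + l} = {1..?m}"
   using im by auto
  then show ?thesis unfolding shob_eq using r pf by (simp add: obs_def)
 qed
 have "shl Y us r A (x # xs) ?\<beta> = (star us A, star us (cd x), hm (sm us x)) # tlist (shob Y us r A (x # xs) ?\<beta>) (shmo Y us r A (x # xs) ?\<beta>) (?m + l)"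
  using 1[of "?m + l"] 3 4 5 r by (simp add: shl_def)
 moreover have "tlist (shob Y us r A (x # xs) ?\<beta>) (shmo Y us r A (x # xs) ?\<beta>) (?m + l) = shl Y us r (cd x) xs \<beta>"
  unfolding shl_def r by (rule tlist_cong) (use 1 2 in auto)
 ultimately show "shl Y us r A (x # xs) ?\<beta> = sm us x # shl Y us r (cd x) xs \<beta>"
  using dm_sm[of us x] cd_sm[of us x] x by (cases "sm us x") simp
qed

text \<open>The two cases give the two parts of the recursion that defines \<open>S\<close>.\<close>

lemma path_shuffle_sum:
 assumes "pth Y us Z" "length us = Suc l" "chain Z A xs E"
 shows "(\<Sum>r\<in>paths \<U> l us. \<Sum>\<beta>\<in>shuffles (length xs) l. scA (path_sign r * of_int (sign \<beta>)) (K (shl Y us r A xs \<beta>))) = S us A xs K"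
 using assms
proof (induction us A xs K arbitrary: l rule: S.induct)
 case (1 us A xs K)
 note p = 1(3) and us = 1(4) and ch = 1(5)
 let ?t = "%us r A xs K \<beta>. scA (path_sign r * of_int (sign \<beta>)) (K (shl Y us r A xs \<beta>))"
 show ?case
 proof (cases "length xs + l = 0")
  case True
  then obtain u where "us = [u]" "xs = []" "l = 0" using us by (auto simp: length_Suc_conv)
  then show ?thesis by (simp add: shuffles_0 path_sign_def shl_def)
 next
  case False
  have 1: "(\<Sum>r\<in>paths \<U> l us. case l of 0 => 0 | Suc l' => \<Sum>\<beta>\<in>shuffles (length xs) l'. ?t us r A xs K \<beta>) =
   (\<Sum>j<l. - sg j (S (fc j us) A xs (%ys. K (ep j us A # ys))))"
  proof (cases l)
   case (Suc l')
   have "(\<Sum>r\<in>paths \<U> l' (inner_face \<U> (Suc j) us). \<Sum>\<beta>\<in>shuffles (length xs) l'. ?t us (r @ [(us, Suc j)]) A xs K \<beta>) =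
    - sg j (S (fc j us) A xs (%ys. K (ep j us A # ys)))" if "j < l" for j
   proof -
    have j: "Suc j < length us" "j < Suc l'" "length us = Suc (Suc l')" using that us Suc by auto
    have "?t us (r @ [(us, Suc j)]) A xs K \<beta> = - sg j (?t (fc j us) r A xs (%ys. K (ep j us A # ys)) \<beta>)"
     if "r \<in> paths \<U> l' (fc j us)" "\<beta> \<in> shuffles (length xs) l'" for r \<beta>
     unfolding shl_path(1)[OF that(2,1) j(3,2) p]
     by (simp add: path_sign_def power_add hv.scale_sg[symmetric] mult_ac)
    then have "(\<Sum>r\<in>paths \<U> l' (inner_face \<U> (Suc j) us). \<Sum>\<beta>\<in>shuffles (length xs) l'. ?t us (r @ [(us, Suc j)]) A xs K \<beta>) =
     - sg j (\<Sum>r\<in>paths \<U> l' (fc j us). \<Sum>\<beta>\<in>shuffles (length xs) l'. ?t (fc j us) r A xs (%ys. K (ep j us A # ys)) \<beta>)"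
     unfolding fc_inner_face[OF j(1)] by (simp add: sg_sum sum_negf)
    also have "... = - sg j (S (fc j us) A xs (%ys. K (ep j us A # ys)))"
     using "1.IH"(1)[of j l'] j fc_pth[OF j(1) p] fc_length[OF j(1)] ch by simp
    finally show ?thesis .
   qed
   then show ?thesis unfolding Suc sum_paths_Suc nat.case by (intro sum.cong) (auto simp: Suc)
  qed simp
  have 2: "(\<Sum>r\<in>paths \<U> l us. case length xs of 0 => 0 | Suc m' => \<Sum>\<beta>\<in>shuffles m' l. ?t us r A xs K (\<beta> \<circ> rot (length xs) l)) =
   (case xs of [] => 0 | x # xs' => sg l (S us (cd x) xs' (%ys. K (sm us x # ys))))"
  proof (cases xs)
   case (Cons x xs')
   have x: "dm x = A" "chain Z (cd x) xs' E" using ch Cons by auto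
   have "?t us r A (x # xs') K (\<beta> \<circ> rot (Suc (length xs')) l) = sg l (?t us r (cd x) xs' (%ys. K (sm us x # ys)) \<beta>)"
    if "r \<in> paths \<U> l us" "\<beta> \<in> shuffles (length xs') l" for r \<beta>
   proof -
    have "permutation \<beta>" "permutation (rot (Suc (length xs')) l)"
     using shufflesD(1)[OF that(2)] rot_permutes[of "Suc (length xs')" l] permutation_permutes by (metis finite_atLeastAtMost)+
    note sg = sign_compose[OF this, unfolded sign_rot]
    show ?thesis unfolding shl_chain(1)[OF that(2,1) us p x(1)] sg
     by (simp add: hv.scale_sg[symmetric] mult_ac)
   qed
   then have "(\<Sum>r\<in>paths \<U> l us. \<Sum>\<beta>\<in>shuffles (length xs') l. ?t us r A (x # xs') K (\<beta> \<circ> rot (Suc (length xs')) l)) =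
     sg l (\<Sum>r\<in>paths \<U> l us. \<Sum>\<beta>\<in>shuffles (length xs') l. ?t us r (cd x) xs' (%ys. K (sm us x # ys)) \<beta>)"
    by (simp add: sg_sum)
   then show ?thesis using "1.IH"(2)[OF Cons p us x(2)] by (simp add: Cons)
  qed simp
  have "S us A xs K = (\<Sum>j<l. - sg j (S (fc j us) A xs (%ys. K (ep j us A # ys)))) +
   (case xs of [] => 0 | x # xs' => sg l (S us (cd x) xs' (%ys. K (sm us x # ys))))"
   using False us by (subst S_expand) (auto split: list.split)
  then show ?thesis unfolding sum_shuffles[OF False] sum.distrib 1 2 by simp
 qed
qed

end

section \<open>The Gerstenhaber--Schack complex as a complex of bimodule homomorphisms\<close>

context prestack
begin

lemma hd_obs [simp]: "hd (obs A xs) = A" and last_obs [simp]: "last (obs A xs) = endo A xs"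
 by (auto simp: obs_def endo_def last_map)

lemma obs_butlast: "xs ~= [] ==> butlast (obs A xs) = obs A (butlast xs)"
 and mrs_butlast: "xs ~= [] ==> tl (mrs xs) = mrs (butlast xs)"
 by (induction xs rule: rev_induct) (auto simp: obs_def mrs_def butlast_append)

lemma obs_tl: "xs ~= [] ==> tl (obs A xs) = obs (cd (hd xs)) (tl xs)"
 and mrs_tl: "xs ~= [] ==> butlast (mrs xs) = mrs (tl xs)"
 by (cases xs; auto simp: obs_def mrs_def)+

lemma chain_nth: "chain U A xs E ==> i < length xs ==> xs ! i \<in> arr U & dm (xs ! i) = obs A xs ! i & cd (xs ! i) = obs A xs ! Suc i"
proof (induction xs arbitrary: A i)
 case (Cons x xs)
 then show ?case by (cases i) (auto simp: obs_def)
qed simp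

lemma chain_obs: "chain U A xs E ==> set (obs A xs) \<subseteq> obA U"
 by (induction xs arbitrary: A) (auto simp: obs_def dest: arrD)

lemma mrs_nth: "i < length xs ==> mrs xs ! i = hm (xs ! (length xs - 1 - i))"
 by (simp add: mrs_def rev_nth)

lemma chainI:
 "length As = Suc (length hs) ==> set As \<subseteq> obA U ==> (!!i. i < length hs ==> hs ! i \<in> hom \<A> U (As ! i) (As ! Suc i)) ==>
  \<exists>xs E. chain U (hd As) xs E & As = obs (hd As) xs & map hm xs = hs"
proof (induction hs arbitrary: As)
 case Nil
 then obtain A where "As = [A]" by (auto simp: length_Suc_conv)
 then show ?case using Nil by (intro exI[of _ "[]"]) (auto simp: obs_def)
next
 case (Cons h hs)
 then obtain A B As' where As: "As = A # B # As'" by (auto simp: length_Suc_conv)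
 have "hs ! i \<in> hom \<A> U ((B # As') ! i) ((B # As') ! Suc i)" if "i < length hs" for i
  using Cons(4)[of "Suc i"] that As by simp
 then obtain xs E where xs: "chain U B xs E" "B # As' = obs B xs" "map hm xs = hs" using Cons(1)[of "B # As'"] Cons(2,3) As by auto
 have "(A, B, h) \<in> arr U" using Cons(3) Cons(4)[of 0] As by (auto simp: arr_iff)
 then show ?case using xs As by (intro exI[of _ "(A, B, h) # xs"] exI[of _ E]) (auto simp: obs_def)
qed

lemma GS_argI:
 assumes p: "pth X us Y" and c: "chain Y A xs E"
 shows "GS_arg \<U> \<A> (X, us) (obs A xs) (mrs xs)"
proof -
 have "mrs xs ! i \<in> hom \<A> Y (obs A xs ! (length xs - 1 - i)) (obs A xs ! (length xs - i))" if i: "i < length xs" for i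
 proof -
  define k where "k = length xs - 1 - i"
  have k: "k < length xs" "length xs - i = Suc k" using i by (auto simp: k_def)
  show ?thesis unfolding mrs_nth[OF i] k_def[symmetric] k(2) using chain_nth[OF c k(1)] by (auto simp: arr_def)
 qed
 then show ?thesis using chain_obs[OF c] p by (simp add: GS_arg_def pth_iff)
qed

lemma GS_argE:
 assumes "GS_arg \<U> \<A> (X, us) As as"
 obtains Y A xs E where "pth X us Y" "chain Y A xs E" "As = obs A xs" "as = mrs xs"
proof -
 let ?Y = "lstU X us"
 have h: "composable \<U> X us" "length As = Suc (length (rev as))" "set As \<subseteq> obA ?Y"
  "!!i. i < length as ==> as ! i \<in> hom \<A> ?Y (As ! (length as - 1 - i)) (As ! (length as - i))"
  using assms by (auto simp: GS_arg_def)
 have "rev as ! i \<in> hom \<A> ?Y (As ! i) (As ! Suc i)" if "i < length (rev as)" for i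
  using h(4)[of "length as - Suc i"] that by (simp add: rev_nth Suc_diff_Suc)
 then obtain xs E where xs: "chain ?Y (hd As) xs E" "As = obs (hd As) xs" "map hm xs = rev as"
  using chainI[OF h(2,3)] by blast
 have "as = mrs xs" unfolding mrs_def xs(3) by simp
 then show thesis using that[of ?Y "hd As" xs E] xs h(1) by (simp add: pth_iff)
qed

text \<open>The cochain on typed chains that corresponds to a function on pairs of lists, and its value as a
 typed morphism.\<close>

definition uc where
 "uc \<phi> X us A xs = \<phi> (X, us) (obs A xs) (mrs xs)"

definition cv where
 "cv \<phi> X us A xs = (star us A, foA (co X us) (endo A xs), uc \<phi> X us A xs)"

lemma cv_simps [simp]: "dm (cv \<phi> X us A xs) = star us A" "cd (cv \<phi> X us A xs) = foA (co X us) (endo A xs)" "hm (cv \<phi> X us A xs) = uc \<phi> X us A xs"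
 by (simp_all add: cv_def)

lemma hm_cp: "hm (cp U g f) = ccmp \<A> U (dm f) (cd f) (cd g) (hm g) (hm f)"
 by (simp add: cp_def)

lemma cv_arr: "coch scA selfA n (uc \<phi>) ==> pth X us Y ==> chain Y A xs E ==> length us + length xs = n ==> cv \<phi> X us A xs \<in> arr X"
 using star_obj[of X us Y A] chain_obj[of Y A xs E] chain_endo[of Y A xs E] co_Ar[of X us Y] src_co[of X us Y] tgt_co[of X us Y] fob_obj[of "co X us" E]
 by (auto simp: cv_def arr_iff coch_def self_bimod_def)

text \<open>With values in \<open>\<A>\<close>, the homomorphism determined by a cochain composes \<open>b\<close>, a twist, the restricted value and \<open>g\<close>.\<close>

lemma Fk_uc:
 assumes D: "gd n X P Q (v # vs) A xs b g"
 shows "Fk selfA (uc \<phi>) X (v # vs) A xs b g =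
  hm (cp X (cp X b (tws (co (tgU v) vs) v (endo A xs))) (cp X (fn v (cv \<phi> (tgU v) vs A xs)) g))"
 using D
proof (rule gdE)
 assume "cd g = star (v # vs) A"
 then have g: "cd g = foA v (star vs A)" by simp
 let ?c = "cv \<phi> (tgU v) vs A xs"
 have t: "dm (tws w v E) = foA v (foA w E)" for w E by (simp add: tws_def)
 show ?thesis
  using res_self[of v ?c] ra_self[of g "fn v ?c" X] la_self[of "cp X (fn v ?c) g" "cp X b (tws (co (tgU v) vs) v (endo A xs))" X] g
  by (simp add: Fk_def Let_def fn_def t)
qed

lemma Fk_uc_idn:
 assumes \<phi>: "coch scA selfA n (uc \<phi>)" and D: "gd n X P Q (idU X # us) A xs b g"
 shows "Fk selfA (uc \<phi>) X (idU X # us) A xs b g = hm (cp X b (cp X (cv \<phi> X us A xs) g))"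
 using D
proof (rule gd_ConsE)
 fix v vs Z Y E
 assume h: "idU X # us = v # vs" "tgU v = Z" "pth Z vs Y" "length vs + length xs = n" "chain Y A xs E" "endo A xs = E"
  "b \<in> arr X" "dm b = foA (cmU (co Z vs) v) E" "X \<in> ObU" "co Z vs \<in> ArU" "srU (co Z vs) = Z" "tgU (co Z vs) = Y" "E \<in> obA Y"
 have Z: "Z = X" "us = vs" "v = idU X" using h by (auto simp: tgt_idn)
 have "cv \<phi> X us A xs \<in> arr X" using cv_arr[OF \<phi> h(3,5,4)] by (simp add: Z)
 moreover have "tws (co X us) (idU X) E = ida X (foA (co X us) E)" using tws_idn_right[OF h(10), of E] h(11-13) Z by (simp del: tws_idn_right)
 moreover have "dm b = foA (co X us) E" using h(8,10,11) Z by (simp add: cmp_idn_right[of "co X us", symmetric] del: composite.simps) (metis cmp_idn_right)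
 ultimately show ?thesis unfolding Fk_uc[OF D] tgt_idn[OF h(9)] h(6) using h(7,9) by simp
qed

lemma mg_eq: "Suc k < length xs ==> mg U k xs = take k xs @ [cp U (xs ! Suc k) (xs ! k)] @ drop (Suc (Suc k)) xs"
 by (induction U k xs rule: mg.induct) auto

lemma obs_nth: "i < length xs ==> chain U A xs E ==> obs A xs ! i = dm (xs ! i)" "i < length xs ==> obs A xs ! Suc i = cd (xs ! i)"
 using chain_nth[of U A xs E i] by (auto simp: obs_def)

lemma obs_mg:
 assumes "chain U A xs E" "Suc k < length xs"
 shows "obs A (mg U k xs) = take (Suc k) (obs A xs) @ drop (k + 2) (obs A xs)"
 using assms(2) by (simp add: mg_eq obs_def take_map drop_map drop_Suc_Cons[symmetric] Cons_nth_drop_Suc[symmetric, of "Suc k" xs])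

lemma mrs_mg:
 assumes "chain U A xs E" "Suc k < length xs"
 shows "mrs (mg U k xs) = take (length xs - k - 2) (mrs xs) @
   [ccmp \<A> U (obs A xs ! k) (obs A xs ! Suc k) (obs A xs ! Suc (Suc k)) (mrs xs ! (length xs - k - 2)) (mrs xs ! (length xs - k - 1))] @
   drop (length xs - k) (mrs xs)"
proof -
 have 1: "mrs xs ! (length xs - k - 2) = hm (xs ! Suc k)" "mrs xs ! (length xs - k - 1) = hm (xs ! k)"
  using assms(2) by (auto simp: mrs_nth Suc_diff_Suc numeral_2_eq_2)
 have 2: "cd (xs ! k) = dm (xs ! Suc k)" using chain_nth[OF assms(1), of k] chain_nth[OF assms(1,2)] assms(2) by simp
 have 3: "take (length xs - k - 2) (mrs xs) = rev (map hm (drop (Suc (Suc k)) xs))" "drop (length xs - k) (mrs xs) = rev (map hm (take k xs))"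
  using assms(2) by (simp_all add: mrs_def take_rev drop_rev take_map drop_map numeral_2_eq_2)
 show ?thesis
  unfolding 1 3 using obs_nth(1)[OF assms(2,1)] obs_nth(1)[OF _ assms(1), of k] obs_nth(2)[of k xs A] obs_nth(2)[OF assms(2), of A] assms(2) 2
  by (simp add: mg_eq mrs_def hm_cp)
qed

lemma d_zero_bd:
 assumes \<phi>: "coch scA selfA n (uc \<phi>)" and p: "pth X us Y" and c: "chain Y A xs E" and n: "length us + length xs = Suc n"
 shows "d_zero \<U> \<A> \<phi> (X, us) (obs A xs) (mrs xs) =
  (if xs = [] then 0 else hm (cp X (fn (co X us) (last xs)) (cv \<phi> X us A (butlast xs))) +
   (\<Sum>i<length xs - 1. sg (length xs - 1 - i) (uc \<phi> X us A (mg Y i xs))) +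
   sg (length xs) (hm (cp X (cv \<phi> X us (cd (hd xs)) (tl xs)) (sm us (hd xs)))))"
proof (cases "xs = []")
 case False
 let ?q = "length xs"
 have q: "?q ~= 0" "length xs - 1 < length xs" "0 < length xs" using False by auto
 have Y: "lstU X us = Y" using p by (simp add: pth_iff)
 note cb = chain_butlast[OF c False] and ct = chain_tl[OF c False]
 have l: "mrs xs ! 0 = hm (last xs)" "mrs xs ! (?q - 1) = hm (hd xs)" "obs A xs ! 0 = A" "obs A xs ! 1 = cd (hd xs)"
  "obs A xs ! (?q - 1) = dm (last xs)" "obs A xs ! ?q = E"
  using False obs_nth(1)[OF q(2) c] obs_nth(2)[OF q(2), of A] obs_nth(2)[OF q(3), of A] cb(3)
  by (auto simp: mrs_nth last_conv_nth hd_conv_nth obs_def)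
 have 1: "ccmp \<A> X (star us A) (foA (co X us) (dm (last xs))) (foA (co X us) E)
   (fmor \<A> (co X us) (dm (last xs)) E (hm (last xs))) (\<phi> (X, us) (butlast (obs A xs)) (tl (mrs xs))) =
  hm (cp X (fn (co X us) (last xs)) (cv \<phi> X us A (butlast xs)))"
  using False cb chain_endo[OF cb(1)] by (simp add: hm_cp fn_def uc_def obs_butlast mrs_butlast)
 have et: "endo (cd (hd xs)) (tl xs) = E" using chain_endo[OF ct(1)] .
 have 2: "ccmp \<A> X (star us A) (star us (cd (hd xs))) (foA (co X us) E) (\<phi> (X, us) (tl (obs A xs)) (butlast (mrs xs))) (star_mor \<A> us A (cd (hd xs)) (hm (hd xs))) =
  hm (cp X (cv \<phi> X us (cd (hd xs)) (tl xs)) (sm us (hd xs)))"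
  using False ct et by (simp add: hm_cp hm_sm uc_def obs_tl mrs_tl)
 have 3: "(\<Sum>i\<in>{1..<?q}. scA ((- 1) ^ i) (\<phi> (X, us) (take (?q - i) (obs A xs) @ drop (?q - i + 1) (obs A xs))
   (take (i - 1) (mrs xs) @ [ccmp \<A> Y (obs A xs ! (?q - i - 1)) (obs A xs ! (?q - i)) (obs A xs ! (?q - i + 1)) (mrs xs ! (i - 1)) (mrs xs ! i)] @
    drop (i + 1) (mrs xs)))) = (\<Sum>i<?q - 1. sg (?q - 1 - i) (uc \<phi> X us A (mg Y i xs)))"
 proof (rule sum.reindex_bij_witness[of _ "%i. ?q - 1 - i" "%i. ?q - 1 - i"])
  fix i assume i: "i \<in> {1..<?q}"
  define k where "k = ?q - 1 - i"
  have k: "Suc k < ?q" "?q - i = Suc k" "?q - i + 1 = k + 2" "i - 1 = ?q - k - 2" "?q - i - 1 = k" "i = ?q - k - 1" "i + 1 = ?q - k" "?q - 1 - k = i"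
   using i by (auto simp: k_def)
  have k2: "Suc (Suc k) = k + 2" by simp
  have "sg (?q - 1 - k) (uc \<phi> X us A (mg Y k xs)) = scA ((- 1) ^ i) (\<phi> (X, us) (take (Suc k) (obs A xs) @ drop (k + 2) (obs A xs))
   (take (?q - k - 2) (mrs xs) @ [ccmp \<A> Y (obs A xs ! k) (obs A xs ! Suc k) (obs A xs ! (k + 2)) (mrs xs ! (?q - k - 2)) (mrs xs ! (?q - k - 1))] @
    drop (?q - k) (mrs xs)))"
   unfolding uc_def obs_mg[OF c k(1)] mrs_mg[OF c k(1)] hv.scale_sg[symmetric] k(8) k2 ..
  then show "sg (?q - 1 - (?q - 1 - i)) (uc \<phi> X us A (mg Y (?q - 1 - i) xs)) = scA ((- 1) ^ i) (\<phi> (X, us) (take (?q - i) (obs A xs) @ drop (?q - i + 1) (obs A xs))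
   (take (i - 1) (mrs xs) @ [ccmp \<A> Y (obs A xs ! (?q - i - 1)) (obs A xs ! (?q - i)) (obs A xs ! (?q - i + 1)) (mrs xs ! (i - 1)) (mrs xs ! i)] @
    drop (i + 1) (mrs xs)))"
   unfolding k_def[symmetric] k(2,3,4,5,7) k(6)[symmetric] by simp
 qed auto
 show ?thesis
  unfolding d_zero_def prod.case Let_def length_mrs Y
  using q(1) False l 1 2 3 by (simp add: hv.scale_sg)
qed (simp add: d_zero_def mrs_def)

end

context prestack
begin

lemma endo_map: "endo (foA v A) (map (fn v) xs) = foA v (endo A xs)"
 by (simp add: endo_def last_map fn_def)

lemma obs_map: "map (foA v) (obs A xs) = obs (foA v A) (map (fn v) xs)"
 by (simp add: obs_def fn_def)

lemma mrs_map:
 assumes "chain U A xs E"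
 shows "map (%i. fmor \<A> v (obs A xs ! (length xs - 1 - i)) (obs A xs ! (length xs - i)) (mrs xs ! i)) [0..<length xs] = mrs (map (fn v) xs)"
proof (rule nth_equalityI)
 fix i assume "i < length (map (%i. fmor \<A> v (obs A xs ! (length xs - 1 - i)) (obs A xs ! (length xs - i)) (mrs xs ! i)) [0..<length xs])"
 then have i: "i < length xs" by simp
 define k where "k = length xs - Suc i"
 have k: "k < length xs" "length xs - i = Suc k" using i by (auto simp: k_def)
 show "map (%i. fmor \<A> v (obs A xs ! (length xs - 1 - i)) (obs A xs ! (length xs - i)) (mrs xs ! i)) [0..<length xs] ! i = mrs (map (fn v) xs) ! i"
  using i k obs_nth[OF k(1)] assms by (simp add: mrs_nth k_def[symmetric] fn_def)
qed simp

lemma d_simp_eq: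
 assumes p: "pth X us Y" and us: "us ~= []" and c: "chain Y A xs E"
 shows "d_simp \<U> \<A> \<phi> (X, us) (obs A xs) (mrs xs) =
  hm (cp X (tws (co (tgU (hd us)) (tl us)) (hd us) E) (fn (hd us) (cv \<phi> (tgU (hd us)) (tl us) A xs))) +
  (\<Sum>j<length us - 1. sg (Suc j) (hm (cp X (cv \<phi> X (fc j us) A xs) (ep j us A)))) +
  sg (length us) (hm (cp X (cut X (butlast us) [last us] E) (cv \<phi> X (butlast us) (foA (last us) A) (map (fn (last us)) xs))))"
proof -
 have E: "endo A xs = E" by (rule chain_endo[OF c])
 obtain u vs where uv: "us = u # vs" using us by (cases us) auto
 obtain L v where Lv: "us = L @ [v]" using us by (cases us rule: rev_cases) auto
 have u: "u \<in> ArU" "srU u = X" "v \<in> ArU" using p uv p[unfolded Lv pth_append] by auto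
 have w: "co X us = cmU (co (tgU u) vs) u" using uv by simp
 have 1: "ccmp \<A> X (star us A) (foA (hd us) (foA (co (tgU (hd us)) (tl us)) E)) (foA (co X us) E) (c_simp \<U> \<A> X us 1 E)
   (fmor \<A> (hd us) (star (tl us) A) (foA (co (tgU (hd us)) (tl us)) E) (\<phi> (face \<U> 0 (X, us)) (obs A xs) (mrs xs))) =
  hm (cp X (tws (co (tgU (hd us)) (tl us)) (hd us) E) (fn (hd us) (cv \<phi> (tgU (hd us)) (tl us) A xs)))"
  using uv u E by (simp add: hm_cp fn_def tws_def c_simp_def face_def uc_def last_ob_def cmp_idn_left)
 have 2: "(\<Sum>i\<in>{1..length us - 1}. scA ((- 1) ^ i) (ccmp \<A> X (star us A) (star (inner_face \<U> i us) A) (foA (co X us) E)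
   (\<phi> (face \<U> i (X, us)) (obs A xs) (mrs xs)) (eps \<U> \<A> us i A))) =
  (\<Sum>j<length us - 1. sg (Suc j) (hm (cp X (cv \<phi> X (fc j us) A xs) (ep j us A))))"
 proof (rule sum.reindex_bij_witness[of _ Suc "%i. i - 1"])
  fix i assume i: "i \<in> {1..length us - 1}"
  define j where "j = i - 1"
  have j: "i = Suc j" "Suc j < length us" using i by (auto simp: j_def)
  show "sg (Suc (i - 1)) (hm (cp X (cv \<phi> X (fc (i - 1) us) A xs) (ep (i - 1) us A))) = scA ((- 1) ^ i) (ccmp \<A> X (star us A) (star (inner_face \<U> i us) A) (foA (co X us) E)
   (\<phi> (face \<U> i (X, us)) (obs A xs) (mrs xs)) (eps \<U> \<A> us i A))"
   unfolding j(1) hv.scale_sg using j(2) dm_ep[OF j(2), of A] cd_ep[OF j(2), of A] ep_eps[OF j(2), of A] fc_co[OF j(2) p] fc_inner_face[OF j(2)] E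
   by (simp add: hm_cp uc_def face_def)
 qed auto
 have 3: "ccmp \<A> X (star us A) (foA (co X (butlast us)) (foA (last us) E)) (foA (co X us) E) (c_simp \<U> \<A> X us (length us - 1) E)
   (\<phi> (face \<U> (length us - 1 + 1) (X, us)) (map (foA (last us)) (obs A xs))
    (map (%i. fmor \<A> (last us) (obs A xs ! (length xs - 1 - i)) (obs A xs ! (length xs - i)) (mrs xs ! i)) [0..<length xs])) =
  hm (cp X (cut X (butlast us) [last us] E) (cv \<phi> X (butlast us) (foA (last us) A) (map (fn (last us)) xs)))"
 proof -
  have cov: "co Z [v] = v" for Z by (rule co_single[OF u(3)])
  obtain Z where Z: "pth X L Z" "pth Z [v] Y" using p unfolding Lv pth_append by blast
  have w: "co X us = cmU v (co X L)" unfolding Lv using co_append[OF Z] cov by simp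
  show ?thesis
   unfolding obs_map mrs_map[OF c] w
   using E cov by (simp add: Lv hm_cp uc_def face_def c_simp_def cut_def tws_def endo_map star_append del: composite.simps)
 qed
 show ?thesis
  unfolding d_simp_def prod.case Let_def length_mrs hd_obs last_obs E
  using 1 2 3 us by (simp add: hv.scale_sg)
qed

lemma shob_end:
 assumes b: "\<beta> \<in> shuffles (length xs) l" and r: "r \<in> paths \<U> l us" and us: "length us = Suc l" and p: "pth Y us Z"
 shows "shob Y us r A xs \<beta> (length xs + l) = star us A"
proof -
 have im: "\<beta> x \<le> length xs + l" if "x \<in> {1..length xs + l}" for x
 proof -
  have "\<beta> x \<in> {1..length xs + l}" using that permutes_in_image[OF shufflesD(1)[OF b], of x] by (rule iffD2[rotated])
  then show ?thesis by (rule atLeastAtMost_iff[THEN iffD1, THEN conjunct2])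
 qed
 have "{x \<in> {length xs + 1..length xs + l}. \<beta> x \<le> length xs + l} = {length xs + 1..length xs + l}" "{x \<in> {1..length xs}. \<beta> x \<le> length xs + l} = {1..length xs}"
  using im by auto
 then show ?thesis unfolding shob_eq using paths_length[OF r] path_fun_start[OF r us p] by (simp add: obs_def)
qed

lemma d_higher_eq:
 assumes L: "pth X L Z" and R: "pth Z R Y" "R ~= []" and c: "chain Y A xs E"
 shows "d_higher \<U> \<A> (length R) \<phi> (X, L @ R) (obs A xs) (mrs xs) =
  sg (length xs) (S R A xs (%zs. hm (cp X (cut X L R E) (cv \<phi> X L (star R A) zs))))"
proof -
 have E: "endo A xs = E" by (rule chain_endo[OF c])
 have Z: "lstU X L = Z" using L by (simp add: pth_iff)
 obtain l where l: "length R = Suc l" using R(2) by (cases R) auto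
 let ?K = "%zs. ccmp \<A> X (star (L @ R) A) (foA (co X L) (foA (co Z R) E)) (foA (co X (L @ R)) E) (tw \<A> (co Z R) (co X L) E) (\<phi> (X, L) (obs (star R A) zs) (mrs zs))"
 have "d_higher \<U> \<A> (length R) \<phi> (X, L @ R) (obs A xs) (mrs xs) =
  (\<Sum>r\<in>paths \<U> l R. \<Sum>\<beta>\<in>shuffles (length xs) l. scA (path_sign r * of_int (sign \<beta>) * (- 1) ^ length xs) (?K (shl Z R r A xs \<beta>)))"
 proof -
  have "\<phi> (X, L) (shuffle_obs \<U> \<A> Z R r (obs A xs) (mrs xs) \<beta>) (shuffle_mors \<U> \<A> Z R r (obs A xs) (mrs xs) \<beta>) =
   \<phi> (X, L) (obs (star R A) (shl Z R r A xs \<beta>)) (mrs (shl Z R r A xs \<beta>))"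
   if "r \<in> paths \<U> l R" "\<beta> \<in> Defs.shuffles (length xs) l" for r \<beta>
   unfolding shuffle_obs_shl[OF paths_length[OF that(1)]] shuffle_mors_shl[OF paths_length[OF that(1)]] shob_end[OF that(2,1) l R(1)] ..
  then show ?thesis
   unfolding d_higher_def prod.case Let_def length_mrs hd_obs last_obs E
   by (simp add: Z c_simp_def l)
 qed
 also have "... = sg (length xs) (S R A xs ?K)"
  unfolding path_shuffle_sum[OF R(1) l c, symmetric] hv.scale_sg[symmetric] hv.scale_sum_right
  by (simp add: mult.commute)
 also have "S R A xs ?K = S R A xs (%zs. hm (cp X (cut X L R E) (cv \<phi> X L (star R A) zs)))"
  using chain_endo
  by (intro S_cong[OF R c]) (simp add: hm_cp uc_def cut_def Z tws_def star_append co_append[OF L R(1)] del: composite.simps)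
 finally show ?thesis .
qed

lemma Fk_cut:
 assumes \<phi>: "coch scA selfA n (uc \<phi>)" and L: "pth X L Z" and R: "pth Z R Y" "R ~= []" and c: "chain Y A xs E"
  and n: "length (L @ R) + length xs = Suc n"
 shows "S R A xs (%zs. Fk selfA (uc \<phi>) X (idU X # L) (star R A) zs
   (cp X (ida X (foA (co X (L @ R)) E)) (cut X (idU X # L) R E)) (ida X (star (L @ R) A))) =
  S R A xs (%zs. hm (cp X (cut X L R E) (cv \<phi> X L (star R A) zs)))"
proof (rule S_cong[OF R c])
 fix zs assume zs: "chain Z (star R A) zs (foA (co Z R) E)" "Suc (length zs) = length R + length xs"
 have o: "X \<in> ObU" "A \<in> obA Y" "E \<in> obA Y" using pth_Ob[OF L] chain_obj[OF c] by auto
 have LR: "pth X (L @ R) Y" using L R pth_append by blast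
 note w = co_Ar[OF LR] src_co[OF LR] tgt_co[OF LR] and wL = co_Ar[OF L] src_co[OF L] tgt_co[OF L]
 have LR': "pth X (idU X # L) Z" using L o by (simp add: idn_Ar src_idn tgt_idn)
 have ci: "co X (idU X # L) = co X L" using cmp_idn_right[OF wL(1)] wL(2) o by (simp add: tgt_idn)
 have cut: "cut X (idU X # L) R E = cut X L R E" unfolding cut_eq[OF LR'] cut_eq[OF L] ci ..
 note ca = cut_arr[OF L R(1) o(3)]
 have s: "star (L @ R) A \<in> obA X" using star_obj[OF LR o(2)] .
 have b: "cp X (ida X (foA (co X (L @ R)) E)) (cut X (idU X # L) R E) = cut X L R E" unfolding cut using ca o by simp
 have g: "gd n X (star (L @ R) A) (foA (co X (L @ R)) E) (idU X # L) (star R A) zs (cut X L R E) (ida X (star (L @ R) A))"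
  using o s ca ci zs n by (intro gdI[OF LR' _ _ zs(1)]) (auto simp: star_append fob_idn)
 have k: "cv \<phi> X L (star R A) zs \<in> arr X" using cv_arr[OF \<phi> L zs(1)] zs(2) n R by simp
 show "Fk selfA (uc \<phi>) X (idU X # L) (star R A) zs
   (cp X (ida X (foA (co X (L @ R)) E)) (cut X (idU X # L) R E)) (ida X (star (L @ R) A)) = hm (cp X (cut X L R E) (cv \<phi> X L (star R A) zs))"
  unfolding b Fk_uc_idn[OF \<phi> g] using k o by (simp add: star_append)
qed

end

text \<open>A linear bijection of graded vector spaces commuting with the differentials transports the complex
 structure.\<close>

lemma cohomology_iso_bij:
 fixes s :: "'k::field => 'x => 'x::ab_group_add" and s' :: "'k => 'y => 'y::ab_group_add"
 assumes C': "cochain_complex s' C' d'" and s: "vector_space s"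
  and lin: "!!n. linear_from s' s (C' n) (\<beta> n)" and im: "!!n. \<beta> n ` C' n = C n" and inj: "!!n. inj_on (\<beta> n) (C' n)"
  and com: "!!n f. f \<in> C' n ==> \<beta> (Suc n) (d' n f) = d n (\<beta> n f)"
 shows "kspace_iso (cohomology s C d n) (cohomology s' C' d' n)"
proof -
 note D' = cochain_complexD[OF C'] and S' = subspaceD[OF cochain_complexD(1,2)[OF C']]
 define \<alpha> where "\<alpha> n = inv_into (C' n) (\<beta> n)" for n
 have \<beta>: "\<beta> n f \<in> C n" if "f \<in> C' n" for n f using im that by blast
 have \<alpha>: "\<alpha> n x \<in> C' n" "\<beta> n (\<alpha> n x) = x" if "x \<in> C n" for n x
  using that im[of n] inv_into_into[of x "\<beta> n" "C' n"] f_inv_into_f[of x "\<beta> n" "C' n"] by (auto simp: \<alpha>_def)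
 have \<alpha>\<beta>: "\<alpha> n (\<beta> n f) = f" if "f \<in> C' n" for n f by (simp add: \<alpha>_def inv_into_f_f[OF inj that])
 have eq: "\<alpha> n x = f" if "f \<in> C' n" "x = \<beta> n f" for n x f using \<alpha>\<beta> that by simp
 have add: "x + y = \<beta> n (\<alpha> n x + \<alpha> n y)" if "x \<in> C n" "y \<in> C n" for n x y
  using linear_fromD(1)[OF lin \<alpha>(1)[OF that(1)] \<alpha>(1)[OF that(2)]] \<alpha>(2) that by simp
 have sc: "s c x = \<beta> n (s' c (\<alpha> n x))" if "x \<in> C n" for c n x
  using linear_fromD(2)[OF lin \<alpha>(1)[OF that]] \<alpha>(2) that by simp
 have d: "d n x = \<beta> (Suc n) (d' n (\<alpha> n x))" if "x \<in> C n" for n x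
  using com[OF \<alpha>(1)[OF that]] \<alpha>(2)[OF that] by simp
 have lin\<alpha>: "linear_from s s' (C n) (\<alpha> n)" for n
  unfolding linear_from_def using eq[OF _ add] eq[OF _ sc] S'(2,3) \<alpha>(1) by blast
 have sub: "module.subspace s (C n)" for n
  using lin_0[OF lin D'(1,2)] \<beta>[OF S'(1)] add sc \<beta>[OF S'(2)[OF \<alpha>(1) \<alpha>(1)]] \<beta>[OF S'(3)[OF \<alpha>(1)]]
  by (intro subspaceI[OF s]) auto
 have "linear_from s s (C n) (d n)" for n
  by (rule lin_cong[THEN iffD2, OF d s sub], assumption,
    rule lin_comp[OF lin_comp[OF lin\<alpha> \<alpha>(1) D'(3)] D'(4)[OF \<alpha>(1)] lin])
 then have C: "cochain_complex s C d"
  unfolding cochain_complex_def using s sub d \<beta>[OF D'(4)[OF \<alpha>(1)]] by auto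
 note Z = subspaceD(1)[OF s subspace_coboundaries[OF C]] and Z' = subspaceD(1)[OF D'(1) subspace_coboundaries[OF C']]
 show ?thesis
 proof (rule cohomology_iso[OF C C' \<alpha>(1) lin\<alpha> _ \<beta> lin com])
  show "\<alpha> (Suc n) (d n x) = d' n (\<alpha> n x)" if "x \<in> C n" for n x
   by (rule eq[OF D'(4)[OF \<alpha>(1)[OF that]] d[OF that]])
 qed (auto simp: cocycles_def \<alpha>(2) \<alpha>\<beta> Z Z')
qed

context prestack_universe
begin

text \<open>Term by term: the bar differential is \<open>d\<^sub>0\<close>; merging the identity with the first arrow of the path is the first term of \<open>d\<^sub>1\<close>,
 the other inner faces are its middle terms, the cut before the last arrow is its last term; the remaining
 cuts are the \<open>d\<^sub>j\<close> with \<open>j \<ge> 2\<close>.\<close>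

lemma Dl_ug_GS_d:
 assumes \<phi>: "coch scA selfA n (uc \<phi>)" and p: "pth X us Y" and c: "chain Y A xs E" and n: "length us + length xs = Suc n"
 shows "Dl X (Fk selfA (uc \<phi>) X) (idU X # us) A xs (ida X (foA (co X us) E)) (ida X (star us A)) =
  GS_d \<U> \<A> n \<phi> (X, us) (obs A xs) (mrs xs)"
proof -
 let ?F = "Fk selfA (uc \<phi>) X" and ?i = "idU X" and ?w = "co X us"
 let ?b = "ida X (foA (co X us) E)" and ?g = "ida X (star us A)" and ?q = "length xs" and ?m = "length us"
 let ?d = "%j. d_higher \<U> \<A> j \<phi> (X, us) (obs A xs) (mrs xs)"
 note D = gd_ug[OF p c n]
 have o: "X \<in> ObU" "Y \<in> ObU" "A \<in> obA Y" "E \<in> obA Y" "endo A xs = E" using pth_Ob[OF p] chain_obj[OF c] chain_endo[OF c] by auto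
 note w = co_Ar[OF p] src_co[OF p] tgt_co[OF p]
 have ob: "star us A \<in> obA X" "foA ?w E \<in> obA X" using gd_Ob[OF D] by auto
 have ci: "co X (?i # us) = ?w" using cmp_idn_right[OF w(1)] w(2) o by (simp add: tgt_idn)
 have lo: "lstU X (?i # us) = Y" using p o by (auto simp: pth_iff last_ob_def tgt_idn)
 have smi: "sm (?i # us) x = sm us x" if "x \<in> arr Y" for x using sm_arr[OF p that] o by simp
 have B: "bd (%b x. cp X b (fn (co X (?i # us)) x)) (%x g. cp X (sm (?i # us) x) g) (lstU X (?i # us)) (%b A xs g. ?F (?i # us) A xs b g) ?b A xs ?g =
  d_zero \<U> \<A> \<phi> (X, us) (obs A xs) (mrs xs)"
 proof (cases "xs = []")
  case False
  note cb = chain_butlast[OF c False] and ct = chain_tl[OF c False]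
  have l: "length us + length (butlast xs) = n" "length us + length (tl xs) = n" using n length_greater_0_conv[THEN iffD2, OF False] unfolding length_butlast length_tl by linarith+
  have fl: "fn ?w (last xs) \<in> arr X" "cd (fn ?w (last xs)) = foA ?w E" using fn_arr[OF w(1), of "last xs"] cb(2,3) w(2,3) by (simp_all add: fn_def)
  have 1: "?F (?i # us) A (butlast xs) (cp X ?b (fn ?w (last xs))) ?g = hm (cp X (fn ?w (last xs)) (cv \<phi> X us A (butlast xs)))"
   unfolding Fk_uc_idn[OF \<phi> gd_butlast[OF D False, unfolded ci]] using fl o ob cv_arr[OF \<phi> p cb(1) l(1)] by simp
  have 2: "?F (?i # us) A (mg Y i xs) ?b ?g = uc \<phi> X us A (mg Y i xs)" if i: "Suc i < length xs" for i
  proof -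
   note cm = chain_mg[OF o(2) c i]
   have "length us + length (mg Y i xs) = n" using mg_length[OF i] i n by simp
   from cv_arr[OF \<phi> p cm this] show ?thesis
    unfolding Fk_uc_idn[OF \<phi> gd_mg[OF D i, unfolded lo]] using o ob chain_endo[OF cm] by simp
  qed
  have s: "sm us (hd xs) \<in> arr X" "dm (sm us (hd xs)) = star us A" using sm_arr[OF p ct(2)] ct(3) by auto
  have 3: "?F (?i # us) (cd (hd xs)) (tl xs) ?b (cp X (sm (?i # us) (hd xs)) ?g) = hm (cp X (cv \<phi> X us (cd (hd xs)) (tl xs)) (sm us (hd xs)))"
   unfolding smi[OF ct(2)] Fk_uc_idn[OF \<phi> gd_tl[OF D False], unfolded smi[OF ct(2)]]
   using s o ob cv_arr[OF \<phi> p ct(1) l(2)] chain_endo[OF ct(1)] by simp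
  show ?thesis
   unfolding bd_explicit d_zero_bd[OF \<phi> p c n] ci lo using False 1 2 3 by simp
 next
  case True
  then show ?thesis unfolding bd_explicit d_zero_bd[OF \<phi> p c n] by simp
 qed
 have C: "(\<Sum>k\<in>{1..<length (?i # us)}. sg ?q (S (drop k (?i # us)) A xs (%zs. ?F (take k (?i # us)) (star (drop k (?i # us)) A) zs
    (cp X ?b (cut X (take k (?i # us)) (drop k (?i # us)) (endo A xs))) ?g))) = (\<Sum>j\<in>{1..?m}. ?d j)"
 proof (rule sum.reindex_bij_witness[of _ "%j. Suc ?m - j" "%k. Suc ?m - k"])
  fix k assume k: "k \<in> {1..<length (?i # us)}"
  define h where "h = k - 1"
  have h: "k = Suc h" "h < ?m" using k by (auto simp: h_def)
  have ne: "drop h us ~= []" and le: "length (drop h us) = Suc ?m - k" using h by auto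
  obtain Z where Z: "pth X (take h us) Z" "pth Z (drop h us) Y" using p pth_append[of X "take h us" "drop h us" Y] by auto
  show "?d (Suc ?m - k) = sg ?q (S (drop k (?i # us)) A xs (%zs. ?F (take k (?i # us)) (star (drop k (?i # us)) A) zs
    (cp X ?b (cut X (take k (?i # us)) (drop k (?i # us)) (endo A xs))) ?g))"
   using Fk_cut[OF \<phi> Z ne c] d_higher_eq[OF Z ne c, of \<phi>] n unfolding le h(1) o(5) by simp
 qed auto
 show ?thesis
 proof (cases us)
  case Nil
  then show ?thesis unfolding Dl_def B C using GS_argI[OF p c] n by (simp add: GS_d_def d_comp_def)
 next
  case (Cons u vs)
  let ?f = "%j. sg (Suc (length (?i # us) + ?q + j)) (?F (fc j (?i # us)) A xs ?b (cp X (ep j (?i # us) A) ?g))"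
  have u: "u \<in> ArU" "srU u = X" "pth (tgU u) vs Y" using p Cons by auto
  note wv = co_Ar[OF u(3)] src_co[OF u(3)] tgt_co[OF u(3)]
  have wc: "?w = cmU (co (tgU u) vs) u" using Cons by simp
  have 0: "?F (fc 0 (?i # us)) A xs ?b (cp X (ep 0 (?i # us) A) ?g) = hm (cp X (tws (co (tgU u) vs) u E) (fn u (cv \<phi> (tgU u) vs A xs)))"
  proof -
   have f: "fc 0 (?i # us) = u # vs" using Cons cmp_idn_right[OF u(1)] u(2) by simp
   have "star vs A \<in> obA (tgU u)" using star_obj[OF u(3) o(3)] .
   then have "ep 0 (?i # us) A = ?g" using tws_idn_right[OF u(1)] u(2) Cons by simp
   then have g: "cp X (ep 0 (?i # us) A) ?g = ?g" using o ob by simp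
   have d: "gd n X (star us A) (foA ?w E) (u # vs) A xs ?b ?g"
    using gd_fc[OF D, of 0] f g Cons by simp
   have "tws (co (tgU u) vs) u E \<in> arr X" "cd (tws (co (tgU u) vs) u E) = foA ?w E"
    using tws_arr[OF wv(1) u(1)] wv u o wc by (auto simp: tws_def)
   moreover have "fn u (cv \<phi> (tgU u) vs A xs) \<in> arr X" "dm (fn u (cv \<phi> (tgU u) vs A xs)) = star us A"
    using fn_arr[OF u(1) cv_arr[OF \<phi> u(3) c]] u(2) n Cons by (auto simp: fn_def)
   ultimately show ?thesis unfolding f g Fk_uc[OF d] using o ob by simp
  qed
  have S: "?F (fc (Suc j) (?i # us)) A xs ?b (cp X (ep (Suc j) (?i # us) A) ?g) = hm (cp X (cv \<phi> X (fc j us) A xs) (ep j us A))"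
   if j: "Suc j < ?m" for j
  proof -
   have f: "fc (Suc j) (?i # us) = ?i # fc j us" using Cons by simp
   have e: "ep (Suc j) (?i # us) A = ep j us A" using ep_arr[OF j p o(3)] o(1) Cons by simp
   note e2 = ep_arr[OF j p o(3)] dm_ep[OF j, of A]
   have g: "cp X (ep (Suc j) (?i # us) A) ?g = ep j us A" unfolding e using e2 o by simp
   have d: "gd n X (star us A) (foA ?w E) (?i # fc j us) A xs ?b (ep j us A)"
    using gd_fc[OF D, of "Suc j"] j unfolding g f by simp
   have "cv \<phi> X (fc j us) A xs \<in> arr X" using cv_arr[OF \<phi> fc_pth[OF j p] c] fc_length[OF j] n j by simp
   then show ?thesis unfolding f g Fk_uc_idn[OF \<phi> d] using o ob e2 cd_ep[OF j, of A] fc_co[OF j p] by simp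
  qed
  have sg2: "sg (Suc (length (?i # us) + ?q + j)) x = sg (?m + ?q) (sg j x)" for j and x :: 'h by (simp add: sg_sg)
  have F: "(\<Sum>j<length (?i # us) - 1. ?f j) = sg (?m + ?q) (hm (cp X (tws (co (tgU u) vs) u E) (fn u (cv \<phi> (tgU u) vs A xs))) +
   (\<Sum>j<?m - 1. sg (Suc j) (hm (cp X (cv \<phi> X (fc j us) A xs) (ep j us A)))))"
  proof -
   have "length (?i # us) - 1 = Suc (?m - 1)" using Cons by simp
   then have "(\<Sum>j<length (?i # us) - 1. ?f j) = ?f 0 + (\<Sum>j<?m - 1. ?f (Suc j))" by (simp only: sum.lessThan_Suc_shift o_def)
   also have "(\<Sum>j<?m - 1. ?f (Suc j)) = (\<Sum>j<?m - 1. sg (?m + ?q) (sg (Suc j) (hm (cp X (cv \<phi> X (fc j us) A xs) (ep j us A)))))"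
    using S unfolding sg2 by (intro sum.cong refl) simp
   finally show ?thesis unfolding 0 sg2 sg_add sg_sum by simp
  qed
  have L: "?d 1 = sg ?q (hm (cp X (cut X (butlast us) [last us] E) (cv \<phi> X (butlast us) (foA (last us) A) (map (fn (last us)) xs))))"
  proof -
   have ap: "us = butlast us @ [last us]" using Cons by simp
   obtain Z where Z: "pth X (butlast us) Z" "pth Z [last us] Y" using p ap pth_append[of X "butlast us" "[last us]" Y] by auto
   show ?thesis using d_higher_eq[OF Z _ c, of \<phi>, folded ap] by (simp add: S_single)
  qed
  have one: "(\<Sum>j\<le>?m. d_comp \<U> \<A> j \<phi> (X, us) (obs A xs) (mrs xs)) = d_comp \<U> \<A> 0 \<phi> (X, us) (obs A xs) (mrs xs) +
    (d_comp \<U> \<A> 1 \<phi> (X, us) (obs A xs) (mrs xs) + (\<Sum>j\<in>{2..?m}. ?d j))"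
   and two: "(\<Sum>j\<in>{1..?m}. ?d j) = ?d 1 + (\<Sum>j\<in>{2..?m}. ?d j)"
  proof -
   have s: "{..?m} = insert 0 (insert 1 {2..?m})" "{1..?m} = insert 1 {2..?m}" using Cons by auto
   show "(\<Sum>j\<in>{1..?m}. ?d j) = ?d 1 + (\<Sum>j\<in>{2..?m}. ?d j)" unfolding s(2) by simp
   show "(\<Sum>j\<le>?m. d_comp \<U> \<A> j \<phi> (X, us) (obs A xs) (mrs xs)) = d_comp \<U> \<A> 0 \<phi> (X, us) (obs A xs) (mrs xs) +
    (d_comp \<U> \<A> 1 \<phi> (X, us) (obs A xs) (mrs xs) + (\<Sum>j\<in>{2..?m}. ?d j))"
    unfolding s(1) by (simp add: d_comp_def)
  qed
  have "d_comp \<U> \<A> 1 \<phi> (X, us) (obs A xs) (mrs xs) = (\<Sum>j<length (?i # us) - 1. ?f j) + ?d 1"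
  proof -
   have ne: "us ~= []" using Cons by simp
   have hu: "hd us = u" "tl us = vs" using Cons by auto
   have "sg (?m + ?q) (sg ?m x) = sg ?q x" for x :: 'h by (simp add: sg_sg sg_def)
   then show ?thesis
    unfolding F L by (simp add: d_comp_def hv.scale_sg d_simp_eq[OF p ne c] sg_add hu)
  qed
  then show ?thesis
   unfolding Dl_def B C using GS_argI[OF p c] n one two by (simp add: GS_d_def d_comp_def[of _ _ 0] add_ac)
 qed
qed

text \<open>Evaluation at the free generators; \<open>zip\<close> restores the typed chain from the two lists.\<close>

definition rc :: "nat => ('u => 'a => 'a => 'v => 'h) => 'u * 'm list => 'a list => 'h list => 'h" where
 "rc n f = (%(X, us) As as. if GS_arg \<U> \<A> (X, us) As as & length us + length as = n
   then ph f X us (hd As) (zip (butlast As) (zip (tl As) (rev as))) else 0)"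

lemma zip_obs: "chain U A xs E ==> zip (butlast (obs A xs)) (zip (tl (obs A xs)) (rev (mrs xs))) = xs"
proof (induction xs arbitrary: A)
 case (Cons x xs)
 then have "zip (butlast (obs (cd x) xs)) (zip (tl (obs (cd x) xs)) (rev (mrs xs))) = xs" "dm x = A" by auto
 then show ?case by (cases x) (simp add: obs_def mrs_def)
qed (simp add: obs_def)

lemma uc_rc: "pth X us Y ==> chain Y A xs E ==> length us + length xs = n ==> uc (rc n f) X us A xs = ph f X us A xs"
 using GS_argI[of X us Y A xs E] by (simp add: uc_def rc_def zip_obs)

lemma coch_cong:
 assumes "!!X us Y A xs E. pth X us Y ==> chain Y A xs E ==> length us + length xs = n ==> \<phi> X us A xs = \<psi> X us A xs"
  and "coch sw M n \<psi>"
 shows "coch sw M n \<phi>"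
 unfolding coch_def
proof (intro allI impI conjI)
 fix X us Y A xs E assume h: "pth X us Y" "length us + length xs = n" "chain Y A xs E"
 show "\<phi> X us A xs \<in> car M X (star us A) (foA (co X us) E)" using assms(2) h assms(1)[OF h(1,3,2)] by (simp add: coch_def)
 fix c xs' xs'' assume l: "lcl Y c xs xs' xs''"
 have ch: "chain Y A xs' E" "chain Y A xs'' E" "length us + length xs' = n" "length us + length xs'' = n"
  using lcl_chain[OF l pth_Ob(2)[OF h(1)] h(3)] lcl_length[OF l] h(2) by auto
 have "\<psi> X us A xs'' = \<psi> X us A xs + sw c (\<psi> X us A xs')" using assms(2) h l unfolding coch_def by blast
 then show "\<phi> X us A xs'' = \<phi> X us A xs + sw c (\<phi> X us A xs')"
  using assms(1)[OF h(1,3,2)] assms(1)[OF h(1) ch(1,3)] assms(1)[OF h(1) ch(2,4)] by simp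
qed

lemma mrs_update: "(mrs xs)[i := h] = mrs (xs[length xs - Suc i := (B, C, h)])" if "i < length xs"
 using that by (simp add: mrs_def rev_update map_update)

lemma obs_update: "i < length xs ==> obs A (xs[i := (B, cd (xs ! i), h)]) = obs A xs"
 by (simp add: obs_def map_update list_update_same_conv)

lemma lcl_update:
 "i < length xs ==> chain U A xs E ==> lc U c x y z ==> lcl U c (xs[i := x]) (xs[i := y]) (xs[i := z])"
proof (induction xs arbitrary: i A)
 case (Cons w xs)
 then show ?case by (cases i) auto
qed simp

lemma chain_update:
 "i < length xs ==> chain U A xs E ==> x \<in> arr U ==> dm x = dm (xs ! i) ==> cd x = cd (xs ! i) ==> chain U A (xs[i := x]) E"
proof (induction xs arbitrary: i A)
 case (Cons w xs)
 then show ?case by (cases i) auto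
qed simp

lemma lcl_obtain:
 assumes "lcl U c xs ys zs"
 shows "\<exists>i<length xs. \<exists>y z. ys = xs[i := y] & zs = xs[i := z] & lc U c (xs ! i) y z"
 using assms
proof (induction U c xs ys zs rule: lcl.induct)
 case (1 U c x xs y ys z zs)
 show ?case
 proof (cases "lc U c x y z & ys = xs & zs = xs")
  case True
  then show ?thesis by (intro exI[of _ 0]) auto
 next
  case False
  then obtain i y' z' where "i < length xs" "ys = xs[i := y']" "zs = xs[i := z']" "lc U c (xs ! i) y' z'" "y = x" "z = x" using 1 by auto
  then have "Suc i < length (x # xs)" "y # ys = (x # xs)[Suc i := y']" "z # zs = (x # xs)[Suc i := z']" "lc U c ((x # xs) ! Suc i) y' z'" by auto
  then show ?thesis by blast
 qed
qed auto

lemma coch_uc: "\<phi> \<in> GS_cochains \<U> \<A> n ==> coch scA selfA n (uc \<phi>)"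
 unfolding coch_def
proof (intro allI impI conjI)
 assume p: "\<phi> \<in> GS_cochains \<U> \<A> n"
 fix X us Y A xs E assume h: "pth X us Y" "length us + length xs = n" "chain Y A xs E"
 have Y: "lstU X us = Y" using h(1) by (simp add: pth_iff)
 have G: "\<phi> (X, us) (obs A xs) (mrs xs) \<in> hom \<A> X (star us A) (foA (co X us) E)"
  "!!i. i < length xs ==> linear_from scA scA (hom \<A> Y (obs A xs ! (length xs - 1 - i)) (obs A xs ! (length xs - i)))
    (%x. \<phi> (X, us) (obs A xs) ((mrs xs)[i := x]))"
  using p GS_argI[OF h(1,3)] h(2) chain_endo[OF h(3)] Y unfolding GS_cochains_def by force+
 show "uc \<phi> X us A xs \<in> car selfA X (star us A) (foA (co X us) E)" using G(1) by (simp add: uc_def self_bimod_def)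
 fix c xs' xs'' assume "lcl Y c xs xs' xs''"
 then obtain k y z where k: "k < length xs" "xs' = xs[k := y]" "xs'' = xs[k := z]" "lc Y c (xs ! k) y z" using lcl_obtain by blast
 \<comment> \<open>the letters of a simplex are indexed from the end of the chain\<close>
 define i where "i = length xs - Suc k"
 have i: "i < length xs" "length xs - 1 - i = k" "length xs - i = Suc k" "length xs - Suc i = k" using k(1) by (auto simp: i_def)
 have a: "hm (xs ! k) \<in> hom \<A> Y (dm (xs ! k)) (cd (xs ! k))" "hm y \<in> hom \<A> Y (dm (xs ! k)) (cd (xs ! k))"
  using k(4) by (auto simp: lc_def arr_def)
 have o: "dm (xs ! k) \<in> obA Y" "cd (xs ! k) \<in> obA Y" using k(4) by (auto simp: lc_def arr_def)
 have e: "y = (dm (xs ! k), cd (xs ! k), hm y)" "z = (dm (xs ! k), cd (xs ! k), hm (xs ! k) + scA c (hm y))" "xs ! k = (dm (xs ! k), cd (xs ! k), hm (xs ! k))"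
  using k(4) by (auto simp: lc_def prod_eq_iff)
 have u: "mrs (xs[k := (dm (xs ! k), cd (xs ! k), h)]) = (mrs xs)[i := h]" "obs A (xs[k := (dm (xs ! k), cd (xs ! k), h)]) = obs A xs" for h
  using mrs_update[OF i(1), of h "dm (xs ! k)" "cd (xs ! k)"] obs_update[OF k(1)] i(4) by simp_all
 have u0: "mrs xs = (mrs xs)[i := hm (xs ! k)]" using u(1)[of "hm (xs ! k)"] e(3) by simp
 show "uc \<phi> X us A xs'' = uc \<phi> X us A xs + scA c (uc \<phi> X us A xs')"
 proof -
  have 1: "xs' = xs[k := (dm (xs ! k), cd (xs ! k), hm y)]" using k(2) by (simp only: e(1)[symmetric])
  have 2: "xs'' = xs[k := (dm (xs ! k), cd (xs ! k), hm (xs ! k) + scA c (hm y))]" using k(3) by (simp only: e(2)[symmetric])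
  have 0: "uc \<phi> X us A xs = \<phi> (X, us) (obs A xs) ((mrs xs)[i := hm (xs ! k)])" unfolding uc_def u0[symmetric] ..
  show ?thesis
   unfolding 0 unfolding uc_def 1 2 u
   by (rule lin_combination[OF G(2)[OF i(1), unfolded i(2,3) obs_nth(1)[OF k(1) h(3)] obs_nth(2)[OF k(1)]] vsA hom_subspace[OF pth_Ob(2)[OF h(1)] o] a])
 qed
qed

lemma GS_cochains_uc:
 assumes \<phi>: "coch scA selfA n (uc \<phi>)"
  and off: "!!X us As as. ~ (GS_arg \<U> \<A> (X, us) As as & length us + length as = n) ==> \<phi> (X, us) As as = 0"
 shows "\<phi> \<in> GS_cochains \<U> \<A> n"
 unfolding GS_cochains_def
proof (intro CollectI conjI allI impI off)
 fix X us As as assume "GS_arg \<U> \<A> (X, us) As as & length us + length as = n"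
 then obtain Y A xs E where h: "pth X us Y" "chain Y A xs E" "As = obs A xs" "as = mrs xs" "length us + length xs = n" using GS_argE by (metis length_mrs)
 have Y: "lstU X us = Y" using h(1) by (simp add: pth_iff)
 show "\<phi> (X, us) As as \<in> hom \<A> X (star us (hd As)) (foA (co X us) (last As))"
  using \<phi> h chain_endo[OF h(2)] by (auto simp: coch_def uc_def self_bimod_def)
 fix i assume "i < length as"
 then have i0: "i < length xs" using h by simp
 define k where "k = length xs - Suc i"
 have i: "k < length xs" "length xs - 1 - i = k" "length xs - i = Suc k" "length xs - Suc i = k" using i0 by (auto simp: k_def)
 have o: "dm (xs ! k) \<in> obA Y" "cd (xs ! k) \<in> obA Y" using chain_nth[OF h(2) i(1)] by (auto simp: arr_def)
 let ?x = "%h. (dm (xs ! k), cd (xs ! k), h)"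
 have u: "(mrs xs)[i := h] = mrs (xs[k := ?x h])" "obs A (xs[k := ?x h]) = obs A xs" for h
  using mrs_update[OF i0, of h] obs_update[OF i(1)] i(4) by simp_all
 have "\<phi> (X, us) (obs A xs) ((mrs xs)[i := x + scA c y]) = \<phi> (X, us) (obs A xs) ((mrs xs)[i := x]) + scA c (\<phi> (X, us) (obs A xs) ((mrs xs)[i := y]))"
  if xy: "x \<in> hom \<A> Y (dm (xs ! k)) (cd (xs ! k))" "y \<in> hom \<A> Y (dm (xs ! k)) (cd (xs ! k))" for c x y
 proof -
  have "lc Y c (?x x) (?x y) (?x (x + scA c y))" using xy o by (simp add: lc_def arr_iff)
  then have l: "lcl Y c (xs[k := ?x x]) (xs[k := ?x y]) (xs[k := ?x (x + scA c y)])" by (rule lcl_update[OF i(1) h(2)])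
  have "chain Y A (xs[k := ?x x]) E" by (rule chain_update[OF i(1) h(2)]) (use xy o in \<open>auto simp: arr_iff\<close>)
  then have "uc \<phi> X us A (xs[k := ?x (x + scA c y)]) = uc \<phi> X us A (xs[k := ?x x]) + scA c (uc \<phi> X us A (xs[k := ?x y]))"
   using \<phi> h(1,5) l unfolding coch_def by (metis length_list_update)
  then show ?thesis unfolding uc_def u .
 qed
 then show "linear_from scA scA (hom \<A> (lstU X us) (As ! (length as - 1 - i)) (As ! (length as - i))) (%x. \<phi> (X, us) As (as[i := x]))"
  unfolding h(3,4) Y length_mrs i(2,3) obs_nth(1)[OF i(1) h(2)] obs_nth(2)[OF i(1)]
  by (intro lin_combinationI[OF vsA vsA hom_subspace[OF pth_Ob(2)[OF h(1)] o]])
qed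

theorem GS_cohomology_iso: "kspace_iso (GS_cohomology \<U> \<A> n) (Ext_via \<U> \<A> s Bb \<delta> scA selfA n)"
 unfolding GS_cohomology_def Ext_via_comp
proof (rule cohomology_iso_bij[where \<beta> = rc, OF hom_complex[OF resolution_Bb]])
 note V = vsA
 show "vector_space (%c \<phi> \<sigma> As as. scA c (\<phi> \<sigma> As as))"
  by (rule vector_space_pointwise[OF vector_space_pointwise[OF vector_space_pointwise[OF V]]])
 show "linear_from (%c f U A B x. scA c (f U A B x)) (%c \<phi> \<sigma> As as. scA c (\<phi> \<sigma> As as)) (bhom s (Bb n) scA selfA) (rc n)" for n
  by (auto simp: linear_from_def rc_def ph_def fun_eq_iff)
 fix n
 have off: "rc n f (X, us) As as = 0" if "~ (GS_arg \<U> \<A> (X, us) As as & length us + length as = n)" for f X us As as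
  using that by (auto simp: rc_def)
 have co: "coch scA selfA n (uc (rc n f))" if "f \<in> bhom s (Bb n) scA selfA" for f
  by (rule coch_cong[OF uc_rc coch_ph[OF bimodule_self that]])
 show "rc n ` bhom s (Bb n) scA selfA = GS_cochains \<U> \<A> n"
 proof (intro Set.equalityI subsetI)
  fix \<phi> assume "\<phi> \<in> rc n ` bhom s (Bb n) scA selfA"
  then show "\<phi> \<in> GS_cochains \<U> \<A> n" using GS_cochains_uc[OF co off] by blast
 next
  fix \<phi> assume p: "\<phi> \<in> GS_cochains \<U> \<A> n"
  then have z: "\<phi> (X, us) As as = 0" if "~ (GS_arg \<U> \<A> (X, us) As as & length us + length as = n)" for X us As as
   using that unfolding GS_cochains_def by blast
  have c: "coch scA selfA n (uc \<phi>)" by (rule coch_uc[OF p])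
  have "rc n (hg n scA (Fk selfA (uc \<phi>))) (X, us) As as = \<phi> (X, us) As as" for X us As as
  proof (cases "GS_arg \<U> \<A> (X, us) As as & length us + length as = n")
   case True
   then obtain Y A xs E where h: "pth X us Y" "chain Y A xs E" "As = obs A xs" "as = mrs xs" using GS_argE by blast
   then show ?thesis using True ph_hg_Fk[OF bimodule_self c h(1,2)] uc_rc[OF h(1,2)] by (simp add: uc_def)
  qed (simp add: off z)
  then have "\<phi> = rc n (hg n scA (Fk selfA (uc \<phi>)))" by (auto simp: fun_eq_iff)
  then show "\<phi> \<in> rc n ` bhom s (Bb n) scA selfA" using hg_Fk_hom[OF bimodule_self c] by blast
 qed
 have Fkc: "Fk selfA (ph f) X us A xs b g = Fk selfA (uc (rc n f)) X us A xs b g" if "gd n X P Q us A xs b g" for f X P Q us A xs b g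
  using that by (rule gd_ConsE) (simp add: Fk_def Let_def uc_rc)
 show "inj_on (rc n) (bhom s (Bb n) scA selfA)"
 proof (rule inj_onI)
  fix f f' assume f: "f \<in> bhom s (Bb n) scA selfA" and f': "f' \<in> bhom s (Bb n) scA selfA"
   and e: "rc n f = rc n f'"
  show "f = f'" by (rule hom_eqI[OF bimodule_self f f']) (simp add: hom_gen[OF bimodule_self f] hom_gen[OF bimodule_self f'] Fkc e)
 qed
 fix f assume f: "f \<in> bhom s (Bb n) scA selfA"
 have "rc (Suc n) (f oo \<delta> n) (X, us) As as = GS_d \<U> \<A> n (rc n f) (X, us) As as" for X us As as
 proof (cases "GS_arg \<U> \<A> (X, us) As as & length us + length as = Suc n")
  case True
  then obtain Y A xs E where h: "pth X us Y" "chain Y A xs E" "As = obs A xs" "as = mrs xs" using GS_argE by blast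
  have n: "length us + length xs = Suc n" using True h by simp
  note D = gd_ug[OF h(1,2) n]
  let ?P = "star us A" and ?Q = "foA (co X us) E"
  let ?l = "lex n X ?P ?Q scA (Fk selfA (ph f) X)"
  interpret self: pbim \<U> \<A> "scA" "selfA" by (rule pbimI[OF bimodule_self])
  note ml = self.mlK_Fk[OF coch_ph[OF bimodule_self f], of X ?P ?Q]
  have O: "X \<in> ObU" "?P \<in> obA X" "?Q \<in> obA X" using gd_Ob[OF D] by auto
  let ?x = "Dl X gen (idU X # us) A xs (ida X ?Q) (ida X ?P)"
  have x: "?x \<in> Bc n X ?P ?Q" using Dl_mem[OF vsS Bc_subspace D gen_Bc] by simp
  have "f X ?P ?Q ?x = ?l ?x"
   by (rule Bc_eqI[OF V bimod_homD(2)[OF f O, unfolded car_Bb] lex_linear[OF V ml]]) (use x in \<open>simp_all add: lex_gen[OF V ml] hom_gen[OF bimodule_self f]\<close>)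
  also have "... = Dl X (%us A xs b g. ?l (gen us A xs b g)) (idU X # us) A xs (ida X ?Q) (ida X ?P)"
   by (rule Dl_hom[OF additive_linear[OF lex_linear[OF V ml]]])
  also have "... = Dl X (Fk selfA (uc (rc n f)) X) (idU X # us) A xs (ida X ?Q) (ida X ?P)"
   by (rule Dl_cong[OF D]) (simp add: lex_gen[OF V ml] Fkc)
  also have "... = GS_d \<U> \<A> n (rc n f) (X, us) As as"
   unfolding h(3,4) by (rule Dl_ug_GS_d[OF co[OF f] h(1,2) n])
  finally show ?thesis
   using uc_rc[OF h(1,2) n, of "f oo \<delta> n"] \<delta>_gen[OF D] chain_endo[OF h(2)]
   by (simp add: uc_def ph_def ug_def h(3,4) bcomp_def)
 qed (auto simp: rc_def GS_d_def)
 then show "rc (Suc n) (f oo \<delta> n) = GS_d \<U> \<A> n (rc n f)" by (auto simp: fun_eq_iff)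
qed

end

theorem corollary1p3:
  fixes \<U> :: "('u, 'm) cat"
    and \<A> :: "('k::field, 'u, 'm, 'a, 'h::ab_group_add) prestack_data"
    and s :: "'k \<Rightarrow> 'v \<Rightarrow> 'v::ab_group_add"
  assumes "small_category \<U>"
    and "prestack \<U> \<A>"
    and "bimod_universe \<A> s"
  shows "(\<exists>P \<delta> \<eta>. projective_resolution \<U> \<A> s P \<delta> \<eta> (hscale \<A>) (self_bimod \<A>)) \<and>
    (\<forall>P \<delta> \<eta>. projective_resolution \<U> \<A> s P \<delta> \<eta> (hscale \<A>) (self_bimod \<A>) \<longrightarrow>
       (\<forall>n. kspace_iso (GS_cohomology \<U> \<A> n)
              (Ext_via \<U> \<A> s P \<delta> (hscale \<A>) (self_bimod \<A>) n)))"
proof -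
  obtain e :: "('u + 'm + 'a + 'h) list \<Rightarrow> 'v" where e: "vector_space s" "inj e" "\<not> module.dependent s (range e)"
    using assms(3) unfolding bimod_universe_def by blast
  interpret prestack_universe \<U> \<A> s e
    using assms(2) e by (simp add: prestack_universe_def prestack_universe_axioms_def)
  show ?thesis
    using resolution_Bb kspace_iso_trans[OF GS_cohomology_iso Ext_independent[OF resolution_Bb]] by blast
qed

end
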